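(* Let $\Phi$ be any Drinfeld module over $\bar k$ of rank $d$ and put $c_2:=q^{5d(2(d+1)h(\Phi)+1)c(\Phi)^2}$. Then for every non-torsion point $x\in\bar k$ of $\Phi$, with $D=[k(x):k]$, $$\widehat h(x)\ge c_2^{-D^2}.$$
   Context: $A=\mathbb{F}_q[T]$, $k=\mathbb{F}_q(T)$, $\bar k$ an algebraic closure, $\tau$ the $q$-Frobenius. A Drinfeld module of rank $d\ge1$ is an injective $\mathbb{F}_q$-algebra homomorphism $\Phi:A\to\bar k\{\tau\}$ with $\Phi(T)=T+a_1\tau+\dots+a_d\tau^d$, $a_d\ne0$; $c(\Phi)=[k(a_1,\dots,a_d):k]$. $x\in\bar k$ is torsion if $\Phi(a)(x)=0$ for some $a\in A\setminus\{0\}$. Places of $k$: $v(y)=\deg_T(l)v_l(y)$ for monic irreducible $l$, $v_\infty(y)=-\deg_T(y)$; $n_w=[K_w:k_v]$; Weil height $h(y_1,\dots,y_n)=\frac1{[K:k]}\sum_w n_w\max_i\{0,-w(y_i)\}$. $h(\Phi)=\frac1{c(\Phi)}\sum_w n_w\max_{0\le i\le d}\{0,-w(a_i)\}$ over places of $k(a_1,\dots,a_d)$, with $a_0=T$. Canonical height: $\widehat h(x)=\lim_{n\to\infty}h(\Phi(T^n)(x))/q^{dn}$. *)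

theory Defs
  imports
    "HOL-Library.Cardinality"
    "HOL-Analysis.Infinite_Sum"
    "HOL-Algebra.Algebraic_Closure_Type"
    "HOL-Algebra.Generated_Fields"
    "HOL-Algebra.Embedded_Algebras"
    "HOL-Algebra.QuotRing"
begin

text \<open>
  The finite field is a type \<open>'f\<close> of class \<open>{field,finite}\<close>, so \<open>q = CARD('f)\<close>,
  \<open>A = 'f poly\<close> and \<open>k = 'f poly fract\<close>. Finite extensions of \<open>k\<close> are sets of elements of the
  closure that contain \<open>base_field\<close>.
\<close>

type_synonym 'f kbar = "'f poly fract alg_closure"

definition base_field :: "'f::field kbar set" where
  "base_field = range to_ac"

definition embed_poly :: "'f::field poly \<Rightarrow> 'f kbar" where
  "embed_poly a = to_ac (Fract a 1)"

definition adjoin :: "'f::field kbar set \<Rightarrow> 'f kbar set" where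
  "adjoin S = generate_field ring_of_type_algebra (base_field \<union> S)"

definition ext_degree :: "'f::field kbar set \<Rightarrow> nat" where
  "ext_degree K = ring.dim ring_of_type_algebra base_field K"


subsection \<open>Places\<close>

text \<open>
  The library's \<open>multiplicity\<close> on \<open>'f poly\<close> would require the class \<open>field_gcd\<close>, so it is
  unfolded here; it is used for irreducible \<open>l\<close> and nonzero \<open>a\<close> only.
\<close>

definition exponent_at :: "'f::field poly \<Rightarrow> 'f poly \<Rightarrow> nat" where
  "exponent_at l a = Max {n. l ^ n dvd a}"

definition ord_at :: "'f::field poly \<Rightarrow> 'f poly fract \<Rightarrow> ereal" where
  "ord_at l y = (if y = 0 then \<infinity> else ereal (THE r. \<exists>a b. a \<noteq> 0 \<and> b \<noteq> 0 \<and> y = Fract a b \<and>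
     r = real (exponent_at l a) - real (exponent_at l b)))"

definition finite_place :: "'f::field poly \<Rightarrow> 'f poly fract \<Rightarrow> ereal" where
  "finite_place l y = ereal (real (degree l)) * ord_at l y"

definition infinite_place :: "'f::field poly fract \<Rightarrow> ereal" where
  "infinite_place y = (if y = 0 then \<infinity> else ereal (THE r. \<exists>a b. a \<noteq> 0 \<and> b \<noteq> 0 \<and> y = Fract a b \<and>
     r = real (degree b) - real (degree a)))"

definition base_places :: "('f::field poly fract \<Rightarrow> ereal) set" where
  "base_places = insert infinite_place {finite_place l | l. Factorial_Ring.irreducible l \<and> lead_coeff l = 1}"

text \<open>
  A place \<open>w\<close> of \<open>K\<close> is normalised so that it extends a place of \<open>k\<close> on the nose (its values
  may then be fractional). It is extensional, so that each place is counted once.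
\<close>

definition is_valuation :: "'f::field kbar set \<Rightarrow> ('f kbar \<Rightarrow> ereal) \<Rightarrow> bool" where
  "is_valuation K w \<longleftrightarrow>
     (\<forall>x\<in>K. w x \<noteq> -\<infinity> \<and> (w x = \<infinity> \<longleftrightarrow> x = 0)) \<and>
     (\<forall>x\<in>K. \<forall>y\<in>K. w (x * y) = w x + w y) \<and>
     (\<forall>x\<in>K. \<forall>y\<in>K. min (w x) (w y) \<le> w (x + y))"

definition places :: "'f::field kbar set \<Rightarrow> ('f kbar \<Rightarrow> ereal) set" where
  "places K = {w \<in> extensional K. is_valuation K w \<and> (\<exists>v\<in>base_places. \<forall>y. w (to_ac y) = v y)}"


subsection \<open>Completions and local degrees\<close>

definition cauchy_seqs :: "'f::field kbar set \<Rightarrow> ('f kbar \<Rightarrow> ereal) \<Rightarrow> (nat \<Rightarrow> 'f kbar) set" where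
  "cauchy_seqs K w = {s. range s \<subseteq> K \<and>
     (\<forall>B::real. \<exists>N. \<forall>m\<ge>N. \<forall>n\<ge>N. ereal B \<le> w (s m - s n))}"

definition null_seqs :: "'f::field kbar set \<Rightarrow> ('f kbar \<Rightarrow> ereal) \<Rightarrow> (nat \<Rightarrow> 'f kbar) set" where
  "null_seqs K w = {s. range s \<subseteq> K \<and> (\<lambda>n. w (s n)) \<longlonglongrightarrow> \<infinity>}"

definition cauchy_ring :: "'f::field kbar set \<Rightarrow> ('f kbar \<Rightarrow> ereal) \<Rightarrow> (nat \<Rightarrow> 'f kbar) ring" where
  "cauchy_ring K w =
     \<lparr>carrier = cauchy_seqs K w, monoid.mult = (\<lambda>s t n. s n * t n), one = (\<lambda>n. 1),
      ring.zero = (\<lambda>n. 0), add = (\<lambda>s t n. s n + t n)\<rparr>"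

definition completion :: "'f::field kbar set \<Rightarrow> ('f kbar \<Rightarrow> ereal) \<Rightarrow> (nat \<Rightarrow> 'f kbar) set ring" where
  "completion K w = cauchy_ring K w Quot null_seqs K w"

text \<open>
  The completion of \<open>k\<close> at the place below \<open>w\<close>, as a subfield of the completion of \<open>K\<close>:
  the classes of Cauchy sequences with terms in \<open>k\<close>.
\<close>

definition base_completion :: "'f::field kbar set \<Rightarrow> ('f kbar \<Rightarrow> ereal) \<Rightarrow> (nat \<Rightarrow> 'f kbar) set set" where
  "base_completion K w =
     (\<lambda>s. null_seqs K w +>\<^bsub>cauchy_ring K w\<^esub> s) ` cauchy_seqs base_field w"

definition local_degree :: "'f::field kbar set \<Rightarrow> ('f kbar \<Rightarrow> ereal) \<Rightarrow> nat" where
  "local_degree K w = ring.dim (completion K w) (base_completion K w) (carrier (completion K w))"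


subsection \<open>Weil height\<close>

text \<open>Only finitely many terms of the sum over the places of \<open>K\<close> are nonzero.\<close>

definition height_in :: "'f::field kbar set \<Rightarrow> 'f kbar list \<Rightarrow> real" where
  "height_in K ys = (\<Sum>\<^sub>\<infinity>w\<in>places K.
     real (local_degree K w) * real_of_ereal (Max (insert 0 ((\<lambda>y. - w y) ` set ys))))
     / real (ext_degree K)"

definition weil_height :: "'f::field kbar list \<Rightarrow> real" where
  "weil_height ys = height_in (adjoin (set ys)) ys"


subsection \<open>Drinfeld modules\<close>

text \<open>
  An element of the twisted polynomial ring is stored as the ordinary polynomial with the same
  coefficients; only the multiplication differs, by \<open>\<tau> * c = c^q * \<tau>\<close>.
\<close>

definition twisted_mult :: "'f::{field,finite} kbar poly \<Rightarrow> 'f kbar poly \<Rightarrow> 'f kbar poly" where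
  "twisted_mult P Q = (\<Sum>i\<le>degree P. \<Sum>j\<le>degree Q.
     monom (coeff P i * coeff Q j ^ (CARD('f) ^ i)) (i + j))"

definition twisted_ring :: "'f::{field,finite} kbar poly ring" where
  "twisted_ring =
     \<lparr>carrier = UNIV, monoid.mult = twisted_mult, one = 1, ring.zero = 0, add = (+)\<rparr>"

definition twisted_eval :: "'f::{field,finite} kbar poly \<Rightarrow> 'f kbar \<Rightarrow> 'f kbar" where
  "twisted_eval P x = (\<Sum>i\<le>degree P. coeff P i * x ^ (CARD('f) ^ i))"

abbreviation polyT :: "'f::field poly" where
  "polyT \<equiv> [:0, 1:]"

definition drinfeld_module :: "nat \<Rightarrow> ('f::{field,finite} poly \<Rightarrow> 'f kbar poly) \<Rightarrow> bool" where
  "drinfeld_module d \<Phi> \<longleftrightarrow> d \<ge> 1 \<and>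
     \<Phi> \<in> ring_hom ring_of_type_algebra twisted_ring \<and>
     (\<forall>c a. \<Phi> (smult c a) = smult (embed_poly [:c:]) (\<Phi> a)) \<and>
     inj \<Phi> \<and> coeff (\<Phi> polyT) 0 = embed_poly polyT \<and> degree (\<Phi> polyT) = d"

definition is_torsion :: "('f::{field,finite} poly \<Rightarrow> 'f kbar poly) \<Rightarrow> 'f kbar \<Rightarrow> bool" where
  "is_torsion \<Phi> x \<longleftrightarrow> (\<exists>a. a \<noteq> 0 \<and> twisted_eval (\<Phi> a) x = 0)"

definition coeff_field :: "('f::{field,finite} poly \<Rightarrow> 'f kbar poly) \<Rightarrow> 'f kbar set" where
  "coeff_field \<Phi> = adjoin (coeff (\<Phi> polyT) ` {1..degree (\<Phi> polyT)})"

definition coeff_degree :: "('f::{field,finite} poly \<Rightarrow> 'f kbar poly) \<Rightarrow> nat" where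
  "coeff_degree \<Phi> = ext_degree (coeff_field \<Phi>)"

definition module_height :: "('f::{field,finite} poly \<Rightarrow> 'f kbar poly) \<Rightarrow> real" where
  "module_height \<Phi> = height_in (coeff_field \<Phi>) (coeffs (\<Phi> polyT))"

definition canonical_height :: "('f::{field,finite} poly \<Rightarrow> 'f kbar poly) \<Rightarrow> 'f kbar \<Rightarrow> real" where
  "canonical_height \<Phi> x =
     lim (\<lambda>n. weil_height [twisted_eval (\<Phi> (polyT ^ n)) x] / real CARD('f) ^ (degree (\<Phi> polyT) * n))"

end

theory Submission
  imports Defs "Jordan_Normal_Form.Char_Poly"
begin

text \<open>
  Let \<open>x\<close> be a non-torsion point and \<open>G = c(\<Phi>) D\<close>. Comparing \<open>h(\<Phi>(T)(y))\<close> with \<open>q^d h(y)\<close> place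
  by place and telescoping shows that the canonical height exists and that \<open>h\<close> exceeds it by at
  most \<open>4 h(\<Phi>)\<close>. Hence the \<open>q^(n+1)\<close> distinct points \<open>\<Phi>(a)(x)\<close> with \<open>deg a \<le> n\<close>
  have degree at most \<open>G\<close> over \<open>k\<close>, and height at most \<open>2 q^(dn) * (canonical height of x) + 4 h(\<Phi>)\<close>.
  If the canonical height of \<open>x\<close> is below the asserted bound and \<open>n = floor (G^2 (8 h(\<Phi>) + 4))\<close>,
  this is at most \<open>B = 4 h(\<Phi>) + 1\<close>. By a quantitative Northcott theorem (clear denominators in
  the minimal polynomials) there are at most \<open>G q^((GB+1)(G+1))\<close> such points, fewer than \<open>q^(n+1)\<close>.

  The height is computed from absolute values instead of places. With \<open>P\<close> a power of the
  characteristic and \<open>\<eta>\<close> separable, all elements of interest lie in a finite extension of the form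
  \<open>{z. z^P \<in> k(\<eta>)}\<close>. Its embeddings over \<open>k\<close> correspond to the conjugates of \<open>\<eta>\<close>, and composing
  them with one fixed extension of each place of \<open>k\<close> to the algebraic closure yields every place
  above it. The local degree of a place is proportional to the number of embeddings inducing it,
  so the height of \<open>y\<close> is an average over the conjugates of \<open>\<eta>\<close>; in particular it does not depend
  on the field containing \<open>y\<close>.
\<close>


section \<open>Absolute values and weak approximation\<close>

text \<open>The local degrees in the height are dimensions of completions, and also for inseparable
  \<open>K\<close> they have to be tied to the degree of \<open>K\<close>. This is done by a
  squeeze, without structure theory of complete fields. Weak approximation bounds the sum of the
  local degrees above a place by the global degree. Explicit independent families, powers of \<eta>
  times powers of a P-th root of a uniformiser, bound each local degree from below in terms of the
  number of embeddings inducing the place. Both bounds have the same total, so each is an equality,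
  and every place comes from an embedding. Inseparability does no harm because P-th roots are
  unique: embeddings of k(\<eta>) extend uniquely.

  Constants: after absorbing the factor G, the counting bound is q to the power G^2 B + G B + 2 G,
  at most 2 G^2 (B + 1) = G^2 (8 h + 4), where h is the height of \<Phi>; this dictates n. The
  canonical height must then beat q^(dn) with a factor 1/2 to spare. The exponent 5 d (4 h + 1) G^2
  leaves a margin of at least 1, and 4 h is at most 2 (d + 1) h.\<close>

definition subf :: "'k::field alg_closure set \<Rightarrow> bool" where
  "subf K \<longleftrightarrow> range to_ac \<subseteq> K \<and> (\<forall>x\<in>K. \<forall>y\<in>K. x + y \<in> K \<and> x * y \<in> K) \<and> (\<forall>x\<in>K. - x \<in> K \<and> inverse x \<in> K)"

lemma subf_to_ac [simp]: "subf K \<Longrightarrow> to_ac c \<in> K"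
  by (auto simp: subf_def)

lemma subf_0 [simp]: "subf K \<Longrightarrow> 0 \<in> K" and subf_1 [simp]: "subf K \<Longrightarrow> 1 \<in> K"
  using subf_to_ac[of K 0] subf_to_ac[of K 1] by auto

lemma subf_add: "subf K \<Longrightarrow> x \<in> K \<Longrightarrow> y \<in> K \<Longrightarrow> x + y \<in> K"
  and subf_mult: "subf K \<Longrightarrow> x \<in> K \<Longrightarrow> y \<in> K \<Longrightarrow> x * y \<in> K"
  and subf_uminus: "subf K \<Longrightarrow> x \<in> K \<Longrightarrow> - x \<in> K"
  and subf_inverse: "subf K \<Longrightarrow> x \<in> K \<Longrightarrow> inverse x \<in> K"
  by (auto simp: subf_def)

lemma subf_diff: "subf K \<Longrightarrow> x \<in> K \<Longrightarrow> y \<in> K \<Longrightarrow> x - y \<in> K"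
  using subf_add[of K x "- y"] subf_uminus[of K y] by auto

lemma subf_divide: "subf K \<Longrightarrow> x \<in> K \<Longrightarrow> y \<in> K \<Longrightarrow> x / y \<in> K"
  by (simp add: divide_inverse subf_inverse subf_mult)

lemma subf_power: "subf K \<Longrightarrow> x \<in> K \<Longrightarrow> x ^ n \<in> K"
  by (induction n) (auto intro: subf_mult)

lemma subf_sum: "subf K \<Longrightarrow> (\<And>i. i \<in> I \<Longrightarrow> f i \<in> K) \<Longrightarrow> sum f I \<in> K"
  by (induction I rule: infinite_finite_induct) (auto intro: subf_add)

lemmas subf_ops = subf_add subf_mult subf_uminus subf_inverse subf_diff subf_divide subf_power subf_sum

lemma subf_UNIV [simp]: "subf UNIV"
  by (auto simp: subf_def)

text \<open>Conditions are imposed on \<open>K\<close> only, so one function on the closure can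
  serve several subfields. Real multiplicative values avoid the infinite value of the
  \<open>ereal\<close> valuations.\<close>

definition absval :: "'k::field alg_closure set \<Rightarrow> ('k alg_closure \<Rightarrow> real) \<Rightarrow> bool" where
  "absval K N \<longleftrightarrow> (\<forall>x\<in>K. N x \<ge> 0 \<and> (N x = 0 \<longleftrightarrow> x = 0)) \<and>
     (\<forall>x\<in>K. \<forall>y\<in>K. N (x * y) = N x * N y \<and> N (x + y) \<le> max (N x) (N y))"

lemma absval_subset: "absval K N \<Longrightarrow> L \<subseteq> K \<Longrightarrow> absval L N"
  unfolding absval_def by blast

context
  fixes K :: "'k::field alg_closure set" and N
  assumes K: "subf K" and N: "absval K N"
begin

lemma av_nonneg: "x \<in> K \<Longrightarrow> N x \<ge> 0"
  and av_eq_0: "x \<in> K \<Longrightarrow> N x = 0 \<longleftrightarrow> x = 0"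
  and av_mult: "x \<in> K \<Longrightarrow> y \<in> K \<Longrightarrow> N (x * y) = N x * N y"
  and av_add: "x \<in> K \<Longrightarrow> y \<in> K \<Longrightarrow> N (x + y) \<le> max (N x) (N y)"
  using N by (auto simp: absval_def)

lemma av_0: "N 0 = 0"
  using av_eq_0[of 0] K by simp

lemma av_pos: "x \<in> K \<Longrightarrow> x \<noteq> 0 \<Longrightarrow> N x > 0"
  using av_nonneg[of x] av_eq_0[of x] by linarith

lemma av_1: "N 1 = 1"
  using av_mult[of 1 1] av_pos[of 1] K by simp

lemma av_minus1: "N (- 1) = 1"
proof -
  have "N (-1) * N (-1) = 1"
    using av_mult[of "-1" "-1"] av_1 K by (simp add: subf_uminus)
  moreover have "N (-1) \<ge> 0" using K by (simp add: av_nonneg subf_uminus)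
  ultimately show ?thesis by (metis abs_of_nonneg mult_1 abs_mult_self_eq real_sqrt_abs2 real_sqrt_one)
qed

lemma av_uminus: "x \<in> K \<Longrightarrow> N (- x) = N x"
  using av_mult[of "-1" x] av_minus1 K by (simp add: subf_uminus)

lemma av_diff: "x \<in> K \<Longrightarrow> y \<in> K \<Longrightarrow> N (x - y) \<le> max (N x) (N y)"
  using av_add[of x "- y"] av_uminus[of y] subf_uminus[OF K] by auto

lemma av_inverse: "x \<in> K \<Longrightarrow> N (inverse x) = inverse (N x)"
proof (cases "x = 0")
  case False
  assume x: "x \<in> K"
  have "N x * N (inverse x) = 1"
    using av_mult[of x "inverse x"] av_1 x False subf_inverse[OF K x] by simp
  thus ?thesis by (metis inverse_unique)
qed (use av_0 in auto)

lemma av_divide: "x \<in> K \<Longrightarrow> y \<in> K \<Longrightarrow> N (x / y) = N x / N y"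
  by (simp add: divide_inverse av_mult subf_inverse[OF K] av_inverse)

lemma av_power: "x \<in> K \<Longrightarrow> N (x ^ n) = N x ^ n"
  by (induction n) (auto simp: av_1 av_mult subf_power[OF K])

lemma av_power_int: "x \<in> K \<Longrightarrow> N (x powi n) = N x powi n"
  by (auto simp: power_int_def av_power av_inverse subf_inverse[OF K])

lemma av_sum_le: 
  assumes "\<And>i. i \<in> I \<Longrightarrow> f i \<in> K" "\<And>i. i \<in> I \<Longrightarrow> N (f i) \<le> B" "B \<ge> 0"
  shows "N (sum f I) \<le> B"
  using assms
proof (induction I rule: infinite_finite_induct)
  case (insert i I)
  have "N (f i + sum f I) \<le> max (N (f i)) (N (sum f I))"
    using insert by (intro av_add subf_sum[OF K]) auto
  also have "\<dots> \<le> B" using insert by auto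
  finally show ?case using insert by simp
qed (auto simp: av_0)

text \<open>If \<open>x + y\<close> were smaller than \<open>y\<close>, then
  \<open>y = (x + y) - x\<close> would be a difference of two elements smaller than itself.\<close>

lemma av_add_eq: assumes "x \<in> K" "y \<in> K" "N x < N y" shows "N (x + y) = N y"
proof (rule antisym)
  show "N (x + y) \<le> N y" using av_add[of x y] assms by auto
  have "N y \<le> max (N (x + y)) (N x)"
    using av_diff[of "x + y" x] assms subf_add[OF K] by auto
  thus "N y \<le> N (x + y)" using assms by auto
qed

end

lemma absval_trans_eq:
  assumes "absval K N" "\<And>x. x \<in> K \<Longrightarrow> N' x = N x" "subf K"
  shows "absval K N'"
  using assms unfolding absval_def by (simp add: subf_add subf_mult)

section \<open>Linear dependence, and independence over the completion\<close>

lemma lin_dep: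
  fixes c :: "'i \<Rightarrow> 'j \<Rightarrow> 'k::field"
  assumes "finite J" "finite I" "card J < card I"
  shows "\<exists>t. (\<exists>i\<in>I. t i \<noteq> 0) \<and> (\<forall>j\<in>J. (\<Sum>i\<in>I. t i * c i j) = 0)"
  using assms
proof (induction J arbitrary: I c rule: finite_induct)
  case empty
  then obtain i where "i \<in> I" by fastforce
  thus ?case by (intro exI[of _ "\<lambda>_. 1"]) auto
next
  case (insert j J)
  show ?case
  proof (cases "\<forall>i\<in>I. c i j = 0")
    case True
    have "\<exists>t. (\<exists>i\<in>I. t i \<noteq> 0) \<and> (\<forall>j\<in>J. (\<Sum>i\<in>I. t i * c i j) = 0)"
      using insert by (intro insert.IH) auto
    then obtain t where "\<exists>i\<in>I. t i \<noteq> 0" "\<forall>j\<in>J. (\<Sum>i\<in>I. t i * c i j) = 0" by blast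
    thus ?thesis using True by (intro exI[of _ t]) auto
  next
    case False
    then obtain i0 where i0: "i0 \<in> I" "c i0 j \<noteq> 0" by blast
    define I' where "I' = I - {i0}"
    \<comment> \<open>One step of Gaussian elimination: \<open>i0\<close> is the pivot for equation
      \<open>j\<close>, and its own coefficient \<open>s\<close> is chosen afterwards so that this
      equation holds.\<close>
    define c' where "c' = (\<lambda>i l. c i l - c i j / c i0 j * c i0 l)"
    have "\<exists>t. (\<exists>i\<in>I'. t i \<noteq> 0) \<and> (\<forall>j\<in>J. (\<Sum>i\<in>I'. t i * c' i j) = 0)"
      using insert i0 by (intro insert.IH) (auto simp: I'_def)
    then obtain t where t: "\<exists>i\<in>I'. t i \<noteq> 0" "\<forall>j\<in>J. (\<Sum>i\<in>I'. t i * c' i j) = 0" by blast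
    define s where "s = - (\<Sum>i\<in>I'. t i * (c i j / c i0 j))"
    define u where "u = t(i0 := s)"
    have split: "(\<Sum>i\<in>I. u i * c i l) = s * c i0 l + (\<Sum>i\<in>I'. t i * c i l)" for l
    proof -
      have "(\<Sum>i\<in>I. u i * c i l) = u i0 * c i0 l + (\<Sum>i\<in>I'. u i * c i l)"
        unfolding I'_def using insert.prems i0 by (intro sum.remove) auto
      also have "(\<Sum>i\<in>I'. u i * c i l) = (\<Sum>i\<in>I'. t i * c i l)"
        by (intro sum.cong) (auto simp: u_def I'_def)
      finally show ?thesis by (simp add: u_def)
    qed
    have s: "s * c i0 l = - (\<Sum>i\<in>I'. t i * (c i j / c i0 j * c i0 l))" for l
      by (simp add: s_def sum_distrib_right mult.assoc)
    have "(\<Sum>i\<in>I. u i * c i l) = (\<Sum>i\<in>I'. t i * c' i l)" for l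
      unfolding split s c'_def by (simp add: sum_subtractf algebra_simps)
    moreover have "(\<Sum>i\<in>I'. t i * c' i j) = 0"
      using i0 by (simp add: c'_def)
    moreover have "\<exists>i\<in>I. u i \<noteq> 0" using t(1) by (auto simp: u_def I'_def)
    ultimately show ?thesis using t(2) by (intro exI[of _ u]) auto
  qed
qed

text \<open>
  Independence over \<open>k\<close> that survives passage to the completion: by the uniform bound, no null
  sequence of combinations has a coefficient that stays away from 0.
\<close>

definition nind :: "('k::field alg_closure \<Rightarrow> real) \<Rightarrow> 'i set \<Rightarrow> ('i \<Rightarrow> 'k alg_closure) \<Rightarrow> bool" where
  "nind N I b \<longleftrightarrow> (\<exists>C. \<forall>t. \<forall>i\<in>I. N (to_ac (t i)) \<le> C * N (\<Sum>j\<in>I. to_ac (t j) * b j))"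

lemma nind_bound:
  assumes "nind N I b" "subf K" "absval K N" "\<And>i. i \<in> I \<Longrightarrow> b i \<in> K"
  obtains C where "C \<ge> 1" "\<And>t i. i \<in> I \<Longrightarrow> N (to_ac (t i)) \<le> C * N (\<Sum>j\<in>I. to_ac (t j) * b j)"
proof -
  obtain C where C: "\<And>t i. i \<in> I \<Longrightarrow> N (to_ac (t i)) \<le> C * N (\<Sum>j\<in>I. to_ac (t j) * b j)"
    using assms(1) unfolding nind_def by blast
  have "N (to_ac (t i)) \<le> max C 1 * N (\<Sum>j\<in>I. to_ac (t j) * b j)" if "i \<in> I" for t i
  proof -
    have "N (\<Sum>j\<in>I. to_ac (t j) * b j) \<ge> 0"
      using assms by (intro av_nonneg[OF assms(2,3)] subf_ops) auto
    hence "C * N (\<Sum>j\<in>I. to_ac (t j) * b j) \<le> max C 1 * N (\<Sum>j\<in>I. to_ac (t j) * b j)"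
      by (intro mult_right_mono) auto
    thus ?thesis using C[OF that, of t] by linarith
  qed
  thus ?thesis using that[of "max C 1"] by auto
qed

text \<open>As no constant works for the enlarged family, some combination is tiny compared with one
  of its coefficients. Independence of the old family forces the coefficient of \<open>x\<close> to
  be large as well, and dividing by it shows that \<open>x\<close> is close to the span.\<close>

lemma nind_maximal_dense:
  assumes K: "subf K" and N: "absval K N" and b: "\<And>i. i < n \<Longrightarrow> b i \<in> K"
    and nb: "nind N {..<n} b" and x: "x \<in> K" and nx: "\<not> nind N {..<Suc n} (b(n := x))" and "\<epsilon> > 0"
  shows "\<exists>t. N (x - (\<Sum>i<n. to_ac (t i) * b i)) < \<epsilon>"
proof -
  obtain C0 where C0: "C0 \<ge> 1" "\<And>t i. i < n \<Longrightarrow> N (to_ac (t i)) \<le> C0 * N (\<Sum>j<n. to_ac (t j) * b j)"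
    using nind_bound[OF nb K N] b by (metis lessThan_iff)
  note av = av_nonneg[OF K N] av_mult[OF K N]
  \<comment> \<open>If the large coefficient belongs to the old family, it is at most
    \<open>C0\<close> times the larger of \<open>N z\<close> and
    \<open>N (to_ac (t n)) * N x\<close>. The choice \<open>C > C0\<close> excludes the first
    alternative, the second gives the factor \<open>D\<close>, whose summand 1 covers the
    coefficient of \<open>x\<close> itself, and \<open>C * \<epsilon> > D\<close> is what the final
    division needs.\<close>
  define D where "D = C0 * N x + 1"
  have D: "D \<ge> 1" using C0 av(1)[OF x] by (simp add: D_def)
  define C where "C = (C0 + D) * (1 + 1 / \<epsilon>)"
  have C1: "C > C0" and C2: "C * \<epsilon> > D"
  proof -
    have "C = (C0 + D) + (C0 + D) / \<epsilon>" by (simp add: C_def distrib_left)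
    moreover have "(C0 + D) / \<epsilon> > 0" using C0 D \<open>\<epsilon> > 0\<close> by simp
    ultimately show "C > C0" using D by linarith
    have "C * \<epsilon> = (C0 + D) * \<epsilon> + (C0 + D)" using \<open>\<epsilon> > 0\<close> by (simp add: C_def field_simps)
    moreover have "(C0 + D) * \<epsilon> > 0" using C0 D \<open>\<epsilon> > 0\<close> by simp
    ultimately show "C * \<epsilon> > D" using C0 by linarith
  qed
  obtain t i where ti: "i < Suc n" "N (to_ac (t i)) > C * N (\<Sum>j<Suc n. to_ac (t j) * (b(n := x)) j)"
    using nx unfolding nind_def by (meson lessThan_iff linorder_le_less_linear)
  define s where "s = (\<Sum>j<n. to_ac (t j) * b j)"
  define z where "z = s + to_ac (t n) * x"
  have sK: "s \<in> K" unfolding s_def using b K by (auto intro!: subf_ops)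
  have zK: "z \<in> K" unfolding z_def using sK x K by (auto intro!: subf_ops)
  have "(\<Sum>j<Suc n. to_ac (t j) * (b(n := x)) j) = z"
    by (simp add: z_def s_def)
  hence ti': "N (to_ac (t i)) > C * N z" using ti by simp
  have ns: "N s \<le> max (N z) (N (to_ac (t n)) * N x)"
  proof -
    have "s = z - to_ac (t n) * x" by (simp add: z_def)
    hence "N s \<le> max (N z) (N (to_ac (t n) * x))"
      using av_diff[OF K N zK subf_mult[OF K subf_to_ac[OF K] x]] by simp
    thus ?thesis using av K x by auto
  qed
  have le: "C * N z < D * N (to_ac (t n))"
  proof (cases "i = n")
    case True
    have "1 * N (to_ac (t n)) \<le> D * N (to_ac (t n))" 
      using D av K by (intro mult_right_mono) auto
    thus ?thesis using ti' True by simp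
  next
    case False
    hence "C * N z < C0 * N s" using ti ti' C0(2)[of i t] by (auto simp: s_def)
    also have "\<dots> \<le> C0 * max (N z) (N (to_ac (t n)) * N x)" using ns C0 by (intro mult_left_mono) auto
    finally have *: "C * N z < C0 * max (N z) (N (to_ac (t n)) * N x)" .
    have "N z \<le> N (to_ac (t n)) * N x"
    proof (rule ccontr)
      assume "\<not> ?thesis"
      hence "C * N z < C0 * N z" using * by (auto simp: max_def)
      moreover have "C0 * N z \<le> C * N z" using C1 av(1)[OF zK] by (intro mult_right_mono) auto
      ultimately show False by linarith
    qed
    hence "C * N z < C0 * (N (to_ac (t n)) * N x)" using * by (auto simp: max_def)
    also have "\<dots> \<le> D * N (to_ac (t n))" using av K by (auto simp: D_def algebra_simps)
    finally show ?thesis .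
  qed
  have tn: "t n \<noteq> 0"
  proof
    assume "t n = 0"
    hence "C * N z < 0" using le av_0[OF K N] by simp
    moreover have "C * N z \<ge> 0" using C1 C0 av(1)[OF zK] by simp
    ultimately show False by simp
  qed
  hence Ntn: "N (to_ac (t n)) > 0" using av_pos[OF K N] K by simp
  have "C * N z < C * \<epsilon> * N (to_ac (t n))" using le C2 Ntn by (smt (verit) mult_strict_right_mono)
  hence "N z < \<epsilon> * N (to_ac (t n))" using C1 C0 by (simp add: mult.assoc)
  hence "N (z / to_ac (t n)) < \<epsilon>" using av_divide[OF K N zK, of "to_ac (t n)"] K Ntn by (simp add: pos_divide_less_eq)
  moreover have "z / to_ac (t n) = x - (\<Sum>i<n. to_ac (- t i / t n) * b i)"
    using tn by (simp add: z_def s_def add_divide_distrib sum_divide_distrib sum_negf)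
  ultimately show ?thesis by (intro exI[of _ "\<lambda>i. - t i / t n"]) auto
qed

section \<open>Weak approximation\<close>

lemma separate_two:
  assumes K: "subf K" and N1: "absval K N1" and N2: "absval K N2"
    and V: "\<And>c. N1 (to_ac c) = V c" "\<And>c. N2 (to_ac c) = V c" and p: "0 < V p" "V p < 1"
    and z: "z \<in> K" "N1 z \<noteq> N2 z"
  shows "\<exists>u\<in>K. N1 u > 1 \<and> N2 u < 1"
proof -
  have main: "\<exists>u\<in>K. N1 u > 1 \<and> N2 u < 1" if z: "z \<in> K" "N1 z > N2 z" for z
  proof -
    have z0: "z \<noteq> 0" using z av_0[OF K N1] av_0[OF K N2] by auto
    have pos: "N1 z > 0" "N2 z > 0" using av_pos[OF K N1] av_pos[OF K N2] z z0 by auto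
    \<comment> \<open>Multiplication by a power of \<open>p\<close> shifts both logarithms by the
      same multiple of \<open>L\<close>. For large \<open>n\<close> the numbers
      \<open>n * ln (N2 z)\<close> and \<open>n * ln (N1 z)\<close> are more than \<open>L\<close>
      apart, so a multiple \<open>a * L\<close> lies strictly between them; subtracting it leaves
      one negative and one positive.\<close>
    define L where "L = - ln (V p)"
    have L: "L > 0" using p by (simp add: L_def)
    have dl: "ln (N1 z) - ln (N2 z) > 0" using z pos by simp
    obtain n :: nat where n: "L < real n * (ln (N1 z) - ln (N2 z))"
      using reals_Archimedean3[OF dl] by blast
    define a where "a = \<lfloor>real n * ln (N2 z) / L\<rfloor> + 1"
    have a1: "real_of_int a > real n * ln (N2 z) / L" and a2: "real_of_int a \<le> real n * ln (N2 z) / L + 1"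
      unfolding a_def by linarith+
    have a1': "real_of_int a * L > real n * ln (N2 z)" using a1 L by (simp add: field_simps)
    have a2': "real_of_int a * L < real n * ln (N1 z)"
    proof -
      have "real_of_int a * L \<le> real n * ln (N2 z) + L" using a2 L by (simp add: field_simps)
      thus ?thesis using n by (simp add: algebra_simps)
    qed
    define u where "u = z ^ n * to_ac (p powi a)"
    have pi: "to_ac (p powi a) = to_ac p powi a"
      by (auto simp: power_int_def)
    have uK: "u \<in> K" unfolding u_def using z K by (auto intro!: subf_ops)
    have ln: "N u > 0 \<and> ln (N u) = real n * ln (N z) - real_of_int a * L" if N: "absval K N" and V: "\<And>c. N (to_ac c) = V c" for N
    proof -
      have Nz: "N z > 0" using av_pos[OF K N z(1) z0] .
      have "N u = N z ^ n * (V p) powi a"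
        unfolding u_def using z K V[where c = p]
        by (simp add: av_mult[OF K N] subf_power av_power[OF K N]) (simp add: pi av_power_int[OF K N])
      thus ?thesis using Nz p by (simp add: ln_mult ln_realpow L_def power_int_def ln_inverse)
    qed
    have "N1 u > 1" using ln[OF N1 V(1)] a2' by (simp add: ln_gt_zero_iff[symmetric])
    moreover have "N2 u < 1" using ln[OF N2 V(2)] a1' by (simp add: ln_less_zero_iff[symmetric])
    ultimately show ?thesis using uK by blast
  qed
  show ?thesis
  proof (cases "N1 z > N2 z")
    case True thus ?thesis using main[of z] z by blast
  next
    case False
    hence lt: "N1 z < N2 z" using z by simp
    have "z \<noteq> 0" using z av_0[OF K N1] av_0[OF K N2] by auto
    hence "N1 (inverse z) > N2 (inverse z)"
      using lt av_pos[OF K N1 z(1)] z av_inverse[OF K N1 z(1)] av_inverse[OF K N2 z(1)] by simp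
    thus ?thesis using main[of "inverse z"] subf_inverse[OF K z(1)] by blast
  qed
qed

lemma eventually_power_lt: 
  assumes "0 \<le> r" "r < (1::real)" "0 < e"
  shows "eventually (\<lambda>n. r ^ n * s < e) sequentially"
proof -
  have "(\<lambda>n. r ^ n * s) \<longlonglongrightarrow> 0 * s"
    using assms by (intro tendsto_intros LIMSEQ_realpow_zero) auto
  thus ?thesis using assms by (auto intro: order_tendstoD)
qed

context
  fixes K :: "'k::field alg_closure set" and Nf :: "'j \<Rightarrow> 'k alg_closure \<Rightarrow> real" and V p J
  assumes K: "subf K" and N: "\<And>j. j \<in> J \<Longrightarrow> absval K (Nf j)"
    and V: "\<And>j c. j \<in> J \<Longrightarrow> Nf j (to_ac c) = V c" and p: "0 < V p" "V p < 1"
    and dist: "\<And>i j. i \<in> J \<Longrightarrow> j \<in> J \<Longrightarrow> i \<noteq> j \<Longrightarrow> \<exists>z\<in>K. Nf i z \<noteq> Nf j z"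
begin

text \<open>The quotient \<open>u ^ n / (1 + u ^ n)\<close> is an approximate idempotent: for
  growing \<open>n\<close> it tends to 0 where \<open>u\<close> is small and to 1 where
  \<open>u\<close> is large. In the first case 1 dominates the denominator, in the second
  \<open>u ^ n\<close> does.\<close>

lemma geom_quot:
  assumes "j \<in> J" "u \<in> K"
  shows "Nf j u < 1 \<Longrightarrow> n > 0 \<Longrightarrow> Nf j (u ^ n / (1 + u ^ n)) = Nf j u ^ n"
    "Nf j u > 1 \<Longrightarrow> n > 0 \<Longrightarrow> Nf j (u ^ n / (1 + u ^ n)) = 1"
    "Nf j u > 1 \<Longrightarrow> n > 0 \<Longrightarrow> Nf j (u ^ n / (1 + u ^ n) - 1) = (1 / Nf j u) ^ n"
proof -
  note Nj = N[OF assms(1)]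
  have un: "u ^ n \<in> K" "1 + u ^ n \<in> K" using K assms by (auto intro!: subf_ops)
  have Nun: "Nf j (u ^ n) = Nf j u ^ n" using av_power[OF K Nj assms(2)] .
  have nn: "Nf j u \<ge> 0" using av_nonneg[OF K Nj assms(2)] .
  show "Nf j (u ^ n / (1 + u ^ n)) = Nf j u ^ n" if "Nf j u < 1" "n > 0"
  proof -
    have "Nf j (u ^ n + 1) = Nf j 1"
      using that nn un K Nun av_1[OF K Nj] by (intro av_add_eq[OF K Nj]) (auto simp: power_less_one_iff)
    thus ?thesis using av_divide[OF K Nj un] Nun av_1[OF K Nj] by (simp add: add.commute)
  qed
  have gt: "Nf j (1 + u ^ n) = Nf j u ^ n" "Nf j u ^ n > 1" if "Nf j u > 1" "n > 0"
  proof -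
    show "Nf j u ^ n > 1" using that by (simp add: one_less_power)
    thus "Nf j (1 + u ^ n) = Nf j u ^ n"
      using av_add_eq[OF K Nj, of 1 "u ^ n"] un K av_1[OF K Nj] Nun by simp
  qed
  show "Nf j (u ^ n / (1 + u ^ n)) = 1" if "Nf j u > 1" "n > 0"
    using av_divide[OF K Nj un] Nun gt[OF that] that by simp
  show "Nf j (u ^ n / (1 + u ^ n) - 1) = (1 / Nf j u) ^ n" if "Nf j u > 1" "n > 0"
  proof -
    have "1 + u ^ n \<noteq> 0"
    proof
      assume "1 + u ^ n = 0"
      hence "Nf j (1 + u ^ n) = 0" using av_0[OF K Nj] by simp
      thus False using gt[OF that] by linarith
    qed
    hence "u ^ n / (1 + u ^ n) - 1 = - inverse (1 + u ^ n)" by (simp add: field_simps)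
    hence "Nf j (u ^ n / (1 + u ^ n) - 1) = inverse (Nf j (1 + u ^ n))"
      using av_uminus[OF K Nj subf_inverse[OF K un(2)]] av_inverse[OF K Nj un(2)] by simp
    thus ?thesis using gt[OF that] by (simp add: power_one_over inverse_eq_divide)
  qed
qed

text \<open>The induction adds one place \<open>j\<close> to be made small. The element
  \<open>u\<close> treats the old places, \<open>u'\<close> treats \<open>j\<close>, and a high
  power of \<open>u\<close> outweighs whatever \<open>u'\<close> does at the old places.\<close>

lemma separate_many:
  assumes "finite I" "I \<subseteq> J" "i \<in> J" "i \<notin> I"
  shows "\<exists>u\<in>K. Nf i u > 1 \<and> (\<forall>j\<in>I. Nf j u < 1)"
  using assms
proof (induction I rule: finite_induct)
  case empty
  have "Nf i (to_ac (inverse p)) > 1"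
    using p av_inverse[OF K N[of i], of "to_ac p"] K empty V[of i p] by (auto simp: one_less_inverse_iff)
  thus ?case using subf_to_ac[OF K, of "inverse p"] by blast
next
  case (insert j I)
  then obtain u where u: "u \<in> K" "Nf i u > 1" "\<forall>j\<in>I. Nf j u < 1" by auto
  have ij: "i \<in> J" "j \<in> J" "i \<noteq> j" using insert by auto
  obtain u' where u': "u' \<in> K" "Nf i u' > 1" "Nf j u' < 1"
  proof -
    obtain z where "z \<in> K" "Nf i z \<noteq> Nf j z" using dist[OF ij] by blast
    thus ?thesis using that separate_two[OF K N[OF ij(1)] N[OF ij(2)] V[OF ij(1)] V[OF ij(2)] p] by blast
  qed
  have nn: "Nf l x \<ge> 0" if "l \<in> J" "x \<in> K" for l x using av_nonneg[OF K N[OF that(1)] that(2)] .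
  have mult: "Nf l (x * y) = Nf l x * Nf l y" if "l \<in> J" "x \<in> K" "y \<in> K" for l x y
    using av_mult[OF K N[OF that(1)] that(2,3)] .
  have "eventually (\<lambda>n. \<forall>l\<in>I. Nf l u ^ n * Nf l u' < 1) sequentially"
    using insert u nn by (intro eventually_ball_finite ballI eventually_power_lt) auto
  hence "eventually (\<lambda>n. n > 0 \<and> (\<forall>l\<in>I. Nf l u ^ n * Nf l u' < 1)) sequentially"
    by (intro eventually_conj eventually_gt_at_top) auto
  then obtain n where n: "n > 0" "\<forall>l\<in>I. Nf l u ^ n * Nf l u' < 1"
    by (auto dest!: eventually_happens)
  show ?case
  proof (cases "Nf j u > 1")
    case True
    \<comment> \<open>The power \<open>u ^ n\<close> alone would be too large at \<open>j\<close>;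
      the quotient has value 1 there and at \<open>i\<close>, and still becomes small on
      \<open>I\<close>.\<close>
    define w where "w = u ^ n / (1 + u ^ n) * u'"
    have qK: "u ^ n / (1 + u ^ n) \<in> K" using u K by (auto intro!: subf_ops)
    hence w: "w \<in> K" unfolding w_def using u' by (intro subf_mult[OF K qK]) auto
    have "Nf i w > 1" using mult[OF ij(1) qK u'(1)] geom_quot(2)[OF ij(1) u(1,2) n(1)] u' by (simp add: w_def)
    moreover have "Nf j w < 1" using mult[OF ij(2) qK u'(1)] geom_quot(2)[OF ij(2) u(1) True n(1)] u' by (simp add: w_def)
    moreover have "Nf l w < 1" if "l \<in> I" for l
      using mult[OF _ qK u'(1), of l] geom_quot(1)[of l u n] that insert.prems u n by (auto simp: w_def)
    ultimately show ?thesis using w by blast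
  next
    case False
    define w where "w = u ^ n * u'"
    have qK: "u ^ n \<in> K" using u K by (auto intro!: subf_ops)
    hence w: "w \<in> K" using u' K by (auto simp: w_def intro!: subf_ops)
    have eq: "Nf l w = Nf l u ^ n * Nf l u'" if "l \<in> J" for l
      using mult[OF that qK u'(1)] av_power[OF K N[OF that] u(1)] by (simp add: w_def)
    have "Nf i w > 1" using eq[OF ij(1)] u u' n by (simp add: less_1_mult one_less_power)
    moreover have "Nf j w < 1"
    proof -
      have "Nf j u ^ n \<le> 1" using False nn[OF ij(2) u(1)] by (intro power_le_one) auto
      hence "Nf j u ^ n * Nf j u' \<le> 1 * Nf j u'" using nn[OF ij(2) u'(1)] by (intro mult_right_mono) auto
      thus ?thesis using eq[OF ij(2)] u' by simp
    qed
    moreover have "Nf l w < 1" if "l \<in> I" for l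
      using eq[of l] that insert.prems n by auto
    ultimately show ?thesis using w by blast
  qed
qed

text \<open>An element that is large at \<open>i\<close> and small at all other places is fed into
  the approximate idempotent of \<open>geom_quot\<close>.\<close>

lemma weak_approx:
  assumes "finite J" "i \<in> J" "\<epsilon> > 0"
  shows "\<exists>\<phi>\<in>K. Nf i (\<phi> - 1) < \<epsilon> \<and> (\<forall>j\<in>J - {i}. Nf j \<phi> < \<epsilon>)"
proof -
  obtain u where u: "u \<in> K" "Nf i u > 1" "\<forall>j\<in>J-{i}. Nf j u < 1"
    using separate_many[of "J - {i}" i] assms by auto
  have nn: "Nf l x \<ge> 0" if "l \<in> J" "x \<in> K" for l x using av_nonneg[OF K N[OF that(1)] that(2)] .
  have "eventually (\<lambda>n. \<forall>l\<in>J-{i}. Nf l u ^ n * 1 < \<epsilon>) sequentially"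
    using assms u nn by (intro eventually_ball_finite ballI eventually_power_lt) auto
  moreover have "eventually (\<lambda>n. (1 / Nf i u) ^ n * 1 < \<epsilon>) sequentially"
    using u assms by (intro eventually_power_lt) auto
  ultimately have "eventually (\<lambda>n. n > 0 \<and> (1 / Nf i u) ^ n * 1 < \<epsilon> \<and> (\<forall>l\<in>J-{i}. Nf l u ^ n * 1 < \<epsilon>)) sequentially"
    by (intro eventually_conj eventually_gt_at_top) auto
  then obtain n where n: "n > 0" "(1 / Nf i u) ^ n < \<epsilon>" "\<forall>l\<in>J-{i}. Nf l u ^ n < \<epsilon>"
    by (auto dest!: eventually_happens)
  show ?thesis
    using u n geom_quot[of _ u n] assms K
    by (intro bexI[of _ "u ^ n / (1 + u ^ n)"]) (auto intro!: subf_ops)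
qed

text \<open>Independent families at the single places are glued into one family in \<open>K\<close>:
  each is multiplied by an element close to 1 at its own place and close to 0 at the others. At the
  place that owns the largest coefficient of a combination, the glued combination is a small
  perturbation of a combination of the original family there, so this place detects the
  coefficient.\<close>

lemma joint_nind:
  fixes n :: "'j \<Rightarrow> nat"
  assumes J: "finite J" and b: "\<And>j i. j \<in> J \<Longrightarrow> i < n j \<Longrightarrow> b j i \<in> K"
    and nb: "\<And>j. j \<in> J \<Longrightarrow> nind (Nf j) {..<n j} (b j)"
  shows "\<exists>\<beta>. (\<forall>q\<in>Sigma J (\<lambda>j. {..<n j}). \<beta> q \<in> K) \<and> (\<exists>C. \<forall>t. \<forall>q\<in>Sigma J (\<lambda>j. {..<n j}). \<exists>j\<in>J.
           V (t q) \<le> C * Nf j (\<Sum>r\<in>Sigma J (\<lambda>j. {..<n j}). to_ac (t r) * \<beta> r))"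
proof -
  define S where "S = Sigma J (\<lambda>j. {..<n j})"
  have S: "finite S" using J by (simp add: S_def)
  have SJ: "fst q \<in> J" "snd q < n (fst q)" if "q \<in> S" for q using that by (auto simp: S_def)
  have nn: "Nf l x \<ge> 0" if "l \<in> J" "x \<in> K" for l x using av_nonneg[OF K N[OF that(1)] that(2)] .
  have "\<forall>j\<in>J. \<exists>C\<ge>1. \<forall>t. \<forall>i\<in>{..<n j}. V (t i) \<le> C * Nf j (\<Sum>i<n j. to_ac (t i) * b j i)"
  proof
    fix j assume j: "j \<in> J"
    show "\<exists>C\<ge>1. \<forall>t. \<forall>i\<in>{..<n j}. V (t i) \<le> C * Nf j (\<Sum>i<n j. to_ac (t i) * b j i)"
      using nind_bound[OF nb[OF j] K N[OF j]] b[OF j] V[OF j] by (metis lessThan_iff)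
  qed
  then obtain Cf where Cf: "\<And>j. j \<in> J \<Longrightarrow> Cf j \<ge> (1::real)"
    "\<And>j t i. j \<in> J \<Longrightarrow> i < n j \<Longrightarrow> V (t i) \<le> Cf j * Nf j (\<Sum>i<n j. to_ac (t i) * b j i)"
    by (metis lessThan_iff)
  define C where "C = Max (insert 1 (Cf ` J))"
  have C: "C \<ge> 1" "\<And>j. j \<in> J \<Longrightarrow> Cf j \<le> C" using J by (auto simp: C_def)
  define B where "B = Max (insert 1 ((\<lambda>(l, q). Nf l (b (fst q) (snd q))) ` (J \<times> S)))"
  have B: "B \<ge> 1" "\<And>l q. l \<in> J \<Longrightarrow> q \<in> S \<Longrightarrow> Nf l (b (fst q) (snd q)) \<le> B"
  proof -
    have fin: "finite (insert 1 ((\<lambda>(l, q). Nf l (b (fst q) (snd q))) ` (J \<times> S)))" using J S by simp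
    show "B \<ge> 1" unfolding B_def using fin by (intro Max_ge) auto
    show "Nf l (b (fst q) (snd q)) \<le> B" if "l \<in> J" "q \<in> S" for l q
      unfolding B_def using fin that by (intro Max_ge) force+
  qed
  \<comment> \<open>At the place \<open>j\<close> the perturbation is at most
    \<open>\<tau> * (B * \<epsilon>)\<close>, where \<open>\<tau>\<close> is the largest
    coefficient. Multiplied by \<open>C\<close> this is \<open>\<tau> / 2\<close>, too small to
    account for \<open>\<tau>\<close>.\<close>
  define \<epsilon> where "\<epsilon> = 1 / (2 * B * C)"
  have eps: "\<epsilon> > 0" using B C by (simp add: \<epsilon>_def)
  have "\<forall>j\<in>J. \<exists>\<phi>. \<phi> \<in> K \<and> Nf j (\<phi> - 1) < \<epsilon> \<and> (\<forall>i\<in>J - {j}. Nf i \<phi> < \<epsilon>)"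
    using weak_approx[OF J _ eps] by blast
  then obtain \<phi> where \<phi>: "\<And>j. j \<in> J \<Longrightarrow> \<phi> j \<in> K" "\<And>j. j \<in> J \<Longrightarrow> Nf j (\<phi> j - 1) < \<epsilon>"
    "\<And>j i. j \<in> J \<Longrightarrow> i \<in> J \<Longrightarrow> i \<noteq> j \<Longrightarrow> Nf i (\<phi> j) < \<epsilon>" by (metis DiffI singletonD)
  define \<beta> where "\<beta> q = b (fst q) (snd q) * \<phi> (fst q)" for q
  have \<beta>K: "\<beta> q \<in> K" if "q \<in> S" for q
    unfolding \<beta>_def using SJ[OF that] b \<phi> K by (auto intro!: subf_ops)
  have "\<exists>j\<in>J. V (t q) \<le> C * Nf j (\<Sum>r\<in>S. to_ac (t r) * \<beta> r)" if q: "q \<in> S" for t q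
  proof -
    define \<tau> where "\<tau> = Max ((\<lambda>q. V (t q)) ` S)"
    have \<tau>: "V (t r) \<le> \<tau>" if "r \<in> S" for r using S that by (simp add: \<tau>_def)
    have "\<tau> \<in> (\<lambda>q. V (t q)) ` S" unfolding \<tau>_def using S q by (intro Max_in) auto
    then obtain q0 where q0: "q0 \<in> S" "\<tau> = V (t q0)" by auto
    define j where "j = fst q0"
    have j: "j \<in> J" "snd q0 < n j" using SJ[OF q0(1)] by (auto simp: j_def)
    note Nj = N[OF j(1)]
    have \<tau>0: "\<tau> \<ge> 0" using q0 V[OF j(1)] nn[OF j(1)] K by (metis subf_to_ac)
    define z where "z = (\<Sum>r\<in>S. to_ac (t r) * \<beta> r)"
    define y where "y = (\<Sum>i<n j. to_ac (t (j, i)) * b j i)"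
    have zK: "z \<in> K" unfolding z_def using \<beta>K K by (auto intro!: subf_ops)
    have yK: "y \<in> K" unfolding y_def using b[OF j(1)] K by (auto intro!: subf_ops)
    define e where "e r = b (fst r) (snd r) * (if fst r = j then \<phi> j - 1 else \<phi> (fst r))" for r
    have eK: "e r \<in> K" if "r \<in> S" for r
      unfolding e_def using SJ[OF that] b \<phi> K j by (auto intro!: subf_ops)
    have Ne: "Nf j (e r) \<le> B * \<epsilon>" if "r \<in> S" for r
    proof -
      define x where "x = (if fst r = j then \<phi> j - 1 else \<phi> (fst r))"
      have xK: "x \<in> K" using SJ[OF that] \<phi> K j by (auto simp: x_def intro!: subf_ops)
      have "Nf j x \<le> \<epsilon>" unfolding x_def using \<phi>(2)[OF j(1)] \<phi>(3)[of "fst r" j] SJ[OF that] j by (auto simp: less_imp_le)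
      moreover have "Nf j (e r) = Nf j (b (fst r) (snd r)) * Nf j x"
        unfolding e_def x_def[symmetric] using xK b SJ[OF that] by (intro av_mult[OF K Nj]) auto
      ultimately show ?thesis using B(2)[OF j(1) that] nn[OF j(1) xK] B(1)
        by (simp add: mult_mono)
    qed
    have y': "y = (\<Sum>r\<in>S. if fst r = j then to_ac (t r) * b (fst r) (snd r) else 0)"
    proof -
      have "(\<Sum>r\<in>S. if fst r = j then to_ac (t r) * b (fst r) (snd r) else 0) = 
            (\<Sum>l\<in>J. \<Sum>i<n l. if l = j then to_ac (t (l, i)) * b l i else 0)"
        unfolding S_def using J by (subst sum.Sigma) (auto intro!: sum.cong)
      also have "\<dots> = (\<Sum>l\<in>J. if l = j then (\<Sum>i<n l. to_ac (t (l, i)) * b l i) else 0)"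
        by (intro sum.cong) auto
      also have "\<dots> = y" using J j by (simp add: y_def)
      finally show ?thesis by simp
    qed
    have zy: "z - y = (\<Sum>r\<in>S. to_ac (t r) * e r)"
      unfolding y' z_def sum_subtractf[symmetric] e_def \<beta>_def by (intro sum.cong) (auto simp: algebra_simps)
    have "Nf j (z - y) \<le> \<tau> * (B * \<epsilon>)" unfolding zy
    proof (rule av_sum_le[OF K Nj])
      fix r assume r: "r \<in> S"
      show "to_ac (t r) * e r \<in> K" using eK[OF r] K by (auto intro!: subf_ops)
      have "Nf j (to_ac (t r) * e r) = V (t r) * Nf j (e r)"
        using av_mult[OF K Nj _ eK[OF r]] K V[OF j(1)] by simp
      also have "\<dots> \<le> \<tau> * (B * \<epsilon>)" using \<tau>[OF r] Ne[OF r] nn[OF j(1) eK[OF r]] \<tau>0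
        by (intro mult_mono) auto
      finally show "Nf j (to_ac (t r) * e r) \<le> \<tau> * (B * \<epsilon>)" .
    qed (use \<tau>0 B eps in auto)
    hence Ny: "Nf j y \<le> max (Nf j z) (\<tau> * (B * \<epsilon>))"
      using av_diff[OF K Nj zK subf_diff[OF K zK yK]] by auto
    have "\<tau> \<le> Cf j * Nf j y"
      using Cf(2)[OF j, of "\<lambda>i. t (j, i)"] q0 by (simp add: y_def j_def)
    also have "\<dots> \<le> C * max (Nf j z) (\<tau> * (B * \<epsilon>))"
      using Ny C(2)[OF j(1)] nn[OF j(1) yK] C(1) by (intro mult_mono) auto
    also have "\<dots> = max (C * Nf j z) (\<tau> / 2)"
      using C B by (simp add: max_mult_distrib_left \<epsilon>_def field_simps)
    finally have "\<tau> \<le> C * Nf j z"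
      using \<tau>0 nn[OF j(1) zK] C(1) by (cases "\<tau> = 0") (auto simp: max_def split: if_splits)
    thus ?thesis using \<tau>[OF q] j(1) by (auto simp: z_def intro!: bexI[of _ j])
  qed
  thus ?thesis using \<beta>K unfolding S_def[symmetric] by (intro exI[of _ \<beta>]) blast
qed

text \<open>The fundamental inequality, relative to an intermediate field \<open>L\<close> with
  local degree \<open>m\<close>. If there were more jointly independent elements, their coordinates
  in \<open>L\<close> could be approximated from a space spanned over \<open>k\<close> by
  \<open>m\<close> elements. A linear relation among the approximations would give a combination
  with a coefficient of value 1 that is too small at every place to be compatible with
  \<open>joint_nind\<close>.\<close>

lemma local_degree_sum_le:
  fixes n :: "'j \<Rightarrow> nat"
  assumes J: "finite J" and b: "\<And>j i. j \<in> J \<Longrightarrow> i < n j \<Longrightarrow> b j i \<in> K"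
    and nb: "\<And>j. j \<in> J \<Longrightarrow> nind (Nf j) {..<n j} (b j)"
    and L: "subf L" "L \<subseteq> K" and N0: "absval L N0" and NL: "\<And>j x. j \<in> J \<Longrightarrow> x \<in> L \<Longrightarrow> Nf j x = N0 x"
    and c: "\<And>i. i < m \<Longrightarrow> c i \<in> L"
    and dense: "\<And>x \<epsilon>. x \<in> L \<Longrightarrow> \<epsilon> > 0 \<Longrightarrow> \<exists>t. N0 (x - (\<Sum>i<m. to_ac (t i) * c i)) < \<epsilon>"
    and e: "\<And>l. l < d \<Longrightarrow> e l \<in> K"
    and span: "\<And>z. z \<in> K \<Longrightarrow> \<exists>x. (\<forall>l<d. x l \<in> L) \<and> z = (\<Sum>l<d. x l * e l)"
  shows "(\<Sum>j\<in>J. n j) \<le> m * d"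
proof (rule ccontr)
  assume neg: "\<not> ?thesis"
  define S where "S = Sigma J (\<lambda>j. {..<n j})"
  have S: "finite S" "card S = (\<Sum>j\<in>J. n j)" using J by (auto simp: S_def)
  obtain \<beta> C where \<beta>K: "\<And>q. q \<in> S \<Longrightarrow> \<beta> q \<in> K" and
    C: "\<And>t q. q \<in> S \<Longrightarrow> \<exists>j\<in>J. V (t q) \<le> C * Nf j (\<Sum>r\<in>S. to_ac (t r) * \<beta> r)"
    using joint_nind[OF J b nb] unfolding S_def[symmetric] by blast
  have "\<forall>q\<in>S. \<exists>x. (\<forall>l<d. x l \<in> L) \<and> \<beta> q = (\<Sum>l<d. x l * e l)" using span \<beta>K by blast
  then obtain x where x: "\<And>q l. q \<in> S \<Longrightarrow> l < d \<Longrightarrow> x q l \<in> L" "\<And>q. q \<in> S \<Longrightarrow> \<beta> q = (\<Sum>l<d. x q l * e l)"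
    by metis
  have Jne: "J \<noteq> {}" using neg by auto
  have nn: "Nf l x \<ge> 0" if "l \<in> J" "x \<in> K" for l x using av_nonneg[OF K N[OF that(1)] that(2)] .
  define E where "E = Max (insert 1 ((\<lambda>(j, l). Nf j (e l)) ` (J \<times> {..<d})))"
  have E: "E \<ge> 1" "\<And>j l. j \<in> J \<Longrightarrow> l < d \<Longrightarrow> Nf j (e l) \<le> E"
  proof -
    have fin: "finite (insert 1 ((\<lambda>(j, l). Nf j (e l)) ` (J \<times> {..<d})))" using J by simp
    show "E \<ge> 1" unfolding E_def using fin by (intro Max_ge) auto
    show "Nf j (e l) \<le> E" if "j \<in> J" "l < d" for j l
      unfolding E_def using fin that by (intro Max_ge) force+
  qed
  define C' where "C' = max C 1"
  define \<epsilon> where "\<epsilon> = 1 / (2 * E * C')"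
  have eps: "\<epsilon> > 0" using E by (simp add: \<epsilon>_def C'_def)
  have "\<forall>q\<in>S. \<forall>l<d. \<exists>s. N0 (x q l - (\<Sum>i<m. to_ac (s i) * c i)) < \<epsilon>" using dense x(1) eps by blast
  then obtain s where s: "\<And>q l. q \<in> S \<Longrightarrow> l < d \<Longrightarrow> N0 (x q l - (\<Sum>i<m. to_ac (s q l i) * c i)) < \<epsilon>" by metis
  \<comment> \<open>These \<open>d * m\<close> equations make the approximations cancel in every
    coordinate, so only errors below \<open>\<epsilon>\<close> remain.\<close>
  have "\<exists>t. (\<exists>q\<in>S. t q \<noteq> 0) \<and> (\<forall>li\<in>{..<d} \<times> {..<m}. (\<Sum>q\<in>S. t q * s q (fst li) (snd li)) = 0)"
    using neg S by (intro lin_dep) (auto simp: mult.commute)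
  then obtain t where t: "\<exists>q\<in>S. t q \<noteq> 0" "\<And>l i. l < d \<Longrightarrow> i < m \<Longrightarrow> (\<Sum>q\<in>S. t q * s q l i) = 0" by fastforce
  have Sne: "S \<noteq> {}" using t by auto
  obtain j0 where j0: "j0 \<in> J" using Jne by blast
  have V0: "V c \<ge> 0" for c using V[OF j0, of c] nn[OF j0, of "to_ac c"] K by simp
  have Vpos: "V c > 0" if "c \<noteq> 0" for c using V[OF j0, of c] av_pos[OF K N[OF j0], of "to_ac c"] K that by simp
  have Vdiv: "V (a / b) = V a / V b" for a b
    using V[OF j0] av_divide[OF K N[OF j0], of "to_ac a" "to_ac b"] K by (metis subf_to_ac to_ac_divide)
  define \<tau> where "\<tau> = Max ((\<lambda>q. V (t q)) ` S)"
  have \<tau>: "V (t r) \<le> \<tau>" if "r \<in> S" for r using S that by (simp add: \<tau>_def)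
  have "\<tau> \<in> (\<lambda>q. V (t q)) ` S" unfolding \<tau>_def using S Sne by (intro Max_in) auto
  then obtain q0 where q0: "q0 \<in> S" "\<tau> = V (t q0)" by auto
  have \<tau>0: "\<tau> > 0" using t(1) \<tau> Vpos by force
  hence tq0: "t q0 \<noteq> 0" using q0 V[OF j0, of 0] av_0[OF K N[OF j0]] by auto
  \<comment> \<open>After scaling, the largest coefficient has value 1. Hence the approximation
    errors are not amplified, and 1 contradicts the bound 1/2 reached at the end.\<close>
  define t' where "t' q = t q / t q0" for q
  have t'1: "V (t' q) \<le> 1" if "q \<in> S" for q
    using \<tau>[OF that] \<tau>0 q0 unfolding t'_def Vdiv by simp
  have t'q0: "V (t' q0) = 1" using \<tau>0 q0 unfolding t'_def Vdiv by simp
  have t'0: "(\<Sum>q\<in>S. t' q * s q l i) = 0" if "l < d" "i < m" for l i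
    using t(2)[OF that] by (simp add: t'_def sum_divide_distrib[symmetric])
  define y where "y l = (\<Sum>q\<in>S. to_ac (t' q) * x q l)" for l
  have yL: "y l \<in> L" if "l < d" for l
    unfolding y_def using x(1) that L by (auto intro!: subf_ops)
  have Ny: "N0 (y l) \<le> \<epsilon>" if l: "l < d" for l
  proof -
    have "(\<Sum>q\<in>S. to_ac (t' q) * (\<Sum>i<m. to_ac (s q l i) * c i)) = (\<Sum>q\<in>S. \<Sum>i<m. to_ac (t' q * s q l i) * c i)"
      by (simp add: sum_distrib_left mult.assoc)
    also have "\<dots> = (\<Sum>i<m. \<Sum>q\<in>S. to_ac (t' q * s q l i) * c i)" by (rule sum.swap)
    also have "\<dots> = (\<Sum>i<m. to_ac (\<Sum>q\<in>S. t' q * s q l i) * c i)"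
      unfolding to_ac_sum sum_distrib_right ..
    also have "\<dots> = 0" using t'0[OF l] by simp
    finally have "y l = (\<Sum>q\<in>S. to_ac (t' q) * (x q l - (\<Sum>i<m. to_ac (s q l i) * c i)))"
      unfolding y_def right_diff_distrib sum_subtractf by simp
    also have "N0 \<dots> \<le> \<epsilon>"
    proof (rule av_sum_le[OF L(1) N0])
      fix q assume q: "q \<in> S"
      have dL: "x q l - (\<Sum>i<m. to_ac (s q l i) * c i) \<in> L" using x(1)[OF q l] c L by (auto intro!: subf_ops)
      thus "to_ac (t' q) * (x q l - (\<Sum>i<m. to_ac (s q l i) * c i)) \<in> L" using L by (auto intro!: subf_ops)
      have "N0 (to_ac (t' q) * (x q l - (\<Sum>i<m. to_ac (s q l i) * c i))) = V (t' q) * N0 (x q l - (\<Sum>i<m. to_ac (s q l i) * c i))"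
        using av_mult[OF L(1) N0 _ dL] NL[OF j0, of "to_ac (t' q)"] V[OF j0] L by simp
      also have "\<dots> \<le> 1 * \<epsilon>" using t'1[OF q] s[OF q l] V0 av_nonneg[OF L(1) N0 dL] by (intro mult_mono) auto
      finally show "N0 (to_ac (t' q) * (x q l - (\<Sum>i<m. to_ac (s q l i) * c i))) \<le> \<epsilon>" by simp
    qed (use eps in auto)
    finally show ?thesis .
  qed
  have sum: "(\<Sum>r\<in>S. to_ac (t' r) * \<beta> r) = (\<Sum>l<d. y l * e l)"
  proof -
    have "(\<Sum>r\<in>S. to_ac (t' r) * \<beta> r) = (\<Sum>r\<in>S. \<Sum>l<d. to_ac (t' r) * x r l * e l)"
      using x(2) by (simp add: sum_distrib_left mult.assoc)
    also have "\<dots> = (\<Sum>l<d. y l * e l)" unfolding y_def sum_distrib_right by (rule sum.swap)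
    finally show ?thesis .
  qed
  obtain j where j: "j \<in> J" "V (t' q0) \<le> C * Nf j (\<Sum>r\<in>S. to_ac (t' r) * \<beta> r)" using C[OF q0(1)] by blast
  have "Nf j (\<Sum>l<d. y l * e l) \<le> \<epsilon> * E"
  proof (rule av_sum_le[OF K N[OF j(1)]])
    fix l assume l: "l \<in> {..<d}"
    have yK: "y l \<in> K" "e l \<in> K" using yL e l L by auto
    show "y l * e l \<in> K" using yK by (intro subf_mult[OF K])
    have "Nf j (y l * e l) = N0 (y l) * Nf j (e l)"
      using av_mult[OF K N[OF j(1)] yK] NL[OF j(1) yL] l by simp
    also have "\<dots> \<le> \<epsilon> * E" using Ny E(2)[OF j(1)] l nn[OF j(1) yK(2)] eps by (intro mult_mono) auto
    finally show "Nf j (y l * e l) \<le> \<epsilon> * E" .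
  qed (use eps E in auto)
  moreover have sK: "(\<Sum>l<d. y l * e l) \<in> K"
    using yL e L(2) by (intro subf_sum[OF K] subf_mult[OF K]) auto
  ultimately have "C * Nf j (\<Sum>l<d. y l * e l) \<le> C' * (\<epsilon> * E)"
    using nn[OF j(1) sK] by (intro mult_mono) (auto simp: C'_def)
  also have "\<dots> = 1 / 2" using E(1) by (simp add: \<epsilon>_def C'_def)
  finally show False using j(2) unfolding t'q0 sum by linarith
qed

end

section \<open>Extending a discrete absolute value to the algebraic closure\<close>

lemma poly_altdef_le:
  fixes p :: "'a::comm_semiring_1 poly"
  assumes "Polynomial.degree p \<le> n"
  shows "poly p x = (\<Sum>i\<le>n. Polynomial.coeff p i * x ^ i)"
  unfolding poly_altdef using assms by (intro sum.mono_neutral_left) (auto simp: coeff_eq_0)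

lemma power_times_inverse_power:
  assumes "(u::'a::field) \<noteq> 0" "i \<le> n"
  shows "u ^ n * inverse u ^ i = u ^ (n - i)"
  using assms by (simp add: power_diff divide_inverse power_inverse)

text \<open>Since all nonzero values are powers of the value of \<open>p\<close>, the single
  excluded element \<open>1/p\<close> will control the whole intersection of an extension ring with
  \<open>k\<close>.\<close>

locale discrete_absval =
  fixes N0 :: "'k::field \<Rightarrow> real" and p :: 'k
  assumes N0_nonneg: "N0 x \<ge> 0" and N0_eq_0: "N0 x = 0 \<longleftrightarrow> x = 0"
    and N0_mult: "N0 (x * y) = N0 x * N0 y"
    and N0_add: "N0 (x + y) \<le> max (N0 x) (N0 y)"
    and p0: "p \<noteq> 0" and p1: "N0 p < 1"
    and N0_discrete: "x \<noteq> 0 \<Longrightarrow> \<exists>j::int. N0 x = N0 p powi j"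
begin

lemma N0_pos: "x \<noteq> 0 \<Longrightarrow> N0 x > 0"
  using N0_nonneg[of x] N0_eq_0[of x] by linarith

lemma N0_0 [simp]: "N0 0 = 0" by (simp add: N0_eq_0)

lemma N0_1 [simp]: "N0 1 = 1"
  using N0_mult[of 1 1] N0_pos[of 1] by simp

lemma N0_inverse: "N0 (inverse x) = inverse (N0 x)"
proof (cases "x = 0")
  case False
  hence "N0 x * N0 (inverse x) = 1" by (simp flip: N0_mult)
  thus ?thesis by (metis inverse_unique)
qed simp

lemma N0_divide: "N0 (x / y) = N0 x / N0 y"
  by (simp add: divide_inverse N0_mult N0_inverse)

lemma N0_power: "N0 (x ^ n) = N0 x ^ n"
  by (induction n) (auto simp: N0_mult)

lemma N0_uminus: "N0 (- x) = N0 x"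
proof -
  have "N0 (-1) * N0 (-1) = 1" by (simp flip: N0_mult)
  hence "N0 (-1) = 1" using N0_nonneg[of "-1"] by (metis abs_of_nonneg abs_mult_self_eq real_sqrt_abs2 real_sqrt_one)
  thus ?thesis using N0_mult[of "-1" x] by simp
qed

text \<open>
  A maximal subring of the closure that contains the valuation ring of \<open>N0\<close> but not \<open>1/p\<close> is the
  valuation ring of an extension.
\<close>

definition dominated :: "'k alg_closure set \<Rightarrow> bool" where
  "dominated R \<longleftrightarrow> (\<forall>c. N0 c \<le> 1 \<longrightarrow> to_ac c \<in> R) \<and> (\<forall>x\<in>R. \<forall>y\<in>R. x + y \<in> R \<and> x * y \<in> R) \<and>
     (\<forall>x\<in>R. - x \<in> R) \<and> inverse (to_ac p) \<notin> R"

lemma maximal_exists: "\<exists>R. dominated R \<and> (\<forall>S. dominated S \<longrightarrow> R \<subseteq> S \<longrightarrow> S = R)"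
proof -
  have ne: "dominated (to_ac ` {c. N0 c \<le> 1})"
    unfolding dominated_def
  proof (intro conjI allI impI ballI)
    fix x y assume "x \<in> to_ac ` {c. N0 c \<le> 1}" "y \<in> to_ac ` {c. N0 c \<le> 1}"
    then obtain a b where ab: "x = to_ac a" "y = to_ac b" "N0 a \<le> 1" "N0 b \<le> 1" by auto
    have "N0 (a + b) \<le> 1" "N0 (a * b) \<le> 1"
      using N0_add[of a b] ab N0_nonneg by (auto simp: N0_mult intro: mult_le_one)
    thus "x + y \<in> to_ac ` {c. N0 c \<le> 1}" "x * y \<in> to_ac ` {c. N0 c \<le> 1}"
      using ab by (auto simp flip: to_ac_add to_ac_mult)
  next
    fix x assume "x \<in> to_ac ` {c. N0 c \<le> 1}"
    then obtain a where "x = to_ac a" "N0 a \<le> 1" by auto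
    thus "- x \<in> to_ac ` {c. N0 c \<le> 1}" by (auto simp: N0_uminus simp flip: to_ac_minus)
  next
    show "inverse (to_ac p) \<notin> to_ac ` {c. N0 c \<le> 1}"
      using p1 N0_pos[OF p0] by (auto simp: N0_inverse inverse_le_1_iff simp flip: to_ac_inverse)
  qed auto
  have "\<exists>Q\<in>{R. dominated R}. \<forall>S\<in>{R. dominated R}. Q \<subseteq> S \<longrightarrow> S = Q"
  proof (rule Zorn_Lemma2, intro ballI)
    fix Ch assume C: "Ch \<in> chains ({R. dominated R})"
    have d: "\<And>R. R \<in> Ch \<Longrightarrow> dominated R" and ch: "\<And>R S. R \<in> Ch \<Longrightarrow> S \<in> Ch \<Longrightarrow> R \<subseteq> S \<or> S \<subseteq> R"
      using chainsD2[OF C] chainsD[OF C] by auto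
    show "\<exists>U\<in>{R. dominated R}. \<forall>S\<in>Ch. S \<subseteq> U"
    proof (cases "Ch = {}")
      \<comment> \<open>The empty chain needs an upper bound of its own: the valuation ring of
        \<open>N0\<close>.\<close>
      case True thus ?thesis using ne by blast
    next
      case False
      have "dominated (\<Union>Ch)"
      unfolding dominated_def
    proof (intro conjI allI impI ballI)
      fix x y assume "x \<in> \<Union>Ch" "y \<in> \<Union>Ch"
      then obtain R where "R \<in> Ch" "x \<in> R" "y \<in> R" using ch by (elim UnionE) (metis subsetD)
      thus "x + y \<in> \<Union>Ch" "x * y \<in> \<Union>Ch" using d unfolding dominated_def by blast+
    qed (use False d in \<open>auto simp: dominated_def\<close>)
      thus ?thesis by blast
    qed
  qed
  thus ?thesis by blast
qed

section \<open>A maximal dominated ring is a valuation ring\<close>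

context
  fixes R :: "'k alg_closure set"
  assumes R: "dominated R" and maxR: "\<And>S. dominated S \<Longrightarrow> R \<subseteq> S \<Longrightarrow> S = R"
begin

lemma R_to_ac: "N0 c \<le> 1 \<Longrightarrow> to_ac c \<in> R"
  and R_add: "x \<in> R \<Longrightarrow> y \<in> R \<Longrightarrow> x + y \<in> R"
  and R_mult: "x \<in> R \<Longrightarrow> y \<in> R \<Longrightarrow> x * y \<in> R"
  and R_uminus: "x \<in> R \<Longrightarrow> - x \<in> R"
  and R_p: "inverse (to_ac p) \<notin> R"
  using R by (auto simp: dominated_def)

lemma R_0: "0 \<in> R" and R_1: "1 \<in> R" and R_p': "to_ac p \<in> R"
  using R_to_ac[of 0] R_to_ac[of 1] R_to_ac[of p] p1 by auto

lemma R_diff: "x \<in> R \<Longrightarrow> y \<in> R \<Longrightarrow> x - y \<in> R"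
  using R_add[of x "-y"] R_uminus[of y] by simp

lemma R_power: "x \<in> R \<Longrightarrow> x ^ n \<in> R"
  by (induction n) (auto intro: R_1 R_mult)

lemma R_sum: "(\<And>i. i \<in> I \<Longrightarrow> f i \<in> R) \<Longrightarrow> sum f I \<in> R"
  by (induction I rule: infinite_finite_induct) (auto intro: R_0 R_add)

text \<open>Adjoining \<open>z\<close> to \<open>R\<close> preserves all closure conditions. So by
  maximality the only thing that can go wrong is that \<open>1/p\<close> becomes a polynomial in
  \<open>z\<close> over \<open>R\<close>.\<close>

lemma adjoin_not_in:
  assumes "z \<notin> R"
  shows "\<exists>q. (\<forall>i. Polynomial.coeff q i \<in> R) \<and> to_ac p * poly q z = 1"
proof -
  define S where "S = {poly q z |q. \<forall>i. Polynomial.coeff q i \<in> R}"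
  have RS: "R \<subseteq> S"
  proof
    fix x assume "x \<in> R"
    thus "x \<in> S" unfolding S_def
      by (intro CollectI exI[of _ "[:x:]"]) (auto simp: coeff_pCons R_0 split: nat.splits)
  qed
  have zS: "z \<in> S" unfolding S_def
    by (intro CollectI exI[of _ "[:0, 1:]"]) (auto simp: coeff_pCons R_0 R_1 split: nat.splits)
  have "\<not> dominated S" using maxR[OF _ RS] zS assms by blast
  moreover have "x + y \<in> S \<and> x * y \<in> S" if xy: "x \<in> S" "y \<in> S" for x y
  proof -
    from xy obtain a b where ab: "x = poly a z" "y = poly b z" "\<forall>i. Polynomial.coeff a i \<in> R" "\<forall>i. Polynomial.coeff b i \<in> R"
      by (auto simp: S_def)
    have "\<forall>i. Polynomial.coeff (a + b) i \<in> R" "\<forall>i. Polynomial.coeff (a * b) i \<in> R"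
      using ab by (auto simp: coeff_mult intro: R_add R_sum R_mult)
    thus ?thesis using ab by (auto simp: S_def simp flip: poly_add poly_mult)
  qed
  moreover have "- x \<in> S" if "x \<in> S" for x
  proof -
    from that obtain a where a: "x = poly a z" "\<forall>i. Polynomial.coeff a i \<in> R" by (auto simp: S_def)
    hence "\<forall>i. Polynomial.coeff (- a) i \<in> R" by (auto intro: R_uminus)
    thus ?thesis using a by (auto simp: S_def simp flip: poly_minus)
  qed
  ultimately have "inverse (to_ac p) \<in> S" using RS R_to_ac unfolding dominated_def by blast
  then obtain q where "inverse (to_ac p) = poly q z" "\<forall>i. Polynomial.coeff q i \<in> R" by (auto simp: S_def)
  thus ?thesis using p0 by (intro exI[of _ q]) (metis right_inverse to_ac_eq_0_iff)
qed

text \<open>If \<open>u = 1 + p r\<close> had no inverse in \<open>R\<close>, then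
  \<open>1/p\<close> would be a polynomial in \<open>1/u\<close> over \<open>R\<close>. Multiplying
  by a high power of \<open>u\<close> clears \<open>1/u\<close>, and since all powers of
  \<open>u\<close> are 1 modulo \<open>p\<close>, this would put \<open>1/p\<close> itself into
  \<open>R\<close>.\<close>

lemma unit_R:
  assumes "r \<in> R" shows "1 + to_ac p * r \<noteq> 0" "inverse (1 + to_ac p * r) \<in> R"
proof -
  define u where "u = 1 + to_ac p * r"
  have uR: "u \<in> R" unfolding u_def using assms by (intro R_add R_mult R_1 R_p')
  show u0: "1 + to_ac p * r \<noteq> 0"
  proof
    assume "1 + to_ac p * r = 0"
    hence "to_ac p * (- r) = 1" by (simp add: algebra_simps add_eq_0_iff2)
    hence "inverse (to_ac p) = - r" by (rule inverse_unique)
    thus False using R_p R_uminus[OF assms] by simp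
  qed
  show "inverse (1 + to_ac p * r) \<in> R"
  proof (rule ccontr)
    assume "inverse (1 + to_ac p * r) \<notin> R"
    then obtain q where q: "\<forall>i. Polynomial.coeff q i \<in> R" "to_ac p * poly q (inverse u) = 1"
      using adjoin_not_in unfolding u_def by blast
    define n where "n = Polynomial.degree q"
    have pw: "\<exists>s\<in>R. u ^ k = 1 + to_ac p * s" for k
    proof (induction k)
      case (Suc k)
      then obtain s where s: "s \<in> R" "u ^ k = 1 + to_ac p * s" by blast
      have "u ^ Suc k = 1 + to_ac p * (s * u + r)" unfolding power_Suc s(2) by (simp add: u_def algebra_simps)
      thus ?case using s uR assms by (intro bexI[of _ "s * u + r"]) (auto intro: R_add R_mult)
    qed (auto intro!: bexI[of _ 0] R_0)
    then obtain s where s: "s \<in> R" "u ^ n = 1 + to_ac p * s" by blast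
    have "u ^ n * poly q (inverse u) = (\<Sum>i\<le>n. Polynomial.coeff q i * u ^ (n - i))"
      unfolding poly_altdef n_def[symmetric] sum_distrib_left
      using u0 by (intro sum.cong) (auto simp: u_def[symmetric] power_times_inverse_power mult.left_commute[of "u ^ n"])
    hence "u ^ n * poly q (inverse u) \<in> R" using q uR by (auto intro!: R_sum R_mult R_power)
    moreover have "poly q (inverse u) = inverse (to_ac p)" using q(2) by (metis inverse_unique)
    ultimately have "(1 + to_ac p * s) * inverse (to_ac p) \<in> R" by (simp add: s)
    moreover have "(1 + to_ac p * s) * inverse (to_ac p) = inverse (to_ac p) + s" using p0 by (simp add: distrib_right)
    ultimately have "inverse (to_ac p) + s \<in> R" by simp
    hence "inverse (to_ac p) + s - s \<in> R" using s by (intro R_diff)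
    thus False using R_p by simp
  qed
qed

text \<open>Chevalley's descent. The relation for the inverse of \<open>z\<close>, divided by the
  unit \<open>u\<close> and multiplied by \<open>z ^ n\<close>, expresses \<open>z ^ n\<close>
  through lower powers of \<open>z\<close>. Substituting this into the relation for \<open>z\<close>
  removes its top term. The condition \<open>m \<le> n\<close> keeps the exponents
  \<open>n - j\<close> from being truncated.\<close>

lemma lower_degree:
  assumes "z \<noteq> 0" "\<forall>i. Polynomial.coeff a i \<in> R" "Polynomial.degree a \<le> n" "to_ac p * poly a z = 1"
    "\<forall>i. Polynomial.coeff b i \<in> R" "Polynomial.degree b \<le> m" "to_ac p * poly b (inverse z) = 1" "m \<le> n"
  shows "n > 0 \<and> (\<exists>a'. (\<forall>i. Polynomial.coeff a' i \<in> R) \<and> Polynomial.degree a' \<le> n - 1 \<and> to_ac p * poly a' z = 1)"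
proof
  show n: "n > 0"
  proof (rule ccontr)
    assume "\<not> n > 0"
    hence "poly a z = Polynomial.coeff a 0" using assms(3) by (simp add: poly_altdef)
    hence "inverse (to_ac p) = Polynomial.coeff a 0" using assms(4) by (metis inverse_unique)
    thus False using assms(2) R_p by simp
  qed
  define u where "u = 1 + to_ac p * (- Polynomial.coeff b 0)"
  have u: "u \<noteq> 0" "inverse u \<in> R" using unit_R[of "- Polynomial.coeff b 0"] assms(5) by (auto simp: u_def R_uminus)
  define c where "c j = inverse u * Polynomial.coeff b j" for j
  have cR: "c j \<in> R" for j using u assms(5) by (auto simp: c_def intro: R_mult)
  have pb: "poly b (inverse z) = Polynomial.coeff b 0 + (\<Sum>j=1..m. Polynomial.coeff b j * inverse z ^ j)"
  proof -
    have "poly b (inverse z) = (\<Sum>j\<le>m. Polynomial.coeff b j * inverse z ^ j)"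
      using assms(6) by (rule poly_altdef_le)
    also have "{..m} = insert 0 {1..m}" by auto
    finally show ?thesis by (simp add: sum.insert)
  qed
  have "u = to_ac p * (\<Sum>j=1..m. Polynomial.coeff b j * inverse z ^ j)"
    using assms(7) unfolding pb u_def by (simp add: algebra_simps)
  hence "inverse u * u = to_ac p * (\<Sum>j=1..m. c j * inverse z ^ j)"
    by (simp add: c_def sum_distrib_left mult.assoc mult.left_commute)
  hence one: "1 = to_ac p * (\<Sum>j=1..m. c j * inverse z ^ j)" using u by simp
  have zn: "z ^ n = to_ac p * (\<Sum>j=1..m. c j * z ^ (n - j))"
  proof -
    have "z ^ n = z ^ n * (to_ac p * (\<Sum>j=1..m. c j * inverse z ^ j))" using one by simp
    also have "\<dots> = to_ac p * (\<Sum>j=1..m. c j * (z ^ n * inverse z ^ j))" by (simp add: sum_distrib_left mult_ac)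
    also have "(\<Sum>j=1..m. c j * (z ^ n * inverse z ^ j)) = (\<Sum>j=1..m. c j * z ^ (n - j))"
      using assms(1,8) by (intro sum.cong) (auto simp: power_times_inverse_power)
    finally show ?thesis .
  qed
  define an where "an = Polynomial.coeff a n"
  define a' where "a' = (\<Sum>i<n. Polynomial.monom (Polynomial.coeff a i) i) + (\<Sum>j=1..m. Polynomial.monom (an * to_ac p * c j) (n - j))"
  have "\<forall>i. Polynomial.coeff a' i \<in> R"
    unfolding a'_def an_def using assms(2) cR
    by (auto simp: coeff_sum intro!: R_add R_sum R_mult R_p' R_0)
  moreover have "Polynomial.degree a' \<le> n - 1"
    unfolding a'_def using n
    by (intro degree_add_le degree_sum_le) (auto intro!: order.trans[OF degree_monom_le])
  moreover have "to_ac p * poly a' z = 1"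
  proof -
    have "poly a' z = (\<Sum>i<n. Polynomial.coeff a i * z ^ i) + an * (to_ac p * (\<Sum>j=1..m. c j * z ^ (n - j)))"
      by (simp add: a'_def poly_sum poly_monom sum_distrib_left mult_ac)
    also have "\<dots> = (\<Sum>i<n. Polynomial.coeff a i * z ^ i) + an * z ^ n" using zn by simp
    also have "\<dots> = (\<Sum>i\<le>n. Polynomial.coeff a i * z ^ i)"
      by (simp add: an_def lessThan_Suc_atMost[symmetric])
    also have "\<dots> = poly a z" using poly_altdef_le[OF assms(3)] by simp
    finally show ?thesis using assms(4) by simp
  qed
  ultimately show "\<exists>a'. (\<forall>i. Polynomial.coeff a' i \<in> R) \<and> Polynomial.degree a' \<le> n - 1 \<and> to_ac p * poly a' z = 1"
    by blast
qed

text \<open>If neither \<open>z\<close> nor its inverse lay in \<open>R\<close>, both would satisfy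
  a relation as in \<open>adjoin_not_in\<close>, and the descent could be repeated forever.\<close>

lemma valuation_ring: "z \<in> R \<or> inverse z \<in> R"
proof (cases "z = 0")
  case False
  define P where "P x n \<longleftrightarrow> (\<exists>a. (\<forall>i. Polynomial.coeff a i \<in> R) \<and> Polynomial.degree a \<le> n \<and> to_ac p * poly a x = 1)" for x n
  have "\<not> (P z n \<and> P (inverse z) m)" for n m
  proof (induction "n + m" arbitrary: n m rule: less_induct)
    case less
    show ?case
    proof
      assume *: "P z n \<and> P (inverse z) m"
      show False
      proof (cases "m \<le> n")
        case True
        hence "n > 0 \<and> P z (n - 1)"
          using lower_degree[OF False, of _ n _ m] * unfolding P_def by blast
        thus False using less[of "n - 1" m] * by auto
      next
        case F: False
        hence "m > 0 \<and> P (inverse z) (m - 1)"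
          using lower_degree[of "inverse z" _ m _ n] * False unfolding P_def by auto
        thus False using less[of n "m - 1"] * by auto
      qed
    qed
  qed
  thus ?thesis using adjoin_not_in unfolding P_def by (metis order_refl)
qed (auto intro: R_0)

text \<open>A constant of value above 1 has, by discreteness, at least the value of
  \<open>1/p\<close>. If it lay in \<open>R\<close>, then \<open>1/p\<close> would be its product
  with a constant of value at most 1.\<close>

lemma R_to_ac_iff: "to_ac c \<in> R \<longleftrightarrow> N0 c \<le> 1"
proof
  assume cR: "to_ac c \<in> R"
  show "N0 c \<le> 1"
  proof (rule ccontr)
    assume n: "\<not> N0 c \<le> 1"
    hence c0: "c \<noteq> 0" by auto
    then obtain j where j: "N0 c = N0 p powi j" using N0_discrete by blast
    have Np: "N0 p > 0" using N0_pos[OF p0] .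
    have "j < 0"
    proof (rule ccontr)
      assume "\<not> j < 0"
      hence "N0 p powi j \<le> 1" using Np p1 by (auto simp: power_int_def intro!: power_le_one)
      thus False using n j by simp
    qed
    then obtain k where k: "j = - int (Suc k)" using negD by blast
    have "N0 c = inverse (N0 p ^ Suc k)"
      unfolding j k power_int_minus power_int_of_nat ..
    hence "N0 (inverse (p * c)) = N0 p ^ k"
      unfolding N0_inverse N0_mult using Np by simp
    also have "\<dots> \<le> 1" using Np p1 by (intro power_le_one) auto
    finally have "to_ac (inverse (p * c)) * to_ac c \<in> R" by (rule R_mult[OF R_to_ac cR])
    moreover have "to_ac (inverse (p * c)) * to_ac c = inverse (to_ac p)" using c0 p0 by (simp add: field_simps)
    ultimately show False using R_p by metis
  qed
qed (rule R_to_ac)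

section \<open>Values in the extension\<close>

definition RU :: "'k alg_closure set" where "RU = {x. x \<noteq> 0 \<and> x \<in> R \<and> inverse x \<in> R}"

lemma RU_mult: "x \<in> RU \<Longrightarrow> y \<in> RU \<Longrightarrow> x * y \<in> RU"
  and RU_inverse: "x \<in> RU \<Longrightarrow> inverse x \<in> RU"
  by (auto simp: RU_def intro: R_mult)

lemma RU_power: "x \<in> RU \<Longrightarrow> x ^ n \<in> RU"
  by (induction n) (auto intro: RU_mult simp: RU_def R_1 R_mult)

lemma RU_to_ac_iff: "to_ac c \<in> RU \<longleftrightarrow> N0 c = 1"
proof (cases "c = 0")
  case False
  hence "to_ac c \<in> RU \<longleftrightarrow> to_ac c \<in> R \<and> to_ac (inverse c) \<in> R" by (auto simp: RU_def)
  also have "\<dots> \<longleftrightarrow> N0 c = 1"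
    using N0_pos[OF False] by (auto simp only: R_to_ac_iff N0_inverse inverse_le_1_iff)
  finally show ?thesis .
qed (auto simp: RU_def)

text \<open>Of two nonzero elements one divides the other, say \<open>x / y \<in> R\<close>. If
  \<open>x + y\<close> were a unit, its inverse times \<open>x / y + 1\<close> would be
  \<open>1/y\<close>, so \<open>y\<close> would be a unit too.\<close>

lemma non_units_add: "x \<in> R - RU \<Longrightarrow> y \<in> R - RU \<Longrightarrow> x + y \<in> R - RU"
proof -
  have *: "x + y \<notin> RU" if xy: "x \<in> R - RU" "y \<in> R - RU" "x / y \<in> R" "y \<noteq> 0" for x y
  proof
    assume xyU: "x + y \<in> RU"
    have "x / y + 1 \<in> R" using xy by (intro R_add R_1)
    hence "inverse (x + y) * (x / y + 1) \<in> R" using xyU by (auto simp: RU_def intro: R_mult)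
    moreover have "inverse (x + y) * (x / y + 1) = inverse y" using xyU xy by (auto simp: RU_def field_simps)
    ultimately show False using xy by (auto simp: RU_def)
  qed
  assume xy: "x \<in> R - RU" "y \<in> R - RU"
  have R: "x + y \<in> R" using xy by (auto intro: R_add)
  consider "x = 0" | "y = 0" | "x \<noteq> 0" "y \<noteq> 0" "x / y \<in> R" | "x \<noteq> 0" "y \<noteq> 0" "y / x \<in> R"
    using valuation_ring[of "x / y"] by (cases "x = 0"; cases "y = 0") (auto simp: field_simps)
  thus ?thesis
  proof cases
    case 3 thus ?thesis using *[of x y] xy R by blast
  next
    case 4 thus ?thesis using *[of y x] xy R by (simp add: add.commute)
  qed (use xy in auto)
qed

lemma non_units_sum: "(\<And>i. i \<in> I \<Longrightarrow> f i \<in> R - RU) \<Longrightarrow> sum f I \<in> R - RU"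
proof (induction I rule: infinite_finite_induct)
  case (insert i I)
  have "f i + sum f I \<in> R - RU" using insert by (intro non_units_add) auto
  thus ?case using insert by simp
qed (auto simp: R_0 RU_def)

text \<open>By \<open>valuation_ring\<close> divisibility is a total preorder on the nonzero
  elements.\<close>

lemma finite_max_div:
  assumes "finite I" "I \<noteq> {}" "\<And>i. i \<in> I \<Longrightarrow> f i \<noteq> 0"
  shows "\<exists>i\<in>I. \<forall>j\<in>I. f j / f i \<in> R"
  using assms
proof (induction I rule: finite_ne_induct)
  case (singleton x)
  thus ?case by (auto simp: R_1)
next
  case (insert x I)
  then obtain i where i: "i \<in> I" "\<forall>j\<in>I. f j / f i \<in> R" by blast
  show ?case
  proof (cases "f x / f i \<in> R")
    case True thus ?thesis using i by (intro bexI[of _ i]) auto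
  next
    case False
    hence fi: "f i / f x \<in> R" using valuation_ring[of "f x / f i"] by simp
    have "f j / f x \<in> R" if "j \<in> I" for j
    proof -
      have "f j / f i * (f i / f x) \<in> R" using i that fi by (intro R_mult) auto
      thus ?thesis using i insert.prems by simp
    qed
    thus ?thesis using insert.prems by (intro bexI[of _ x]) (auto simp: R_1)
  qed
qed

text \<open>In an algebraic equation for \<open>z\<close> two terms must have the same order:
  otherwise dividing by the dominant term would write -1 as a sum of non-units. The quotient of
  these two terms is a unit, and it is also a constant times a power of \<open>z\<close> with
  nonzero exponent.\<close>

lemma value_torsion:
  assumes "z \<noteq> 0"
  shows "\<exists>n>0. \<exists>c. c \<noteq> 0 \<and> (\<exists>u\<in>RU. z ^ n = to_ac c * u)"
proof -
  obtain q where q: "q \<noteq> 0" "poly (map_poly to_ac q) z = 0" using alg_closure_algebraic[of z] by blast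
  define I where "I = {i. i \<le> Polynomial.degree q \<and> Polynomial.coeff q i \<noteq> 0}"
  have I: "finite I" "I \<noteq> {}" using q(1) by (auto simp: I_def intro!: exI[of _ "Polynomial.degree q"])
  define f where "f i = to_ac (Polynomial.coeff q i) * z ^ i" for i
  have f0: "f i \<noteq> 0" if "i \<in> I" for i using that assms by (auto simp: f_def I_def)
  have "(\<Sum>i\<le>Polynomial.degree q. f i) = 0"
    using q(2) by (simp add: poly_altdef f_def coeff_map_poly degree_map_poly)
  moreover have "(\<Sum>i\<in>I. f i) = (\<Sum>i\<le>Polynomial.degree q. f i)"
    by (intro sum.mono_neutral_left) (auto simp: I_def f_def)
  ultimately have s0: "(\<Sum>i\<in>I. f i) = 0" by simp
  obtain i where i: "i \<in> I" "\<forall>j\<in>I. f j / f i \<in> R" using finite_max_div[OF I, of f] f0 by blast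
  have "\<exists>j\<in>I-{i}. f j / f i \<in> RU"
  proof (rule ccontr)
    assume "\<not> ?thesis"
    hence "(\<Sum>j\<in>I-{i}. f j / f i) \<in> R - RU" using i by (intro non_units_sum) auto
    moreover have "(\<Sum>j\<in>I-{i}. f j / f i) = - 1"
    proof -
      have "f i + (\<Sum>j\<in>I-{i}. f j) = 0" using s0 sum.remove[OF I(1) i(1), of f] by simp
      hence "(\<Sum>j\<in>I-{i}. f j) = - f i" by (simp add: add_eq_0_iff)
      thus ?thesis using f0[OF i(1)] by (simp add: sum_divide_distrib[symmetric])
    qed
    moreover have "- 1 \<in> RU" by (auto simp: RU_def R_1 R_uminus)
    ultimately show False by simp
  qed
  then obtain j where j: "j \<in> I" "j \<noteq> i" "f j / f i \<in> RU" by blast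
  have main: "\<exists>n>0. \<exists>c. c \<noteq> 0 \<and> (\<exists>u\<in>RU. z ^ n = to_ac c * u)" if ij: "i \<in> I" "j \<in> I" "f j / f i \<in> RU" "i < j" for i j
  proof -
    define c where "c = Polynomial.coeff q i / Polynomial.coeff q j"
    have c: "c \<noteq> 0" "Polynomial.coeff q i \<noteq> 0" "Polynomial.coeff q j \<noteq> 0" using ij by (auto simp: c_def I_def)
    have "z ^ (j - i) = to_ac c * (f j / f i)"
      using c assms ij by (simp add: f_def c_def power_diff field_simps)
    thus ?thesis using ij c(1) zero_less_diff by blast
  qed
  show ?thesis
  proof (cases "i < j")
    case True thus ?thesis using main[OF i(1) j(1,3)] by blast
  next
    case False
    hence "f i / f j \<in> RU" using RU_inverse[OF j(3)] by simp
    thus ?thesis using main[OF j(1) i(1)] False j(2) by auto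
  qed
qed

text \<open>
  Some power of every \<open>z\<close> is a constant times a unit of \<open>R\<close>, which determines the extended value.
\<close>

definition Wv :: "'k alg_closure \<Rightarrow> real" where
  "Wv z = (if z = 0 then 0 else SOME r. \<exists>n>0. \<exists>c. c \<noteq> 0 \<and> (\<exists>u\<in>RU. z ^ n = to_ac c * u) \<and> r = N0 c powr (1 / real n))"

text \<open>Independence of the choices: raise each of two representations to the exponent of the
  other. The quotient of the resulting constants is a unit of \<open>R\<close>, hence of value
  1.\<close>

lemma Wv_eqI:
  assumes "n > 0" "c \<noteq> 0" "u \<in> RU" "z ^ n = to_ac c * u"
  shows "Wv z = N0 c powr (1 / real n)"
proof -
  have "z ^ n \<noteq> 0" using assms(2,3) unfolding assms(4) by (auto simp: RU_def)
  hence z0: "z \<noteq> 0" using assms(1) by auto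
  let ?P = "\<lambda>r. \<exists>n>0. \<exists>c. c \<noteq> 0 \<and> (\<exists>u\<in>RU. z ^ n = to_ac c * u) \<and> r = N0 c powr (1 / real n)"
  have "?P (N0 c powr (1 / real n))" using assms by blast
  hence "?P (SOME r. ?P r)" by (rule someI[of ?P])
  then obtain m d v where m: "m > 0" "d \<noteq> 0" "v \<in> RU" "z ^ m = to_ac d * v" "Wv z = N0 d powr (1 / real m)"
    unfolding Wv_def using z0 by auto
  have "to_ac c ^ m * u ^ m = to_ac d ^ n * v ^ n"
    using assms(4) m(4) by (metis power_mult power_mult_distrib mult.commute)
  hence "to_ac (c ^ m / d ^ n) = v ^ n * inverse (u ^ m)"
    using assms m by (auto simp: RU_def field_simps)
  also have "\<dots> \<in> RU" using assms m by (intro RU_mult RU_power RU_inverse)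
  finally have "N0 (c ^ m / d ^ n) = 1" using RU_to_ac_iff by metis
  hence "N0 c ^ m = N0 d ^ n" using N0_pos[OF m(2)] by (simp add: N0_divide N0_power)
  hence "(N0 c ^ m) powr (1 / (real m * real n)) = (N0 d ^ n) powr (1 / (real m * real n))" by simp
  hence "N0 c powr (1 / real n) = N0 d powr (1 / real m)"
    using m(1) assms(1) N0_pos[OF m(2)] N0_pos[OF assms(2)] by (simp add: powr_powr flip: powr_realpow)
  thus ?thesis using m by simp
qed

lemma Wv_cases:
  assumes "z \<noteq> 0"
  obtains n c u where "n > 0" "c \<noteq> 0" "u \<in> RU" "z ^ n = to_ac c * u" "Wv z = N0 c powr (1 / real n)"
  using value_torsion[OF assms] Wv_eqI by metis

lemma Wv_0: "Wv 0 = 0" by (simp add: Wv_def)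

lemma Wv_pos: "z \<noteq> 0 \<Longrightarrow> Wv z > 0"
  by (erule Wv_cases) (simp add: powr_gt_zero N0_pos less_imp_neq[OF N0_pos, symmetric] N0_eq_0)

lemma RU_1: "1 \<in> RU" by (auto simp: RU_def R_1)

lemma Wv_to_ac: "Wv (to_ac c) = N0 c"
proof (cases "c = 0")
  case False
  thus ?thesis using Wv_eqI[of 1 c 1 "to_ac c"] RU_1 N0_pos[OF False] by simp
qed (simp add: Wv_0)

lemma Wv_mult: "Wv (x * y) = Wv x * Wv y"
proof (cases "x = 0 \<or> y = 0")
  case False
  obtain n c u where x: "n > 0" "c \<noteq> 0" "u \<in> RU" "x ^ n = to_ac c * u" "Wv x = N0 c powr (1 / real n)"
    by (rule Wv_cases[of x]) (use False in auto)
  obtain m d v where y: "m > 0" "d \<noteq> 0" "v \<in> RU" "y ^ m = to_ac d * v" "Wv y = N0 d powr (1 / real m)"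
    by (rule Wv_cases[of y]) (use False in auto)
  have "(x * y) ^ (n * m) = (x ^ n) ^ m * (y ^ m) ^ n"
    by (simp add: power_mult_distrib power_mult[symmetric] mult.commute)
  also have "\<dots> = to_ac (c ^ m * d ^ n) * (u ^ m * v ^ n)" by (simp add: x(4) y(4) power_mult_distrib)
  finally have "Wv (x * y) = N0 (c ^ m * d ^ n) powr (1 / real (n * m))"
    using x y by (intro Wv_eqI) (auto intro: RU_mult RU_power)
  also have "\<dots> = Wv x * Wv y"
    using x y N0_pos[OF x(2)] N0_pos[OF y(2)]
    by (simp add: N0_mult N0_power powr_mult powr_powr flip: powr_realpow)
  finally show ?thesis .
qed (auto simp: Wv_0)

text \<open>This reduces the ultrametric inequality for \<open>Wv\<close> to closure of
  \<open>R\<close> under addition. To pass from \<open>x ^ n \<in> R\<close> to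
  \<open>x \<in> R\<close>: otherwise the inverse of \<open>x\<close> is in \<open>R\<close>, and
  \<open>x\<close> is \<open>x ^ n\<close> times a power of it.\<close>

lemma Wv_le_1_iff: "Wv x \<le> 1 \<longleftrightarrow> x \<in> R"
proof (cases "x = 0")
  case False
  obtain n c u where x: "n > 0" "c \<noteq> 0" "u \<in> RU" "x ^ n = to_ac c * u" "Wv x = N0 c powr (1 / real n)"
    by (rule Wv_cases[OF False])
  have "Wv x \<le> 1 \<longleftrightarrow> N0 c \<le> 1"
  proof -
    have "ln (Wv x) = ln (N0 c) / real n"
      using x(5) N0_pos[OF x(2)] by (simp add: ln_powr)
    hence "ln (Wv x) \<le> 0 \<longleftrightarrow> ln (N0 c) \<le> 0"
      using x(1) by (simp add: divide_le_0_iff)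
    thus ?thesis using Wv_pos[OF False] N0_pos[OF x(2)] by simp
  qed
  also have "\<dots> \<longleftrightarrow> to_ac c \<in> R" by (simp add: R_to_ac_iff)
  also have "\<dots> \<longleftrightarrow> x ^ n \<in> R"
  proof
    assume "to_ac c \<in> R" thus "x ^ n \<in> R" using x by (auto simp: RU_def intro: R_mult)
  next
    assume "x ^ n \<in> R"
    hence "x ^ n * inverse u \<in> R" using x by (auto simp: RU_def intro: R_mult)
    thus "to_ac c \<in> R" using x by (simp add: RU_def mult.assoc)
  qed
  also have "\<dots> \<longleftrightarrow> x \<in> R"
  proof
    assume xn: "x ^ n \<in> R"
    show "x \<in> R"
    proof (rule ccontr)
      assume "x \<notin> R"
      hence "inverse x \<in> R" using valuation_ring by blast
      hence "x ^ n * inverse x ^ (n - 1) \<in> R" by (intro R_mult[OF xn] R_power)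
      moreover have "x ^ n * inverse x ^ (n - 1) = x"
        using x(1) False power_times_inverse_power[of x "n - 1" n] by simp
      ultimately show False using \<open>x \<notin> R\<close> by simp
    qed
  qed (auto intro: R_power)
  finally show ?thesis .
qed (auto simp: Wv_0 R_0)

lemma Wv_add: "Wv (x + y) \<le> max (Wv x) (Wv y)"
proof -
  have *: "Wv (x + y) \<le> Wv y" if "x / y \<in> R" "y \<noteq> 0" for x y
  proof -
    have "Wv (x / y + 1) \<le> 1" unfolding Wv_le_1_iff using that by (intro R_add R_1)
    hence "Wv (x / y + 1) * Wv y \<le> 1 * Wv y" using Wv_pos[OF that(2)] by (intro mult_right_mono) auto
    thus ?thesis using that by (simp add: Wv_mult[symmetric] field_simps)
  qed
  consider "x = 0" | "y = 0" | "x \<noteq> 0" "y \<noteq> 0" "x / y \<in> R" | "x \<noteq> 0" "y \<noteq> 0" "y / x \<in> R"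
    using valuation_ring[of "x / y"] by (cases "x = 0"; cases "y = 0") (auto simp: field_simps)
  thus ?thesis
  proof cases
    case 3 thus ?thesis using *[of x y] by auto
  next
    case 4 thus ?thesis using *[of y x] by (auto simp: add.commute)
  qed auto
qed

lemma absval_Wv: "absval UNIV Wv"
proof -
  have "Wv x \<ge> 0 \<and> (Wv x = 0 \<longleftrightarrow> x = 0)" for x
    using Wv_0 Wv_pos[of x] by (cases "x = 0") auto
  thus ?thesis unfolding absval_def using Wv_mult Wv_add by blast
qed

end

theorem extension_exists: "\<exists>W. absval UNIV W \<and> (\<forall>c. W (to_ac c) = N0 c)"
proof -
  obtain R where R: "dominated R" "\<And>S. dominated S \<Longrightarrow> R \<subseteq> S \<Longrightarrow> S = R" using maximal_exists by blast
  show ?thesis using absval_Wv[OF R] Wv_to_ac[OF R] by blast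
qed

end

section \<open>Separable elements and primitive elements\<close>

abbreviation acp :: "'k::field poly \<Rightarrow> 'k alg_closure poly" where "acp \<equiv> map_poly to_ac"

lemma coeff_acp [simp]: "Polynomial.coeff (acp q) i = to_ac (Polynomial.coeff q i)"
  by (simp add: coeff_map_poly)

lemma degree_acp [simp]: "Polynomial.degree (acp q) = Polynomial.degree q"
  by (simp add: degree_map_poly)

lemma acp_0 [simp]: "acp 0 = 0" and acp_1 [simp]: "acp 1 = 1"
  by (auto simp: poly_eq_iff coeff_1)

lemma acp_eq_0_iff [simp]: "acp q = 0 \<longleftrightarrow> q = 0"
  by (auto simp: poly_eq_iff)

lemma acp_eq_iff [simp]: "acp q = acp r \<longleftrightarrow> q = r"
  by (auto simp: poly_eq_iff)

lemma acp_add: "acp (q + r) = acp q + acp r"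
  and acp_diff: "acp (q - r) = acp q - acp r"
  and acp_uminus: "acp (- q) = - acp q"
  and acp_smult: "acp (Polynomial.smult c q) = Polynomial.smult (to_ac c) (acp q)"
  and acp_mult: "acp (q * r) = acp q * acp r"
  by (auto simp: poly_eq_iff coeff_mult to_ac_sum)

lemma acp_pCons: "acp (pCons a q) = pCons (to_ac a) (acp q)"
  by (auto simp: poly_eq_iff coeff_pCons split: nat.splits)

lemma acp_monom: "acp (Polynomial.monom a n) = Polynomial.monom (to_ac a) n"
  by (auto simp: poly_eq_iff)

lemma acp_sum: "acp (sum f I) = (\<Sum>i\<in>I. acp (f i))"
  by (induction I rule: infinite_finite_induct) (auto simp: acp_add)

lemma acp_power: "acp (q ^ n) = acp q ^ n"
  by (induction n) (auto simp: acp_mult)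

lemma acp_pderiv: "acp (pderiv q) = pderiv (acp q)"
  by (auto simp: poly_eq_iff coeff_pderiv)

lemma acp_pcompose: "acp (pcompose q r) = pcompose (acp q) (acp r)"
  by (induction q) (auto simp: pcompose_pCons acp_add acp_mult acp_pCons)

lemma poly_acp_dvd: "q dvd r \<Longrightarrow> poly (acp q) y = 0 \<Longrightarrow> poly (acp r) y = 0"
  by (auto simp: acp_mult elim!: dvdE)

definition minimal_poly :: "'k::field poly \<Rightarrow> 'k alg_closure \<Rightarrow> bool" where
  "minimal_poly f y \<longleftrightarrow> Polynomial.lead_coeff f = 1 \<and> Factorial_Ring.irreducible f \<and> poly (acp f) y = 0"

lemma minimal_poly_exists: "\<exists>f. minimal_poly f y"
proof -
  define P where "P n \<longleftrightarrow> (\<exists>f. f \<noteq> 0 \<and> poly (acp f) y = 0 \<and> Polynomial.degree f = n)" for n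
  have "\<exists>n. P n" using alg_closure_algebraic[of y] unfolding P_def by metis
  hence P: "P (LEAST n. P n)" by (rule LeastI_ex)
  then obtain g where g: "g \<noteq> 0" "poly (acp g) y = 0" "Polynomial.degree g = (LEAST n. P n)"
    unfolding P_def by blast
  define f where "f = Polynomial.smult (inverse (Polynomial.lead_coeff g)) g"
  have f: "f \<noteq> 0" "poly (acp f) y = 0" "Polynomial.degree f = (LEAST n. P n)" "Polynomial.lead_coeff f = 1"
    using g(1,2) by (simp_all add: f_def acp_smult g(3)[symmetric])
  have min: "Polynomial.degree f \<le> Polynomial.degree h" if "h \<noteq> 0" "poly (acp h) y = 0" for h
    unfolding f(3) by (rule Least_le) (use that in \<open>auto simp: P_def\<close>)
  have dpos: "Polynomial.degree f > 0"
  proof (rule ccontr)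
    assume "\<not> ?thesis"
    hence "Polynomial.degree f = 0" by simp
    then obtain c where "f = [:c:]" by (rule degree_eq_zeroE)
    thus False using f by (auto simp: acp_pCons)
  qed
  have "Factorial_Ring.irreducible f"
  proof (rule Factorial_Ring.irreducibleI)
    show "\<not> f dvd 1" using dpos by (metis degree_1 dvd_imp_degree_le f(1) leD one_neq_zero)
    fix a b assume ab: "f = a * b"
    have n0: "a \<noteq> 0" "b \<noteq> 0" using f(1) ab by auto
    have deg: "Polynomial.degree f = Polynomial.degree a + Polynomial.degree b" using ab n0 by (simp add: degree_mult_eq)
    have "poly (acp a) y = 0 \<or> poly (acp b) y = 0" using f(2) by (simp add: ab acp_mult)
    hence "Polynomial.degree a = 0 \<or> Polynomial.degree b = 0"
      using min[of a] min[of b] n0 deg by linarith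
    thus "a dvd 1 \<or> b dvd 1" using n0 by (auto simp: is_unit_iff_degree)
  qed (use f in auto)
  thus ?thesis using f unfolding minimal_poly_def by blast
qed

lemma minimal_poly_nonzero: "minimal_poly f y \<Longrightarrow> f \<noteq> 0"
  by (auto simp: minimal_poly_def)

text \<open>An element \<open>h\<close> of least degree in the ideal generated by \<open>f\<close>
  and \<open>g\<close> divides both. If the irreducible \<open>f\<close> did not divide
  \<open>g\<close>, then \<open>h\<close> would be a unit, but \<open>h\<close> vanishes at
  \<open>y\<close>.\<close>

lemma minimal_poly_dvd:
  assumes "minimal_poly f y" "poly (acp g) y = 0"
  shows "f dvd g"
proof (rule ccontr)
  assume nd: "\<not> f dvd g"
  define P where "P n \<longleftrightarrow> (\<exists>u v. u * f + v * g \<noteq> 0 \<and> Polynomial.degree (u * f + v * g) = n)" for n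
  have f0: "f \<noteq> 0" using minimal_poly_nonzero[OF assms(1)] .
  have "P (Polynomial.degree f)" unfolding P_def using f0 by (intro exI[of _ 1] exI[of _ 0]) auto
  hence "P (LEAST n. P n)" by (rule LeastI)
  then obtain u v where uv: "u * f + v * g \<noteq> 0" "Polynomial.degree (u * f + v * g) = (LEAST n. P n)"
    unfolding P_def by blast
  define h where "h = u * f + v * g"
  have dv: "h dvd w" if "w = a * f + b * g" for w a b
  proof (rule ccontr)
    assume "\<not> h dvd w"
    hence m: "w mod h \<noteq> 0" by (simp add: dvd_eq_mod_eq_0)
    have eq: "w mod h = (a - w div h * u) * f + (b - w div h * v) * g"
      using minus_div_mult_eq_mod[of w h] that by (simp add: h_def algebra_simps)
    have "P (Polynomial.degree (w mod h))" unfolding P_def using m eq by metis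
    hence "Polynomial.degree h \<le> Polynomial.degree (w mod h)"
      using uv(2) unfolding h_def by (metis Least_le)
    moreover have "Polynomial.degree (w mod h) < Polynomial.degree h"
      using m degree_mod_less[of h w] uv(1) by (auto simp: h_def)
    ultimately show False by simp
  qed
  have hf: "h dvd f" "h dvd g" using dv[of f 1 0] dv[of g 0 1] by auto
  obtain w where w: "f = h * w" using hf(1) by (rule dvdE)
  have "h dvd 1 \<or> w dvd 1" using assms(1) w unfolding minimal_poly_def by (metis Factorial_Ring.irreducibleD)
  hence "h dvd 1"
  proof
    assume "w dvd 1"
    hence "f dvd h" using w by (metis dvd_mult_unit_iff dvd_refl)
    thus ?thesis using nd hf(2) by (meson dvd_trans)
  qed
  have "poly (acp h) y = 0" using assms by (simp add: h_def acp_add acp_mult minimal_poly_def)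
  hence "poly (acp 1) y = 0" using poly_acp_dvd[OF \<open>h dvd 1\<close>] by blast
  thus False by simp
qed

lemma minimal_poly_degree_pos: assumes "minimal_poly f y" shows "Polynomial.degree f > 0"
proof (rule ccontr)
  assume "\<not> ?thesis"
  hence "Polynomial.degree f = 0" by simp
  then obtain c where "f = [:c:]" by (rule degree_eq_zeroE)
  thus False using assms by (auto simp: acp_pCons minimal_poly_def)
qed

lemma minimal_poly_degree_le:
  assumes "minimal_poly f y" "poly (acp g) y = 0" "g \<noteq> 0"
  shows "Polynomial.degree f \<le> Polynomial.degree g"
  using dvd_imp_degree_le[OF minimal_poly_dvd[OF assms(1,2)] assms(3)] .

lemma minimal_poly_conj: "minimal_poly f y \<Longrightarrow> poly (acp f) z = 0 \<Longrightarrow> minimal_poly f z"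
  by (auto simp: minimal_poly_def)

text \<open>The field generated by \<open>\<eta>\<close> over \<open>k\<close>; polynomial
  expressions suffice because \<open>\<eta>\<close> is algebraic.\<close>

definition simple_ext :: "'k::field alg_closure \<Rightarrow> 'k alg_closure set" where
  "simple_ext \<eta> = range (\<lambda>q. poly (acp q) \<eta>)"

lemma simple_extI: "poly (acp q) \<eta> \<in> simple_ext \<eta>"
  by (auto simp: simple_ext_def)

text \<open>The constant coefficient of the minimal polynomial is nonzero by minimality of the
  degree, so the equation can be solved for the inverse.\<close>

lemma inverse_in_simple_ext: "inverse x \<in> simple_ext x"
proof (cases "x = 0")
  case True thus ?thesis using simple_extI[of 0 x] by simp
next
  case False
  obtain f where f: "minimal_poly f x" using minimal_poly_exists by blast
  obtain a g where ag: "f = pCons a g" by (cases f)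
  have e: "to_ac a + x * poly (acp g) x = 0" using f by (simp add: minimal_poly_def ag acp_pCons)
  have a: "a \<noteq> 0"
  proof
    assume "a = 0"
    hence "poly (acp g) x = 0" using e False by simp
    moreover have "g \<noteq> 0" using minimal_poly_nonzero[OF f] ag \<open>a = 0\<close> by auto
    ultimately show False using minimal_poly_degree_le[OF f, of g] ag by (auto simp: degree_pCons_eq)
  qed
  have "x * poly (acp (Polynomial.smult (- inverse a) g)) x = 1"
    unfolding acp_smult poly_smult using e a by (simp add: field_simps add_eq_0_iff)
  hence "inverse x = poly (acp (Polynomial.smult (- inverse a) g)) x" by (rule inverse_unique)
  thus ?thesis using simple_extI by metis
qed

lemma simple_ext_trans:
  assumes "x \<in> simple_ext \<eta>" "y \<in> simple_ext x" shows "y \<in> simple_ext \<eta>"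
proof -
  obtain q r where "x = poly (acp q) \<eta>" "y = poly (acp r) x" using assms by (auto simp: simple_ext_def)
  hence "y = poly (acp (pcompose r q)) \<eta>" by (simp add: acp_pcompose poly_pcompose)
  thus ?thesis by (simp add: simple_extI)
qed

lemma subf_simple_ext: "subf (simple_ext \<eta>)"
  unfolding subf_def
proof (intro conjI ballI)
  show "range to_ac \<subseteq> simple_ext \<eta>"
  proof
    fix x assume "x \<in> range (to_ac :: 'a \<Rightarrow> _)"
    then obtain c where "x = to_ac c" by auto
    thus "x \<in> simple_ext \<eta>" using simple_extI[of "[:c:]" \<eta>] by (simp add: acp_pCons)
  qed
next
  fix x y assume "x \<in> simple_ext \<eta>" "y \<in> simple_ext \<eta>"
  then obtain q r where "x = poly (acp q) \<eta>" "y = poly (acp r) \<eta>" by (auto simp: simple_ext_def)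
  thus "x + y \<in> simple_ext \<eta>" "x * y \<in> simple_ext \<eta>"
    using simple_extI[of "q + r" \<eta>] simple_extI[of "q * r" \<eta>] by (auto simp: acp_add acp_mult)
next
  fix x assume x: "x \<in> simple_ext \<eta>"
  then obtain q where "x = poly (acp q) \<eta>" by (auto simp: simple_ext_def)
  thus "- x \<in> simple_ext \<eta>" using simple_extI[of "- q" \<eta>] by (auto simp: acp_uminus)
  show "inverse x \<in> simple_ext \<eta>" using simple_ext_trans[OF x inverse_in_simple_ext] .
qed

lemma simple_ext_self: "\<eta> \<in> simple_ext \<eta>"
  using simple_extI[of "[:0, 1:]" \<eta>] by (simp add: acp_pCons)

section \<open>Simple roots and the primitive element theorem\<close>

definition separable :: "'k::field alg_closure \<Rightarrow> bool" where
  "separable y \<longleftrightarrow> (\<exists>f. minimal_poly f y \<and> pderiv f \<noteq> 0)"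

lemma pderiv_double_root:
  assumes "[:- x, 1:] ^ 2 dvd (p :: 'a::field poly)" shows "poly (pderiv p) x = 0"
proof -
  obtain k where "p = [:- x, 1:] ^ 2 * k" using assms by (rule dvdE)
  hence p: "p = [:- x, 1:] * ([:- x, 1:] * k)" by (simp only: power2_eq_square mult.assoc)
  show ?thesis unfolding p pderiv_mult poly_add poly_mult by simp
qed

text \<open>The polynomial \<open>f\<close> is minimal for \<open>z\<close> too, and its derivative
  is nonzero of smaller degree.\<close>

lemma separable_pderiv:
  assumes "minimal_poly f y" "pderiv f \<noteq> 0" "poly (acp f) z = 0"
  shows "poly (pderiv (acp f)) z \<noteq> 0"
proof
  assume "poly (pderiv (acp f)) z = 0"
  hence "Polynomial.degree f \<le> Polynomial.degree (pderiv f)"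
    using minimal_poly_degree_le[OF minimal_poly_conj[OF assms(1,3)], of "pderiv f"] assms(2) by (simp add: acp_pderiv)
  moreover have "Polynomial.degree (pderiv f) \<le> Polynomial.degree f - 1" by (rule degree_pderiv_le)
  ultimately show False using minimal_poly_degree_pos[OF assms(1)] by linarith
qed

lemma separable_roots:
  assumes "minimal_poly f y" "pderiv f \<noteq> 0"
  shows "card {z. poly (acp f) z = 0} = Polynomial.degree f"
    "acp f = (\<Prod>z | poly (acp f) z = 0. [:- z, 1:])"
proof -
  have f0: "acp f \<noteq> 0" using minimal_poly_nonzero[OF assms(1)] by simp
  obtain A where A: "size A = Polynomial.degree (acp f)"
      "acp f = Polynomial.smult (Polynomial.lead_coeff (acp f)) (\<Prod>x\<in>#A. [:-x, 1:])"
    using alg_closed_imp_factorization[OF f0] by blast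
  have A2: "acp f = (\<Prod>x\<in>#A. [:-x, 1:])" using A(2) assms(1) by (simp add: minimal_poly_def)
  have roots: "poly (acp f) z = 0 \<longleftrightarrow> z \<in># A" for z
    unfolding A2 by (auto simp: poly_prod_mset prod_mset_zero_iff)
  have c1: "count A z = 1" if "z \<in># A" for z
  proof (rule ccontr)
    assume "count A z \<noteq> 1"
    hence "count A z \<ge> 2" using that by (metis count_greater_eq_one_iff le_neq_implies_less Suc_1 Suc_leI)
    hence "replicate_mset 2 z \<subseteq># A" by (simp add: subseteq_mset_def)
    then obtain B where "A = replicate_mset 2 z + B" by (metis subset_mset.add_diff_inverse)
    hence "acp f = [:-z, 1:] ^ 2 * (\<Prod>x\<in>#B. [:-x, 1:])" using A2 by simp
    hence "poly (pderiv (acp f)) z = 0" by (intro pderiv_double_root) auto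
    thus False using separable_pderiv[OF assms] roots that by blast
  qed
  have Am: "A = mset_set {z. poly (acp f) z = 0}"
  proof (rule multiset_eqI)
    fix z show "count A z = count (mset_set {z. poly (acp f) z = 0}) z"
      using c1 f0 roots[of z] poly_roots_finite[OF f0]
      by (cases "z \<in># A") (auto simp: count_mset_set not_in_iff)
  qed
  show "card {z. poly (acp f) z = 0} = Polynomial.degree f"
    using A(1) unfolding Am by simp
  show "acp f = (\<Prod>z | poly (acp f) z = 0. [:- z, 1:])"
    using A2 unfolding Am by (simp add: prod_unfold_prod_mset)
qed

text \<open>Division with remainder that keeps the coefficients in a subfield \<open>R\<close> of
  the closure; the divisor is monic, so each step only subtracts multiples with coefficients in
  \<open>R\<close>.\<close>

lemma monic_division:
  assumes R: "subf R" and r: "\<forall>i. Polynomial.coeff r i \<in> R" "Polynomial.lead_coeff r = 1" "Polynomial.degree r > 0"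
    and p: "\<forall>i. Polynomial.coeff p i \<in> R"
  shows "\<exists>q. Polynomial.degree (p - q * r) < Polynomial.degree r \<and> (\<forall>i. Polynomial.coeff (p - q * r) i \<in> R)"
  using p
proof (induction "Polynomial.degree p" arbitrary: p rule: less_induct)
  case less
  show ?case
  proof (cases "Polynomial.degree p < Polynomial.degree r")
    case True thus ?thesis using less.prems by (intro exI[of _ 0]) auto
  next
    case False
    define n where "n = Polynomial.degree p"
    define m where "m = Polynomial.monom (Polynomial.lead_coeff p) (n - Polynomial.degree r)"
    define p' where "p' = p - m * r"
    have cR: "\<forall>i. Polynomial.coeff p' i \<in> R"
      unfolding p'_def m_def using less.prems r(1) R by (auto simp: coeff_monom_mult intro!: subf_ops)
    have "Polynomial.degree p' \<le> n" unfolding p'_def m_def n_def using False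
      by (intro degree_diff_le order.trans[OF degree_mult_le] order.trans[OF add_mono[OF degree_monom_le order.refl]]) auto
    moreover have "Polynomial.coeff p' n = 0"
      using False r(2) by (simp add: p'_def m_def n_def coeff_monom_mult)
    ultimately have "Polynomial.degree p' < n"
      using False r(3) by (metis le_neq_implies_less leading_coeff_0_iff degree_0 n_def not_less neq0_conv)
    then obtain q where "Polynomial.degree (p' - q * r) < Polynomial.degree r" "\<forall>i. Polynomial.coeff (p' - q * r) i \<in> R"
      using less.hyps[of p'] cR unfolding n_def by blast
    moreover have "p' - q * r = p - (m + q) * r" by (simp add: p'_def algebra_simps)
    ultimately show ?thesis by metis
  qed
qed

text \<open>Take \<open>\<zeta> = \<alpha> + c \<beta>\<close> with \<open>c\<close> outside a
  finite set. The monic polynomial \<open>r\<close> of least degree over k(\<zeta>) with root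
  \<open>\<beta>\<close> divides \<open>g\<close>, and also \<open>h\<close>, which arises from
  \<open>f\<close> by the substitution \<open>\<zeta> - c X\<close>. By the choice of
  \<open>c\<close> the only common root of \<open>g\<close> and \<open>h\<close> is
  \<open>\<beta>\<close>, and it is a simple root of \<open>g\<close>. So \<open>r\<close> is linear
  and \<open>\<beta>\<close> lies in k(\<zeta>).\<close>

lemma primitive_element:
  fixes \<alpha> \<beta> :: "'k::field alg_closure"
  assumes inf: "infinite (UNIV :: 'k set)" and sep: "separable \<beta>"
  shows "\<exists>\<zeta>. \<alpha> \<in> simple_ext \<zeta> \<and> \<beta> \<in> simple_ext \<zeta>"
proof -
  obtain f where f: "minimal_poly f \<alpha>" using minimal_poly_exists by blast
  obtain g where g: "minimal_poly g \<beta>" "pderiv g \<noteq> 0" using sep by (auto simp: separable_def)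
  \<comment> \<open>The values of \<open>c\<close> for which another pair of conjugates gives
    \<open>a + c b = \<zeta>\<close>. For \<open>b = \<beta>\<close> the division by zero merely
    adds 0 to the set.\<close>
  define bad where "bad = (\<lambda>(a, b). (a - \<alpha>) / (\<beta> - b)) ` ({z. poly (acp f) z = 0} \<times> {z. poly (acp g) z = 0})"
  have "finite bad" unfolding bad_def
    using minimal_poly_nonzero[OF f] minimal_poly_nonzero[OF g(1)] by (intro finite_imageI finite_cartesian_product poly_roots_finite) auto
  moreover have "infinite (range (to_ac :: 'k \<Rightarrow> _))" using inf finite_imageD[OF _ inj_to_ac] by blast
  ultimately obtain c :: 'k where c: "to_ac c \<notin> bad" by (metis finite_subset image_subsetI)
  define \<zeta> where "\<zeta> = \<alpha> + to_ac c * \<beta>"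
  define R where "R = simple_ext \<zeta>"
  have R: "subf R" unfolding R_def by (rule subf_simple_ext)
  have \<zeta>R: "\<zeta> \<in> R" by (simp add: R_def simple_ext_self)
  define h where "h = pcompose (acp f) [:\<zeta>, - to_ac c:]"
  have pc: "\<forall>i. Polynomial.coeff (pcompose p q) i \<in> R" if "\<forall>i. Polynomial.coeff p i \<in> R" "\<forall>i. Polynomial.coeff q i \<in> R" for p q
    using that(1)
  proof (induction p)
    case (pCons a p)
    have "\<forall>i. Polynomial.coeff p i \<in> R" using pCons.prems by (metis coeff_pCons_Suc)
    moreover have "a \<in> R" using pCons.prems by (metis coeff_pCons_0)
    hence "Polynomial.coeff [:a:] i \<in> R" for i using R by (auto simp: coeff_pCons split: nat.splits)
    ultimately show ?case using pCons.IH that(2)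
      unfolding pcompose_pCons coeff_add coeff_mult by (blast intro: subf_add[OF R] subf_sum[OF R] subf_mult[OF R])
  qed (use R in auto)
  have hR: "\<forall>i. Polynomial.coeff h i \<in> R"
    unfolding h_def using R \<zeta>R by (intro pc) (auto simp: coeff_pCons intro!: subf_uminus split: nat.splits)
  define P where "P n \<longleftrightarrow> (\<exists>r. (\<forall>i. Polynomial.coeff r i \<in> R) \<and> Polynomial.lead_coeff r = 1 \<and> poly r \<beta> = 0 \<and> Polynomial.degree r = n)" for n
  have "P (Polynomial.degree g)" unfolding P_def using g R
    by (intro exI[of _ "acp g"]) (auto simp: minimal_poly_def)
  hence "P (LEAST n. P n)" by (rule LeastI)
  then obtain r where r: "\<forall>i. Polynomial.coeff r i \<in> R" "Polynomial.lead_coeff r = 1" "poly r \<beta> = 0" "Polynomial.degree r = (LEAST n. P n)"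
    unfolding P_def by blast
  have r0: "r \<noteq> 0" using r(2) by auto
  have rdeg: "Polynomial.degree r > 0"
  proof (rule ccontr)
    assume "\<not> ?thesis"
    hence "Polynomial.degree r = 0" by simp
    then obtain a where "r = [:a:]" by (rule degree_eq_zeroE)
    thus False using r(3) r0 by auto
  qed
  have rdvd: "r dvd p" if pR: "\<forall>i. Polynomial.coeff p i \<in> R" "poly p \<beta> = 0" for p
  proof -
    obtain q where q: "Polynomial.degree (p - q * r) < Polynomial.degree r" "\<forall>i. Polynomial.coeff (p - q * r) i \<in> R"
      using monic_division[OF R r(1,2) rdeg pR(1)] by blast
    define s where "s = p - q * r"
    have "s = 0"
    proof (rule ccontr)
      assume s0: "s \<noteq> 0"
      define s' where "s' = Polynomial.smult (inverse (Polynomial.lead_coeff s)) s"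
      have sR: "\<And>i. Polynomial.coeff s i \<in> R" and s\<beta>: "poly s \<beta> = 0"
        using q(2) pR(2) r(3) by (auto simp: s_def)
      have "\<forall>i. Polynomial.coeff s' i \<in> R" "Polynomial.lead_coeff s' = 1" "poly s' \<beta> = 0"
        using sR s\<beta> s0 unfolding s'_def by (auto intro!: subf_mult[OF R] subf_inverse[OF R])
      hence "P (Polynomial.degree s')" unfolding P_def by blast
      hence "Polynomial.degree r \<le> Polynomial.degree s'" unfolding r(4) by (rule Least_le)
      moreover have "Polynomial.degree s' = Polynomial.degree s" using s0 by (simp add: s'_def)
      ultimately show False using q(1)[folded s_def] by simp
    qed
    thus ?thesis by (simp add: s_def)
  qed
  have rg: "r dvd acp g" using g R by (intro rdvd) (auto simp: minimal_poly_def)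
  have rh: "r dvd h"
    using hR f by (intro rdvd) (auto simp: h_def poly_pcompose \<zeta>_def minimal_poly_def mult.commute)
  obtain A where A: "size A = Polynomial.degree r" "r = Polynomial.smult (Polynomial.lead_coeff r) (\<Prod>x\<in>#A. [:-x, 1:])"
    using alg_closed_imp_factorization[OF r0] by blast
  have A2: "r = (\<Prod>x\<in>#A. [:-x, 1:])" using A(2) r(2) by simp
  have rootA: "x = \<beta>" if "x \<in># A" for x
  proof (rule ccontr)
    assume ne: "x \<noteq> \<beta>"
    have "poly r x = 0" using that unfolding A2 by (auto simp: poly_prod_mset prod_mset_zero_iff)
    hence gx: "poly (acp g) x = 0" and hx: "poly h x = 0" using rg rh by (auto elim!: dvdE)
    define a where "a = \<zeta> - to_ac c * x"
    have fa: "poly (acp f) a = 0" using hx by (simp add: h_def poly_pcompose a_def mult.commute)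
    have "to_ac c * (\<beta> - x) = a - \<alpha>" by (simp add: a_def \<zeta>_def algebra_simps)
    hence "to_ac c = (a - \<alpha>) / (\<beta> - x)" using ne by (simp add: field_simps)
    hence "to_ac c \<in> bad" unfolding bad_def using fa gx by (auto intro!: image_eqI[of _ _ "(a, x)"])
    thus False using c by simp
  qed
  have Arep: "A = replicate_mset (Polynomial.degree r) \<beta>"
    using rootA A(1) by (metis set_mset_subset_singletonD singletonI subsetI)
  have rpow: "[:- \<beta>, 1:] ^ Polynomial.degree r = r"
    by (rule A2[unfolded Arep image_replicate_mset prod_mset_replicate_mset, symmetric])
  have "Polynomial.degree r = 1"
  proof (rule ccontr)
    assume "\<not> ?thesis"
    hence "2 \<le> Polynomial.degree r" using rdeg by simp
    hence "[:- \<beta>, 1:] ^ 2 dvd [:- \<beta>, 1:] ^ Polynomial.degree r" by (rule le_imp_power_dvd)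
    also note rpow
    also note rg
    finally have "poly (pderiv (acp g)) \<beta> = 0" by (rule pderiv_double_root)
    thus False using separable_pderiv[OF g, of \<beta>] g(1) by (auto simp: minimal_poly_def)
  qed
  hence "r = [:- \<beta>, 1:]" using rpow by (metis power_one_right)
  hence "- \<beta> \<in> R" using r(1) by (metis coeff_pCons_0)
  hence \<beta>R: "\<beta> \<in> R" using subf_uminus[OF R, of "- \<beta>"] by simp
  have "\<zeta> - to_ac c * \<beta> \<in> R" using \<beta>R \<zeta>R R by (intro subf_diff subf_mult) auto
  hence "\<alpha> \<in> R" by (simp add: \<zeta>_def)
  thus ?thesis using \<beta>R unfolding R_def by blast
qed

section \<open>Frobenius powers and inseparability\<close>

locale prime_char =
  fixes dummy :: "'k::field itself"
  assumes prime_CHAR: "Factorial_Ring.prime CHAR('k)"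
begin

lemma frob_add: "m = CHAR('k) ^ e \<Longrightarrow> (x + y :: 'k alg_closure) ^ m = x ^ m + y ^ m"
  by (rule freshmans_dream') (use prime_CHAR in auto)

lemma frob_sum: "m = CHAR('k) ^ e \<Longrightarrow> (sum f I :: 'k alg_closure) ^ m = (\<Sum>i\<in>I. f i ^ m)"
  by (rule freshmans_dream_sum') (use prime_CHAR in auto)

lemma frob_pos: "CHAR('k) ^ e > 0"
  using prime_CHAR prime_gt_0_nat by simp

lemma frob_inj:
  assumes "m = CHAR('k) ^ e" "(x :: 'k alg_closure) ^ m = y ^ m" shows "x = y"
proof -
  have "(x - y + y) ^ m = (x - y) ^ m + y ^ m" by (rule frob_add[OF assms(1)])
  hence "(x - y) ^ m = 0" using assms(2) by simp
  thus ?thesis by simp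
qed

lemma frob_uminus: "m = CHAR('k) ^ e \<Longrightarrow> (- x :: 'k alg_closure) ^ m = - (x ^ m)"
proof -
  assume m: "m = CHAR('k) ^ e"
  have "m > 0" using m frob_pos by simp
  moreover have "(x + - x) ^ m = x ^ m + (- x) ^ m" by (rule frob_add[OF m])
  ultimately have "x ^ m + (- x) ^ m = 0" by (simp add: zero_power)
  thus ?thesis by (simp add: add_eq_0_iff)
qed

lemma frob_root: "\<exists>y :: 'k alg_closure. y ^ (CHAR('k) ^ e) = x"
  using nth_root_exists[of "CHAR('k) ^ e" x] frob_pos[of e] by blast

definition frob_poly :: "nat \<Rightarrow> 'k poly \<Rightarrow> 'k poly" where
  "frob_poly m q = map_poly (\<lambda>c. c ^ m) q"

lemma frob_poly:
  assumes "m = CHAR('k) ^ e"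
  shows "poly (acp q) y ^ m = poly (acp (frob_poly m q)) (y ^ m)"
proof -
  have m: "m > 0" using assms frob_pos by simp
  have "poly (acp q) y ^ m = (\<Sum>i\<le>Polynomial.degree q. to_ac (Polynomial.coeff q i ^ m) * (y ^ m) ^ i)"
    unfolding poly_altdef degree_acp frob_sum[OF assms]
    by (simp add: power_mult_distrib mult.commute flip: power_mult)
  also have "\<dots> = poly (acp (frob_poly m q)) (y ^ m)"
    using m by (subst poly_altdef_le[of _ "Polynomial.degree q"])
      (auto simp: frob_poly_def coeff_map_poly degree_map_poly_le intro!: order.trans[OF map_poly_degree_leq])
  finally show ?thesis .
qed

text \<open>If the derivative of the minimal polynomial vanishes, only exponents divisible by the
  characteristic p occur. The polynomial is then a polynomial in X^p, so \<open>y ^ p\<close> has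
  smaller degree than \<open>y\<close>.\<close>

lemma power_separable: "\<exists>e. separable ((y :: 'k alg_closure) ^ (CHAR('k) ^ e))"
proof -
  have "\<exists>e. separable (y ^ (CHAR('k) ^ e))" if "minimal_poly f y" "Polynomial.degree f = n" for n f and y :: "'k alg_closure"
    using that
  proof (induction n arbitrary: f y rule: less_induct)
    case (less n)
    show ?case
    proof (cases "pderiv f = 0")
      case False
      hence "separable (y ^ (CHAR('k) ^ 0))" using less.prems by (auto simp: separable_def)
      thus ?thesis by blast
    next
      case True
      define p where "p = CHAR('k)"
      have p: "p > 1" using prime_CHAR prime_gt_1_nat by (simp add: p_def)
      have c0: "Polynomial.coeff f i = 0" if "\<not> p dvd i" for i
      proof -
        have "i \<noteq> 0" using that by (metis dvd_0_right)
        then obtain j where j: "i = Suc j" by (cases i) auto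
        have "Polynomial.coeff (pderiv f) j = 0" using True by simp
        hence "of_nat i * Polynomial.coeff f i = 0" by (simp add: coeff_pderiv j)
        thus ?thesis using that by (simp add: p_def of_nat_eq_0_iff_char_dvd)
      qed
      define d where "d = Polynomial.degree f"
      define g where "g = (\<Sum>i\<le>d div p. Polynomial.monom (Polynomial.coeff f (p * i)) i)"
      have dp: "d > 0" using minimal_poly_degree_pos[OF less.prems(1)] by (simp add: d_def)
      have degg: "Polynomial.degree g \<le> d div p"
        unfolding g_def by (intro degree_sum_le) (auto intro: order.trans[OF degree_monom_le])
      have "p dvd d" using c0[of d] minimal_poly_nonzero[OF less.prems(1)] unfolding d_def by auto
      hence "Polynomial.coeff g (d div p) = Polynomial.lead_coeff f"
        by (simp add: g_def coeff_sum d_def)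
      hence g0: "g \<noteq> 0" using minimal_poly_nonzero[OF less.prems(1)] by auto
      have "poly (acp f) y = (\<Sum>i\<le>d. to_ac (Polynomial.coeff f i) * y ^ i)"
        by (simp add: poly_altdef d_def)
      also have "\<dots> = (\<Sum>i\<in>(\<lambda>j. p * j) ` {..d div p}. to_ac (Polynomial.coeff f i) * y ^ i)"
      proof (intro sum.mono_neutral_right ballI)
        show "(\<lambda>j. p * j) ` {..d div p} \<subseteq> {..d}"
          by (auto intro: order.trans[OF mult_le_mono2])
        fix i assume i: "i \<in> {..d} - (\<lambda>j. p * j) ` {..d div p}"
        have "\<not> p dvd i"
        proof
          assume "p dvd i"
          then obtain j where "i = p * j" by auto
          moreover have "j \<le> d div p" using i calculation p by (auto simp: less_eq_div_iff_mult_less_eq mult.commute)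
          ultimately show False using i by auto
        qed
        thus "to_ac (Polynomial.coeff f i) * y ^ i = 0" by (simp add: c0)
      qed auto
      also have "\<dots> = (\<Sum>j\<le>d div p. to_ac (Polynomial.coeff f (p * j)) * (y ^ p) ^ j)"
        using p by (subst sum.reindex) (auto simp: inj_on_def power_mult)
      also have "\<dots> = poly (acp g) (y ^ p)"
        by (simp add: g_def acp_sum acp_monom poly_sum poly_monom)
      finally have gy: "poly (acp g) (y ^ p) = 0" using less.prems(1) by (simp add: minimal_poly_def)
      obtain f' where f': "minimal_poly f' (y ^ p)" using minimal_poly_exists by blast
      have "Polynomial.degree f' \<le> Polynomial.degree g" using minimal_poly_degree_le[OF f' gy g0] .
      also have "\<dots> < n" using degg div_less_dividend[OF p dp] less.prems(2) by (simp add: d_def)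
      finally obtain e where "separable ((y ^ p) ^ (CHAR('k) ^ e))" using less.IH[OF _ f' refl] by blast
      hence "separable (y ^ (CHAR('k) ^ Suc e))" by (simp add: p_def power_mult[symmetric])
      thus ?thesis by blast
    qed
  qed
  thus ?thesis using minimal_poly_exists by blast
qed

lemma simple_ext_frob:
  assumes "m = CHAR('k) ^ e" "x \<in> simple_ext (y :: 'k alg_closure)" shows "x ^ m \<in> simple_ext (y ^ m)"
  using assms frob_poly[OF assms(1)] by (auto simp: simple_ext_def)

text \<open>The generator \<open>\<zeta>\<close> given by the primitive element theorem may be
  inseparable, so it is replaced by a Frobenius power of itself. The price is a further power on the
  elements of \<open>S\<close>; the exponents of different elements are brought to a common value by
  passing to still higher powers.\<close>

lemma separable_generator:
  assumes "infinite (UNIV :: 'k set)" "finite (S :: 'k alg_closure set)"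
  shows "\<exists>\<eta> e. separable \<eta> \<and> (\<forall>y\<in>S. y ^ (CHAR('k) ^ e) \<in> simple_ext \<eta>)"
  using assms(2)
proof (induction S rule: finite_induct)
  case empty
  have "minimal_poly [:- 1, 1:] (1 :: 'k alg_closure)"
    by (auto simp: minimal_poly_def acp_pCons intro!: irreducible_linear_field_poly)
  hence "separable (1 :: 'k alg_closure)" by (auto simp: separable_def pderiv_pCons)
  thus ?case by blast
next
  case (insert y S)
  obtain \<eta> e where IH: "separable \<eta>" "\<And>z. z \<in> S \<Longrightarrow> z ^ (CHAR('k) ^ e) \<in> simple_ext \<eta>" using insert.IH by blast
  obtain e' where e': "separable (y ^ (CHAR('k) ^ e'))" using power_separable by blast
  obtain \<zeta> where \<zeta>: "\<eta> \<in> simple_ext \<zeta>" "y ^ (CHAR('k) ^ e') \<in> simple_ext \<zeta>"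
    using primitive_element[OF assms(1) e'] by blast
  obtain e'' where e'': "separable (\<zeta> ^ (CHAR('k) ^ e''))" using power_separable by blast
  have *: "z ^ (CHAR('k) ^ (a + b + e'')) \<in> simple_ext (\<zeta> ^ (CHAR('k) ^ e''))"
    if "z ^ (CHAR('k) ^ a) \<in> simple_ext \<zeta>" for z a b
  proof -
    have "(z ^ (CHAR('k) ^ a)) ^ (CHAR('k) ^ e'') \<in> simple_ext (\<zeta> ^ (CHAR('k) ^ e''))"
      using simple_ext_frob[OF refl that] .
    hence "((z ^ (CHAR('k) ^ a)) ^ (CHAR('k) ^ e'')) ^ (CHAR('k) ^ b) \<in> simple_ext (\<zeta> ^ (CHAR('k) ^ e''))"
      by (rule subf_power[OF subf_simple_ext])
    thus ?thesis by (simp add: power_mult[symmetric] power_add mult_ac)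
  qed
  have "z ^ (CHAR('k) ^ (e + e' + e'')) \<in> simple_ext (\<zeta> ^ (CHAR('k) ^ e''))" if "z \<in> insert y S" for z
  proof (cases "z = y")
    case True thus ?thesis using *[OF \<zeta>(2), of e] by (simp add: add.commute)
  next
    case False
    hence "z ^ (CHAR('k) ^ e) \<in> simple_ext \<zeta>" using IH(2)[of z] that simple_ext_trans[OF \<zeta>(1)] by blast
    thus ?thesis using * by blast
  qed
  thus ?case using e'' by blast
qed

end

section \<open>Local degrees in a cofinal extension\<close>

text \<open>A quantitative form of the invertibility of the Vandermonde matrix. A point
  \<open>s\<close> is split off by writing \<open>p\<close> as X - s times \<open>q\<close>, plus
  the value of \<open>p\<close> at \<open>s\<close>; the values of \<open>q\<close> at the other
  points are then bounded by means of the distances to \<open>s\<close>.\<close>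

lemma interpolation_bound:
  assumes W: "absval (UNIV :: 'k::field alg_closure set) W" and S: "finite S"
  shows "\<exists>C>0. \<forall>p B. Polynomial.degree p < card S \<longrightarrow> (\<forall>s\<in>S. W (poly p s) \<le> B) \<longrightarrow> (\<forall>i. W (Polynomial.coeff p i) \<le> C * B)"
  using S
proof (induction S rule: finite_induct)
  case empty
  show ?case by (intro exI[of _ 1]) auto
next
  case (insert s S)
  note av = av_mult[OF subf_UNIV W UNIV_I UNIV_I] av_diff[OF subf_UNIV W UNIV_I UNIV_I] av_add[OF subf_UNIV W UNIV_I UNIV_I]
  have nn: "W x \<ge> 0" for x using av_nonneg[OF subf_UNIV W] by simp
  have W0: "W 0 = 0" using av_0[OF subf_UNIV W] .
  show ?case
  proof (cases "S = {}")
    case True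
    have "W (Polynomial.coeff p i) \<le> 1 * B" if "Polynomial.degree p < card (insert s S)" "\<forall>x\<in>insert s S. W (poly p x) \<le> B" for p B i
    proof -
      have "Polynomial.degree p = 0" using that(1) True by simp
      then obtain a where a: "p = [:a:]" by (rule degree_eq_zeroE)
      have "W (poly p s) \<le> B" using that(2) by blast
      hence "W a \<le> B" using a by simp
      moreover have "0 \<le> B" using calculation nn[of a] by linarith
      ultimately show ?thesis using a W0 by (auto simp: coeff_pCons split: nat.splits)
    qed
    thus ?thesis by (intro exI[of _ 1]) auto
  next
    case False
    obtain C where C: "C > 0" "\<And>p B i. Polynomial.degree p < card S \<Longrightarrow> \<forall>s\<in>S. W (poly p s) \<le> B \<Longrightarrow> W (Polynomial.coeff p i) \<le> C * B"
      using insert.IH by blast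
    define D where "D = (\<Sum>r\<in>S. inverse (W (r - s)))"
    have D: "inverse (W (r - s)) \<le> D" if "r \<in> S" for r
      unfolding D_def using insert(1) nn that by (intro member_le_sum) auto
    have D0: "D \<ge> 0" unfolding D_def using nn by (intro sum_nonneg) auto
    \<comment> \<open>A coefficient of \<open>p\<close> is \<open>- s\<close> times a coefficient of
      \<open>q\<close>, plus a neighbouring coefficient of \<open>q\<close> or the value
      \<open>poly p s\<close>. The first summand of \<open>E\<close> covers the coefficients of
      \<open>q\<close>, the 1 covers \<open>poly p s\<close>.\<close>
    define E where "E = max 1 (W s) * C * D + 1"
    have E: "E > 0" unfolding E_def using C D0 by (auto intro!: add_nonneg_pos mult_nonneg_nonneg)
    have "W (Polynomial.coeff p i) \<le> E * B" if p: "Polynomial.degree p < card (insert s S)" "\<forall>x\<in>insert s S. W (poly p x) \<le> B" for p B i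
    proof -
      define q where "q = synthetic_div p s"
      have pq: "[:-s, 1:] * q + [:poly p s:] = p" unfolding q_def by (rule synthetic_div_correct')
      have B0: "B \<ge> 0" using p(2) nn[of "poly p s"] by (auto intro: order.trans)
      have cS: "card S > 0" using insert False by (simp add: card_gt_0_iff)
      have "Polynomial.degree q < card S" using p(1) insert(1,2) cS by (simp add: q_def degree_synthetic_div)
      moreover have "\<forall>r\<in>S. W (poly q r) \<le> D * B"
      proof
        fix r assume r: "r \<in> S"
        hence rs: "r \<noteq> s" using insert by auto
        have "poly p r = (r - s) * poly q r + poly p s" by (subst pq[symmetric]) (simp add: algebra_simps)
        hence "poly q r = (poly p r - poly p s) * inverse (r - s)" using rs by (simp add: field_simps)
        hence "W (poly q r) = W (poly p r - poly p s) * inverse (W (r - s))"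
          by (simp add: av av_inverse[OF subf_UNIV W])
        also have "\<dots> \<le> B * D"
          using av(2)[of "poly p r" "poly p s"] p(2) r D[OF r] nn B0 by (intro mult_mono) auto
        finally show "W (poly q r) \<le> D * B" by (simp add: mult.commute)
      qed
      ultimately have q: "W (Polynomial.coeff q i) \<le> C * (D * B)" for i using C(2) by blast
      have cp: "Polynomial.coeff p i = (- s) * Polynomial.coeff q i + Polynomial.coeff (pCons (poly p s) q) i"
        by (subst pq[symmetric]) (simp add: coeff_pCons split: nat.splits)
      have CDB: "C * (D * B) \<ge> 0" using C D0 B0 by simp
      have "W ((- s) * Polynomial.coeff q i) = W s * W (Polynomial.coeff q i)"
        using av_uminus[OF subf_UNIV W] by (simp add: av)
      also have "\<dots> \<le> max 1 (W s) * (C * (D * B))"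
        using q[of i] nn by (intro mult_mono) auto
      also have "\<dots> \<le> E * B" using B0 by (simp add: E_def algebra_simps)
      finally have 1: "W ((- s) * Polynomial.coeff q i) \<le> E * B" .
      have 2: "W (Polynomial.coeff (pCons (poly p s) q) i) \<le> E * B"
      proof (cases i)
        case 0
        have "W (poly p s) \<le> B" using p(2) by simp
        also have "\<dots> \<le> E * B" using B0 C D0 by (simp add: E_def algebra_simps)
        finally show ?thesis using 0 by simp
      next
        case (Suc j)
        have "W (Polynomial.coeff q j) \<le> 1 * (C * (D * B))" using q[of j] by simp
        also have "\<dots> \<le> max 1 (W s) * (C * (D * B))" using CDB by (intro mult_right_mono) auto
        also have "\<dots> \<le> E * B" using B0 by (simp add: E_def algebra_simps)
        finally show ?thesis using Suc by simp
      qed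
      show ?thesis unfolding cp using av(3) 1 2 by (meson max.boundedI order.trans)
    qed
    thus ?thesis using E by blast
  qed
qed

text \<open>By assumption \<open>dist\<close> the nonzero terms have pairwise different values, so
  the largest one cannot be cancelled and determines the value of the sum.\<close>

lemma absval_distinct_sum:
  assumes W: "absval (UNIV :: 'k::field alg_closure set) W" and I: "finite I"
    and dist: "\<And>i j. i \<in> I \<Longrightarrow> j \<in> I \<Longrightarrow> i \<noteq> j \<Longrightarrow> W (f i) = W (f j) \<Longrightarrow> f i = 0" and i: "i \<in> I"
  shows "W (f i) \<le> W (sum f I)"
proof -
  have nn: "W x \<ge> 0" for x using av_nonneg[OF subf_UNIV W] by simp
  have W0: "W x = 0 \<longleftrightarrow> x = 0" for x using av_eq_0[OF subf_UNIV W] by simp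
  have "Max ((\<lambda>i. W (f i)) ` I) \<in> (\<lambda>i. W (f i)) ` I" using I i by (intro Max_in) auto
  then obtain j where j: "j \<in> I" "W (f j) = Max ((\<lambda>i. W (f i)) ` I)" by auto
  have max: "W (f l) \<le> W (f j)" if "l \<in> I" for l unfolding j(2) using I that by (intro Max_ge) auto
  show ?thesis
  proof (cases "f j = 0")
    case True thus ?thesis using max[OF i] nn[of "sum f I"] W0[of 0] by auto
  next
    case False
    hence jpos: "W (f j) > 0" using nn[of "f j"] W0[of "f j"] by linarith
    have lt: "W (f l) < W (f j)" if "l \<in> I - {j}" for l
      using max[of l] dist[of j l] that False j(1) by fastforce
    define M where "M = Max (insert 0 ((\<lambda>i. W (f i)) ` (I - {j})))"
    have M: "M < W (f j)" "M \<ge> 0" "\<And>l. l \<in> I - {j} \<Longrightarrow> W (f l) \<le> M"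
      unfolding M_def using I lt jpos by (auto simp: Max_less_iff)
    have "W (sum f (I - {j})) \<le> M"
      by (rule av_sum_le[OF subf_UNIV W]) (use M in auto)
    hence "W (sum f (I - {j}) + f j) = W (f j)"
      using M(1) by (intro av_add_eq[OF subf_UNIV W]) auto
    moreover have "sum f (I - {j}) + f j = sum f I" using I j(1) by (simp add: sum.remove[of I j] add.commute)
    ultimately show ?thesis using max[OF i] by simp
  qed
qed

lemma nind_reindex:
  assumes "nind N I b" "bij_betw h J I"
  shows "nind N J (b \<circ> h)"
proof -
  obtain C where C: "\<And>t i. i \<in> I \<Longrightarrow> N (to_ac (t i)) \<le> C * N (\<Sum>j\<in>I. to_ac (t j) * b j)"
    using assms(1) unfolding nind_def by blast
  have "N (to_ac (t i)) \<le> C * N (\<Sum>j\<in>J. to_ac (t j) * (b \<circ> h) j)" if "i \<in> J" for t i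
  proof -
    define t' where "t' = t \<circ> inv_into J h"
    have t': "t' (h i) = t i" if "i \<in> J" for i
      using assms(2) that by (simp add: t'_def bij_betw_def)
    have "h i \<in> I" using assms(2) that by (auto simp: bij_betw_def)
    hence "N (to_ac (t' (h i))) \<le> C * N (\<Sum>j\<in>I. to_ac (t' j) * b j)" by (rule C)
    also have "(\<Sum>j\<in>I. to_ac (t' j) * b j) = (\<Sum>j\<in>J. to_ac (t' (h j)) * b (h j))"
      using assms(2) by (rule sum.reindex_bij_betw[symmetric])
    also have "\<dots> = (\<Sum>j\<in>J. to_ac (t j) * (b \<circ> h) j)" by (intro sum.cong) (auto simp: t')
    finally show ?thesis using t' that by simp
  qed
  thus ?thesis unfolding nind_def by blast
qed

text \<open>
  \<open>n\<close> is the degree of the completion of \<open>K\<close> over that of \<open>k\<close>, expressed without completions.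
\<close>

definition has_ldeg :: "'k::field alg_closure set \<Rightarrow> ('k alg_closure \<Rightarrow> real) \<Rightarrow> nat \<Rightarrow> bool" where
  "has_ldeg K N n \<longleftrightarrow> (\<exists>b. (\<forall>i<n. b i \<in> K) \<and> nind N {..<n} b) \<and>
     (\<forall>m b. (\<forall>i<m. b i \<in> K) \<longrightarrow> nind N {..<m} b \<longrightarrow> m \<le> n)"

text \<open>A linear relation over \<open>k\<close> is a combination of value 0, whose coefficients
  vanish by \<open>nind\<close>. So \<open>nind\<close> implies ordinary linear
  independence.\<close>

lemma nind_card_le:
  fixes m d :: nat
  assumes K: "subf K" and N: "absval K N" and b: "\<And>i. i < m \<Longrightarrow> b i \<in> K" "nind N {..<m} b"
    and span: "\<And>z. z \<in> K \<Longrightarrow> \<exists>x. z = (\<Sum>l<d. to_ac (x l) * e l)"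
  shows "m \<le> d"
proof (rule ccontr)
  assume "\<not> m \<le> d"
  have "\<forall>i<m. \<exists>x. b i = (\<Sum>l<d. to_ac (x l) * e l)" using span b(1) by blast
  then obtain x where x: "\<And>i. i < m \<Longrightarrow> b i = (\<Sum>l<d. to_ac (x i l) * e l)" by metis
  have "\<exists>t. (\<exists>i\<in>{..<m}. t i \<noteq> 0) \<and> (\<forall>j\<in>{..<d}. (\<Sum>i<m. t i * x i j) = 0)"
    using \<open>\<not> m \<le> d\<close> by (intro lin_dep) auto
  then obtain t where t: "\<exists>i\<in>{..<m}. t i \<noteq> 0" "\<forall>j<d. (\<Sum>i<m. t i * x i j) = 0" by auto
  have "(\<Sum>i<m. to_ac (t i) * b i) = (\<Sum>i<m. \<Sum>l<d. to_ac (t i * x i l) * e l)"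
    by (intro sum.cong) (auto simp: x sum_distrib_left mult.assoc)
  also have "\<dots> = (\<Sum>l<d. \<Sum>i<m. to_ac (t i * x i l) * e l)" by (rule sum.swap)
  also have "\<dots> = (\<Sum>l<d. to_ac (\<Sum>i<m. t i * x i l) * e l)" unfolding to_ac_sum sum_distrib_right ..
  also have "\<dots> = 0" using t(2) by simp
  finally have 0: "(\<Sum>i<m. to_ac (t i) * b i) = 0" .
  obtain C where C: "\<forall>t. \<forall>i\<in>{..<m}. N (to_ac (t i)) \<le> C * N (\<Sum>j<m. to_ac (t j) * b j)"
    using b(2) unfolding nind_def by blast
  obtain i where "i < m" "t i \<noteq> 0" using t(1) by auto
  hence "N (to_ac (t i)) \<le> 0" using C[rule_format, of i t] 0 av_0[OF K N] by simp
  moreover have "N (to_ac (t i)) > 0" using av_pos[OF K N] K \<open>t i \<noteq> 0\<close> by simp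
  ultimately show False by simp
qed

lemma has_ldeg_exists:
  fixes d :: nat
  assumes K: "subf K" and N: "absval K N"
    and span: "\<And>z. z \<in> K \<Longrightarrow> \<exists>x. z = (\<Sum>l<d. to_ac (x l) * e l)"
  shows "\<exists>n. has_ldeg K N n"
proof -
  define Q where "Q m \<longleftrightarrow> (\<exists>b. (\<forall>i<(m::nat). b i \<in> K) \<and> nind N {..<m} b)" for m
  have bound: "m \<le> d" if "Q m" for m
    using that nind_card_le[OF K N _ _ span] unfolding Q_def by metis
  have "Q 0" unfolding Q_def nind_def by auto
  hence "Q (Greatest Q)" using bound by (rule GreatestI_nat) 
  moreover have "m \<le> Greatest Q" if "Q m" for m using that bound by (rule Greatest_le_nat)
  ultimately show ?thesis unfolding has_ldeg_def Q_def by blast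
qed

lemma has_ldeg_pos:
  assumes K: "subf K" and N: "absval K N" and n: "has_ldeg K N n"
  shows "n > 0"
proof -
  have "nind N {..<1::nat} (\<lambda>_. 1)"
    unfolding nind_def by (intro exI[of _ 1]) (simp add: lessThan_Suc)
  hence "1 \<le> n" using n K unfolding has_ldeg_def by (metis subf_1)
  thus ?thesis by simp
qed

lemma has_ldeg_dense:
  assumes K: "subf K" and N: "absval K N" and n: "has_ldeg K N n"
  obtains b where "\<And>i. i < n \<Longrightarrow> b i \<in> K" "nind N {..<n} b"
    "\<And>x \<epsilon>. x \<in> K \<Longrightarrow> \<epsilon> > 0 \<Longrightarrow> \<exists>t. N (x - (\<Sum>i<n. to_ac (t i) * b i)) < \<epsilon>"
proof -
  obtain b where b: "\<And>i. i < n \<Longrightarrow> b i \<in> K" "nind N {..<n} b" using n unfolding has_ldeg_def by blast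
  have "\<exists>t. N (x - (\<Sum>i<n. to_ac (t i) * b i)) < \<epsilon>" if "x \<in> K" "\<epsilon> > 0" for x \<epsilon>
  proof (rule nind_maximal_dense[OF K N b(1) b(2) that(1) _ that(2)])
    show "\<not> nind N {..<Suc n} (b(n := x))"
    proof
      assume "nind N {..<Suc n} (b(n := x))"
      moreover have "\<forall>i<Suc n. (b(n := x)) i \<in> K" using b(1) that(1) by (auto simp: less_Suc_eq)
      ultimately have "Suc n \<le> n" using n unfolding has_ldeg_def by blast
      thus False by simp
    qed
  qed
  thus ?thesis using that b by blast
qed

text \<open>
  \<open>T_basis\<close> says that \<open>k\<close> is spanned by \<open>P\<close> elements over its subfield of \<open>P\<close>-th powers, which
  makes \<open>{z. z^P \<in> k(\<eta>)}\<close> a finite extension.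
\<close>

locale cofinal_ext = prime_char dummy for dummy :: "'k::field itself" +
  fixes f :: "'k poly" and \<eta> :: "'k alg_closure" and e :: nat and P :: nat and T :: 'k
  assumes f: "minimal_poly f \<eta>" and f_sep: "pderiv f \<noteq> 0" and P: "P = CHAR('k) ^ e"
    and T_basis: "\<And>c :: 'k. \<exists>s. c = (\<Sum>j<P. s j ^ P * T ^ j)"
begin

definition rts :: "'k alg_closure set" where "rts = {z. poly (acp f) z = 0}"

lemma finite_rts: "finite rts"
  unfolding rts_def using minimal_poly_nonzero[OF f] by (intro poly_roots_finite) simp

lemma card_rts: "card rts = Polynomial.degree f"
  unfolding rts_def by (rule separable_roots[OF f f_sep])

lemma card_rts_pos: "card rts > 0"
  using minimal_poly_degree_pos[OF f] by (simp add: card_rts)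

lemma P_pos: "P > 0" using P frob_pos by simp

definition Kbig :: "'k alg_closure set" where "Kbig = {z. z ^ P \<in> simple_ext \<eta>}"

lemma subf_Kbig: "subf Kbig"
  unfolding subf_def Kbig_def
  using subf_simple_ext[of \<eta>] frob_add[OF P] frob_uminus[OF P]
  by (auto simp: power_mult_distrib power_inverse intro: subf_ops simp flip: to_ac_power)

text \<open>The embedding of \<open>Kbig\<close> over \<open>k\<close> that maps
  \<open>\<eta>\<close> to \<open>\<zeta>\<close>. The P-th power of an element of
  \<open>Kbig\<close> is a polynomial in \<open>\<eta>\<close>, so the image has to be a P-th root
  of the same polynomial in \<open>\<zeta>\<close>, and such roots are unique.\<close>

definition emb :: "'k alg_closure \<Rightarrow> 'k alg_closure \<Rightarrow> 'k alg_closure" where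
  "emb \<zeta> z = (SOME y. \<exists>q. z ^ P = poly (acp q) \<eta> \<and> y ^ P = poly (acp q) \<zeta>)"

text \<open>Two polynomials with the same value at \<open>\<eta>\<close> differ by a multiple of
  \<open>f\<close>, hence agree at the conjugate \<open>\<zeta>\<close>.\<close>

lemma emb_eqI:
  assumes \<zeta>: "\<zeta> \<in> rts" and "z ^ P = poly (acp q) \<eta>" "y ^ P = poly (acp q) \<zeta>"
  shows "emb \<zeta> z = y"
proof -
  let ?Q = "\<lambda>y. \<exists>q. z ^ P = poly (acp q) \<eta> \<and> y ^ P = poly (acp q) \<zeta>"
  have "?Q (emb \<zeta> z)" unfolding emb_def by (rule someI[of ?Q]) (use assms in blast)
  then obtain r where r: "z ^ P = poly (acp r) \<eta>" "emb \<zeta> z ^ P = poly (acp r) \<zeta>" by blast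
  have "f dvd q - r" using r(1) assms(2) by (intro minimal_poly_dvd[OF f]) (simp add: acp_diff)
  hence "poly (acp (q - r)) \<zeta> = 0" using \<zeta> poly_acp_dvd by (auto simp: rts_def)
  hence "emb \<zeta> z ^ P = y ^ P" using r(2) assms(3) by (simp add: acp_diff)
  thus ?thesis by (rule frob_inj[OF P])
qed

lemma Kbig_poly: assumes "z \<in> Kbig" obtains q where "z ^ P = poly (acp q) \<eta>"
  using assms by (auto simp: Kbig_def simple_ext_def)

lemma emb_power:
  assumes "\<zeta> \<in> rts" "z ^ P = poly (acp q) \<eta>" shows "emb \<zeta> z ^ P = poly (acp q) \<zeta>"
proof -
  obtain y where "y ^ P = poly (acp q) \<zeta>" using frob_root[of e "poly (acp q) \<zeta>"] P by auto
  thus ?thesis using emb_eqI[OF assms] by metis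
qed

context
  fixes \<zeta> assumes \<zeta>: "\<zeta> \<in> rts"
begin

lemma emb_add: "x \<in> Kbig \<Longrightarrow> y \<in> Kbig \<Longrightarrow> emb \<zeta> (x + y) = emb \<zeta> x + emb \<zeta> y"
proof -
  assume "x \<in> Kbig" "y \<in> Kbig"
  then obtain q r where qr: "x ^ P = poly (acp q) \<eta>" "y ^ P = poly (acp r) \<eta>" by (metis Kbig_poly)
  show ?thesis
    by (rule emb_eqI[OF \<zeta>, of _ "q + r"]) (auto simp: frob_add[OF P] qr acp_add emb_power[OF \<zeta> qr(1)] emb_power[OF \<zeta> qr(2)])
qed

lemma emb_mult: "x \<in> Kbig \<Longrightarrow> y \<in> Kbig \<Longrightarrow> emb \<zeta> (x * y) = emb \<zeta> x * emb \<zeta> y"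
proof -
  assume "x \<in> Kbig" "y \<in> Kbig"
  then obtain q r where qr: "x ^ P = poly (acp q) \<eta>" "y ^ P = poly (acp r) \<eta>" by (metis Kbig_poly)
  show ?thesis
    by (rule emb_eqI[OF \<zeta>, of _ "q * r"]) (auto simp: power_mult_distrib qr acp_mult emb_power[OF \<zeta> qr(1)] emb_power[OF \<zeta> qr(2)])
qed

lemma emb_to_ac [simp]: "emb \<zeta> (to_ac c) = to_ac c"
  by (rule emb_eqI[OF \<zeta>, of _ "[:c ^ P:]"]) (auto simp: acp_pCons)

lemma emb_0 [simp]: "emb \<zeta> 0 = 0" and emb_1 [simp]: "emb \<zeta> 1 = 1"
  using emb_to_ac[of 0] emb_to_ac[of 1] by auto

lemma emb_sum: "(\<And>i. i \<in> I \<Longrightarrow> g i \<in> Kbig) \<Longrightarrow> emb \<zeta> (sum g I) = (\<Sum>i\<in>I. emb \<zeta> (g i))"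
  by (induction I rule: infinite_finite_induct) (auto simp: emb_add subf_sum[OF subf_Kbig])

lemma emb_pow: "x \<in> Kbig \<Longrightarrow> emb \<zeta> (x ^ n) = emb \<zeta> x ^ n"
  by (induction n) (auto simp: emb_mult subf_power[OF subf_Kbig])

lemma emb_eq_0: "x \<in> Kbig \<Longrightarrow> emb \<zeta> x = 0 \<longleftrightarrow> x = 0"
proof
  assume x: "x \<in> Kbig" "emb \<zeta> x = 0"
  show "x = 0"
  proof (rule ccontr)
    assume "x \<noteq> 0"
    hence "emb \<zeta> x * emb \<zeta> (inverse x) = 1" using emb_mult[OF x(1) subf_inverse[OF subf_Kbig x(1)]] by simp
    thus False using x by simp
  qed
qed simp

text \<open>Purely inseparable elements have no other conjugates, so the P-th roots in the explicit
  families below are fixed by all embeddings.\<close>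

lemma emb_pth_root: "\<tau> ^ P = to_ac c \<Longrightarrow> emb \<zeta> \<tau> = \<tau>"
  by (rule emb_eqI[OF \<zeta>, of _ "[:c:]"]) (auto simp: acp_pCons)

lemma emb_poly: "z \<in> Kbig \<Longrightarrow> emb \<zeta> (poly (acp q) z) = poly (acp q) (emb \<zeta> z)"
  unfolding poly_altdef
  by (subst emb_sum) (auto simp: emb_mult emb_pow subf_Kbig subf_power[OF subf_Kbig] intro!: subf_mult)

lemma absval_emb:
  assumes "absval UNIV W" shows "absval Kbig (\<lambda>z. W (emb \<zeta> z))"
  using assms unfolding absval_def by (auto simp: emb_mult emb_add emb_eq_0)

lemma emb_\<eta>: "emb \<zeta> \<eta> = \<zeta>"
proof (rule emb_eqI[OF \<zeta>])
  show "\<eta> ^ P = poly (acp (Polynomial.monom 1 P)) \<eta>" "\<zeta> ^ P = poly (acp (Polynomial.monom 1 P)) \<zeta>"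
    by (simp_all add: acp_monom poly_monom)
qed

end

lemma \<eta>_Kbig: "\<eta> \<in> Kbig"
  unfolding Kbig_def by (simp add: subf_power[OF subf_simple_ext] simple_ext_self)

lemma pth_root_Kbig: "\<tau> ^ P = to_ac c \<Longrightarrow> \<tau> \<in> Kbig"
  unfolding Kbig_def by (simp add: subf_simple_ext)

lemma poly_mod_f: "poly (acp (q mod f)) \<eta> = poly (acp q) \<eta>"
proof -
  have "acp q = acp (q div f) * acp f + acp (q mod f)" by (simp flip: acp_mult acp_add)
  thus ?thesis using f by (simp add: minimal_poly_def)
qed

text \<open>The powers of \<open>\<eta> ^ P\<close> span k(\<eta>) as well, because the P-th powers
  of the \<open>card rts\<close> conjugates are still distinct. This spanning family is preferred
  since the P-th roots of its members are at hand.\<close>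

lemma simple_ext_power_basis:
  assumes "w \<in> simple_ext \<eta>"
  shows "\<exists>c. w = (\<Sum>i<card rts. to_ac (c i) * (\<eta> ^ i) ^ P)"
proof -
  define n where "n = card rts"
  obtain q where q: "w = poly (acp q) \<eta>" using assms by (auto simp: simple_ext_def)
  \<comment> \<open>Index \<open>n\<close> stands for \<open>w\<close>, the smaller indices for the
    powers of \<open>\<eta> ^ P\<close>. These are \<open>n + 1\<close> polynomials of degree below
    \<open>n\<close>, hence dependent.\<close>
  define r where "r i = (if i < n then Polynomial.monom 1 (i * P) else q) mod f" for i
  have r: "poly (acp (r i)) \<eta> = (if i < n then (\<eta> ^ i) ^ P else w)" for i
    unfolding r_def poly_mod_f by (auto simp: acp_monom poly_monom q power_mult)
  have "Polynomial.degree (w mod f) < n" for w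
    using degree_mod_less[of f w] card_rts_pos minimal_poly_nonzero[OF f] by (auto simp: n_def card_rts)
  hence degr: "Polynomial.degree (r i) < n" for i by (simp add: r_def)
  have "\<exists>t. (\<exists>i\<in>{..n}. t i \<noteq> 0) \<and> (\<forall>j\<in>{..<n}. (\<Sum>i\<in>{..n}. t i * Polynomial.coeff (r i) j) = 0)"
    by (intro lin_dep) auto
  then obtain t where t: "\<exists>i\<in>{..n}. t i \<noteq> 0" "\<And>j. j < n \<Longrightarrow> (\<Sum>i\<in>{..n}. t i * Polynomial.coeff (r i) j) = 0" by auto
  have "(\<Sum>i\<in>{..n}. Polynomial.smult (t i) (r i)) = 0"
  proof (rule poly_eqI)
    fix j show "Polynomial.coeff (\<Sum>i\<in>{..n}. Polynomial.smult (t i) (r i)) j = Polynomial.coeff 0 j"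
    proof (cases "j < n")
      case False
      hence "Polynomial.coeff (r i) j = 0" for i using degr[of i] by (intro coeff_eq_0) linarith
      thus ?thesis by (simp add: coeff_sum)
    qed (use t(2) in \<open>simp add: coeff_sum\<close>)
  qed
  hence "poly (acp (\<Sum>i\<in>{..n}. Polynomial.smult (t i) (r i))) \<eta> = 0" by simp
  hence s: "(\<Sum>i<n. to_ac (t i) * (\<eta> ^ i) ^ P) + to_ac (t n) * w = 0"
    by (simp add: acp_sum acp_add acp_smult poly_sum r lessThan_Suc_atMost[symmetric])
  have "t n \<noteq> 0"
  proof
    assume tn: "t n = 0"
    \<comment> \<open>A relation that does not involve \<open>w\<close> would be a nonzero
      polynomial of degree below \<open>n\<close> vanishing at the P-th powers of all
      \<open>n\<close> conjugates.\<close>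
    define g where "g = (\<Sum>i<n. Polynomial.monom (t i) i)"
    have cg: "Polynomial.coeff g i = (if i < n then t i else 0)" for i
      by (simp add: g_def coeff_sum)
    obtain i where "i \<le> n" "t i \<noteq> 0" using t(1) by auto
    hence "Polynomial.coeff g i \<noteq> 0" using tn by (auto simp: cg le_less)
    hence g0: "g \<noteq> 0" by auto
    have "Polynomial.degree g \<le> n - 1" by (rule degree_le) (auto simp: cg)
    hence "Polynomial.degree g < n" using card_rts_pos by (simp add: n_def)
    define h where "h = (\<Sum>i<n. Polynomial.monom (t i) (i * P))"
    have h: "poly (acp h) z = poly (acp g) (z ^ P)" for z
      by (simp add: h_def g_def acp_sum acp_monom poly_sum poly_monom power_mult[symmetric] mult.commute)
    have "poly (acp h) \<eta> = 0" using s tn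
      by (simp add: h_def acp_sum acp_monom poly_sum poly_monom power_mult)
    hence "f dvd h" by (rule minimal_poly_dvd[OF f])
    hence "poly (acp g) (z ^ P) = 0" if "z \<in> rts" for z
      using poly_acp_dvd[of f h z] that h by (simp add: rts_def)
    hence "(\<lambda>z. z ^ P) ` rts \<subseteq> {z. poly (acp g) z = 0}" by auto
    hence "card ((\<lambda>z. z ^ P) ` rts) \<le> card {z. poly (acp g) z = 0}"
      using g0 by (intro card_mono poly_roots_finite) auto
    also have "\<dots> \<le> Polynomial.degree g" using card_poly_roots_bound[of "acp g"] g0 by simp
    also have "card ((\<lambda>z. z ^ P) ` rts) = n"
      unfolding n_def using frob_inj[OF P] by (intro card_image) (auto simp: inj_on_def)
    finally show False using \<open>Polynomial.degree g < n\<close> by simp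
  qed
  hence "w = (\<Sum>i<n. to_ac (- t i / t n) * (\<eta> ^ i) ^ P)"
    using s by (simp add: sum_negf sum_divide_distrib[symmetric] field_simps add_eq_0_iff)
  thus ?thesis by (intro exI[of _ "\<lambda>i. - t i / t n"]) (simp add: n_def)
qed

text \<open>With \<open>\<tau>\<close> a P-th root of \<open>T\<close>, the products of powers of
  \<open>\<eta>\<close> and \<open>\<tau>\<close> span: write \<open>z ^ P\<close> by means of
  \<open>simple_ext_power_basis\<close>, expand its coefficients by \<open>T_basis\<close>, and take
  P-th roots term by term, Frobenius being additive and injective.\<close>

lemma Kbig_span:
  "\<exists>b :: nat \<Rightarrow> 'k alg_closure. (\<forall>l<P * card rts. b l \<in> Kbig) \<and> (\<forall>z\<in>Kbig. \<exists>x. z = (\<Sum>l<P * card rts. to_ac (x l) * b l))"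
proof -
  obtain \<tau> where \<tau>: "\<tau> ^ P = to_ac T" using frob_root[of e "to_ac T"] P by auto
  define S where "S = {..<card rts} \<times> {..<P}"
  have S: "finite S" "card S = P * card rts" by (auto simp: S_def)
  define b where "b = (\<lambda>(i, j). \<eta> ^ i * \<tau> ^ j)"
  have bK: "b s \<in> Kbig" for s
    using \<eta>_Kbig pth_root_Kbig[OF \<tau>] by (auto simp: b_def split: prod.splits intro!: subf_mult[OF subf_Kbig] subf_power[OF subf_Kbig])
  have span: "\<exists>x. z = (\<Sum>s\<in>S. to_ac (x s) * b s)" if "z \<in> Kbig" for z
  proof -
    obtain c where c: "z ^ P = (\<Sum>i<card rts. to_ac (c i) * (\<eta> ^ i) ^ P)"
      using simple_ext_power_basis \<open>z \<in> Kbig\<close> unfolding Kbig_def by blast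
    have "\<forall>i. \<exists>s. c i = (\<Sum>j<P. s j ^ P * T ^ j)" using T_basis by blast
    then obtain s where s: "\<And>i. c i = (\<Sum>j<P. s i j ^ P * T ^ j)" by metis
    have "z ^ P = (\<Sum>i<card rts. \<Sum>j<P. (to_ac (s i j) * (\<eta> ^ i * \<tau> ^ j)) ^ P)"
      unfolding c s to_ac_sum sum_distrib_right
      by (intro sum.cong refl) (auto simp: power_mult_distrib \<tau>[symmetric] mult.commute simp flip: power_mult)
    also have "\<dots> = (\<Sum>r\<in>S. (to_ac (s (fst r) (snd r)) * b r) ^ P)"
      unfolding S_def sum.cartesian_product by (intro sum.cong) (auto simp: b_def)
    also have "\<dots> = (\<Sum>r\<in>S. to_ac (s (fst r) (snd r)) * b r) ^ P" by (rule frob_sum[OF P, symmetric])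
    finally have "z = (\<Sum>r\<in>S. to_ac (s (fst r) (snd r)) * b r)" by (rule frob_inj[OF P])
    thus ?thesis by (intro exI[of _ "\<lambda>r. s (fst r) (snd r)"])
  qed
  obtain h where h: "bij_betw h {..<P * card rts} S"
    using ex_bij_betw_nat_finite[OF S(1)] unfolding S(2) by (auto simp: lessThan_atLeast0)
  have "\<exists>x. z = (\<Sum>l<P * card rts. to_ac (x l) * (b \<circ> h) l)" if z: "z \<in> Kbig" for z
  proof -
    obtain x where "z = (\<Sum>s\<in>S. to_ac (x s) * b s)" using span[OF z] by blast
    also have "\<dots> = (\<Sum>l<P * card rts. to_ac (x (h l)) * b (h l))"
      using sum.reindex_bij_betw[OF h, of "\<lambda>s. to_ac (x s) * b s"] by simp
    finally show ?thesis by (intro exI[of _ "x \<circ> h"]) simp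
  qed
  thus ?thesis using bK by (intro exI[of _ "b \<circ> h"]) auto
qed

end

section \<open>Comparing local degrees with numbers of embeddings\<close>

locale cofinal_local = cofinal_ext dummy + discrete_absval N0 p
  for dummy :: "'k::field itself" and N0 :: "'k \<Rightarrow> real" and p :: 'k +
  fixes W :: "'k alg_closure \<Rightarrow> real"
  assumes W: "absval UNIV W" and W_to_ac: "\<And>c. W (to_ac c) = N0 c"
begin

text \<open>A P-th root of the uniformiser is totally ramified: the values of nonzero terms with
  different exponents of \<open>\<tau>\<close> lie in different classes modulo the value group of
  \<open>k\<close>, so terms cannot cancel.\<close>

lemma powers_bound:
  assumes \<tau>: "\<tau> ^ P = to_ac p"
  shows "\<exists>C>0. \<forall>t. \<forall>j<P. N0 (t j) \<le> C * W (\<Sum>j<P. to_ac (t j) * \<tau> ^ j)"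
proof -
  define \<rho> where "\<rho> = W \<tau>"
  have nn: "W x \<ge> 0" for x using av_nonneg[OF subf_UNIV W] by simp
  have \<rho>P: "\<rho> ^ P = N0 p" using av_power[OF subf_UNIV W, of \<tau> P] \<tau> W_to_ac by (simp add: \<rho>_def)
  have \<rho>pos: "\<rho> > 0"
  proof -
    have "\<rho> \<noteq> 0" using \<rho>P N0_pos[OF p0] P_pos by (auto simp: power_0_left)
    thus ?thesis using nn[of \<tau>] by (simp add: \<rho>_def)
  qed
  have \<rho>1: "\<rho> < 1"
  proof (rule ccontr)
    assume "\<not> \<rho> < 1"
    hence "1 \<le> \<rho> ^ P" by (intro one_le_power) auto
    thus False using \<rho>P p1 by simp
  qed
  have val: "W (to_ac c * \<tau> ^ j) = N0 c * \<rho> ^ j" for c j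
    using av_mult[OF subf_UNIV W] av_power[OF subf_UNIV W] W_to_ac by (simp add: \<rho>_def)
  have key: "N0 (t j) * \<rho> ^ j \<le> W (\<Sum>j<P. to_ac (t j) * \<tau> ^ j)" if j: "j < P" for t j
  proof -
    have "W (to_ac (t j) * \<tau> ^ j) \<le> W (\<Sum>j<P. to_ac (t j) * \<tau> ^ j)"
    proof (rule absval_distinct_sum[OF W, where f = "\<lambda>j. to_ac (t j) * \<tau> ^ j"])
      fix i l assume il: "i \<in> {..<P}" "l \<in> {..<P}" "i \<noteq> l" "W (to_ac (t i) * \<tau> ^ i) = W (to_ac (t l) * \<tau> ^ l)"
      show "to_ac (t i) * \<tau> ^ i = 0"
      proof (rule ccontr)
        assume "\<not> ?thesis"
        hence ti: "t i \<noteq> 0" by auto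
        have eq: "N0 (t i) * \<rho> ^ i = N0 (t l) * \<rho> ^ l" using il(4) unfolding val .
        have tl: "t l \<noteq> 0" using eq N0_pos[OF ti] \<rho>pos by auto
        obtain a where a: "N0 (t i) = N0 p powi a" using N0_discrete[OF ti] by blast
        obtain b where b: "N0 (t l) = N0 p powi b" using N0_discrete[OF tl] by blast
        have pw: "N0 p powi a * \<rho> ^ i = \<rho> powi (int P * a + int i)" for a i
          using \<rho>pos by (simp add: \<rho>P[symmetric] power_int_add power_int_mult)
        have "\<rho> powi (int P * a + int i) = \<rho> powi (int P * b + int l)"
          using eq unfolding a b pw .
        hence "int P * a + int i = int P * b + int l"
          using \<rho>pos \<rho>1 by (metis less_irrefl linorder_neqE_linordered_idom power_int_strict_decreasing)
        \<comment> \<open>Reading the exponent of \<open>\<rho>\<close> modulo \<open>P\<close>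
          recovers the index.\<close>
        hence "(int P * a + int i) mod int P = (int P * b + int l) mod int P" by simp
        hence "i = l" using il(1,2) by simp
        thus False using il(3) by simp
      qed
    qed (use j in auto)
    thus ?thesis unfolding val .
  qed
  have "N0 (t j) \<le> inverse (\<rho> ^ P) * W (\<Sum>j<P. to_ac (t j) * \<tau> ^ j)" if j: "j < P" for t j
  proof -
    have "\<rho> ^ P \<le> \<rho> ^ j" using j \<rho>pos \<rho>1 by (intro power_decreasing) auto
    hence "N0 (t j) * \<rho> ^ P \<le> N0 (t j) * \<rho> ^ j" by (rule mult_left_mono[OF _ N0_nonneg])
    hence "N0 (t j) * \<rho> ^ P \<le> W (\<Sum>j<P. to_ac (t j) * \<tau> ^ j)" using key[OF j, of t] by linarith
    thus ?thesis using \<rho>pos by (simp add: field_simps)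
  qed
  thus ?thesis using \<rho>pos by (intro exI[of _ "inverse (\<rho> ^ P)"]) auto
qed

text \<open>If all embeddings in \<open>I\<close> induce \<open>N\<close>, then \<open>N z\<close>
  is the value of all these conjugates of \<open>z\<close> at once. For a combination of the
  \<open>\<eta> ^ i * \<tau> ^ j\<close> with \<open>i < card I\<close> the conjugates are the
  values on \<open>I\<close> of one polynomial of degree below \<open>card I\<close>. Now
  \<open>interpolation_bound\<close> controls its coefficients, and \<open>powers_bound\<close> the
  scalars inside them.\<close>

lemma local_lower_bound:
  assumes N: "\<And>\<zeta> z. \<zeta> \<in> I \<Longrightarrow> z \<in> Kbig \<Longrightarrow> N z = W (emb \<zeta> z)" and I: "I \<subseteq> rts" "I \<noteq> {}"
  shows "\<exists>b. (\<forall>l<P * card I. b l \<in> Kbig) \<and> nind N {..<P * card I} b"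
proof -
  obtain \<tau> where \<tau>: "\<tau> ^ P = to_ac p" using frob_root[of e "to_ac p"] P by auto
  have fI: "finite I" using I(1) finite_rts finite_subset by blast
  define n where "n = card I"
  define S where "S = {..<n} \<times> {..<P}"
  have S: "finite S" "card S = P * card I" by (auto simp: S_def n_def)
  define b where "b = (\<lambda>(i, j). \<eta> ^ i * \<tau> ^ j)"
  have bK: "b s \<in> Kbig" for s
    using \<eta>_Kbig pth_root_Kbig[OF \<tau>] by (auto simp: b_def split: prod.splits intro!: subf_mult[OF subf_Kbig] subf_power[OF subf_Kbig])
  have nn: "W x \<ge> 0" for x using av_nonneg[OF subf_UNIV W] by simp
  obtain C where C: "C > 0" "\<And>p B i. Polynomial.degree p < card I \<Longrightarrow> \<forall>s\<in>I. W (poly p s) \<le> B \<Longrightarrow> W (Polynomial.coeff p i) \<le> C * B"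
    using interpolation_bound[OF W fI] by blast
  obtain D where D: "D > 0" "\<And>t j. j < P \<Longrightarrow> N0 (t j) \<le> D * W (\<Sum>j<P. to_ac (t j) * \<tau> ^ j)"
    using powers_bound[OF \<tau>] by blast
  have main: "N (to_ac (t s)) \<le> (D * C) * N (\<Sum>r\<in>S. to_ac (t r) * b r)" if s: "s \<in> S" for t s
  proof -
    define z where "z = (\<Sum>r\<in>S. to_ac (t r) * b r)"
    define u where "u a = (\<Sum>j<P. to_ac (t (a, j)) * \<tau> ^ j)" for a
    define q where "q = (\<Sum>a<n. Polynomial.monom (u a) a)"
    have cq: "Polynomial.coeff q a = (if a < n then u a else 0)" for a
      by (simp add: q_def coeff_sum)
    have npos: "n > 0" using I(2) fI by (simp add: n_def card_gt_0_iff)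
    have "Polynomial.degree q \<le> n - 1" by (rule degree_le) (auto simp: cq)
    hence dq: "Polynomial.degree q < card I" using npos by (simp add: n_def)
    have zK: "z \<in> Kbig" unfolding z_def using bK by (intro subf_sum[OF subf_Kbig] subf_mult[OF subf_Kbig]) (auto simp: subf_Kbig)
    have ez: "emb \<zeta> z = poly q \<zeta>" if "\<zeta> \<in> I" for \<zeta>
    proof -
      have \<zeta>: "\<zeta> \<in> rts" using that I by blast
      have eb: "emb \<zeta> (b (i, j)) = \<zeta> ^ i * \<tau> ^ j" for i j
        unfolding b_def using \<eta>_Kbig pth_root_Kbig[OF \<tau>]
        by (simp add: emb_mult[OF \<zeta>] emb_pow[OF \<zeta>] subf_power[OF subf_Kbig] emb_\<eta>[OF \<zeta>] emb_pth_root[OF \<zeta> \<tau>])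
      have "emb \<zeta> z = (\<Sum>r\<in>S. to_ac (t r) * emb \<zeta> (b r))"
        unfolding z_def using bK by (subst emb_sum[OF \<zeta>]) (auto simp: emb_mult[OF \<zeta>] emb_to_ac[OF \<zeta>] subf_Kbig intro!: subf_mult)
      also have "\<dots> = (\<Sum>i<n. \<Sum>j<P. to_ac (t (i, j)) * emb \<zeta> (b (i, j)))"
        unfolding S_def by (simp add: sum.cartesian_product split_beta)
      also have "\<dots> = (\<Sum>i<n. u i * \<zeta> ^ i)"
        unfolding eb u_def sum_distrib_right by (intro sum.cong) (auto simp: mult_ac)
      also have "\<dots> = poly q \<zeta>" by (simp add: q_def poly_sum poly_monom)
      finally show ?thesis .
    qed
    obtain \<zeta>0 where \<zeta>0: "\<zeta>0 \<in> I" using I by blast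
    have "\<forall>\<zeta>\<in>I. W (poly q \<zeta>) \<le> N z" using N[OF _ zK] ez by simp
    hence Wu: "W (Polynomial.coeff q a) \<le> C * N z" for a using C(2)[OF dq] by blast
    obtain a j where aj: "s = (a, j)" "a < n" "j < P" using s by (auto simp: S_def)
    have "N (to_ac (t s)) = N0 (t (a, j))"
      using N[OF \<zeta>0, of "to_ac (t s)"] emb_to_ac[of \<zeta>0] \<zeta>0 I subf_Kbig W_to_ac aj by auto
    also have "\<dots> \<le> D * W (u a)" unfolding u_def using D(2)[OF aj(3), of "\<lambda>j. t (a, j)"] .
    also have "\<dots> \<le> D * (C * N z)" using Wu[of a] aj(2) D(1) by (intro mult_left_mono) (auto simp: cq)
    finally show ?thesis by (simp add: z_def mult.assoc)
  qed
  hence ni: "nind N S b" unfolding nind_def by blast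
  obtain h where h: "bij_betw h {..<P * card I} S"
    using ex_bij_betw_nat_finite[OF S(1)] unfolding S(2) by (auto simp: lessThan_atLeast0)
  show ?thesis using nind_reindex[OF ni h] bK by (intro exI[of _ "b \<circ> h"]) auto
qed

text \<open>A double count over a set \<open>S\<close> of places of \<open>K\<close>. With
  \<open>k\<close> as the lower field, \<open>local_degree_sum_le\<close> bounds the sum of the
  local degrees by \<open>d\<close>. With \<open>K\<close> as the lower field it shows that
  \<open>d'\<close> times a local degree is at least \<open>P\<close> times the number of embeddings
  inducing the place. As there are \<open>card rts\<close> embeddings and
  \<open>d * d' \<le> P * card rts\<close>, equality holds everywhere.\<close>

theorem local_degree_formula:
  assumes K: "subf K" "K \<subseteq> Kbig" and N: "absval K N" "\<And>c. N (to_ac c) = N0 c" and n: "has_ldeg K N n"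
    and g: "\<And>l. l < d \<Longrightarrow> g l \<in> K" and span: "\<And>z. z \<in> K \<Longrightarrow> \<exists>x. z = (\<Sum>l<d. to_ac (x l) * g l)"
    and g': "\<And>l. l < d' \<Longrightarrow> g' l \<in> Kbig"
    and span': "\<And>z. z \<in> Kbig \<Longrightarrow> \<exists>x. (\<forall>l<d'. x l \<in> K) \<and> z = (\<Sum>l<d'. x l * g' l)"
    and dd': "d * d' \<le> P * card rts"
  shows "n * d' = P * card {\<zeta>\<in>rts. \<forall>z\<in>K. N z = W (emb \<zeta> z)}" "d * d' = P * card rts"
proof -
  define r where "r \<zeta> = restrict (\<lambda>z. W (emb \<zeta> z)) K" for \<zeta>
  define r' where "r' \<zeta> = restrict (\<lambda>z. W (emb \<zeta> z)) Kbig" for \<zeta>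
  \<comment> \<open>The place of \<open>N\<close> is included without knowing that it comes from an
    embedding. That it does will follow from the formula, as local degrees are positive.\<close>
  define S where "S = insert (restrict N K) (r ` rts)"
  have S: "finite S" using finite_rts by (simp add: S_def)
  have avr: "absval K (r \<zeta>)" if "\<zeta> \<in> rts" for \<zeta>
    by (rule absval_trans_eq[OF absval_subset[OF absval_emb[OF that W] K(2)] _ K(1)]) (simp add: r_def)
  have avr': "absval Kbig (r' \<zeta>)" if "\<zeta> \<in> rts" for \<zeta>
    by (rule absval_trans_eq[OF absval_emb[OF that W] _ subf_Kbig]) (simp add: r'_def)
  have avS: "absval K M \<and> (\<forall>c. M (to_ac c) = N0 c) \<and> M \<in> extensional K" if "M \<in> S" for M
  proof (cases "M = restrict N K")
    case True
    have "absval K M" by (rule absval_trans_eq[OF N(1) _ K(1)]) (simp add: True)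
    thus ?thesis using True N(2) K(1) by simp
  next
    case False
    then obtain \<zeta> where \<zeta>: "\<zeta> \<in> rts" "M = r \<zeta>" using \<open>M \<in> S\<close> by (auto simp: S_def)
    thus ?thesis using avr[OF \<zeta>(1)] K(1) W_to_ac emb_to_ac[OF \<zeta>(1)] by (auto simp: r_def)
  qed
  have avr'c: "r' \<zeta> (to_ac c) = N0 c" if "\<zeta> \<in> rts" for \<zeta> c
    using that W_to_ac emb_to_ac[OF that] subf_Kbig by (simp add: r'_def)
  have "\<forall>M\<in>S. \<exists>k. has_ldeg K M k" using has_ldeg_exists[OF K(1) _ span] avS by blast
  then obtain k0 where k0: "\<And>M. M \<in> S \<Longrightarrow> has_ldeg K M (k0 M)" by metis
  have nN: "has_ldeg K (restrict N K) n"
  proof -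
    have "nind (restrict N K) {..<m} b \<longleftrightarrow> nind N {..<m} b" if "\<forall>i<m. b i \<in> K" for m and b :: "nat \<Rightarrow> 'k alg_closure"
    proof -
      have "(\<Sum>j<m. to_ac (t j) * b j) \<in> K" for t
        using that by (intro subf_sum[OF K(1)] subf_mult[OF K(1)]) (auto simp: K(1))
      thus ?thesis unfolding nind_def by (simp add: K(1))
    qed
    thus ?thesis using n unfolding has_ldeg_def by metis
  qed
  define k where "k = k0(restrict N K := n)"
  have k: "has_ldeg K M (k M)" if "M \<in> S" for M using k0[OF that] nN by (auto simp: k_def)
  have "\<forall>M\<in>S. \<exists>b. (\<forall>i<k M. b i \<in> K) \<and> nind M {..<k M} b \<and> (\<forall>x \<epsilon>. x \<in> K \<longrightarrow> \<epsilon> > 0 \<longrightarrow> (\<exists>t. M (x - (\<Sum>i<k M. to_ac (t i) * b i)) < \<epsilon>))"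
  proof
    fix M assume M: "M \<in> S"
    show "\<exists>b. (\<forall>i<k M. b i \<in> K) \<and> nind M {..<k M} b \<and> (\<forall>x \<epsilon>. x \<in> K \<longrightarrow> \<epsilon> > 0 \<longrightarrow> (\<exists>t. M (x - (\<Sum>i<k M. to_ac (t i) * b i)) < \<epsilon>))"
      using has_ldeg_dense[OF K(1) _ k[OF M]] avS[OF M] by metis
  qed
  then obtain bb where bb: "\<And>M i. M \<in> S \<Longrightarrow> i < k M \<Longrightarrow> bb M i \<in> K" "\<And>M. M \<in> S \<Longrightarrow> nind M {..<k M} (bb M)"
    "\<And>M x \<epsilon>. M \<in> S \<Longrightarrow> x \<in> K \<Longrightarrow> \<epsilon> > 0 \<Longrightarrow> \<exists>t. M (x - (\<Sum>i<k M. to_ac (t i) * bb M i)) < \<epsilon>"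
    by metis
  have p01: "0 < N0 p" "N0 p < 1" using N0_pos[OF p0] p1 by auto
  have ext_dist: "\<exists>z\<in>A. M z \<noteq> M' z" if "M \<in> extensional A" "M' \<in> extensional A" "M \<noteq> M'" for A and M M' :: "'k alg_closure \<Rightarrow> real"
    using that by (metis extensionalityI)
  have baseF: "subf (range (to_ac :: 'k \<Rightarrow> _))"
    unfolding subf_def by (auto simp flip: to_ac_add to_ac_mult to_ac_minus to_ac_inverse)
  have sum1: "(\<Sum>M\<in>S. k M) \<le> 1 * d"
  proof (rule local_degree_sum_le[where K = K and Nf = "\<lambda>M. M" and V = N0 and p = p and J = S and L = "range to_ac"
      and ?N0.0 = W and b = bb and c = "\<lambda>_. 1" and e = g])
    fix x :: "'k alg_closure" and \<epsilon> :: real assume "x \<in> range to_ac" "\<epsilon> > 0"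
    then obtain c where "x = to_ac c" by auto
    thus "\<exists>t. W (x - (\<Sum>i<(1::nat). to_ac (t i) * 1)) < \<epsilon>"
      using \<open>\<epsilon> > 0\<close> av_0[OF subf_UNIV W] by (intro exI[of _ "\<lambda>_. c"]) (simp add: lessThan_Suc)
  next
    fix z assume "z \<in> K"
    then obtain x where "z = (\<Sum>l<d. to_ac (x l) * g l)" using span by blast
    thus "\<exists>x. (\<forall>l<d. x l \<in> range to_ac) \<and> z = (\<Sum>l<d. x l * g l)" by (intro exI[of _ "\<lambda>l. to_ac (x l)"]) auto
  next
    fix M M' assume "M \<in> S" "M' \<in> S" "M \<noteq> M'"
    thus "\<exists>z\<in>K. M z \<noteq> M' z" using avS by (intro ext_dist) auto
  next
    show "range to_ac \<subseteq> K" using K(1) by auto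
  qed (use K(1) avS S bb g p01 baseF W_to_ac absval_subset[OF W] range_eqI[of 1 to_ac 1] in auto)
  define cnt where "cnt M = card {\<zeta>\<in>rts. r \<zeta> = M}" for M
  have sum2: "P * cnt M \<le> k M * d'" if M: "M \<in> S" for M
  proof -
    \<comment> \<open>The places of \<open>Kbig\<close> above \<open>M\<close>. As restricted
      functions they identify embeddings that induce the same place.\<close>
    define J where "J = r' ` {\<zeta>\<in>rts. r \<zeta> = M}"
    define c' where "c' j = card {\<zeta>\<in>rts. r' \<zeta> = j}" for j
    have rr': "r \<zeta> = r \<xi>" if "r' \<zeta> = r' \<xi>" for \<zeta> \<xi>
      using that K(2) unfolding r_def r'_def by (metis Int_absorb1 restrict_restrict)
    have r'K: "r' \<zeta> x = r \<zeta> x" if "x \<in> K" for \<zeta> x using that K(2) by (auto simp: r_def r'_def)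
    have "\<forall>j\<in>J. \<exists>b. (\<forall>l<P * c' j. b l \<in> Kbig) \<and> nind j {..<P * c' j} b"
    proof
      fix j assume j: "j \<in> J"
      show "\<exists>b. (\<forall>l<P * c' j. b l \<in> Kbig) \<and> nind j {..<P * c' j} b"
        unfolding c'_def
      proof (rule local_lower_bound)
        fix \<zeta> z assume z: "\<zeta> \<in> {\<zeta> \<in> rts. r' \<zeta> = j}" "z \<in> Kbig"
        hence "j z = r' \<zeta> z" by simp
        thus "j z = W (emb \<zeta> z)" using z(2) by (simp add: r'_def)
      qed (use j in \<open>auto simp: J_def\<close>)
    qed
    then obtain \<beta> where \<beta>: "\<And>j l. j \<in> J \<Longrightarrow> l < P * c' j \<Longrightarrow> \<beta> j l \<in> Kbig" "\<And>j. j \<in> J \<Longrightarrow> nind j {..<P * c' j} (\<beta> j)" by metis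
    have fJ: "finite J" using finite_rts by (simp add: J_def)
    have "(\<Sum>j\<in>J. P * c' j) \<le> k M * d'"
    proof (rule local_degree_sum_le[where K = Kbig and Nf = "\<lambda>j. j" and V = N0 and p = p and J = J and L = K
      and ?N0.0 = M and b = \<beta> and c = "bb M" and e = g'])
      fix j j' assume "j \<in> J" "j' \<in> J" "j \<noteq> j'"
      thus "\<exists>z\<in>Kbig. j z \<noteq> j' z" by (intro ext_dist) (auto simp: J_def r'_def)
    next
      fix j x assume "j \<in> J" "x \<in> K" thus "j x = M x" using r'K by (auto simp: J_def)
    next
      fix x \<epsilon> assume "x \<in> K" "(\<epsilon>::real) > 0"
      thus "\<exists>t. M (x - (\<Sum>i<k M. to_ac (t i) * bb M i)) < \<epsilon>" using bb(3)[OF M] by blast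
    next
      fix z assume "z \<in> Kbig" thus "\<exists>x. (\<forall>l<d'. x l \<in> K) \<and> z = (\<Sum>l<d'. x l * g' l)" using span' by blast
    next
      fix j assume "j \<in> J" thus "absval Kbig j" using avr' by (auto simp: J_def)
    next
      fix j c assume "j \<in> J" thus "j (to_ac c) = N0 c" using avr'c by (auto simp: J_def)
    qed (use subf_Kbig K fJ \<beta> bb M avS[OF M] p01 g' in auto)
    moreover have "(\<Sum>j\<in>J. c' j) = cnt M"
    proof -
      have "cnt M = card (\<Union>j\<in>J. {\<zeta>\<in>rts. r' \<zeta> = j})"
        unfolding cnt_def J_def using rr' by (intro arg_cong[of _ _ card]) blast
      also have "\<dots> = (\<Sum>j\<in>J. c' j)"
        unfolding c'_def using fJ finite_rts by (intro card_UN_disjoint) auto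
      finally show ?thesis by simp
    qed
    ultimately show ?thesis by (simp add: sum_distrib_left[symmetric])
  qed
  have "(\<Sum>M\<in>S. cnt M) = card (\<Union>M\<in>S. {\<zeta>\<in>rts. r \<zeta> = M})"
    unfolding cnt_def using S finite_rts by (intro card_UN_disjoint[symmetric]) auto
  also have "(\<Union>M\<in>S. {\<zeta>\<in>rts. r \<zeta> = M}) = rts" by (auto simp: S_def)
  finally have cs: "(\<Sum>M\<in>S. P * cnt M) = P * card rts" by (simp add: sum_distrib_left[symmetric])
  have kd: "(\<Sum>M\<in>S. k M * d') \<le> d * d'"
  proof -
    have "(\<Sum>M\<in>S. k M * d') = (\<Sum>M\<in>S. k M) * d'" by (simp add: sum_distrib_right)
    also have "\<dots> \<le> d * d'" using sum1 by simp
    finally show ?thesis .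
  qed
  \<comment> \<open>The squeeze: both ends are \<open>P * card rts\<close>, so the inequalities
    \<open>sum2\<close> are equalities for each single place.\<close>
  have "P * card rts \<le> (\<Sum>M\<in>S. k M * d')" unfolding cs[symmetric] by (rule sum_mono[OF sum2])
  thus dd: "d * d' = P * card rts" using kd dd' by linarith
  have "(\<Sum>M\<in>S. k M * d') \<le> P * card rts" using kd dd by simp
  hence "(\<Sum>M\<in>S. k M * d') = (\<Sum>M\<in>S. P * cnt M)"
    using sum_mono[of S "\<lambda>M. P * cnt M" "\<lambda>M. k M * d'"] sum2 cs by force
  hence "k (restrict N K) * d' = P * cnt (restrict N K)"
    using sum_mono_inv[of "\<lambda>M. P * cnt M" S "\<lambda>M. k M * d'" "restrict N K"] sum2 S by (auto simp: S_def)
  moreover have "cnt (restrict N K) = card {\<zeta>\<in>rts. \<forall>z\<in>K. N z = W (emb \<zeta> z)}"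
    unfolding cnt_def r_def by (intro arg_cong[of _ _ card] Collect_cong conj_cong refl) (auto simp: fun_eq_iff restrict_def)
  ultimately show "n * d' = P * card {\<zeta>\<in>rts. \<forall>z\<in>K. N z = W (emb \<zeta> z)}" by (simp add: k_def)
qed

end

section \<open>Norms and characteristic polynomials\<close>

context cofinal_ext
begin

text \<open>The product is the characteristic polynomial of multiplication by the value of
  \<open>q\<close> at \<open>\<eta>\<close> on k(\<eta>). In the basis of powers of
  \<open>\<eta>\<close> its matrix \<open>A\<close> has entries in \<open>k\<close>, and the
  Vandermonde matrix of the conjugates diagonalises it over the closure.\<close>

lemma char_poly_rational:
  "\<exists>g :: 'k poly. acp g = (\<Prod>\<zeta>\<in>rts. [:- poly (acp q) \<zeta>, 1:])"
proof -
  define n where "n = card rts"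
  obtain zs where zs: "set zs = rts" "distinct zs" using finite_distinct_list[OF finite_rts] by blast
  have len: "length zs = n" using zs distinct_card n_def by metis
  define R where "R i = (Polynomial.monom 1 i * q) mod f" for i
  have degR: "Polynomial.degree (R i) < n" for i
    using degree_mod_less[of f "Polynomial.monom 1 i * q"] card_rts_pos minimal_poly_nonzero[OF f] by (auto simp: n_def card_rts R_def)
  define A where "A = mat n n (\<lambda>(i, j). Polynomial.coeff (R i) j)"
  define A' where "A' = map_mat to_ac A"
  define V where "V = mat n n (\<lambda>(j, l). (zs ! l) ^ j)"
  define D where "D = mat n n (\<lambda>(i, j). if i = j then poly (acp q) (zs ! i) else 0)"
  have carr: "A \<in> carrier_mat n n" "A' \<in> carrier_mat n n" "V \<in> carrier_mat n n" "D \<in> carrier_mat n n"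
    by (auto simp: A_def A'_def V_def D_def)
  have root: "poly (acp f) (zs ! l) = 0" if "l < n" for l
    using that zs len by (metis (mono_tags, lifting) mem_Collect_eq nth_mem rts_def)
  have AV: "A' * V = V * D"
  proof (rule eq_matI)
    fix i l assume il: "i < dim_row (V * D)" "l < dim_col (V * D)"
    hence i: "i < n" and l: "l < n" using carr by auto
    have "(A' * V) $$ (i, l) = (\<Sum>j = 0..<n. to_ac (Polynomial.coeff (R i) j) * (zs ! l) ^ j)"
      using i l by (simp add: A'_def A_def V_def scalar_prod_def)
    also have "\<dots> = poly (acp (R i)) (zs ! l)"
      using degR[of i] by (subst poly_altdef_le[of _ "n - 1"]) (auto simp: atLeast0LessThan lessThan_Suc_atMost[symmetric])
    also have "\<dots> = (zs ! l) ^ i * poly (acp q) (zs ! l)"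
    proof -
      have "acp (Polynomial.monom 1 i * q) = acp (Polynomial.monom 1 i * q div f) * acp f + acp (R i)"
        unfolding R_def by (simp flip: acp_mult acp_add)
      hence "poly (acp (Polynomial.monom 1 i * q)) (zs ! l) = poly (acp (R i)) (zs ! l)"
        using root[OF l] by simp
      thus ?thesis by (simp add: acp_mult acp_monom poly_monom)
    qed
    also have "\<dots> = (\<Sum>j = 0..<n. (zs ! j) ^ i * (if j = l then poly (acp q) (zs ! j) else 0))"
      using l by (simp add: if_distrib cong: if_cong)
    also have "\<dots> = (V * D) $$ (i, l)"
      using i l by (simp add: V_def D_def scalar_prod_def)
    finally show "(A' * V) $$ (i, l) = (V * D) $$ (i, l)" .
  qed (use carr in auto)
  \<comment> \<open>A kernel vector would be the coefficient vector of a nonzero polynomial of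
    degree below \<open>n\<close> that vanishes at the \<open>n\<close> conjugates.\<close>
  have "det (transpose_mat V) \<noteq> 0"
  proof
    assume "det (transpose_mat V) = 0"
    then obtain v where v: "v \<in> carrier_vec n" "v \<noteq> 0\<^sub>v n" "transpose_mat V *\<^sub>v v = 0\<^sub>v n"
      using det_0_iff_vec_prod_zero_field[of "transpose_mat V" n] carr by auto
    define g where "g = (\<Sum>j<n. Polynomial.monom (v $ j) j)"
    have cg: "Polynomial.coeff g j = (if j < n then v $ j else 0)" for j
      by (simp add: g_def coeff_sum)
    obtain j where "j < n" "v $ j \<noteq> 0" using v(1,2) by (metis carrier_vecD eq_vecI index_zero_vec)
    hence g0: "g \<noteq> 0" using cg[of j] by auto
    have "Polynomial.degree g \<le> n - 1" by (rule degree_le) (auto simp: cg)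
    hence dg: "Polynomial.degree g < n" using card_rts_pos by (simp add: n_def)
    have "poly g z = 0" if "z \<in> rts" for z
    proof -
      have "z \<in> set zs" using that zs(1) by simp
      then obtain l where l: "l < n" "z = zs ! l" using len by (auto simp: in_set_conv_nth)
      have "poly g z = (\<Sum>j<n. z ^ j * v $ j)"
        unfolding g_def poly_sum poly_monom by (intro sum.cong refl mult.commute)
      also have "\<dots> = (transpose_mat V *\<^sub>v v) $ l"
        using l v(1) by (simp add: V_def scalar_prod_def atLeast0LessThan)
      finally have "poly g z = (transpose_mat V *\<^sub>v v) $ l" .
      thus ?thesis using v(3) l by simp
    qed
    hence "rts \<subseteq> {z. poly g z = 0}" by auto
    hence "card rts \<le> card {z. poly g z = 0}" using g0 by (intro card_mono poly_roots_finite) auto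
    also have "\<dots> \<le> Polynomial.degree g" using card_poly_roots_bound[OF g0] .
    finally show False using dg by (simp add: n_def)
  qed
  hence "det V \<noteq> 0" using det_transpose[OF carr(3)] by simp
  hence "V \<in> Units (ring_mat TYPE('k alg_closure) n ())" by (rule det_non_zero_imp_unit[OF carr(3)])
  then obtain U where U: "U \<in> carrier_mat n n" "U * V = 1\<^sub>m n" "V * U = 1\<^sub>m n"
    unfolding Units_def ring_mat_def by auto
  have "A' = V * D * U"
  proof -
    have "V * D * U = A' * V * U" using AV by simp
    also have "\<dots> = A' * (V * U)" using carr U by (intro assoc_mult_mat) auto
    also have "\<dots> = A'" using U carr by simp
    finally show ?thesis by simp
  qed
  hence "similar_mat A' D"
    unfolding similar_mat_def similar_mat_wit_def Let_def using carr U by (intro exI[of _ V] exI[of _ U]) auto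
  hence "char_poly A' = char_poly D" by (rule char_poly_similar)
  also have "\<dots> = (\<Prod>a\<leftarrow>diag_mat D. [:- a, 1:])"
    by (rule char_poly_upper_triangular[OF carr(4)]) (auto simp: D_def upper_triangular_def)
  also have "diag_mat D = map (poly (acp q)) zs"
    using len by (auto simp: diag_mat_def D_def intro: nth_equalityI)
  also have "(\<Prod>a\<leftarrow>map (poly (acp q)) zs. [:- a, 1:]) = (\<Prod>\<zeta>\<in>rts. [:- poly (acp q) \<zeta>, 1:])"
    using zs by (simp add: prod.distinct_set_conv_list[symmetric] comp_def)
  finally have "char_poly A' = (\<Prod>\<zeta>\<in>rts. [:- poly (acp q) \<zeta>, 1:])" .
  moreover have "char_poly A' = acp (char_poly A)"
  proof -
    interpret comm_ring_hom "to_ac :: 'k \<Rightarrow> 'k alg_closure" by standard auto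
    show ?thesis unfolding A'_def by (rule char_poly_hom[OF carr(1)])
  qed
  ultimately show ?thesis by metis
qed

text \<open>The product has coefficients in \<open>k\<close>, and each of its roots is a conjugate
  of \<open>y\<close> and so has minimal polynomial \<open>g\<close>. Hence \<open>g\<close> can be
  split off until nothing is left.\<close>

lemma conjugates_power:
  assumes y: "y \<in> Kbig" and g: "minimal_poly g y"
  shows "\<exists>t. acp g ^ t = (\<Prod>\<zeta>\<in>rts. [:- emb \<zeta> y, 1:] ^ P) \<and> t * Polynomial.degree g = P * card rts"
proof -
  obtain q where q: "y ^ P = poly (acp q) \<eta>" using Kbig_poly[OF y] by blast
  obtain h where h: "acp h = (\<Prod>\<zeta>\<in>rts. [:- poly (acp q) \<zeta>, 1:])" using char_poly_rational by blast
  \<comment> \<open>The roots of \<open>h\<close> are the P-th powers of the conjugates of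
    \<open>y\<close>. Substituting X^P turns each linear factor of \<open>h\<close> into the P-th
    power of a linear factor.\<close>
  define R where "R = pcompose h (Polynomial.monom 1 P)"
  have frobP: "CHAR('k alg_closure poly) = CHAR('k)" by simp
  have lin: "[:- emb \<zeta> y, 1:] ^ P = pcompose [:- poly (acp q) \<zeta>, 1:] (Polynomial.monom 1 P)" if "\<zeta> \<in> rts" for \<zeta>
  proof -
    have "[:- emb \<zeta> y, 1:] = [:- emb \<zeta> y:] + Polynomial.monom 1 1" by (simp add: monom_Suc)
    also have "\<dots> ^ P = [:- emb \<zeta> y:] ^ P + Polynomial.monom 1 1 ^ P"
      by (rule freshmans_dream'[of P e]) (use prime_CHAR P in auto)
    also have "[:- emb \<zeta> y:] ^ P = [:(- emb \<zeta> y) ^ P:]" by (simp add: poly_const_pow)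
    also have "(- emb \<zeta> y) ^ P = - poly (acp q) \<zeta>"
      using frob_uminus[OF P] emb_power[OF that q] by simp
    finally show ?thesis by (simp add: pcompose_pCons monom_power)
  qed
  have acpR: "acp R = (\<Prod>\<zeta>\<in>rts. [:- emb \<zeta> y, 1:] ^ P)"
    unfolding R_def acp_pcompose h pcompose_prod using lin by (simp add: acp_monom)
  have rootsg: "poly (acp g) (emb \<zeta> y) = 0" if "\<zeta> \<in> rts" for \<zeta>
    using g emb_poly[OF that y, of g] emb_0[OF that] by (simp add: minimal_poly_def)
  have key: "\<exists>t. S = g ^ t" if "Polynomial.lead_coeff S = 1" "S dvd R" for S
    using that
  proof (induction "Polynomial.degree S" arbitrary: S rule: less_induct)
    case less
    show ?case
    proof (cases "Polynomial.degree S = 0")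
      case True
      then obtain c where "S = [:c:]" by (rule degree_eq_zeroE)
      hence "S = g ^ 0" using less.prems(1) by (simp add: one_pCons)
      thus ?thesis by blast
    next
      case False
      hence "Polynomial.degree (acp S) > 0" by simp
      then obtain z where z: "poly (acp S) z = 0" using alg_closed_imp_poly_has_root by blast
      hence "poly (acp R) z = 0" using poly_acp_dvd[OF less.prems(2)] by blast
      then obtain \<zeta> where "\<zeta> \<in> rts" "z = emb \<zeta> y"
        unfolding acpR poly_prod using finite_rts by auto
      hence "minimal_poly g z" using minimal_poly_conj[OF g] rootsg by blast
      hence "g dvd S" using z by (rule minimal_poly_dvd)
      then obtain S' where S': "S = g * S'" by (rule dvdE)
      have lc: "Polynomial.lead_coeff S' = 1" using less.prems(1) g unfolding S' by (simp add: lead_coeff_mult minimal_poly_def)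
      have "S' \<noteq> 0" using lc by auto
      hence "Polynomial.degree S' < Polynomial.degree S"
        using minimal_poly_degree_pos[OF g] minimal_poly_nonzero[OF g] unfolding S' by (simp add: degree_mult_eq)
      moreover have "S' dvd R" using less.prems(2) S' by (metis dvd_mult_right)
      ultimately obtain t where "S' = g ^ t" using less.hyps lc by blast
      hence "S = g ^ Suc t" using S' by simp
      thus ?thesis by blast
    qed
  qed
  have "Polynomial.lead_coeff (acp R) = 1"
    unfolding acpR by (simp add: lead_coeff_prod lead_coeff_power)
  hence "Polynomial.lead_coeff R = 1" by simp
  then obtain t where t: "R = g ^ t" using key[of R] by auto
  have "Polynomial.degree (acp R) = P * card rts"
    unfolding acpR by (subst degree_prod_eq_sum_degree) (auto simp: degree_power_eq)
  hence "t * Polynomial.degree g = P * card rts"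
    using t minimal_poly_nonzero[OF g] by (simp add: degree_power_eq mult.commute)
  thus ?thesis using acpR t acp_power by metis
qed

text \<open>Up to sign this is the constant coefficient of the polynomial in
  \<open>char_poly_rational\<close> belonging to \<open>y ^ P\<close>.\<close>

lemma norm_rational:
  assumes y: "y \<in> Kbig"
  shows "\<exists>c. (\<Prod>\<zeta>\<in>rts. emb \<zeta> y) ^ P = to_ac c"
proof -
  obtain q where q: "y ^ P = poly (acp q) \<eta>" using Kbig_poly[OF y] by blast
  obtain h where h: "acp h = (\<Prod>\<zeta>\<in>rts. [:- poly (acp q) \<zeta>, 1:])" using char_poly_rational by blast
  have "to_ac (Polynomial.coeff h 0) = poly (acp h) 0" by (simp add: poly_0_coeff_0)
  also have "\<dots> = (\<Prod>\<zeta>\<in>rts. - 1 * poly (acp q) \<zeta>)" unfolding h by (simp add: poly_prod)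
  also have "\<dots> = (- 1) ^ card rts * (\<Prod>\<zeta>\<in>rts. emb \<zeta> y ^ P)"
    unfolding prod.distrib using emb_power[OF _ q] by simp
  finally have "(\<Prod>\<zeta>\<in>rts. emb \<zeta> y) ^ P = (- 1) ^ card rts * to_ac (Polynomial.coeff h 0)"
    by (simp add: prod_power_distrib flip: power_mult_distrib)
  hence "(\<Prod>\<zeta>\<in>rts. emb \<zeta> y) ^ P = to_ac ((- 1) ^ card rts * Polynomial.coeff h 0)" by simp
  thus ?thesis by blast
qed

end

section \<open>Places of the rational function field\<close>

lemma irreducible_poly_degree_pos:
  fixes l :: "'f::field poly"
  assumes "Factorial_Ring.irreducible l" shows "Polynomial.degree l > 0" "l \<noteq> 0"
proof -
  show "l \<noteq> 0" using assms by (auto simp: Factorial_Ring.irreducible_def)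
  thus "Polynomial.degree l > 0"
    using assms is_unit_iff_degree[of l] by (auto simp: Factorial_Ring.irreducible_def)
qed

section \<open>Orders at an irreducible polynomial\<close>

context
  fixes l :: "'f::field poly"
  assumes l: "Factorial_Ring.irreducible l"
begin

lemma l_prime: "prime_elem l"
  using field_poly_irreducible_imp_prime[OF l] .

lemma exponent_at_eqI:
  assumes "\<not> l dvd b" shows "exponent_at l (l ^ n * b) = n"
proof -
  have "{m. l ^ m dvd l ^ n * b} = {..n}"
  proof (intro equalityI subsetI)
    fix m assume m: "m \<in> {m. l ^ m dvd l ^ n * b}"
    show "m \<in> {..n}"
    proof (rule ccontr)
      assume "m \<notin> {..n}"
      hence "l ^ Suc n dvd l ^ m" by (intro le_imp_power_dvd) auto
      also have "\<dots> dvd l ^ n * b" using m by simp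
      finally have "l ^ n * l dvd l ^ n * b" by (simp add: mult.commute)
      hence "l dvd b" using irreducible_poly_degree_pos(2)[OF l] by (subst (asm) dvd_mult_cancel_left) auto
      thus False using assms by simp
    qed
  qed (auto intro: dvd_mult2 le_imp_power_dvd)
  thus ?thesis unfolding exponent_at_def by (auto intro!: Max_eqI)
qed

lemma exponent_decompose:
  assumes "a \<noteq> 0" obtains b where "a = l ^ exponent_at l a * b" "\<not> l dvd b"
proof -
  have "\<exists>n b. a = l ^ n * b \<and> \<not> l dvd b"
    using assms
  proof (induction "Polynomial.degree a" arbitrary: a rule: less_induct)
    case less
    show ?case
    proof (cases "l dvd a")
      case False thus ?thesis by (intro exI[of _ 0] exI[of _ a]) simp
    next
      case True
      then obtain c where c: "a = l * c" by (rule dvdE)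
      have c0: "c \<noteq> 0" using less.prems c by auto
      hence "Polynomial.degree c < Polynomial.degree a"
        using irreducible_poly_degree_pos[OF l] by (simp add: c degree_mult_eq)
      then obtain n b where "c = l ^ n * b" "\<not> l dvd b" using less.hyps c0 by blast
      thus ?thesis using c by (intro exI[of _ "Suc n"] exI[of _ b]) simp
    qed
  qed
  thus ?thesis using exponent_at_eqI that by metis
qed

lemma exponent_mult:
  assumes "a \<noteq> 0" "b \<noteq> 0" shows "exponent_at l (a * b) = exponent_at l a + exponent_at l b"
proof -
  obtain a' where a': "a = l ^ exponent_at l a * a'" "\<not> l dvd a'" using exponent_decompose[OF assms(1)] .
  obtain b' where b': "b = l ^ exponent_at l b * b'" "\<not> l dvd b'" using exponent_decompose[OF assms(2)] .
  have "a * b = l ^ (exponent_at l a + exponent_at l b) * (a' * b')"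
    by (subst a'(1), subst b'(1)) (simp add: power_add mult_ac)
  moreover have "\<not> l dvd a' * b'" using a'(2) b'(2) prime_elem_dvd_mult_iff[OF l_prime] by blast
  ultimately show ?thesis using exponent_at_eqI by metis
qed

lemma exponent_ge_iff:
  assumes "a \<noteq> 0" shows "n \<le> exponent_at l a \<longleftrightarrow> l ^ n dvd a"
proof -
  obtain a' where a': "a = l ^ exponent_at l a * a'" "\<not> l dvd a'" using exponent_decompose[OF assms(1)] .
  show ?thesis
  proof
    assume "n \<le> exponent_at l a"
    hence "l ^ n dvd l ^ exponent_at l a" by (rule le_imp_power_dvd)
    thus "l ^ n dvd a" by (subst a'(1)) (rule dvd_mult2)
  next
    assume n: "l ^ n dvd a"
    have "finite {m. l ^ m dvd a}"
    proof (rule finite_subset)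
      show "{m. l ^ m dvd a} \<subseteq> {..Polynomial.degree a}"
      proof
        fix m assume "m \<in> {m. l ^ m dvd a}"
        hence "Polynomial.degree (l ^ m) \<le> Polynomial.degree a" using assms dvd_imp_degree_le by auto
        moreover have "Polynomial.degree (l ^ m) = m * Polynomial.degree l"
          using irreducible_poly_degree_pos[OF l] by (simp add: degree_power_eq)
        moreover have "m * 1 \<le> m * Polynomial.degree l" using irreducible_poly_degree_pos[OF l] by (intro mult_le_mono2) auto
        ultimately have "m \<le> Polynomial.degree a" by linarith
        thus "m \<in> {..Polynomial.degree a}" by simp
      qed
    qed auto
    thus "n \<le> exponent_at l a" unfolding exponent_at_def using n by (intro Max_ge) auto
  qed
qed

lemma exponent_add:
  assumes "a \<noteq> 0" "b \<noteq> 0" "a + b \<noteq> 0" shows "min (exponent_at l a) (exponent_at l b) \<le> exponent_at l (a + b)"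
proof -
  let ?m = "min (exponent_at l a) (exponent_at l b)"
  have "l ^ ?m dvd a" "l ^ ?m dvd b" using exponent_ge_iff assms by (metis min.cobounded1, metis min.cobounded2)
  thus ?thesis using exponent_ge_iff[OF assms(3)] by (simp add: dvd_add)
qed

lemma exponent_self: "exponent_at l l = 1" and exponent_one: "exponent_at l 1 = 0"
proof -
  have nu: "\<not> l dvd 1" using l by (auto simp: Factorial_Ring.irreducible_def)
  show "exponent_at l l = 1" using exponent_at_eqI[OF nu, of 1] by simp
  show "exponent_at l 1 = 0" using exponent_at_eqI[OF nu, of 0] by simp
qed

lemma ord_at_Fract:
  assumes "a \<noteq> 0" "b \<noteq> 0"
  shows "ord_at l (Fract a b) = ereal (real (exponent_at l a) - real (exponent_at l b))"
proof -
  have "Fract a b \<noteq> 0" using assms by (simp add: eq_fract Zero_fract_def)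
  moreover have "(THE r. \<exists>c d. c \<noteq> 0 \<and> d \<noteq> 0 \<and> Fract a b = Fract c d \<and> r = real (exponent_at l c) - real (exponent_at l d))
     = real (exponent_at l a) - real (exponent_at l b)"
  proof (rule the_equality)
    fix r assume "\<exists>c d. c \<noteq> 0 \<and> d \<noteq> 0 \<and> Fract a b = Fract c d \<and> r = real (exponent_at l c) - real (exponent_at l d)"
    then obtain c d where cd: "c \<noteq> 0" "d \<noteq> 0" "Fract a b = Fract c d" "r = real (exponent_at l c) - real (exponent_at l d)" by blast
    have "a * d = c * b" using cd(1-3) assms by (simp add: eq_fract)
    hence "exponent_at l a + exponent_at l d = exponent_at l c + exponent_at l b"
      using exponent_mult assms cd by metis
    thus "r = real (exponent_at l a) - real (exponent_at l b)" unfolding cd(4) by linarith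
  qed (use assms in blast)
  ultimately show ?thesis unfolding ord_at_def by simp
qed

end

lemma infinite_place_Fract:
  fixes a b :: "'f::field poly"
  assumes "a \<noteq> 0" "b \<noteq> 0"
  shows "infinite_place (Fract a b) = ereal (real (Polynomial.degree b) - real (Polynomial.degree a))"
proof -
  have "Fract a b \<noteq> 0" using assms by (simp add: eq_fract Zero_fract_def)
  moreover have "(THE r. \<exists>c d. c \<noteq> 0 \<and> d \<noteq> 0 \<and> Fract a b = Fract c d \<and> r = real (Polynomial.degree d) - real (Polynomial.degree c))
     = real (Polynomial.degree b) - real (Polynomial.degree a)"
  proof (rule the_equality)
    fix r assume "\<exists>c d. c \<noteq> 0 \<and> d \<noteq> 0 \<and> Fract a b = Fract c d \<and> r = real (Polynomial.degree d) - real (Polynomial.degree c)"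
    then obtain c d where cd: "c \<noteq> 0" "d \<noteq> 0" "Fract a b = Fract c d" "r = real (Polynomial.degree d) - real (Polynomial.degree c)" by blast
    have "a * d = c * b" using cd(1-3) assms by (simp add: eq_fract)
    hence "Polynomial.degree a + Polynomial.degree d = Polynomial.degree c + Polynomial.degree b"
      using degree_mult_eq assms cd by metis
    thus "r = real (Polynomial.degree b) - real (Polynomial.degree a)" unfolding cd(4) by linarith
  qed (use assms in blast)
  ultimately show ?thesis unfolding infinite_place_def by simp
qed

lemma Fract_nonzero_cases:
  fixes y :: "'f::field poly fract"
  assumes "y \<noteq> 0" obtains a b where "a \<noteq> 0" "b \<noteq> 0" "y = Fract a b"
  using assms by (cases y rule: Fract_cases_nonzero) auto

text \<open>With base e, the logarithm of the norm is minus the valuation, so the terms of a height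
  become logarithms of \<open>max 1\<close> of norms.\<close>

definition rnorm :: "('a \<Rightarrow> ereal) \<Rightarrow> 'a \<Rightarrow> real" where
  "rnorm w x = (if w x = \<infinity> then 0 else exp (- real_of_ereal (w x)))"

lemma rnorm_ereal: "w x = ereal r \<Longrightarrow> rnorm w x = exp (- r)"
  by (simp add: rnorm_def)

lemma base_place_zero: "v \<in> base_places \<Longrightarrow> v 0 = \<infinity>"
  by (auto simp: base_places_def infinite_place_def finite_place_def ord_at_def dest: irreducible_poly_degree_pos)

lemma finite_place_Fract:
  assumes "Factorial_Ring.irreducible l" "a \<noteq> 0" "b \<noteq> 0"
  shows "finite_place l (Fract a b) = ereal (real (Polynomial.degree l) * (real (exponent_at l a) - real (exponent_at l b)))"
  unfolding finite_place_def ord_at_Fract[OF assms] by simp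

text \<open>Covers finite and infinite places at once: \<open>\<phi>\<close> will be the order at an
  irreducible polynomial or minus the degree, and \<open>\<delta>\<close> the degree of the
  place.\<close>

lemma discrete_absvalI:
  fixes v :: "'f::field poly fract \<Rightarrow> ereal" and \<phi> :: "'f poly \<Rightarrow> int"
  assumes v0: "v 0 = \<infinity>" and \<delta>: "\<delta> > 0"
    and v: "\<And>a b. a \<noteq> 0 \<Longrightarrow> b \<noteq> 0 \<Longrightarrow> v (Fract a b) = ereal (\<delta> * of_int (\<phi> a - \<phi> b))"
    and mult: "\<And>a b. a \<noteq> 0 \<Longrightarrow> b \<noteq> 0 \<Longrightarrow> \<phi> (a * b) = \<phi> a + \<phi> b"
    and add: "\<And>a b. a \<noteq> 0 \<Longrightarrow> b \<noteq> 0 \<Longrightarrow> a + b \<noteq> 0 \<Longrightarrow> min (\<phi> a) (\<phi> b) \<le> \<phi> (a + b)"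
    and p: "p = Fract c d" "c \<noteq> 0" "d \<noteq> 0" "\<phi> c - \<phi> d = 1"
  shows "discrete_absval (rnorm v) p"
proof
  have r: "rnorm v (Fract a b) = exp (- (\<delta> * of_int (\<phi> a - \<phi> b)))" if "a \<noteq> 0" "b \<noteq> 0" for a b
    using v[OF that] by (rule rnorm_ereal)
  have r0: "rnorm v 0 = 0" by (simp add: rnorm_def v0)
  fix x y :: "'f poly fract"
  show "rnorm v x \<ge> 0" by (simp add: rnorm_def)
  show "rnorm v x = 0 \<longleftrightarrow> x = 0"
  proof (cases "x = 0")
    case False
    then obtain a b where "a \<noteq> 0" "b \<noteq> 0" "x = Fract a b" by (rule Fract_nonzero_cases)
    thus ?thesis using r False by simp
  qed (simp add: r0)
  show "rnorm v (x * y) = rnorm v x * rnorm v y"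
  proof (cases "x = 0 \<or> y = 0")
    case False
    obtain a b where ab: "a \<noteq> 0" "b \<noteq> 0" "x = Fract a b" using False by (metis Fract_nonzero_cases)
    obtain c d where cd: "c \<noteq> 0" "d \<noteq> 0" "y = Fract c d" using False by (metis Fract_nonzero_cases)
    show ?thesis using ab cd by (simp add: r mult algebra_simps flip: exp_add)
  qed (auto simp: r0)
  show "rnorm v (x + y) \<le> max (rnorm v x) (rnorm v y)"
  proof (cases "x = 0 \<or> y = 0 \<or> x + y = 0")
    case True
    have "rnorm v x \<ge> 0" "rnorm v y \<ge> 0" by (simp_all add: rnorm_def)
    thus ?thesis using True r0 by (elim disjE) (auto simp: max_def)
  next
    case False
    obtain a b where ab: "a \<noteq> 0" "b \<noteq> 0" "x = Fract a b" using False by (metis Fract_nonzero_cases)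
    obtain c d where cd: "c \<noteq> 0" "d \<noteq> 0" "y = Fract c d" using False by (metis Fract_nonzero_cases)
    have s: "x + y = Fract (a * d + c * b) (b * d)" using ab cd by (simp add: add_fract)
    have n0: "a * d + c * b \<noteq> 0" using False unfolding s by (auto simp: Zero_fract_def[symmetric] fract_collapse)
    have "min (\<phi> (a * d)) (\<phi> (c * b)) \<le> \<phi> (a * d + c * b)" using ab cd n0 by (intro add) auto
    hence "min (\<phi> a - \<phi> b) (\<phi> c - \<phi> d) \<le> \<phi> (a * d + c * b) - \<phi> (b * d)"
      using ab cd by (simp add: mult min_def split: if_splits)
    hence "\<phi> a - \<phi> b \<le> \<phi> (a * d + c * b) - \<phi> (b * d) \<or> \<phi> c - \<phi> d \<le> \<phi> (a * d + c * b) - \<phi> (b * d)" by linarith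
    hence "\<delta> * of_int (\<phi> a - \<phi> b) \<le> \<delta> * of_int (\<phi> (a * d + c * b) - \<phi> (b * d)) \<or>
           \<delta> * of_int (\<phi> c - \<phi> d) \<le> \<delta> * of_int (\<phi> (a * d + c * b) - \<phi> (b * d))"
      using \<delta> by (metis mult_le_cancel_left_pos of_int_le_iff)
    thus ?thesis unfolding s using ab cd n0 by (auto simp: r le_max_iff_disj)
  qed
  show "p \<noteq> 0" using p by (simp add: eq_fract Zero_fract_def)
  have rp: "rnorm v p = exp (- \<delta>)" using r[OF p(2,3)] p by simp
  show "rnorm v p < 1" using \<delta> rp by simp
  show "\<exists>j::int. rnorm v x = rnorm v p powi j" if nz: "x \<noteq> 0"
  proof -
    obtain a b where "a \<noteq> 0" "b \<noteq> 0" "x = Fract a b" using nz by (rule Fract_nonzero_cases)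
    hence "rnorm v x = rnorm v p powi (\<phi> a - \<phi> b)"
      using r rp by (simp add: exp_power_int algebra_simps)
    thus ?thesis by blast
  qed
qed

lemma base_place_discrete:
  fixes v :: "'f::field poly fract \<Rightarrow> ereal"
  assumes "v \<in> base_places" shows "\<exists>p. discrete_absval (rnorm v) p"
proof (cases "v = infinite_place")
  case True
  have "discrete_absval (rnorm v) (Fract 1 polyT)"
  proof (rule discrete_absvalI[where \<delta> = 1 and \<phi> = "\<lambda>a. - int (Polynomial.degree a)" and c = 1 and d = polyT])
    fix a b :: "'f poly" assume ab: "a \<noteq> 0" "b \<noteq> 0"
    show "v (Fract a b) = ereal (1 * of_int (- int (Polynomial.degree a) - - int (Polynomial.degree b)))"
      using infinite_place_Fract[OF ab] True by simp
    show "- int (Polynomial.degree (a * b)) = - int (Polynomial.degree a) + - int (Polynomial.degree b)"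
      using ab by (simp add: degree_mult_eq)
    show "min (- int (Polynomial.degree a)) (- int (Polynomial.degree b)) \<le> - int (Polynomial.degree (a + b))"
      using degree_add_le_max[of a b] by linarith
  qed (use assms base_place_zero in auto)
  thus ?thesis by blast
next
  case False
  then obtain l where l: "v = finite_place l" "Factorial_Ring.irreducible l" using assms by (auto simp: base_places_def)
  have "discrete_absval (rnorm v) (Fract l 1)"
  proof (rule discrete_absvalI[where \<delta> = "real (Polynomial.degree l)" and \<phi> = "\<lambda>a. int (exponent_at l a)" and c = l and d = 1])
    fix a b :: "'f poly" assume ab: "a \<noteq> 0" "b \<noteq> 0"
    show "v (Fract a b) = ereal (real (Polynomial.degree l) * of_int (int (exponent_at l a) - int (exponent_at l b)))"
      using finite_place_Fract[OF l(2) ab] l(1) by simp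
    show "int (exponent_at l (a * b)) = int (exponent_at l a) + int (exponent_at l b)"
      using exponent_mult[OF l(2) ab] by simp
    assume "a + b \<noteq> 0"
    thus "min (int (exponent_at l a)) (int (exponent_at l b)) \<le> int (exponent_at l (a + b))"
      using exponent_add[OF l(2) ab] by linarith
  qed (use assms base_place_zero irreducible_poly_degree_pos[OF l(2)] exponent_self[OF l(2)] exponent_one[OF l(2)] in auto)
  thus ?thesis by blast
qed

lemma base_place_finite:
  assumes "v \<in> base_places" "c \<noteq> 0" shows "\<exists>r. v c = ereal r"
proof -
  obtain a b where ab: "a \<noteq> 0" "b \<noteq> 0" "c = Fract a b" using assms(2) by (rule Fract_nonzero_cases)
  show ?thesis
    using assms(1) finite_place_Fract[OF _ ab(1,2)] infinite_place_Fract[OF ab(1,2)] unfolding ab(3) base_places_def by fastforce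
qed

lemma rnorm_ln:
  assumes "v \<in> base_places" "c \<noteq> 0" shows "ln (rnorm v c) = - real_of_ereal (v c)" "rnorm v c > 0"
proof -
  obtain r where "v c = ereal r" using base_place_finite[OF assms] by blast
  thus "ln (rnorm v c) = - real_of_ereal (v c)" "rnorm v c > 0" by (simp_all add: rnorm_ereal)
qed

section \<open>Factorisation and the product formula\<close>

definition monic_irr :: "'f::field poly set" where
  "monic_irr = {l. Factorial_Ring.irreducible l \<and> Polynomial.lead_coeff l = 1}"

lemma base_places_alt: "base_places = insert infinite_place (finite_place ` monic_irr)"
  by (auto simp: base_places_def monic_irr_def)

lemma exists_monic_irreducible_divisor:
  fixes a :: "'f::field poly"
  assumes "Polynomial.degree a > 0"
  shows "\<exists>l\<in>monic_irr. l dvd a"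
proof -
  define Q where "Q n \<longleftrightarrow> (\<exists>b. b dvd a \<and> Polynomial.degree b = n \<and> n > 0)" for n
  have "Q (Polynomial.degree a)" using assms unfolding Q_def by (intro exI[of _ a]) auto
  hence "Q (LEAST n. Q n)" by (rule LeastI)
  then obtain b where b: "b dvd a" "Polynomial.degree b = (LEAST n. Q n)" "Polynomial.degree b > 0" unfolding Q_def by metis
  have b0: "b \<noteq> 0" using b(3) by auto
  define l where "l = Polynomial.smult (inverse (Polynomial.lead_coeff b)) b"
  have lc: "Polynomial.lead_coeff l = 1" and dl: "Polynomial.degree l = Polynomial.degree b" "l \<noteq> 0"
    using b0 by (simp_all add: l_def)
  have la: "l dvd a" using b(1) b0 by (simp add: l_def smult_dvd_iff)
  have "Factorial_Ring.irreducible l"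
  proof (rule Factorial_Ring.irreducibleI)
    show "\<not> l dvd 1" using dl b(3) by (simp add: is_unit_iff_degree)
    fix c d assume cd: "l = c * d"
    have n0: "c \<noteq> 0" "d \<noteq> 0" using cd dl by auto
    have deg: "Polynomial.degree l = Polynomial.degree c + Polynomial.degree d" using cd n0 by (simp add: degree_mult_eq)
    have "c dvd a" using la cd by (metis dvd_mult_left)
    have "Polynomial.degree b \<le> Polynomial.degree c" if "Polynomial.degree c > 0"
      unfolding b(2) by (rule Least_le) (use that \<open>c dvd a\<close> in \<open>auto simp: Q_def\<close>)
    hence "Polynomial.degree c = 0 \<or> Polynomial.degree d = 0" using deg dl by linarith
    thus "c dvd 1 \<or> d dvd 1" using n0 by (auto simp: is_unit_iff_degree)
  qed (use dl in auto)
  thus ?thesis using lc la by (auto simp: monic_irr_def)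
qed

lemma monic_irr_dvd: 
  assumes "l \<in> monic_irr" "l' \<in> monic_irr" "l dvd l'" shows "l = l'"
proof -
  obtain c where c: "l' = l * c" using assms(3) by (rule dvdE)
  have irr: "Factorial_Ring.irreducible l'" "Factorial_Ring.irreducible l" using assms by (auto simp: monic_irr_def)
  have "\<not> l dvd 1" using irr(2) by (auto simp: Factorial_Ring.irreducible_def)
  hence "c dvd 1" using Factorial_Ring.irreducibleD[OF irr(1) c] by blast
  then obtain k where k: "c = [:k:]" using is_unit_poly_iff by blast
  have "Polynomial.lead_coeff l' = Polynomial.lead_coeff l * Polynomial.lead_coeff c" using c by (simp add: lead_coeff_mult)
  hence "k = 1" using assms k by (simp add: monic_irr_def)
  thus ?thesis using c k by simp
qed

lemma exponent_eq_0: 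
  assumes "Factorial_Ring.irreducible l" "a \<noteq> 0" shows "exponent_at l a = 0 \<longleftrightarrow> \<not> l dvd a"
  using exponent_ge_iff[OF assms, of 1] by auto

text \<open>Unique factorisation read off in degrees. Allowing any finite \<open>F\<close> that
  contains the divisors makes one index set usable for both numerator and denominator of a
  fraction.\<close>

lemma degree_eq_sum_exponents:
  fixes a :: "'f::field poly"
  assumes "a \<noteq> 0"
  shows "finite {l\<in>monic_irr. l dvd a} \<and>
    (\<forall>F. finite F \<longrightarrow> F \<subseteq> monic_irr \<longrightarrow> {l\<in>monic_irr. l dvd a} \<subseteq> F \<longrightarrow>
       (\<Sum>l\<in>F. Polynomial.degree l * exponent_at l a) = Polynomial.degree a)"
  using assms
proof (induction "Polynomial.degree a" arbitrary: a rule: less_induct)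
  case less
  show ?case
  proof (cases "Polynomial.degree a = 0")
    case True
    have nd: "\<not> l dvd a" if "l \<in> monic_irr" for l
      using that dvd_imp_degree_le[of l a] less.prems irreducible_poly_degree_pos[of l] True by (auto simp: monic_irr_def)
    hence "exponent_at l a = 0" if "l \<in> monic_irr" for l
      using exponent_eq_0[OF _ less.prems, of l] that by (auto simp: monic_irr_def)
    moreover have empty: "{l\<in>monic_irr. l dvd a} = {}" using nd by auto
    ultimately show ?thesis unfolding empty using True by (auto intro!: sum.neutral)
  next
    case False
    then obtain m where m: "m \<in> monic_irr" "m dvd a" using exists_monic_irreducible_divisor by blast
    obtain b where b: "a = m * b" using m(2) by (rule dvdE)
    have irr: "Factorial_Ring.irreducible l" if "l \<in> monic_irr" for l using that by (simp add: monic_irr_def)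
    have b0: "b \<noteq> 0" using less.prems b by auto
    have m0: "m \<noteq> 0" using irreducible_poly_degree_pos[OF irr[OF m(1)]] by simp
    have "Polynomial.degree b < Polynomial.degree a"
      using irreducible_poly_degree_pos[OF irr[OF m(1)]] b0 by (simp add: b degree_mult_eq)
    note IH = less.hyps[OF this b0]
    have sub: "{l\<in>monic_irr. l dvd a} = insert m {l\<in>monic_irr. l dvd b}"
    proof (intro equalityI subsetI)
      fix l assume l: "l \<in> {l\<in>monic_irr. l dvd a}"
      hence "l dvd m \<or> l dvd b" using prime_elem_dvd_mult_iff[OF l_prime[OF irr]] b by auto
      thus "l \<in> insert m {l\<in>monic_irr. l dvd b}" using l m monic_irr_dvd by auto
    qed (use m b in auto)
    have "(\<Sum>l\<in>F. Polynomial.degree l * exponent_at l a) = Polynomial.degree a"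
      if F: "finite F" "F \<subseteq> monic_irr" "{l\<in>monic_irr. l dvd a} \<subseteq> F" for F
    proof -
      have e: "exponent_at l a = (if l = m then 1 else 0) + exponent_at l b" if "l \<in> F" for l
      proof -
        have li: "l \<in> monic_irr" using that F by blast
        have "exponent_at l m = (if l = m then 1 else 0)"
          using exponent_self[OF irr[OF li]] exponent_eq_0[OF irr[OF li] m0] monic_irr_dvd[OF li m(1)] by auto
        thus ?thesis using exponent_mult[OF irr[OF li] m0 b0] b by simp
      qed
      have mF: "m \<in> F" using F sub by auto
      have "(\<Sum>l\<in>F. Polynomial.degree l * exponent_at l a) =
            (\<Sum>l\<in>F. (if l = m then Polynomial.degree l else 0) + Polynomial.degree l * exponent_at l b)"
        by (intro sum.cong) (auto simp: e)
      also have "\<dots> = Polynomial.degree m + (\<Sum>l\<in>F. Polynomial.degree l * exponent_at l b)"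
        using F mF by (simp add: sum.distrib)
      also have "(\<Sum>l\<in>F. Polynomial.degree l * exponent_at l b) = Polynomial.degree b"
        using IH F sub by blast
      finally show ?thesis using b m0 b0 by (simp add: degree_mult_eq)
    qed
    thus ?thesis using IH sub by auto
  qed
qed

text \<open>The polynomial \<open>l\<close> has a nonzero value at its own place, while at the place
  of \<open>l'\<close> this requires \<open>l'\<close> to divide \<open>l\<close>.\<close>

lemma inj_on_finite_place: "inj_on finite_place monic_irr"
proof
  fix l l' :: "'f::field poly" assume ll: "l \<in> monic_irr" "l' \<in> monic_irr" "finite_place l = finite_place l'"
  have irr: "Factorial_Ring.irreducible l" "Factorial_Ring.irreducible l'" using ll by (auto simp: monic_irr_def)
  note d = irreducible_poly_degree_pos[OF irr(1)] irreducible_poly_degree_pos[OF irr(2)]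
  have "finite_place l (Fract l 1) = finite_place l' (Fract l 1)" using ll by simp
  hence "real (Polynomial.degree l) = real (Polynomial.degree l') * real (exponent_at l' l)"
    using finite_place_Fract[OF irr(1), of l 1] finite_place_Fract[OF irr(2), of l 1] d
      exponent_self[OF irr(1)] exponent_one[OF irr(1)] exponent_one[OF irr(2)] by simp
  hence "exponent_at l' l \<noteq> 0" using d by (auto intro: ccontr)
  hence "l' dvd l" using exponent_eq_0[OF irr(2) d(2)] by simp
  thus "l = l'" using monic_irr_dvd ll by metis
qed

lemma infinite_place_notin: "infinite_place \<notin> finite_place ` (monic_irr :: 'f::field poly set)"
proof
  assume "infinite_place \<in> finite_place ` (monic_irr :: 'f::field poly set)"
  then obtain l :: "'f poly" where l: "l \<in> monic_irr" "infinite_place = finite_place l" by auto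
  have irr: "Factorial_Ring.irreducible l" using l by (auto simp: monic_irr_def)
  note d = irreducible_poly_degree_pos[OF irr]
  have "infinite_place (Fract l 1) = finite_place l (Fract l 1)" using l by simp
  thus False
    using finite_place_Fract[OF irr, of l 1] infinite_place_Fract[of l 1] d exponent_self[OF irr] exponent_one[OF irr] by simp
qed

text \<open>Each finite place is weighted by the degree of its polynomial. So the finite places
  together give the degree of the numerator minus that of the denominator, which the infinite place
  cancels.\<close>

theorem product_formula:
  fixes c :: "'f::field poly fract"
  assumes "c \<noteq> 0"
  shows "finite {v\<in>base_places. v c \<noteq> 0}"
    and "finite S \<Longrightarrow> S \<subseteq> base_places \<Longrightarrow> {v\<in>base_places. v c \<noteq> 0} \<subseteq> S \<Longrightarrow> (\<Sum>v\<in>S. real_of_ereal (v c)) = 0"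
proof -
  obtain a b where ab: "a \<noteq> 0" "b \<noteq> 0" "c = Fract a b" using assms by (rule Fract_nonzero_cases)
  define F where "F = {l\<in>monic_irr. l dvd a} \<union> {l\<in>monic_irr. l dvd b}"
  have F: "finite F" "F \<subseteq> monic_irr" using degree_eq_sum_exponents[OF ab(1)] degree_eq_sum_exponents[OF ab(2)] by (auto simp: F_def)
  have irr: "Factorial_Ring.irreducible l" if "l \<in> monic_irr" for l :: "'f poly" using that by (simp add: monic_irr_def)
  have val: "finite_place l c = ereal (real (Polynomial.degree l) * (real (exponent_at l a) - real (exponent_at l b)))"
    if "l \<in> monic_irr" for l using finite_place_Fract[OF irr[OF that] ab(1,2)] ab(3) by simp
  have zero: "finite_place l c = 0" if "l \<in> monic_irr - F" for l
    using that val[of l] exponent_eq_0[OF irr ab(1), of l] exponent_eq_0[OF irr ab(2), of l] by (auto simp: F_def zero_ereal_def)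
  define S0 where "S0 = insert infinite_place (finite_place ` F)"
  have sub: "{v\<in>base_places. v c \<noteq> 0} \<subseteq> S0" using zero unfolding base_places_alt S0_def by auto
  thus "finite {v\<in>base_places. v c \<noteq> 0}" using F by (auto simp: S0_def intro: finite_subset)
  have S0: "finite S0" "S0 \<subseteq> base_places" using F by (auto simp: S0_def base_places_alt)
  have "(\<Sum>v\<in>S0. real_of_ereal (v c)) = real_of_ereal (infinite_place c) + (\<Sum>v\<in>finite_place ` F. real_of_ereal (v c))"
    unfolding S0_def using F infinite_place_notin by (subst sum.insert) auto
  also have "(\<Sum>v\<in>finite_place ` F. real_of_ereal (v c)) = (\<Sum>l\<in>F. real_of_ereal (finite_place l c))"
    using F inj_on_subset[OF inj_on_finite_place] by (subst sum.reindex) auto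
  also have "\<dots> = (\<Sum>l\<in>F. real (Polynomial.degree l * exponent_at l a) - real (Polynomial.degree l * exponent_at l b))"
    using F val by (intro sum.cong) (auto simp: right_diff_distrib)
  also have "\<dots> = real (\<Sum>l\<in>F. Polynomial.degree l * exponent_at l a) - real (\<Sum>l\<in>F. Polynomial.degree l * exponent_at l b)"
    by (simp add: sum_subtractf)
  also have "(\<Sum>l\<in>F. Polynomial.degree l * exponent_at l a) = Polynomial.degree a"
    using degree_eq_sum_exponents[OF ab(1)] F by (auto simp: F_def)
  also have "(\<Sum>l\<in>F. Polynomial.degree l * exponent_at l b) = Polynomial.degree b"
    using degree_eq_sum_exponents[OF ab(2)] F by (auto simp: F_def)
  also have "real_of_ereal (infinite_place c) = real (Polynomial.degree b) - real (Polynomial.degree a)"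
    using infinite_place_Fract[OF ab(1,2)] ab(3) by simp
  finally have S0sum: "(\<Sum>v\<in>S0. real_of_ereal (v c)) = 0" by simp
  have restrict: "(\<Sum>v\<in>S. real_of_ereal (v c)) = (\<Sum>v\<in>{v\<in>base_places. v c \<noteq> 0}. real_of_ereal (v c))"
    if "finite S" "S \<subseteq> base_places" "{v\<in>base_places. v c \<noteq> 0} \<subseteq> S" for S
    using that by (intro sum.mono_neutral_right) auto
  show "(\<Sum>v\<in>S. real_of_ereal (v c)) = 0" if "finite S" "S \<subseteq> base_places" "{v\<in>base_places. v c \<noteq> 0} \<subseteq> S"
    using restrict[OF that] restrict[OF S0 sub] S0sum by simp
qed

text \<open>Take a denominator of least degree. An irreducible factor of it would by integrality
  also divide the numerator and could be cancelled, so the denominator is constant.\<close>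

lemma integral_imp_poly:
  fixes c :: "'f::field poly fract"
  assumes "\<And>l. l \<in> monic_irr \<Longrightarrow> finite_place l c \<ge> 0"
  shows "\<exists>a. c = Fract a 1"
proof (cases "c = 0")
  case True thus ?thesis by (auto simp: Zero_fract_def)
next
  case False
  define Q where "Q n \<longleftrightarrow> (\<exists>a b. a \<noteq> 0 \<and> b \<noteq> 0 \<and> c = Fract a b \<and> Polynomial.degree b = n)" for n
  have "\<exists>n. Q n" using Fract_nonzero_cases[OF False] unfolding Q_def by metis
  hence "Q (LEAST n. Q n)" by (rule LeastI_ex)
  then obtain a b where ab: "a \<noteq> 0" "b \<noteq> 0" "c = Fract a b" "Polynomial.degree b = (LEAST n. Q n)" unfolding Q_def by blast
  have "Polynomial.degree b = 0"
  proof (rule ccontr)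
    assume "Polynomial.degree b \<noteq> 0"
    then obtain l where l: "l \<in> monic_irr" "l dvd b" using exists_monic_irreducible_divisor by blast
    have irr: "Factorial_Ring.irreducible l" using l by (simp add: monic_irr_def)
    note d = irreducible_poly_degree_pos[OF irr]
    have "real (Polynomial.degree l) * (real (exponent_at l a) - real (exponent_at l b)) \<ge> 0"
      using assms[OF l(1)] finite_place_Fract[OF irr ab(1,2)] ab(3) by simp
    hence "exponent_at l b \<le> exponent_at l a" using d by (simp add: zero_le_mult_iff)
    moreover have "exponent_at l b \<noteq> 0" using exponent_eq_0[OF irr ab(2)] l(2) by blast
    ultimately have "l dvd a" using exponent_eq_0[OF irr ab(1)] by (metis le_zero_eq)
    then obtain a' where a': "a = l * a'" by (rule dvdE)
    obtain b' where b': "b = l * b'" using l(2) by (rule dvdE)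
    have n0: "a' \<noteq> 0" "b' \<noteq> 0" using a' b' ab by auto
    have "c = Fract a' b'" unfolding ab(3) using n0 ab(2) by (simp add: eq_fract a' b')
    hence "Q (Polynomial.degree b')" using n0 by (auto simp: Q_def)
    hence "Polynomial.degree b \<le> Polynomial.degree b'" unfolding ab(4) by (rule Least_le)
    thus False using b' n0 d by (simp add: degree_mult_eq)
  qed
  then obtain k where k: "b = [:k:]" by (rule degree_eq_zeroE)
  hence "c = Fract (Polynomial.smult (inverse k) a) 1" using ab by (simp add: eq_fract)
  thus ?thesis by blast
qed

section \<open>Frobenius on the rational function field\<close>

lemma infinite_fract: "infinite (UNIV :: 'f::field poly fract set)"
proof
  assume fin: "finite (UNIV :: 'f poly fract set)"
  have "inj (\<lambda>n. Fract (Polynomial.monom 1 n :: 'f poly) 1)"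
    by (auto simp: inj_def eq_fract monom_eq_iff')
  hence "infinite (range (\<lambda>n. Fract (Polynomial.monom 1 n :: 'f poly) 1))" by (rule range_inj_infinite)
  thus False using finite_subset[OF subset_UNIV fin] by simp
qed

lemma CHAR_poly_fract [simp]: "CHAR('f::field poly fract) = CHAR('f)"
proof (rule CHAR_eqI)
  have eq: "(of_nat n :: 'f poly fract) = Fract (of_nat n) 1" for n by (simp add: Fract_of_nat_eq)
  show "of_nat CHAR('f) = (0 :: 'f poly fract)" unfolding eq by (simp add: of_nat_poly Zero_fract_def)
  show "CHAR('f) dvd n" if "of_nat n = (0 :: 'f poly fract)" for n
    using that unfolding eq by (simp add: of_nat_poly Zero_fract_def eq_fract of_nat_eq_0_iff_char_dvd)
qed

lemma Fract_power1: "Fract (a ^ n) 1 = Fract a 1 ^ n" for a :: "'f::field poly"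
proof (induction n)
  case (Suc n)
  have "Fract (a ^ Suc n) 1 = Fract a 1 * Fract (a ^ n) 1" by simp
  thus ?case using Suc by simp
qed (simp add: One_fract_def)

lemma Fract_sum1: "Fract (sum u I) 1 = (\<Sum>i\<in>I. Fract (u i) 1)" for u :: "'i \<Rightarrow> 'f::field poly"
proof (induction I rule: infinite_finite_induct)
  case (insert i I)
  have "Fract (u i + sum u I) 1 = Fract (u i) 1 + Fract (sum u I) 1" by (simp add: add_fract)
  thus ?case using insert by simp
qed (auto simp: Zero_fract_def)

text \<open>For polynomials: the coefficients are P-th powers because a finite field is perfect, and
  the monomials are sorted by their exponent modulo \<open>P\<close>. A fraction is first expanded
  so that its denominator is a P-th power.\<close>

lemma fract_frobenius_basis:
  fixes c :: "'f::{field,finite} poly fract"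
  assumes P: "P = CHAR('f) ^ e" and prime: "Factorial_Ring.prime CHAR('f)"
  shows "\<exists>s. c = (\<Sum>j<P. s j ^ P * Fract polyT 1 ^ j)"
proof -
  have P0: "P > 0" using P prime prime_gt_0_nat by simp
  have frobsum: "(sum g I) ^ P = (\<Sum>i\<in>I. g i ^ P)" for g :: "nat \<Rightarrow> 'f poly fract" and I
    by (rule freshmans_dream_sum'[of P e]) (use prime P in auto)
  have "inj (\<lambda>x :: 'f. x ^ P)"
  proof
    fix x y :: 'f assume "x ^ P = y ^ P"
    moreover have "(x - y + y) ^ P = (x - y) ^ P + y ^ P"
      by (rule freshmans_dream'[of P e]) (use prime P in auto)
    ultimately have "(x - y) ^ P = 0" by simp
    thus "x = y" by simp
  qed
  hence surj: "surj (\<lambda>x :: 'f. x ^ P)" by (rule finite_UNIV_inj_surj[rotated]) simp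
  define T where "T = Fract (polyT :: 'f poly) 1"
  have poly: "\<exists>s. Fract g 1 = (\<Sum>j<P. s j ^ P * T ^ j)" for g :: "'f poly"
  proof -
    have "\<forall>i. \<exists>h. Polynomial.coeff g i = h ^ P" using surj by (metis surjD)
    then obtain h where h: "\<And>i. Polynomial.coeff g i = h i ^ P" by metis
    define N where "N = Polynomial.degree g"
    have Fmult: "Fract (a * b) 1 = Fract a 1 * Fract b 1" for a b :: "'f poly" by simp
    have "g = (\<Sum>i\<le>N. [:h i:] ^ P * polyT ^ i)"
      by (subst poly_as_sum_of_monoms[of g, symmetric]) (simp add: N_def h poly_const_pow monom_altdef)
    also have "Fract \<dots> 1 = (\<Sum>i\<le>N. Fract [:h i:] 1 ^ P * T ^ i)"
      unfolding Fract_sum1 Fmult Fract_power1 T_def ..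
    also have "\<dots> = (\<Sum>i\<le>N. \<Sum>j<P. if j = i mod P then Fract [:h i:] 1 ^ P * T ^ i else 0)"
      using P0 by (intro sum.cong) auto
    also have "\<dots> = (\<Sum>i\<le>N. \<Sum>j<P. (if j = i mod P then Fract [:h i:] 1 * T ^ (i div P) else 0) ^ P * T ^ j)"
    proof (intro sum.cong refl)
      fix i j assume "j \<in> {..<P}"
      have "T ^ i = (T ^ (i div P)) ^ P * T ^ (i mod P)"
        by (simp flip: power_mult power_add)
      thus "(if j = i mod P then Fract [:h i:] 1 ^ P * T ^ i else 0) =
          (if j = i mod P then Fract [:h i:] 1 * T ^ (i div P) else 0) ^ P * T ^ j"
        using P0 by (auto simp: power_mult_distrib zero_power)
    qed
    also have "\<dots> = (\<Sum>j<P. \<Sum>i\<le>N. (if j = i mod P then Fract [:h i:] 1 * T ^ (i div P) else 0) ^ P * T ^ j)"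
      by (rule sum.swap)
    also have "\<dots> = (\<Sum>j<P. (\<Sum>i\<le>N. if j = i mod P then Fract [:h i:] 1 * T ^ (i div P) else 0) ^ P * T ^ j)"
      unfolding frobsum sum_distrib_right ..
    finally show ?thesis by (intro exI)
  qed
  show ?thesis
  proof (cases c)
    case (Fract a b)
    have b: "b \<noteq> 0" using Fract by auto
    obtain s where s: "Fract (a * b ^ (P - 1)) 1 = (\<Sum>j<P. s j ^ P * T ^ j)" using poly by blast
    have Fb: "Fract b 1 \<noteq> 0" using b by (simp add: Zero_fract_def eq_fract)
    have bP: "b ^ P = b ^ (P - 1) * b" using P0 by (metis power_minus_mult)
    have "c * Fract b 1 ^ P = Fract (a * b ^ (P - 1)) 1"
      unfolding Fract(1) Fract_power1[symmetric] bP using b by (simp add: eq_fract)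
    hence "c = (\<Sum>j<P. s j ^ P * T ^ j) / Fract b 1 ^ P" using s Fb by (simp add: field_simps)
    also have "\<dots> = (\<Sum>j<P. (s j / Fract b 1) ^ P * T ^ j)" by (simp add: sum_divide_distrib power_divide)
    finally show ?thesis unfolding T_def by (intro exI[of _ "\<lambda>j. s j / Fract b 1"])
  qed
qed

lemma finite_field_prime_CHAR: "Factorial_Ring.prime CHAR('f::{field,finite})"
  by (rule prime_CHAR_semidom) (simp add: finite_imp_CHAR_pos)

section \<open>Completions\<close>

lemma is_valuation_absval:
  assumes K: "subf K" and w: "is_valuation K w"
  shows "absval K (rnorm w)"
  unfolding absval_def
proof (intro conjI ballI)
  have fin: "w x \<noteq> -\<infinity>" "w x = \<infinity> \<longleftrightarrow> x = 0" if "x \<in> K" for x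
    using w that by (auto simp: is_valuation_def)
  fix x assume x: "x \<in> K"
  show "rnorm w x \<ge> 0" "rnorm w x = 0 \<longleftrightarrow> x = 0" using fin[OF x] by (auto simp: rnorm_def)
  fix y assume y: "y \<in> K"
  have mult: "w (x * y) = w x + w y" and add: "min (w x) (w y) \<le> w (x + y)"
    using w x y by (auto simp: is_valuation_def)
  have c1: "w x = \<infinity> \<or> (\<exists>r. w x = ereal r)" using fin(1)[OF x] by (cases "w x") auto
  have c2: "w y = \<infinity> \<or> (\<exists>r. w y = ereal r)" using fin(1)[OF y] by (cases "w y") auto
  show "rnorm w (x * y) = rnorm w x * rnorm w y"
    using c1 c2 mult by (elim disjE exE) (auto simp: rnorm_def exp_add[symmetric])
  have xy: "x + y \<in> K" using subf_add[OF K x y] .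
  have c3: "w (x + y) = \<infinity> \<or> (\<exists>r. w (x + y) = ereal r)" using fin(1)[OF xy] by (cases "w (x + y)") auto
  show "rnorm w (x + y) \<le> max (rnorm w x) (rnorm w y)"
    using c1 c2 c3 add by (elim disjE exE) (auto simp: rnorm_def min_def le_max_iff_disj split: if_splits)
qed

section \<open>Cauchy sequences and null sequences\<close>

locale valued_field =
  fixes K :: "'f::field kbar set" and w :: "'f kbar \<Rightarrow> ereal"
  assumes K: "subf K" and w: "is_valuation K w"
begin

abbreviation "N \<equiv> rnorm w"

lemma N: "absval K N"
  by (rule is_valuation_absval[OF K w])

lemmas N_nonneg = av_nonneg[OF K N] and N_mult = av_mult[OF K N] and N_add = av_add[OF K N]
  and N_diff = av_diff[OF K N] and N_0 = av_0[OF K N] and N_1 = av_1[OF K N] and N_uminus = av_uminus[OF K N]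
  and N_inverse = av_inverse[OF K N] and N_pos = av_pos[OF K N]

lemma val_cases: "x \<in> K \<Longrightarrow> w x = \<infinity> \<or> (\<exists>r. w x = ereal r)"
  using w by (cases "w x") (auto simp: is_valuation_def)

lemma val_ge_iff: "x \<in> K \<Longrightarrow> ereal B \<le> w x \<longleftrightarrow> N x \<le> exp (- B)"
  by (frule val_cases) (auto simp: rnorm_def)

lemma val_gt_iff: "x \<in> K \<Longrightarrow> ereal B < w x \<longleftrightarrow> N x < exp (- B)"
  by (frule val_cases) (auto simp: rnorm_def)

text \<open>The field \<open>L\<close> of the terms varies: it is \<open>K\<close> for the
  completion and \<open>base_field\<close> for the completed base inside it.\<close>

definition Cau :: "'f kbar set \<Rightarrow> (nat \<Rightarrow> 'f kbar) set" where
  "Cau L = {s. range s \<subseteq> L \<and> (\<forall>\<epsilon>>0. \<exists>M. \<forall>m\<ge>M. \<forall>n\<ge>M. N (s m - s n) \<le> \<epsilon>)}"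

lemma cauchy_seqs_eq: assumes "L \<subseteq> K" shows "cauchy_seqs L w = Cau L"
proof -
  have "(\<forall>B::real. \<exists>M. \<forall>m\<ge>M. \<forall>n\<ge>M. ereal B \<le> w (s m - s n)) \<longleftrightarrow> (\<forall>\<epsilon>>0. \<exists>M. \<forall>m\<ge>M. \<forall>n\<ge>M. N (s m - s n) \<le> \<epsilon>)"
    if "range s \<subseteq> L" for s
  proof -
    have sK: "s m - s n \<in> K" for m n using that assms by (intro subf_diff[OF K]) auto
    have "(\<forall>B::real. \<exists>M. \<forall>m\<ge>M. \<forall>n\<ge>M. ereal B \<le> w (s m - s n)) \<longleftrightarrow> (\<forall>B::real. \<exists>M. \<forall>m\<ge>M. \<forall>n\<ge>M. N (s m - s n) \<le> exp (- B))"
      by (simp add: val_ge_iff[OF sK])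
    also have "\<dots> \<longleftrightarrow> (\<forall>\<epsilon>>0. \<exists>M. \<forall>m\<ge>M. \<forall>n\<ge>M. N (s m - s n) \<le> \<epsilon>)"
    proof
      assume B: "\<forall>B::real. \<exists>M. \<forall>m\<ge>M. \<forall>n\<ge>M. N (s m - s n) \<le> exp (- B)"
      show "\<forall>\<epsilon>>0. \<exists>M. \<forall>m\<ge>M. \<forall>n\<ge>M. N (s m - s n) \<le> \<epsilon>"
      proof (intro allI impI)
        fix \<epsilon> :: real assume "\<epsilon> > 0"
        thus "\<exists>M. \<forall>m\<ge>M. \<forall>n\<ge>M. N (s m - s n) \<le> \<epsilon>" using B[rule_format, of "- ln \<epsilon>"] by simp
      qed
    qed simp
    finally show ?thesis .
  qed
  thus ?thesis unfolding cauchy_seqs_def Cau_def by (intro Collect_cong conj_cong refl)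
qed

definition Nul :: "(nat \<Rightarrow> 'f kbar) set" where
  "Nul = {s. range s \<subseteq> K \<and> (\<lambda>n. N (s n)) \<longlonglongrightarrow> 0}"

lemma null_seqs_eq: "null_seqs K w = Nul"
proof -
  have "(\<lambda>n. w (s n)) \<longlonglongrightarrow> \<infinity> \<longleftrightarrow> (\<lambda>n. N (s n)) \<longlonglongrightarrow> 0" if "range s \<subseteq> K" for s
  proof -
    have sK: "s n \<in> K" for n using that by auto
    have "(\<lambda>n. w (s n)) \<longlonglongrightarrow> \<infinity> \<longleftrightarrow> (\<forall>r. eventually (\<lambda>n. N (s n) < exp (- r)) sequentially)"
      unfolding tendsto_PInfty val_gt_iff[OF sK] ..
    also have "\<dots> \<longleftrightarrow> (\<lambda>n. N (s n)) \<longlonglongrightarrow> 0"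
    proof
      assume *: "\<forall>r. eventually (\<lambda>n. N (s n) < exp (- r)) sequentially"
      show "(\<lambda>n. N (s n)) \<longlonglongrightarrow> 0"
      proof (rule order_tendstoI)
        fix a :: real assume "a < 0"
        hence "\<forall>n. a < N (s n)" using N_nonneg[OF sK] by (meson less_le_trans)
        thus "eventually (\<lambda>n. a < N (s n)) sequentially" by simp
      next
        fix a :: real assume "0 < a"
        thus "eventually (\<lambda>n. N (s n) < a) sequentially" using *[rule_format, of "- ln a"] by simp
      qed
    next
      assume "(\<lambda>n. N (s n)) \<longlonglongrightarrow> 0"
      thus "\<forall>r. eventually (\<lambda>n. N (s n) < exp (- r)) sequentially" by (auto intro: order_tendstoD)
    qed
    finally show ?thesis .
  qed
  thus ?thesis unfolding null_seqs_def Nul_def by blast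
qed

lemma Cau_range: "s \<in> Cau L \<Longrightarrow> s n \<in> L" by (auto simp: Cau_def)

lemma Cau_mono: "L \<subseteq> L' \<Longrightarrow> Cau L \<subseteq> Cau L'" by (auto simp: Cau_def)

lemma Nul_Cau: "Nul \<subseteq> Cau K"
proof
  fix s assume s: "s \<in> Nul"
  hence sK: "s n \<in> K" for n by (auto simp: Nul_def)
  have "\<exists>M. \<forall>m\<ge>M. \<forall>n\<ge>M. N (s m - s n) \<le> \<epsilon>" if "\<epsilon> > 0" for \<epsilon>
  proof -
    have "eventually (\<lambda>n. N (s n) < \<epsilon>) sequentially" using s that by (auto simp: Nul_def intro: order_tendstoD)
    then obtain M where "\<forall>n\<ge>M. N (s n) < \<epsilon>" by (auto simp: eventually_sequentially)
    thus ?thesis using N_diff[OF sK sK] by (intro exI[of _ M]) (smt (verit))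
  qed
  thus "s \<in> Cau K" using s by (auto simp: Cau_def Nul_def)
qed

context
  fixes L assumes L: "subf L" "L \<subseteq> K"
begin

lemma Cau_const: "b \<in> L \<Longrightarrow> (\<lambda>_. b) \<in> Cau L"
  by (auto simp: Cau_def N_0)

lemma Cau_bounded: assumes "s \<in> Cau L" shows "\<exists>B>0. \<forall>n. N (s n) \<le> B"
proof -
  have sK: "s n \<in> K" for n using Cau_range[OF assms] L by auto
  obtain M where M: "\<forall>m\<ge>M. \<forall>n\<ge>M. N (s m - s n) \<le> 1" using assms by (auto simp: Cau_def dest: spec[of _ 1])
  define B where "B = Max ((\<lambda>n. N (s n)) ` {..M}) + 1"
  have le: "N (s n) \<le> B - 1" if "n \<le> M" for n unfolding B_def using that by (auto intro!: Max_ge)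
  have B: "B > 0" using le[of M] N_nonneg[OF sK[of M]] by linarith
  have "N (s n) \<le> B" for n
  proof (cases "n \<le> M")
    case False
    have "N (s n) \<le> max (N (s n - s M)) (N (s M))"
      using N_add[OF subf_diff[OF K sK sK] sK, of n M M] by simp
    moreover have "N (s n - s M) \<le> 1" using M False by auto
    moreover have "1 \<le> B" using le[of M] N_nonneg[OF sK[of M]] by linarith
    ultimately show ?thesis using le[of M] by linarith
  qed (use le in force)
  thus ?thesis using B by blast
qed

lemma Cau_add: assumes "s \<in> Cau L" "t \<in> Cau L" shows "(\<lambda>n. s n + t n) \<in> Cau L"
proof -
  have K': "s n \<in> K" "t n \<in> K" for n using Cau_range assms L by blast+
  have "\<exists>M. \<forall>m\<ge>M. \<forall>n\<ge>M. N (s m + t m - (s n + t n)) \<le> \<epsilon>" if \<epsilon>: "\<epsilon> > 0" for \<epsilon>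
  proof -
    obtain M1 where M1: "\<forall>m\<ge>M1. \<forall>n\<ge>M1. N (s m - s n) \<le> \<epsilon>" using assms(1) \<epsilon> unfolding Cau_def by blast
    obtain M2 where M2: "\<forall>m\<ge>M2. \<forall>n\<ge>M2. N (t m - t n) \<le> \<epsilon>" using assms(2) \<epsilon> unfolding Cau_def by blast
    have "N (s m + t m - (s n + t n)) \<le> \<epsilon>" if "m \<ge> max M1 M2" "n \<ge> max M1 M2" for m n
    proof -
      have "N ((s m - s n) + (t m - t n)) \<le> max (N (s m - s n)) (N (t m - t n))"
        using K' by (intro N_add subf_diff[OF K])
      also have "\<dots> \<le> \<epsilon>" using M1 M2 that by auto
      finally show ?thesis by (simp add: algebra_simps)
    qed
    thus ?thesis by blast
  qed
  moreover have "range (\<lambda>n. s n + t n) \<subseteq> L"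
    using Cau_range[OF assms(1)] Cau_range[OF assms(2)] by (auto intro!: subf_add[OF L(1)])
  ultimately show ?thesis unfolding Cau_def by blast
qed

lemma Cau_uminus: assumes "s \<in> Cau L" shows "(\<lambda>n. - s n) \<in> Cau L"
proof -
  have K': "s n \<in> K" for n using Cau_range assms L by blast+
  have eq: "N (- s m - - s n) = N (s m - s n)" for m n
    using N_uminus[OF subf_diff[OF K K'[of m] K'[of n]]] by simp
  show ?thesis using assms L(1) unfolding Cau_def mem_Collect_eq eq by (auto intro: subf_uminus)
qed

lemma Cau_mult: assumes "s \<in> Cau L" "t \<in> Cau L" shows "(\<lambda>n. s n * t n) \<in> Cau L"
proof -
  have K': "s n \<in> K" "t n \<in> K" for n using Cau_range assms L by blast+
  obtain B where B: "B > 0" "\<And>n. N (s n) \<le> B" using Cau_bounded[OF assms(1)] by blast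
  obtain C where C: "C > 0" "\<And>n. N (t n) \<le> C" using Cau_bounded[OF assms(2)] by blast
  have "\<exists>M. \<forall>m\<ge>M. \<forall>n\<ge>M. N (s m * t m - s n * t n) \<le> \<epsilon>" if \<epsilon>: "\<epsilon> > 0" for \<epsilon>
  proof -
    obtain M1 where M1: "\<forall>m\<ge>M1. \<forall>n\<ge>M1. N (s m - s n) \<le> \<epsilon> / C" using assms(1) divide_pos_pos[OF \<epsilon> C(1)] unfolding Cau_def by blast
    obtain M2 where M2: "\<forall>m\<ge>M2. \<forall>n\<ge>M2. N (t m - t n) \<le> \<epsilon> / B" using assms(2) divide_pos_pos[OF \<epsilon> B(1)] unfolding Cau_def by blast
    have "N (s m * t m - s n * t n) \<le> \<epsilon>" if mn: "m \<ge> max M1 M2" "n \<ge> max M1 M2" for m n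
    proof -
      have "N (s m * (t m - t n) + (s m - s n) * t n) \<le> max (N (s m * (t m - t n))) (N ((s m - s n) * t n))"
        using K' by (intro N_add subf_mult[OF K] subf_diff[OF K])
      moreover have "N (s m * (t m - t n)) \<le> B * (\<epsilon> / B)"
        unfolding N_mult[OF K'(1) subf_diff[OF K K'(2) K'(2)]]
        using B M2 mn N_nonneg[OF subf_diff[OF K K'(2) K'(2)]] by (intro mult_mono) auto
      moreover have "N ((s m - s n) * t n) \<le> (\<epsilon> / C) * C"
        unfolding N_mult[OF subf_diff[OF K K'(1) K'(1)] K'(2)]
        using C M1 mn N_nonneg[OF K'(2)] \<epsilon> by (intro mult_mono) auto
      ultimately have "N (s m * (t m - t n) + (s m - s n) * t n) \<le> \<epsilon>" using B C by auto
      thus ?thesis by (simp add: algebra_simps)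
    qed
    thus ?thesis by blast
  qed
  moreover have "range (\<lambda>n. s n * t n) \<subseteq> L"
    using Cau_range[OF assms(1)] Cau_range[OF assms(2)] by (auto intro!: subf_mult[OF L(1)])
  ultimately show ?thesis unfolding Cau_def by blast
qed

text \<open>A Cauchy sequence that is not null stays away from 0 from some index on. Earlier terms
  may vanish, where \<open>inverse 0 = 0\<close> keeps the sequence in \<open>L\<close>; so the
  product with the inverse is 1 only up to a null sequence.\<close>

lemma Cau_inverse:
  assumes s: "s \<in> Cau L" and nn: "s \<notin> Nul"
  shows "(\<lambda>n. inverse (s n)) \<in> Cau L" "(\<lambda>n. s n * inverse (s n) - 1) \<in> Nul"
proof -
  have K': "s n \<in> K" for n using Cau_range[OF s] L by blast
  have "\<not> (\<lambda>n. N (s n)) \<longlonglongrightarrow> 0" using nn K' by (auto simp: Nul_def)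
  then obtain \<delta> where \<delta>: "\<delta> > 0" "\<And>M. \<exists>n\<ge>M. N (s n) \<ge> \<delta>"
    using N_nonneg[OF K'] unfolding lim_sequentially by (auto simp: dist_real_def not_less)
  obtain M where M: "\<forall>m\<ge>M. \<forall>n\<ge>M. N (s m - s n) \<le> \<delta> / 2" using s half_gt_zero[OF \<delta>(1)] unfolding Cau_def by blast
  obtain n0 where n0: "n0 \<ge> M" "N (s n0) \<ge> \<delta>" using \<delta>(2) by blast
  have low: "N (s n) \<ge> \<delta>" if "n \<ge> M" for n
  proof -
    have "N (s n - s n0) < N (s n0)" using M n0 that \<delta>(1) by force
    hence "N (s n - s n0 + s n0) = N (s n0)" by (intro av_add_eq[OF K N] subf_diff[OF K] K')
    thus ?thesis using n0 by simp
  qed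
  have nz: "s n \<noteq> 0" if "n \<ge> M" for n using low[OF that] \<delta>(1) N_0 by auto
  have "\<exists>M'. \<forall>m\<ge>M'. \<forall>n\<ge>M'. N (inverse (s m) - inverse (s n)) \<le> \<epsilon>" if \<epsilon>: "\<epsilon> > 0" for \<epsilon>
  proof -
    obtain M1 where M1: "\<forall>m\<ge>M1. \<forall>n\<ge>M1. N (s m - s n) \<le> \<epsilon> * (\<delta> * \<delta>)"
      using s \<epsilon> \<delta>(1) mult_pos_pos[OF \<epsilon> mult_pos_pos[OF \<delta>(1) \<delta>(1)]] unfolding Cau_def by blast
    have "N (inverse (s m) - inverse (s n)) \<le> \<epsilon>" if mn: "m \<ge> max M M1" "n \<ge> max M M1" for m n
    proof -
      have "inverse (s m) - inverse (s n) = (s n - s m) / (s m * s n)"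
        using nz mn by (simp add: field_simps)
      hence "N (inverse (s m) - inverse (s n)) = N (s n - s m) / (N (s m) * N (s n))"
        using K' by (simp add: av_divide[OF K N] subf_diff[OF K] subf_mult[OF K] N_mult)
      also have "\<dots> \<le> (\<epsilon> * (\<delta> * \<delta>)) / (\<delta> * \<delta>)"
        using M1 mn low[of m] low[of n] \<delta>(1) \<epsilon> by (intro frac_le mult_mono) auto
      also have "\<dots> = \<epsilon>" using \<delta>(1) by simp
      finally show ?thesis .
    qed
    thus ?thesis by blast
  qed
  thus "(\<lambda>n. inverse (s n)) \<in> Cau L" using s L(1) unfolding Cau_def by (auto intro: subf_inverse)
  have "eventually (\<lambda>n. N (s n * inverse (s n) - 1) = 0) sequentially"
    unfolding eventually_sequentially using nz N_0 by (intro exI[of _ M]) auto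
  hence "(\<lambda>n. N (s n * inverse (s n) - 1)) \<longlonglongrightarrow> 0" by (rule tendsto_eventually)
  moreover have "s n * inverse (s n) - 1 \<in> K" for n
    using K' K by (intro subf_diff subf_mult subf_inverse) auto
  ultimately show "(\<lambda>n. s n * inverse (s n) - 1) \<in> Nul" by (auto simp: Nul_def)
qed

end

lemma Nul_add: assumes "s \<in> Nul" "t \<in> Nul" shows "(\<lambda>n. s n + t n) \<in> Nul"
proof -
  have K': "s n \<in> K" "t n \<in> K" for n using assms by (auto simp: Nul_def)
  have l: "(\<lambda>n. N (s n) + N (t n)) \<longlonglongrightarrow> 0 + 0" using assms by (intro tendsto_add) (auto simp: Nul_def)
  have "(\<lambda>n. N (s n + t n)) \<longlonglongrightarrow> 0"
  proof (rule tendsto_sandwich[OF _ _ tendsto_const[of 0]])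
    show "\<forall>\<^sub>F n in sequentially. 0 \<le> N (s n + t n)" using N_nonneg[OF subf_add[OF K K']] by simp
    have "N (s n + t n) \<le> N (s n) + N (t n)" for n
      using N_add[OF K', of n n] N_nonneg[OF K'(1), of n] N_nonneg[OF K'(2), of n] by linarith
    thus "\<forall>\<^sub>F n in sequentially. N (s n + t n) \<le> N (s n) + N (t n)" by simp
  qed (use l in simp)
  thus ?thesis using K' by (auto simp: Nul_def intro: subf_add[OF K])
qed

lemma Nul_mult: assumes "s \<in> Cau K" "t \<in> Nul" shows "(\<lambda>n. s n * t n) \<in> Nul"
proof -
  have K': "s n \<in> K" "t n \<in> K" for n using assms by (auto simp: Nul_def Cau_def)
  obtain B where B: "B > 0" "\<And>n. N (s n) \<le> B" using Cau_bounded[OF K order.refl assms(1)] by blast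
  have l: "(\<lambda>n. B * N (t n)) \<longlonglongrightarrow> B * 0" using assms by (intro tendsto_mult tendsto_const) (auto simp: Nul_def)
  have "(\<lambda>n. N (s n * t n)) \<longlonglongrightarrow> 0"
  proof (rule tendsto_sandwich[OF _ _ tendsto_const[of 0]])
    show "\<forall>\<^sub>F n in sequentially. 0 \<le> N (s n * t n)" using N_nonneg[OF subf_mult[OF K K']] by simp
    have "N (s n * t n) \<le> B * N (t n)" for n
      unfolding N_mult[OF K'] using B N_nonneg[OF K'(2)] by (intro mult_right_mono) auto
    thus "\<forall>\<^sub>F n in sequentially. N (s n * t n) \<le> B * N (t n)" by simp
  qed (use l in simp)
  thus ?thesis using K' by (auto simp: Nul_def intro: subf_mult[OF K])
qed

section \<open>The completion as a quotient ring\<close>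

definition CR where "CR = cauchy_ring K w"

lemma CR_simps [simp]: "carrier CR = Cau K" "s \<otimes>\<^bsub>CR\<^esub> t = (\<lambda>n. s n * t n)" "\<one>\<^bsub>CR\<^esub> = (\<lambda>n. 1)"
  "\<zero>\<^bsub>CR\<^esub> = (\<lambda>n. 0)" "s \<oplus>\<^bsub>CR\<^esub> t = (\<lambda>n. s n + t n)"
  by (auto simp: CR_def cauchy_ring_def cauchy_seqs_eq)

lemmas Cau_K = Cau_add[OF K order.refl] Cau_mult[OF K order.refl] Cau_uminus[OF K order.refl] Cau_const[OF K order.refl]

lemma cring_CR: "cring CR"
proof (rule cringI)
  show "abelian_group CR"
  proof (rule abelian_groupI)
    fix s assume s: "s \<in> carrier CR"
    show "\<exists>t\<in>carrier CR. t \<oplus>\<^bsub>CR\<^esub> s = \<zero>\<^bsub>CR\<^esub>"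
      using Cau_K(3)[of s] s by (intro bexI[of _ "\<lambda>n. - s n"]) auto
  qed (use Cau_K K in \<open>auto simp: algebra_simps\<close>)
  show "Group.comm_monoid CR"
    by (rule comm_monoidI) (use Cau_K K in \<open>auto simp: algebra_simps\<close>)
qed (auto simp: algebra_simps)

sublocale CR: cring CR by (rule cring_CR)

lemma CR_uminus: "s \<in> Cau K \<Longrightarrow> \<ominus>\<^bsub>CR\<^esub> s = (\<lambda>n. - s n)"
  using Cau_K(3) by (intro CR.minus_equality) auto

lemma CR_minus: "s \<in> Cau K \<Longrightarrow> t \<in> Cau K \<Longrightarrow> s \<ominus>\<^bsub>CR\<^esub> t = (\<lambda>n. s n - t n)"
  by (simp add: a_minus_def CR_uminus)

lemma Nul_uminus: "s \<in> Nul \<Longrightarrow> (\<lambda>n. - s n) \<in> Nul"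
  using Nul_mult[OF Cau_const[OF K order.refl subf_uminus[OF K subf_1[OF K]]], of s] by simp

lemma ideal_Nul: "ideal Nul CR"
proof (rule idealI)
  show "ring CR" by (rule CR.ring_axioms)
  show "subgroup Nul (add_monoid CR)"
  proof (rule CR.add.subgroupI)
    show "Nul \<subseteq> carrier CR" using Nul_Cau by simp
    have "(\<lambda>n. 0) \<in> Nul" using K by (auto simp: Nul_def N_0)
    thus "Nul \<noteq> {}" by blast
    show "\<ominus>\<^bsub>CR\<^esub> s \<in> Nul" if "s \<in> Nul" for s using Nul_uminus[OF that] CR_uminus Nul_Cau that by auto
    show "s \<oplus>\<^bsub>CR\<^esub> t \<in> Nul" if "s \<in> Nul" "t \<in> Nul" for s t using Nul_add[OF that] by simp
  qed
  fix s t assume "s \<in> Nul" "t \<in> carrier CR"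
  thus "t \<otimes>\<^bsub>CR\<^esub> s \<in> Nul" "s \<otimes>\<^bsub>CR\<^esub> t \<in> Nul" using Nul_mult[of t s] by (auto simp: mult.commute)
qed

sublocale Nul: ideal Nul CR by (rule ideal_Nul)

definition Q where "Q = completion K w"

lemma Q_eq: "Q = CR Quot Nul"
  by (simp add: Q_def completion_def CR_def null_seqs_eq)

lemma cring_Q: "cring Q"
  unfolding Q_eq by (rule Nul.quotient_is_cring[OF cring_CR])

sublocale Q: cring Q by (rule cring_Q)

definition cls where "cls s = Nul +>\<^bsub>CR\<^esub> s"

lemma hom_cls: "ring_hom_ring CR Q cls"
  using Nul.rcos_ring_hom_ring unfolding Q_eq cls_def[abs_def] .

sublocale cls: ring_hom_ring CR Q cls by (rule hom_cls)

lemma carrier_Q: "carrier Q = cls ` Cau K"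
  by (auto simp: Q_eq FactRing_def A_RCOSETS_def' cls_def)

lemma cls_eq_0_iff: "s \<in> Cau K \<Longrightarrow> cls s = \<zero>\<^bsub>Q\<^esub> \<longleftrightarrow> s \<in> Nul"
proof -
  assume s: "s \<in> Cau K"
  have z: "\<zero>\<^bsub>Q\<^esub> = Nul" by (simp add: Q_eq FactRing_def)
  show ?thesis
  proof
    assume "cls s = \<zero>\<^bsub>Q\<^esub>"
    hence "Nul +>\<^bsub>CR\<^esub> s = Nul" unfolding z cls_def .
    thus "s \<in> Nul" by (rule Nul.rcos_const_imp_mem[rotated]) (use s in simp)
  next
    assume "s \<in> Nul"
    thus "cls s = \<zero>\<^bsub>Q\<^esub>" unfolding z cls_def by (rule CR.a_rcos_zero[OF ideal_Nul])
  qed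
qed

lemma cls_eq_iff: "s \<in> Cau K \<Longrightarrow> t \<in> Cau K \<Longrightarrow> cls s = cls t \<longleftrightarrow> (\<lambda>n. s n - t n) \<in> Nul"
proof -
  assume s: "s \<in> Cau K" "t \<in> Cau K"
  have m: "s \<ominus>\<^bsub>CR\<^esub> t \<in> Cau K" using s by (metis CR.minus_closed CR_simps(1))
  have c: "cls s \<in> carrier Q" "cls t \<in> carrier Q" using s by (auto simp: carrier_Q)
  have "cls s = cls t \<longleftrightarrow> cls s \<ominus>\<^bsub>Q\<^esub> cls t = \<zero>\<^bsub>Q\<^esub>" using c Q.r_right_minus_eq by metis
  also have "cls s \<ominus>\<^bsub>Q\<^esub> cls t = cls (s \<ominus>\<^bsub>CR\<^esub> t)"
    unfolding a_minus_def using cls.hom_add[of s "\<ominus>\<^bsub>CR\<^esub> t"] cls.hom_a_inv[of t] s CR.a_inv_closed[of t]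
    by (simp del: CR_simps(5))
  also have "cls (s \<ominus>\<^bsub>CR\<^esub> t) = \<zero>\<^bsub>Q\<^esub> \<longleftrightarrow> s \<ominus>\<^bsub>CR\<^esub> t \<in> Nul" by (rule cls_eq_0_iff[OF m])
  finally show ?thesis using CR_minus s by simp
qed

definition C where "C = cls ` Cau base_field"

lemma C_eq: "base_completion K w = C"
  using K unfolding base_completion_def C_def cls_def CR_def
  by (subst cauchy_seqs_eq) (auto simp: null_seqs_eq base_field_def)

lemma subf_base: "subf (base_field :: 'f kbar set)"
  unfolding subf_def base_field_def by (auto simp flip: to_ac_add to_ac_mult to_ac_minus to_ac_inverse)

lemma base_K: "base_field \<subseteq> K" using K by (auto simp: base_field_def)

lemmas Cau_base = Cau_add[OF subf_base base_K] Cau_mult[OF subf_base base_K] Cau_uminus[OF subf_base base_K] Cau_const[OF subf_base base_K]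

text \<open>Dimensions over \<open>C\<close> require the scalars to form a field. The completion
  itself enters only as a commutative ring, so inverses are constructed just for sequences from the
  base.\<close>

lemma subfield_C: "subfield C Q"
proof (rule Q.subfieldI)
  have "subring (Cau base_field) CR"
  proof (rule CR.subringI)
    show "Cau base_field \<subseteq> carrier CR" using Cau_mono[OF base_K] by simp
    show "\<ominus>\<^bsub>CR\<^esub> s \<in> Cau base_field" if "s \<in> Cau base_field" for s
      using CR_uminus[of s] Cau_base(3)[OF that] Cau_mono[OF base_K] that by auto
  qed (use Cau_base subf_base in auto)
  hence "subring C Q" unfolding C_def by (rule cls.img_is_subring)
  thus "subcring C Q" by (rule Q.subcringI')
  have one: "\<one>\<^bsub>Q\<^esub> = cls (\<lambda>n. 1)" using cls.hom_one by simp
  have "(\<lambda>n. 1) \<notin> Nul" by (auto simp: Nul_def N_1 LIMSEQ_const_iff)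
  hence ne: "\<one>\<^bsub>Q\<^esub> \<noteq> \<zero>\<^bsub>Q\<^esub>" unfolding one using cls_eq_0_iff[of "\<lambda>n. 1"] Cau_K(4)[of 1] K by simp
  have CQ: "C \<subseteq> carrier Q" unfolding C_def carrier_Q using Cau_mono[OF base_K] by blast
  show "Units (Q\<lparr>carrier := C\<rparr>) = C - {\<zero>\<^bsub>Q\<^esub>}"
  proof (intro equalityI subsetI)
    fix y assume "y \<in> Units (Q\<lparr>carrier := C\<rparr>)"
    then obtain x where "y \<in> C" "x \<in> C" "x \<otimes>\<^bsub>Q\<^esub> y = \<one>\<^bsub>Q\<^esub>" by (auto simp: Units_def)
    thus "y \<in> C - {\<zero>\<^bsub>Q\<^esub>}" using ne CQ Q.r_null by auto
  next
    fix y assume y: "y \<in> C - {\<zero>\<^bsub>Q\<^esub>}"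
    then obtain s where s: "s \<in> Cau base_field" "y = cls s" by (auto simp: C_def)
    have sK: "s \<in> Cau K" using s Cau_mono[OF base_K] by blast
    have "s \<notin> Nul" using y s cls_eq_0_iff[OF sK] by blast
    note inv = Cau_inverse[OF subf_base base_K s(1) this]
    define t where "t = (\<lambda>n. inverse (s n))"
    have t: "t \<in> Cau base_field" "t \<in> Cau K" using inv Cau_mono[OF base_K] by (auto simp: t_def)
    have "cls (\<lambda>n. s n * t n) = cls (\<lambda>n. 1)"
      using inv(2) Cau_K(2)[OF sK t(2)] Cau_K(4)[of 1] K by (subst cls_eq_iff) (auto simp: t_def)
    hence "y \<otimes>\<^bsub>Q\<^esub> cls t = \<one>\<^bsub>Q\<^esub>" unfolding one s(2) using cls.hom_mult[of s t] sK t by simp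
    moreover have "cls t \<in> C" using t by (auto simp: C_def)
    moreover have "cls t \<otimes>\<^bsub>Q\<^esub> y = y \<otimes>\<^bsub>Q\<^esub> cls t" using calculation(2) y CQ by (intro Q.m_comm) auto
    ultimately show "y \<in> Units (Q\<lparr>carrier := C\<rparr>)" using y by (auto simp: Units_def)
  qed
qed

lemma combine_CR:
  assumes "length ss = length us"
  shows "CR.combine ss us = (\<lambda>n. \<Sum>i<length us. (ss ! i) n * (us ! i) n)"
  using assms
proof (induction ss us rule: list_induct2)
  case (Cons s ss u us)
  show ?case by (simp add: Cons.IH sum.lessThan_Suc_shift del: sum.lessThan_Suc)
qed simp

text \<open>A family of \<open>n\<close> elements realising \<open>has_ldeg\<close>, taken as
  constant sequences, is a basis of the completion over the completed base. The bound in
  \<open>nind\<close> survives limits, which gives independence. Density gives approximating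
  combinations, and by the same bound their coefficients form Cauchy sequences.\<close>

theorem local_degree_eq:
  assumes n: "has_ldeg K N n"
  shows "local_degree K w = n"
proof -
  have "\<exists>b. (\<forall>i<n. b i \<in> K) \<and> nind N {..<n} b \<and> (\<forall>x\<in>K. \<forall>\<epsilon>>0. \<exists>t. N (x - (\<Sum>i<n. to_ac (t i) * b i)) < \<epsilon>)"
    by (rule has_ldeg_dense[OF K N n]) blast
  then obtain b where b: "\<And>i. i < n \<Longrightarrow> b i \<in> K" "nind N {..<n} b"
    "\<And>x \<epsilon>. x \<in> K \<Longrightarrow> \<epsilon> > 0 \<Longrightarrow> \<exists>t. N (x - (\<Sum>i<n. to_ac (t i) * b i)) < \<epsilon>"
    by auto
  obtain D where D': "D \<ge> 1" "\<And>t i. i \<in> {..<n} \<Longrightarrow> N (to_ac (t i)) \<le> D * N (\<Sum>j<n. to_ac (t j) * b j)"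
    by (rule nind_bound[OF b(2) K N]) (use b(1) in auto)
  have D: "D \<ge> 1" "\<And>t i. i < n \<Longrightarrow> N (to_ac (t i)) \<le> D * N (\<Sum>j<n. to_ac (t j) * b j)"
    using D' by auto
  define bs where "bs = map (\<lambda>i. (\<lambda>_::nat. b i)) [0..<n]"
  have len: "length bs = n" by (simp add: bs_def)
  have bsC: "set bs \<subseteq> carrier CR" using b(1) Cau_K(4) by (auto simp: bs_def)
  have comb: "CR.combine ss bs = (\<lambda>m. \<Sum>i<n. (ss ! i) m * b i)" if "length ss = n" for ss
    using combine_CR[of ss bs] that len by (simp add: bs_def)
  define Us where "Us = map cls bs"
  have UsC: "set Us \<subseteq> carrier Q" using bsC by (auto simp: Us_def carrier_Q)
  have ind: "Q.independent C Us"
  proof (rule Q.trivial_combine_imp_independent[OF subfield_C UsC])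
    fix Ks assume Ks: "set Ks \<subseteq> C" "Q.combine Ks Us = \<zero>\<^bsub>Q\<^esub>"
    \<comment> \<open>A combination ignores surplus list entries, so the coefficient list is first
      brought to the length of \<open>Us\<close>.\<close>
    obtain Ks' where Ks': "set (take (length Us) Ks) \<subseteq> set Ks'" "set Ks' \<subseteq> set (take (length Us) Ks) \<union> {\<zero>\<^bsub>Q\<^esub>}"
      "length Ks' = length Us" "Q.combine Ks' Us = \<zero>\<^bsub>Q\<^esub>"
      using Q.combine_normalize[OF _ UsC Ks(2)] Ks(1) subfieldE(3)[OF subfield_C] by blast
    have "set Ks' \<subseteq> C" using Ks'(2) Ks(1) subringE(2)[OF subfieldE(1)[OF subfield_C]] set_take_subset by fast
    hence "\<forall>x\<in>set Ks'. \<exists>s. s \<in> Cau base_field \<and> x = cls s" by (auto simp: C_def)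
    then obtain g where g: "\<And>x. x \<in> set Ks' \<Longrightarrow> g x \<in> Cau base_field" "\<And>x. x \<in> set Ks' \<Longrightarrow> x = cls (g x)" by metis
    define ss where "ss = map g Ks'"
    have ssl: "length ss = n" using Ks'(3) len by (simp add: ss_def Us_def)
    have Ks'ss: "Ks' = map cls ss" using g(2) by (auto simp: ss_def intro!: map_idI[symmetric])
    have ssC: "set ss \<subseteq> Cau base_field" using g(1) by (auto simp: ss_def)
    hence ssK: "set ss \<subseteq> carrier CR" using Cau_mono[OF base_K] by auto
    have "cls (CR.combine ss bs) = \<zero>\<^bsub>Q\<^esub>"
      using cls.combine_hom[OF ssK bsC] Ks'(4) Ks'ss by (simp add: Us_def)
    hence nul: "(\<lambda>m. \<Sum>i<n. (ss ! i) m * b i) \<in> Nul"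
      using cls_eq_0_iff[of "CR.combine ss bs"] CR.combine_in_carrier[OF ssK bsC] comb[OF ssl] by simp
    have "cls (ss ! i) = \<zero>\<^bsub>Q\<^esub>" if i: "i < n" for i
    proof -
      have si: "ss ! i \<in> Cau base_field" using ssC ssl i by auto
      have "\<forall>m. \<exists>t. \<forall>j<n. (ss ! j) m = to_ac (t j)"
      proof
        fix m
        have "\<forall>j<n. \<exists>c. (ss ! j) m = to_ac c"
        proof (intro allI impI)
          fix j assume "j < n"
          hence "ss ! j \<in> Cau base_field" using ssC ssl by auto
          hence "(ss ! j) m \<in> base_field" by (rule Cau_range)
          thus "\<exists>c. (ss ! j) m = to_ac c" by (auto simp: base_field_def)
        qed
        thus "\<exists>t. \<forall>j<n. (ss ! j) m = to_ac (t j)" by metis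
      qed
      then obtain t where t: "\<And>m j. j < n \<Longrightarrow> (ss ! j) m = to_ac (t m j)" by metis
      have le: "N ((ss ! i) m) \<le> D * N (\<Sum>j<n. (ss ! j) m * b j)" for m
        using D(2)[OF i, of "t m"] t i by simp
      have l: "(\<lambda>m. D * N (\<Sum>j<n. (ss ! j) m * b j)) \<longlonglongrightarrow> D * 0"
        using nul by (intro tendsto_mult tendsto_const) (auto simp: Nul_def)
      have sK: "(ss ! i) m \<in> K" for m using Cau_range[OF si] base_K by blast
      have "(\<lambda>m. N ((ss ! i) m)) \<longlonglongrightarrow> 0"
      proof (rule tendsto_sandwich[OF _ _ tendsto_const[of 0]])
        show "\<forall>\<^sub>F m in sequentially. 0 \<le> N ((ss ! i) m)" using N_nonneg[OF sK] by simp
        show "\<forall>\<^sub>F m in sequentially. N ((ss ! i) m) \<le> D * N (\<Sum>j<n. (ss ! j) m * b j)" using le by simp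
      qed (use l in simp)
      hence "ss ! i \<in> Nul" using sK by (auto simp: Nul_def)
      thus ?thesis using cls_eq_0_iff[of "ss ! i"] Nul_Cau by blast
    qed
    hence "set Ks' \<subseteq> {\<zero>\<^bsub>Q\<^esub>}" unfolding Ks'ss using ssl by (auto simp: set_conv_nth)
    thus "set (take (length Us) Ks) \<subseteq> {\<zero>\<^bsub>Q\<^esub>}" using Ks'(1) by blast
  qed
  have span: "Q.Span C Us = carrier Q"
  proof (intro equalityI subsetI)
    fix a assume "a \<in> carrier Q"
    then obtain u where u: "u \<in> Cau K" "a = cls u" by (auto simp: carrier_Q)
    have uK: "u m \<in> K" for m using Cau_range[OF u(1)] .
    \<comment> \<open>The errors tend to 0, so the sequence \<open>v\<close> of approximations
      differs from \<open>u\<close> by a null sequence and has the same class.\<close>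
    have "\<forall>m. \<exists>t. N (u m - (\<Sum>i<n. to_ac (t i) * b i)) < 1 / real (Suc m)"
      using b(3)[OF uK] by simp
    then obtain t where t: "\<And>m. N (u m - (\<Sum>i<n. to_ac (t m i) * b i)) < 1 / real (Suc m)" by metis
    define v where "v m = (\<Sum>i<n. to_ac (t m i) * b i)" for m
    have vK: "v m \<in> K" for m unfolding v_def using b(1) K by (intro subf_sum subf_mult) auto
    have uv: "(\<lambda>m. u m - v m) \<in> Nul"
    proof -
      have "(\<lambda>m. N (u m - v m)) \<longlonglongrightarrow> 0"
      proof (rule tendsto_sandwich[OF _ _ tendsto_const[of 0]])
        show "\<forall>\<^sub>F m in sequentially. 0 \<le> N (u m - v m)" using N_nonneg[OF subf_diff[OF K uK vK]] by simp
        show "\<forall>\<^sub>F m in sequentially. N (u m - v m) \<le> 1 / real (Suc m)" using t by (simp add: v_def less_imp_le)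
        show "(\<lambda>m. 1 / real (Suc m)) \<longlonglongrightarrow> 0" using LIMSEQ_inverse_real_of_nat by (simp add: inverse_eq_divide)
      qed
      thus ?thesis using subf_diff[OF K uK vK] by (auto simp: Nul_def)
    qed
    have vC: "v \<in> Cau K"
    proof -
      have "(\<lambda>m. u m + - (u m - v m)) \<in> Cau K" using u(1) Nul_Cau uv by (intro Cau_K) blast+
      thus ?thesis by simp
    qed
    have tC: "(\<lambda>m. to_ac (t m i)) \<in> Cau base_field" if i: "i < n" for i
    proof -
      have "\<exists>M. \<forall>m\<ge>M. \<forall>m'\<ge>M. N (to_ac (t m i) - to_ac (t m' i)) \<le> \<epsilon>" if \<epsilon>: "\<epsilon> > 0" for \<epsilon>
      proof -
        have "\<epsilon> / D > 0" using \<epsilon> D(1) by simp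
        then obtain M where M: "\<forall>m\<ge>M. \<forall>m'\<ge>M. N (v m - v m') \<le> \<epsilon> / D" using vC unfolding Cau_def by blast
        have "N (to_ac (t m i) - to_ac (t m' i)) \<le> \<epsilon>" if mm: "m \<ge> M" "m' \<ge> M" for m m'
        proof -
          have "N (to_ac (t m i - t m' i)) \<le> D * N (\<Sum>j<n. to_ac (t m j - t m' j) * b j)"
            using D(2)[OF i, of "\<lambda>j. t m j - t m' j"] .
          also have "(\<Sum>j<n. to_ac (t m j - t m' j) * b j) = v m - v m'"
            by (simp add: v_def left_diff_distrib sum_subtractf)
          also have "D * N (v m - v m') \<le> D * (\<epsilon> / D)" using M mm D(1) by (intro mult_left_mono) auto
          finally show ?thesis using D(1) by simp
        qed
        thus ?thesis by blast
      qed
      thus ?thesis by (auto simp: Cau_def base_field_def)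
    qed
    define ss where "ss = map (\<lambda>i m. to_ac (t m i)) [0..<n]"
    have ssl: "length ss = n" by (simp add: ss_def)
    have ssC: "set ss \<subseteq> Cau base_field" using tC by (auto simp: ss_def)
    hence ssK: "set ss \<subseteq> carrier CR" using Cau_mono[OF base_K] by auto
    have "CR.combine ss bs = v" using comb[OF ssl] by (auto simp: ss_def v_def fun_eq_iff)
    hence "Q.combine (map cls ss) Us = cls v" using cls.combine_hom[OF ssK bsC] by (simp add: Us_def)
    also have "cls v = a" using cls_eq_iff[OF u(1) vC] uv u(2) by simp
    finally have "a = Q.combine (map cls ss) Us" by simp
    moreover have "set (map cls ss) \<subseteq> C" using ssC by (auto simp: C_def)
    moreover have "length (map cls ss) = length Us" using ssl len by (simp add: Us_def)
    ultimately show "a \<in> Q.Span C Us" using Q.Span_mem_iff_length_version[OF subfield_C UsC] by blast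
  qed (use Q.Span_in_carrier[OF _ UsC] subfieldE(3)[OF subfield_C] in blast)
  have "Q.dimension (length Us) C (carrier Q)" by (rule Q.dimensionI[OF subfield_C ind span])
  hence "Q.dim C (carrier Q) = length Us" using Q.dimI[OF subfield_C] by (simp add: over_def)
  thus ?thesis unfolding local_degree_def C_eq Q_def[symmetric] using len by (simp add: Us_def)
qed

end

section \<open>Field degrees\<close>

abbreviation (input) AR :: "'f::field kbar ring" where "AR \<equiv> ring_of_type_algebra"

lemma AR_simps [simp]: "carrier (AR :: 'f::field kbar ring) = UNIV" "\<zero>\<^bsub>AR :: 'f kbar ring\<^esub> = 0" "\<one>\<^bsub>AR :: 'f kbar ring\<^esub> = 1"
  "x \<oplus>\<^bsub>AR :: 'f kbar ring\<^esub> y = x + y" "x \<otimes>\<^bsub>AR :: 'f kbar ring\<^esub> y = x * y"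
  by (auto simp: ring_of_type_algebra_def)

interpretation AR: cring "AR :: 'f::field kbar ring"
  by (rule cring_from_type_algebra)

declare AR.Span.simps [simp del]

lemma AR_uminus [simp]: "\<ominus>\<^bsub>AR :: 'f::field kbar ring\<^esub> x = - x"
  by (intro AR.minus_equality) auto

lemma AR_inv: "x \<noteq> 0 \<Longrightarrow> inv\<^bsub>AR :: 'f::field kbar ring\<^esub> x = inverse x"
  by (intro AR.comm_inv_char) auto

lemma AR_combine:
  assumes "length xs = length us"
  shows "AR.combine xs us = (\<Sum>i<length us. xs ! i * us ! i)"
  using assms
proof (induction xs us rule: list_induct2)
  case (Cons s ss u us)
  show ?case by (simp add: Cons.IH sum.lessThan_Suc_shift del: sum.lessThan_Suc)
qed simp

lemma subfield_of_subf: assumes "subf K" shows "subfield K AR"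
proof (rule field.subfieldI'[OF field_from_type_algebra])
  show "subring K AR" by (rule AR.subringI) (use assms in \<open>auto intro: subf_ops\<close>)
  show "inv\<^bsub>AR\<^esub> k \<in> K" if "k \<in> K - {\<zero>\<^bsub>AR\<^esub>}" for k
    using that assms by (simp add: AR_inv subf_inverse)
qed

lemma subf_base_field: "subf (base_field :: 'f::field kbar set)"
  unfolding subf_def base_field_def by (auto simp flip: to_ac_add to_ac_mult to_ac_minus to_ac_inverse)

lemma subf_adjoin: "subf (adjoin S)"
  unfolding subf_def
proof (intro conjI ballI)
  show "range to_ac \<subseteq> adjoin S" unfolding adjoin_def base_field_def by (auto intro: generate_field.incl)
  fix x assume x: "x \<in> adjoin S"
  have "\<ominus>\<^bsub>AR\<^esub> x \<in> adjoin S" using x unfolding adjoin_def by (rule generate_field.a_inv)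
  thus "- x \<in> adjoin S" by simp
  show "inverse x \<in> adjoin S"
  proof (cases "x = 0")
    case True thus ?thesis using x by simp
  next
    case False
    have "inv\<^bsub>AR\<^esub> x \<in> adjoin S" using x False unfolding adjoin_def by (intro generate_field.m_inv) auto
    thus ?thesis using False by (simp add: AR_inv)
  qed
  fix y assume y: "y \<in> adjoin S"
  have "x \<oplus>\<^bsub>AR\<^esub> y \<in> adjoin S" "x \<otimes>\<^bsub>AR\<^esub> y \<in> adjoin S"
    using x y unfolding adjoin_def by (auto simp del: AR_simps intro: generate_field.eng_add generate_field.eng_mult)
  thus "x + y \<in> adjoin S" "x * y \<in> adjoin S" by auto
qed

lemma adjoin_incl: "S \<subseteq> adjoin S"
  unfolding adjoin_def by (auto intro: generate_field.incl)

lemma adjoin_min: assumes "subf K" "S \<subseteq> K" shows "adjoin S \<subseteq> K"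
proof
  fix x assume "x \<in> adjoin S"
  thus "x \<in> K" unfolding adjoin_def
  proof (induction rule: generate_field.induct)
    case (incl h) thus ?case using assms by (auto simp: base_field_def)
  next
    case (m_inv h) thus ?case using assms by (simp add: AR_inv subf_inverse)
  qed (use assms in \<open>auto intro: subf_ops\<close>)
qed

lemma AR_SpanI:
  assumes K: "subf K" and z: "z = (\<Sum>l<length us. x l * us ! l)" and x: "\<And>l. l < length us \<Longrightarrow> x l \<in> K"
  shows "z \<in> AR.Span K us"
proof -
  have "z = AR.combine (map x [0..<length us]) us" using z by (simp add: AR_combine)
  hence "\<exists>Ks. set Ks \<subseteq> K \<and> length Ks = length us \<and> z = AR.combine Ks us"
    using x by (intro exI[of _ "map x [0..<length us]"]) auto
  thus ?thesis using AR.Span_mem_iff_length_version[OF subfield_of_subf[OF K], of us z] by simp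
qed

lemma AR_SpanD:
  assumes K: "subf K" and z: "z \<in> AR.Span K us"
  shows "\<exists>x. (\<forall>l<length us. x l \<in> K) \<and> z = (\<Sum>l<length us. x l * us ! l)"
proof -
  have "\<exists>xs. set xs \<subseteq> K \<and> length xs = length us \<and> z = AR.combine xs us"
    using AR.Span_mem_iff_length_version[OF subfield_of_subf[OF K], of us z] z by simp
  then obtain xs where xs: "set xs \<subseteq> K" "length xs = length us" "z = AR.combine xs us" by blast
  have "\<forall>l<length us. xs ! l \<in> K" using xs(1,2) by (metis nth_mem subsetD)
  thus ?thesis using xs(3) AR_combine[OF xs(2)] by (intro exI[of _ "\<lambda>l. xs ! l"]) simp
qed

lemma independent_length_le_span:
  fixes us :: "'f::field kbar list"
  assumes ind: "AR.independent base_field us"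
    and span: "\<And>i. i < length us \<Longrightarrow> \<exists>x. us ! i = (\<Sum>l<(d::nat). to_ac (x l) * e l)"
  shows "length us \<le> d"
proof (rule ccontr)
  define m where "m = length us"
  assume "\<not> length us \<le> d"
  hence dm: "d < m" by (simp add: m_def)
  have "\<forall>i<m. \<exists>x. us ! i = (\<Sum>l<d. to_ac (x l) * e l)" using span by (auto simp: m_def)
  then obtain x where x: "\<And>i. i < m \<Longrightarrow> us ! i = (\<Sum>l<d. to_ac (x i l) * e l)" by metis
  have "\<exists>t. (\<exists>i\<in>{..<m}. t i \<noteq> 0) \<and> (\<forall>j\<in>{..<d}. (\<Sum>i<m. t i * x i j) = 0)"
    using dm by (intro lin_dep) auto
  then obtain t where t: "\<exists>i\<in>{..<m}. t i \<noteq> 0" "\<forall>j<d. (\<Sum>i<m. t i * x i j) = 0" by auto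
  have "(\<Sum>i<m. to_ac (t i) * us ! i) = (\<Sum>i<m. \<Sum>l<d. to_ac (t i * x i l) * e l)"
    by (intro sum.cong) (auto simp: x sum_distrib_left mult.assoc)
  also have "\<dots> = (\<Sum>l<d. \<Sum>i<m. to_ac (t i * x i l) * e l)" by (rule sum.swap)
  also have "\<dots> = (\<Sum>l<d. to_ac (\<Sum>i<m. t i * x i l) * e l)" unfolding to_ac_sum sum_distrib_right ..
  also have "\<dots> = 0" using t(2) by simp
  finally have 0: "AR.combine (map (\<lambda>i. to_ac (t i)) [0..<m]) us = \<zero>\<^bsub>AR\<^esub>"
    by (subst AR_combine) (auto simp: m_def)
  obtain i where i: "i < m" "t i \<noteq> 0" using t(1) by auto
  have "\<not> AR.independent base_field us"
  proof (rule AR.non_trivial_combine_imp_dependent[OF subfield_of_subf[OF subf_base_field] _ 0])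
    show "set (map (\<lambda>i. to_ac (t i)) [0..<m]) \<subseteq> base_field" by (auto simp: base_field_def)
    have "to_ac (t i) \<in> set (take (length us) (map (\<lambda>i. to_ac (t i)) [0..<m]))" using i by (auto simp: m_def)
    thus "\<not> set (take (length us) (map (\<lambda>i. to_ac (t i)) [0..<m])) \<subseteq> {\<zero>\<^bsub>AR\<^esub>}" using i(2) by auto
  qed
  thus False using ind by blast
qed

lemma ext_degree_basis:
  assumes fin: "AR.finite_dimension base_field K"
  obtains us where "length us = ext_degree K" "set us \<subseteq> K"
    "\<And>z. z \<in> K \<Longrightarrow> \<exists>x. z = (\<Sum>l<ext_degree K. to_ac (x l) * us ! l)"
proof -
  note sb = subfield_of_subf[OF subf_base_field]
  have d: "AR.dimension (ext_degree K) base_field K"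
    using AR.finite_dimensionE[OF sb fin] by (simp add: ext_degree_def over_def)
  obtain us where us: "AR.independent base_field us" "length us = ext_degree K" "AR.Span base_field us = K"
    using AR.exists_base[OF sb d] by blast
  have "set us \<subseteq> K" using AR.Span_base_incl[OF sb, of us] us(3) by simp
  moreover have "\<exists>x. z = (\<Sum>l<ext_degree K. to_ac (x l) * us ! l)" if "z \<in> K" for z
  proof -
    obtain x where x: "\<And>l. l < length us \<Longrightarrow> x l \<in> base_field" "z = (\<Sum>l<length us. x l * us ! l)"
      using AR_SpanD[OF subf_base_field, of z us] \<open>z \<in> K\<close> us(3) by blast
    have "\<forall>l<length us. \<exists>c. x l = to_ac c" using x(1) by (auto simp: base_field_def)
    then obtain c where "\<And>l. l < length us \<Longrightarrow> x l = to_ac (c l)" by metis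
    thus ?thesis using x(2) us(2) by (intro exI[of _ c]) auto
  qed
  ultimately show ?thesis using that us(2) by blast
qed

section \<open>The height as a sum over embeddings\<close>

text \<open>The positive part of the logarithm, that is, the contribution of one element at one
  place to a height.\<close>

definition lp :: "real \<Rightarrow> real" where "lp r = ln (max 1 r)"

lemma lp_nonneg: "lp r \<ge> 0" by (simp add: lp_def)

lemma lp_mono: "r \<le> s \<Longrightarrow> lp r \<le> lp s" by (simp add: lp_def)

lemma lp_eq_0: "r \<le> 1 \<Longrightarrow> lp r = 0" by (simp add: lp_def)

lemma lp_max: "lp (max r s) = max (lp r) (lp s)"
  by (auto simp: max_def lp_mono intro: antisym lp_mono)

section \<open>Absolute values attached to places and embeddings\<close>

locale height_setup = cofinal_ext "TYPE('f::{field,finite} poly fract)" f \<eta> e P T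
  for f :: "'f::{field,finite} poly fract poly" and \<eta> e P T
begin

definition Wp :: "('f poly fract \<Rightarrow> ereal) \<Rightarrow> 'f kbar \<Rightarrow> real" where
  "Wp v = (SOME W. absval UNIV W \<and> (\<forall>c. W (to_ac c) = rnorm v c))"

lemma Wp: assumes "v \<in> base_places"
  shows "absval UNIV (Wp v)" "Wp v (to_ac c) = rnorm v c"
proof -
  obtain p where "discrete_absval (rnorm v) p" using base_place_discrete[OF assms] by blast
  then interpret discrete_absval "rnorm v" p .
  have "absval UNIV (Wp v) \<and> (\<forall>c. Wp v (to_ac c) = rnorm v c)"
    unfolding Wp_def by (rule someI_ex[OF extension_exists])
  thus "absval UNIV (Wp v)" "Wp v (to_ac c) = rnorm v c" by auto
qed

definition nv :: "('f poly fract \<Rightarrow> ereal) \<Rightarrow> 'f kbar \<Rightarrow> 'f kbar \<Rightarrow> real" where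
  "nv v \<zeta> z = Wp v (emb \<zeta> z)"

lemma nv_absval: "v \<in> base_places \<Longrightarrow> \<zeta> \<in> rts \<Longrightarrow> absval Kbig (nv v \<zeta>)"
  unfolding nv_def[abs_def] by (rule absval_emb[OF _ Wp(1)])

lemma nv_to_ac: "v \<in> base_places \<Longrightarrow> \<zeta> \<in> rts \<Longrightarrow> nv v \<zeta> (to_ac c) = rnorm v c"
  by (simp add: nv_def Wp)

text \<open>By the tower law \<open>ext_degree K * d'\<close> is the degree of \<open>Kbig\<close>,
  hence at most the number of elements spanning it in \<open>Kbig_span\<close>. That this is an
  equality comes out only of \<open>local_degree_formula\<close>.\<close>

lemma Kbig_dimension:
  assumes K: "subf K" "K \<subseteq> Kbig"
  shows "AR.finite_dimension base_field K" (is ?th1)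
    "\<exists>d' g. ext_degree K * d' \<le> P * card rts \<and> (\<forall>l<d'. g l \<in> Kbig) \<and> (\<forall>z\<in>Kbig. \<exists>x. (\<forall>l<d'. x l \<in> K) \<and> z = (\<Sum>l<d'. x l * g l))" (is ?th2)
proof -
  note sb = subfield_of_subf[OF subf_base_field]
  obtain b where b: "\<And>l. l < P * card rts \<Longrightarrow> b l \<in> Kbig" "\<And>z. z \<in> Kbig \<Longrightarrow> \<exists>x. z = (\<Sum>l<P * card rts. to_ac (x l) * b l)"
    using Kbig_span by blast
  define bl where "bl = map b [0..<P * card rts]"
  have len: "length bl = P * card rts" by (simp add: bl_def)
  have bl: "bl ! l = b l" if "l < P * card rts" for l using that by (simp add: bl_def)
  have blK: "set bl \<subseteq> Kbig" using b(1) by (auto simp: bl_def)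
  have Span: "AR.Span L bl = Kbig" if L: "subf L" "L \<subseteq> Kbig" for L
  proof (intro equalityI subsetI)
    fix z assume "z \<in> AR.Span L bl"
    then obtain x where x: "\<forall>l<length bl. x l \<in> L" "z = (\<Sum>l<length bl. x l * bl ! l)" using AR_SpanD[OF L(1)] by blast
    show "z \<in> Kbig" unfolding x(2) using x(1) L(2) blK by (intro subf_sum[OF subf_Kbig] subf_mult[OF subf_Kbig]) auto
  next
    fix z assume "z \<in> Kbig"
    then obtain x where "z = (\<Sum>l<P * card rts. to_ac (x l) * b l)" using b(2) by blast
    hence "z = (\<Sum>l<length bl. to_ac (x l) * bl ! l)" using bl len by simp
    thus "z \<in> AR.Span L bl" by (rule AR_SpanI[OF L(1)]) (use L(1) in simp)
  qed
  have baseK: "base_field \<subseteq> K" using K(1) by (auto simp: base_field_def)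
  have f1: "AR.finite_dimension base_field Kbig"
    using AR.Span_finite_dimension[OF sb, of bl] Span[OF subf_base_field] baseK K(2) by simp
  have "subalgebra base_field K AR"
    unfolding subalgebra_def subalgebra_axioms_def
  proof (intro conjI allI impI)
    show "subgroup K (add_monoid AR)"
      using subring.axioms(1)[OF subfieldE(1)[OF subfield_of_subf[OF K(1)]]] .
    fix k v :: "'f kbar" assume "k \<in> base_field" "v \<in> K"
    thus "k \<otimes>\<^bsub>AR\<^esub> v \<in> K" using baseK subf_mult[OF K(1)] by auto
  qed
  thus f2: ?th1 using AR.subalbegra_incl_imp_finite_dimension[OF sb f1 _ K(2)] by blast
  have f3: "AR.finite_dimension K Kbig"
    using AR.Span_finite_dimension[OF subfield_of_subf[OF K(1)], of bl] Span[OF K] by simp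
  define d' where "d' = AR.dim K Kbig"
  have d1: "AR.dimension (ext_degree K) base_field K"
    using AR.finite_dimensionE[OF sb f2] by (simp add: ext_degree_def over_def)
  have d2: "AR.dimension d' K Kbig"
    using AR.finite_dimensionE[OF subfield_of_subf[OF K(1)] f3] by (simp add: d'_def over_def)
  have d3: "AR.dimension (ext_degree K * d') base_field Kbig"
    by (rule AR.telescopic_base[OF sb subfield_of_subf[OF K(1)] d1 d2])
  obtain us where us: "AR.independent base_field us" "length us = ext_degree K * d'" "AR.Span base_field us = Kbig"
    using AR.exists_base[OF sb d3] by blast
  have usK: "set us \<subseteq> Kbig" using AR.Span_base_incl[OF sb, of us] us(3) by simp
  have le: "ext_degree K * d' \<le> P * card rts"
    using independent_length_le_span[OF us(1), where d = "P * card rts" and e = b] b(2) usK us(2) by (metis nth_mem subsetD)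
  obtain ws where ws: "AR.independent K ws" "length ws = d'" "AR.Span K ws = Kbig"
    using AR.exists_base[OF subfield_of_subf[OF K(1)] d2] by blast
  have wsK: "set ws \<subseteq> Kbig" using AR.Span_base_incl[OF subfield_of_subf[OF K(1)], of ws] ws(3) by simp
  have "\<exists>x. (\<forall>l<d'. x l \<in> K) \<and> z = (\<Sum>l<d'. x l * ws ! l)" if "z \<in> Kbig" for z
  proof -
    have "z \<in> AR.Span K ws" using that ws(3) by simp
    thus ?thesis using AR_SpanD[OF K(1)] ws(2) by blast
  qed
  thus ?th2 using le wsK ws(2) by (intro exI[of _ d'] exI[of _ "\<lambda>l. ws ! l"]) auto
qed

text \<open>The place of \<open>K\<close> induced by the embedding \<open>\<zeta>\<close> and the
  chosen extension of \<open>v\<close>; the restriction makes it extensional, as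
  \<open>places\<close> demands.\<close>

definition wz :: "'f kbar set \<Rightarrow> ('f poly fract \<Rightarrow> ereal) \<Rightarrow> 'f kbar \<Rightarrow> 'f kbar \<Rightarrow> ereal" where
  "wz K v \<zeta> = restrict (\<lambda>z. if z = 0 then \<infinity> else ereal (- ln (nv v \<zeta> z))) K"

lemma rnorm_wz:
  assumes "subf K" "K \<subseteq> Kbig" "v \<in> base_places" "\<zeta> \<in> rts" "z \<in> K"
  shows "rnorm (wz K v \<zeta>) z = nv v \<zeta> z"
proof -
  have "z \<in> Kbig" using assms by blast
  thus ?thesis using av_0[OF subf_Kbig nv_absval[OF assms(3,4)]] av_pos[OF subf_Kbig nv_absval[OF assms(3,4)], of z] assms(5)
    by (simp add: rnorm_def wz_def)
qed

lemma wz_place: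
  assumes K: "subf K" "K \<subseteq> Kbig" and v: "v \<in> base_places" and \<zeta>: "\<zeta> \<in> rts"
  shows "wz K v \<zeta> \<in> places K" "wz K v \<zeta> (to_ac c) = v c"
proof -
  note nva = nv_absval[OF v \<zeta>]
  have pos: "nv v \<zeta> z > 0" if "z \<in> K" "z \<noteq> 0" for z using av_pos[OF subf_Kbig nva] that K(2) by blast
  have to_ac: "wz K v \<zeta> (to_ac c) = v c" for c
  proof (cases "c = 0")
    case True thus ?thesis using base_place_zero[OF v] K(1) by (simp add: wz_def)
  next
    case False
    obtain r where "v c = ereal r" using base_place_finite[OF v False] by blast
    thus ?thesis using False K(1) rnorm_ln[OF v False] by (simp add: wz_def nv_to_ac[OF v \<zeta>])
  qed
  thus "wz K v \<zeta> (to_ac c) = v c" .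
  have "is_valuation K (wz K v \<zeta>)"
    unfolding is_valuation_def
  proof (intro conjI ballI)
    fix x assume x: "x \<in> K"
    show "wz K v \<zeta> x \<noteq> - \<infinity>" "wz K v \<zeta> x = \<infinity> \<longleftrightarrow> x = 0" using x by (auto simp: wz_def)
    fix y assume y: "y \<in> K"
    have xyB: "x \<in> Kbig" "y \<in> Kbig" using x y K(2) by auto
    show "wz K v \<zeta> (x * y) = wz K v \<zeta> x + wz K v \<zeta> y"
      using x y subf_mult[OF K(1) x y] pos[of x] pos[of y] av_mult[OF subf_Kbig nva xyB]
      by (auto simp: wz_def ln_mult)
    show "min (wz K v \<zeta> x) (wz K v \<zeta> y) \<le> wz K v \<zeta> (x + y)"
    proof (cases "x = 0 \<or> y = 0 \<or> x + y = 0")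
      case True thus ?thesis using x y subf_add[OF K(1) x y] by (auto simp: wz_def)
    next
      case False
      have "nv v \<zeta> (x + y) \<le> nv v \<zeta> x \<or> nv v \<zeta> (x + y) \<le> nv v \<zeta> y"
        using av_add[OF subf_Kbig nva xyB] by linarith
      thus ?thesis using False x y subf_add[OF K(1) x y] pos[of x] pos[of y] pos[of "x + y"]
        by (auto simp: wz_def min_le_iff_disj)
    qed
  qed
  thus "wz K v \<zeta> \<in> places K"
    unfolding places_def using to_ac v by (auto simp: wz_def)
qed

definition loc :: "'f kbar list \<Rightarrow> ('f poly fract \<Rightarrow> ereal) \<Rightarrow> 'f kbar \<Rightarrow> real" where
  "loc ys v \<zeta> = Max (insert 0 ((\<lambda>y. lp (nv v \<zeta> y)) ` set ys))"

lemma local_height_real: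
  assumes "subf K" "is_valuation K w" "set ys \<subseteq> K"
  shows "real_of_ereal (Max (insert 0 ((\<lambda>y. - w y) ` set ys))) = Max (insert 0 ((\<lambda>y. lp (rnorm w y)) ` set ys))"
proof -
  have fin: "Max (insert 0 ((\<lambda>y. - w y) ` Y)) = ereal (Max (insert 0 ((\<lambda>y. lp (rnorm w y)) ` Y)))"
    if "finite Y" "Y \<subseteq> K" for Y
    using that
  proof (induction Y rule: finite_induct)
    case empty thus ?case by (simp add: zero_ereal_def)
  next
    case (insert y Y)
    have y: "w y = \<infinity> \<or> (\<exists>r. w y = ereal r)" using insert assms by (cases "w y") (auto simp: is_valuation_def)
    have "max 0 (- w y) = ereal (lp (rnorm w y))"
      using y by (auto simp: rnorm_def lp_def max_def zero_ereal_def)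
    moreover have "Max (insert 0 ((\<lambda>y. - w y) ` insert y Y)) = max (max 0 (- w y)) (Max (insert 0 ((\<lambda>y. - w y) ` Y)))"
    proof -
      have eq: "insert 0 ((\<lambda>y. - w y) ` insert y Y) = insert (- w y) (insert 0 ((\<lambda>y. - w y) ` Y))" by auto
      have "0 \<le> Max (insert 0 ((\<lambda>y. - w y) ` Y))" using insert(1) by (intro Max_ge) auto
      moreover have "Max (insert (- w y) (insert 0 ((\<lambda>y. - w y) ` Y))) = max (- w y) (Max (insert 0 ((\<lambda>y. - w y) ` Y)))"
        using insert(1) by (intro Max_insert) auto
      ultimately show ?thesis unfolding eq
        by (cases "- w y \<le> 0") (simp_all add: max.absorb1 max.absorb2 order.trans)
    qed
    moreover have "Max (insert 0 ((\<lambda>y. lp (rnorm w y)) ` insert y Y)) = max (lp (rnorm w y)) (Max (insert 0 ((\<lambda>y. lp (rnorm w y)) ` Y)))"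
    proof -
      have "insert 0 ((\<lambda>y. lp (rnorm w y)) ` insert y Y) = insert (lp (rnorm w y)) (insert 0 ((\<lambda>y. lp (rnorm w y)) ` Y))" by auto
      thus ?thesis using insert(1) by simp
    qed
    ultimately show ?case using insert by (simp add: max_def)
  qed
  show ?thesis using fin[of "set ys"] assms(3) by simp
qed

lemma loc_0:
  assumes "\<And>y. y \<in> set ys \<Longrightarrow> nv v \<zeta> y \<le> 1" shows "loc ys v \<zeta> = 0"
proof -
  have eq: "insert 0 ((\<lambda>y. lp (nv v \<zeta> y)) ` set ys) = {0}" using assms by (auto simp: lp_eq_0)
  show ?thesis unfolding loc_def eq by simp
qed

text \<open>By \<open>local_degree_formula\<close>, \<open>local_degree K w * d'\<close> is
  \<open>P\<close> times the number of embeddings inducing \<open>w\<close>, while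
  \<open>ext_degree K * d'\<close> is \<open>P * card rts\<close>. In the quotient \<open>P\<close>
  and \<open>d'\<close> cancel, and with them all dependence on \<open>K\<close>.\<close>

theorem height_in_eq:
  assumes K: "subf K" "K \<subseteq> Kbig" and ys: "set ys \<subseteq> K" and S: "finite S" "S \<subseteq> base_places"
    and good: "\<And>v \<zeta> y. v \<in> base_places - S \<Longrightarrow> \<zeta> \<in> rts \<Longrightarrow> y \<in> set ys \<Longrightarrow> nv v \<zeta> y \<le> 1"
  shows "height_in K ys = (\<Sum>v\<in>S. \<Sum>\<zeta>\<in>rts. loc ys v \<zeta>) / real (card rts)"
proof -
  have fd: "AR.finite_dimension base_field K" using Kbig_dimension(1)[OF K] .
  obtain us where us: "length us = ext_degree K" "set us \<subseteq> K" "\<And>z. z \<in> K \<Longrightarrow> \<exists>x. z = (\<Sum>l<ext_degree K. to_ac (x l) * us ! l)"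
    using ext_degree_basis[OF fd] by blast
  obtain d' g where dg: "ext_degree K * d' \<le> P * card rts" "\<And>l. l < d' \<Longrightarrow> g l \<in> Kbig"
    "\<And>z. z \<in> Kbig \<Longrightarrow> \<exists>x. (\<forall>l<d'. x l \<in> K) \<and> z = (\<Sum>l<d'. x l * g l)"
    using Kbig_dimension(2)[OF K] by blast
  define Pl where "Pl v = {w \<in> places K. \<forall>c. w (to_ac c) = v c}" for v
  define Z where "Z v w = {\<zeta>\<in>rts. \<forall>z\<in>K. rnorm w z = nv v \<zeta> z}" for v w
  have Pl_val: "is_valuation K w" "w \<in> extensional K" if "w \<in> Pl v" for v w using that by (auto simp: Pl_def places_def)
  have wz_Pl: "wz K v \<zeta> \<in> Pl v" if "v \<in> base_places" "\<zeta> \<in> rts" for v \<zeta>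
    using wz_place[OF K that] by (auto simp: Pl_def)
  have inj: "w = w'" if "w \<in> Pl v" "w' \<in> Pl v'" "\<And>z. z \<in> K \<Longrightarrow> rnorm w z = rnorm w' z" for v v' w w'
  proof (rule extensionalityI[OF Pl_val(2)[OF that(1)] Pl_val(2)[OF that(2)]])
    fix z assume z: "z \<in> K"
    have "w z = \<infinity> \<or> (\<exists>r. w z = ereal r)" using Pl_val(1)[OF that(1)] z by (cases "w z") (auto simp: is_valuation_def)
    moreover have "w' z = \<infinity> \<or> (\<exists>r. w' z = ereal r)" using Pl_val(1)[OF that(2)] z by (cases "w' z") (auto simp: is_valuation_def)
    ultimately show "w z = w' z" using that(3)[OF z] by (auto simp: rnorm_def)
  qed
  have Z_iff: "\<zeta> \<in> Z v w \<longleftrightarrow> w = wz K v \<zeta>" if "v \<in> base_places" "\<zeta> \<in> rts" "w \<in> Pl v" for v \<zeta> w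
    using inj[OF that(3) wz_Pl[OF that(1,2)]] rnorm_wz[OF K that(1,2)] that(2) by (auto simp: Z_def)
  have deg: "local_degree K w * d' = P * card (Z v w) \<and> local_degree K w > 0 \<and> ext_degree K * d' = P * card rts"
    if v: "v \<in> base_places" and w: "w \<in> Pl v" for v w
  proof -
    obtain p where p: "discrete_absval (rnorm v) p" using base_place_discrete[OF v] by blast
    interpret cl: cofinal_local f \<eta> e P T "TYPE('f poly fract)" "rnorm v" p "Wp v"
      by (intro cofinal_local.intro cofinal_ext_axioms p cofinal_local_axioms.intro Wp[OF v])
    interpret vf: valued_field K w by (rule valued_field.intro[OF K(1) Pl_val(1)[OF w]])
    obtain n where n: "has_ldeg K (rnorm w) n" using has_ldeg_exists[OF K(1) vf.N us(3)] by blast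
    have Nc: "rnorm w (to_ac c) = rnorm v c" for c using w by (simp add: rnorm_def Pl_def)
    have usn: "us ! l \<in> K" if "l < ext_degree K" for l using us(1,2) that by auto
    have "n * d' = P * card {\<zeta>\<in>rts. \<forall>z\<in>K. rnorm w z = Wp v (emb \<zeta> z)}" "ext_degree K * d' = P * card rts"
      using cl.local_degree_formula[OF K vf.N Nc n usn us(3) dg(2) dg(3) dg(1)] by auto
    thus ?thesis using vf.local_degree_eq[OF n] has_ldeg_pos[OF K(1) vf.N n] by (simp add: Z_def nv_def)
  qed
  have infp: "infinite_place \<in> (base_places :: ('f poly fract \<Rightarrow> ereal) set)" by (simp add: base_places_def)
  obtain \<zeta>0 where \<zeta>0: "\<zeta>0 \<in> rts" using card_rts_pos by (metis card.empty ex_in_conv less_numeral_extra(3))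
  \<comment> \<open>This equation does not mention the place, so any single place yields it.\<close>
  have dd: "ext_degree K * d' = P * card rts" using deg[OF infp wz_Pl[OF infp \<zeta>0]] by blast
  have pos: "d' > 0" "ext_degree K > 0" using dd P_pos card_rts_pos by (auto intro!: Nat.gr0I)
  \<comment> \<open>A positive local degree forces a positive number of inducing embeddings. So all
    places above \<open>v\<close> come from embeddings, and there are finitely many.\<close>
  have Pl_eq: "Pl v = wz K v ` rts" if v: "v \<in> base_places" for v
  proof (intro equalityI subsetI)
    fix w assume w: "w \<in> Pl v"
    have "card (Z v w) > 0" using deg[OF v w] pos by (metis gr0I mult_0_right mult_is_0 neq0_conv)
    then obtain \<zeta> where "\<zeta> \<in> Z v w" by (metis card.empty ex_in_conv less_numeral_extra(3))
    moreover have "\<zeta> \<in> rts" using calculation by (simp add: Z_def)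
    ultimately show "w \<in> wz K v ` rts" using Z_iff[OF v _ w] by blast
  qed (use wz_Pl[OF v] in auto)
  define h where "h w = real (local_degree K w) * real_of_ereal (Max (insert 0 ((\<lambda>y. - w y) ` set ys)))" for w
  have hw: "h w * real d' = real P * (\<Sum>\<zeta>\<in>Z v w. loc ys v \<zeta>)" if v: "v \<in> base_places" and w: "w \<in> Pl v" for v w
  proof -
    have l: "real_of_ereal (Max (insert 0 ((\<lambda>y. - w y) ` set ys))) = loc ys v \<zeta>" if "\<zeta> \<in> Z v w" for \<zeta>
      unfolding local_height_real[OF K(1) Pl_val(1)[OF w] ys] loc_def using that ys
      by (intro arg_cong[of _ _ Max] arg_cong[of _ _ "insert 0"] image_cong) (auto simp: Z_def)
    have "(\<Sum>\<zeta>\<in>Z v w. loc ys v \<zeta>) = real (card (Z v w)) * real_of_ereal (Max (insert 0 ((\<lambda>y. - w y) ` set ys)))"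
    proof -
      have "(\<Sum>\<zeta>\<in>Z v w. loc ys v \<zeta>) = (\<Sum>\<zeta>\<in>Z v w. real_of_ereal (Max (insert 0 ((\<lambda>y. - w y) ` set ys))))"
        by (intro sum.cong refl l[symmetric])
      thus ?thesis by simp
    qed
    moreover have "real (local_degree K w) * real d' = real P * real (card (Z v w))"
      using deg[OF v w] by (simp flip: of_nat_mult)
    ultimately show ?thesis by (simp add: h_def mult_ac)
  qed
  have sumPl: "(\<Sum>w\<in>Pl v. h w) * real d' = real P * (\<Sum>\<zeta>\<in>rts. loc ys v \<zeta>)" if v: "v \<in> base_places" for v
  proof -
    have "(\<Sum>w\<in>Pl v. h w) * real d' = real P * (\<Sum>w\<in>Pl v. \<Sum>\<zeta>\<in>Z v w. loc ys v \<zeta>)"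
      using hw[OF v] by (simp add: sum_distrib_right sum_distrib_left)
    also have "(\<Sum>w\<in>Pl v. \<Sum>\<zeta>\<in>Z v w. loc ys v \<zeta>) = (\<Sum>w\<in>wz K v ` rts. \<Sum>\<zeta>\<in>{\<zeta>\<in>rts. wz K v \<zeta> = w}. loc ys v \<zeta>)"
      unfolding Pl_eq[OF v]
    proof (intro sum.cong refl)
      fix w \<zeta> assume w: "w \<in> wz K v ` rts"
      hence wP: "w \<in> Pl v" using Pl_eq[OF v] by simp
      have "Z v w \<subseteq> rts" by (auto simp: Z_def)
      thus "Z v w = {\<zeta>\<in>rts. wz K v \<zeta> = w}" using Z_iff[OF v _ wP] by blast
    qed
    also have "\<dots> = (\<Sum>\<zeta>\<in>rts. loc ys v \<zeta>)" by (rule sum.image_gen[OF finite_rts, symmetric])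
    finally show ?thesis .
  qed
  have places_eq: "places K = (\<Union>v\<in>base_places. Pl v)"
    unfolding places_def Pl_def by auto
  have fPl: "finite (Pl v)" if "v \<in> base_places" for v using Pl_eq[OF that] finite_rts by simp
  have h0: "h w = 0" if "w \<in> places K - (\<Union>v\<in>S. Pl v)" for w
  proof -
    have "\<exists>v. v \<in> base_places \<and> w \<in> Pl v \<and> v \<notin> S" using that unfolding places_eq by blast
    then obtain v where v: "v \<in> base_places" "w \<in> Pl v" "v \<notin> S" by blast
    have "loc ys v \<zeta> = 0" if "\<zeta> \<in> rts" for \<zeta> using loc_0 good v that by (metis DiffI)
    hence "h w * real d' = 0" using hw[OF v(1,2)] by (simp add: Z_def)
    thus ?thesis using pos by simp
  qed
  have "infsum h (places K) = infsum h (\<Union>v\<in>S. Pl v)"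
    using h0 S places_eq by (intro infsum_cong_neutral) auto
  also have "\<dots> = sum h (\<Union>v\<in>S. Pl v)" using S fPl by (intro infsum_finite) auto
  also have "\<dots> = (\<Sum>v\<in>S. \<Sum>w\<in>Pl v. h w)"
  proof (rule sum.UNION_disjoint)
    show "\<forall>v\<in>S. \<forall>v'\<in>S. v \<noteq> v' \<longrightarrow> Pl v \<inter> Pl v' = {}"
    proof (intro ballI impI, rule ccontr)
      fix v v' assume "v \<noteq> v'" "Pl v \<inter> Pl v' \<noteq> {}"
      then obtain w where "w \<in> Pl v" "w \<in> Pl v'" by blast
      hence "v = v'" by (auto simp: Pl_def fun_eq_iff)
      thus False using \<open>v \<noteq> v'\<close> by simp
    qed
  qed (use S fPl in auto)
  also have "\<dots> = (\<Sum>v\<in>S. real P * (\<Sum>\<zeta>\<in>rts. loc ys v \<zeta>) / real d')"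
    using sumPl S pos by (intro sum.cong) (auto simp: eq_divide_eq)
  also have "\<dots> = real P / real d' * (\<Sum>v\<in>S. \<Sum>\<zeta>\<in>rts. loc ys v \<zeta>)"
    by (simp add: sum_distrib_left sum_divide_distrib)
  finally have inf: "infsum h (places K) = real P / real d' * (\<Sum>v\<in>S. \<Sum>\<zeta>\<in>rts. loc ys v \<zeta>)" .
  have rdd: "real d' * real (ext_degree K) = real P * real (card rts)"
    using dd by (metis of_nat_mult mult.commute)
  have "height_in K ys = infsum h (places K) / real (ext_degree K)"
    unfolding height_in_def h_def ..
  also have "\<dots> = real P * (\<Sum>v\<in>S. \<Sum>\<zeta>\<in>rts. loc ys v \<zeta>) / (real d' * real (ext_degree K))"
    unfolding inf by simp
  also have "\<dots> = (\<Sum>v\<in>S. \<Sum>\<zeta>\<in>rts. loc ys v \<zeta>) / real (card rts)"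
    unfolding rdd using P_pos by simp
  finally show ?thesis .
qed

text \<open>Where all coefficients of the minimal polynomial are integral, so are its roots, and
  each nonzero coefficient has nonzero value at finitely many places only.\<close>

lemma finite_bad_places:
  assumes y: "y \<in> Kbig"
  shows "\<exists>S. finite S \<and> S \<subseteq> base_places \<and> (\<forall>v\<in>base_places - S. \<forall>\<zeta>\<in>rts. nv v \<zeta> y \<le> 1)"
proof -
  obtain g where g: "minimal_poly g y" using minimal_poly_exists by blast
  define n where "n = Polynomial.degree g"
  define S where "S = (\<Union>i\<in>{i. i \<le> n \<and> Polynomial.coeff g i \<noteq> 0}. {v\<in>base_places. v (Polynomial.coeff g i) \<noteq> 0})"
  have "finite S" unfolding S_def using product_formula(1) by auto
  moreover have "S \<subseteq> base_places" by (auto simp: S_def)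
  moreover have "nv v \<zeta> y \<le> 1" if v: "v \<in> base_places - S" and \<zeta>: "\<zeta> \<in> rts" for v \<zeta>
  proof (rule ccontr)
    assume neg: "\<not> nv v \<zeta> y \<le> 1"
    have vb: "v \<in> base_places" using v by simp
    note W = Wp(1)[OF vb]
    define z where "z = emb \<zeta> y"
    have z: "poly (acp g) z = 0" using g emb_poly[OF \<zeta> y, of g] emb_0[OF \<zeta>] by (simp add: minimal_poly_def z_def)
    have Wz: "Wp v z > 1" using neg by (simp add: nv_def z_def)
    have c: "Wp v (to_ac (Polynomial.coeff g i)) \<le> 1" if "i \<le> n" for i
    proof (cases "Polynomial.coeff g i = 0")
      case True thus ?thesis using av_0[OF subf_UNIV W] by simp
    next
      case False
      hence "v (Polynomial.coeff g i) = 0" using v that by (auto simp: S_def)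
      thus ?thesis by (simp add: Wp(2)[OF vb] rnorm_def)
    qed
    have n0: "n > 0" using minimal_poly_degree_pos[OF g] by (simp add: n_def)
    have "z ^ n = - (\<Sum>i<n. to_ac (Polynomial.coeff g i) * z ^ i)"
      using z g by (simp add: poly_altdef n_def[symmetric] lessThan_Suc_atMost[symmetric] minimal_poly_def add_eq_0_iff)
    hence "Wp v (z ^ n) = Wp v (\<Sum>i<n. to_ac (Polynomial.coeff g i) * z ^ i)"
      using av_uminus[OF subf_UNIV W] by simp
    also have "\<dots> \<le> Wp v z ^ (n - 1)"
    proof (rule av_sum_le[OF subf_UNIV W])
      fix i assume i: "i \<in> {..<n}"
      have "Wp v (to_ac (Polynomial.coeff g i) * z ^ i) = Wp v (to_ac (Polynomial.coeff g i)) * Wp v z ^ i"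
        using av_mult[OF subf_UNIV W] av_power[OF subf_UNIV W] by simp
      also have "\<dots> \<le> 1 * Wp v z ^ (n - 1)"
        using c[of i] i Wz by (intro mult_mono power_increasing) auto
      finally show "Wp v (to_ac (Polynomial.coeff g i) * z ^ i) \<le> Wp v z ^ (n - 1)" by simp
    qed (use Wz in auto)
    finally have "Wp v z ^ n \<le> Wp v z ^ (n - 1)" using av_power[OF subf_UNIV W] by simp
    moreover have "Wp v z ^ (n - 1) < Wp v z ^ n" using Wz n0 by (intro power_strict_increasing) auto
    ultimately show False by simp
  qed
  ultimately show ?thesis by blast
qed

text \<open>The norm of \<open>y\<close>, raised to the power \<open>P\<close>, is a constant
  \<open>c\<close>, and \<open>v c\<close> is \<open>- P\<close> times the sum over the conjugates
  at \<open>v\<close>. So the product formula for \<open>c\<close> applies.\<close>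

lemma product_formula_ext:
  assumes y: "y \<in> Kbig" "y \<noteq> 0" and S: "finite S" "S \<subseteq> base_places"
    and good: "\<And>v \<zeta>. v \<in> base_places - S \<Longrightarrow> \<zeta> \<in> rts \<Longrightarrow> nv v \<zeta> y = 1"
  shows "(\<Sum>v\<in>S. \<Sum>\<zeta>\<in>rts. ln (nv v \<zeta> y)) = 0"
proof -
  obtain c where c: "(\<Prod>\<zeta>\<in>rts. emb \<zeta> y) ^ P = to_ac c" using norm_rational[OF y(1)] by blast
  have e0: "emb \<zeta> y \<noteq> 0" if "\<zeta> \<in> rts" for \<zeta> using emb_eq_0[OF that y(1)] y(2) by simp
  have c0: "c \<noteq> 0"
  proof
    assume "c = 0"
    hence "(\<Prod>\<zeta>\<in>rts. emb \<zeta> y) = 0" using c P_pos by simp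
    thus False using e0 finite_rts by simp
  qed
  have key: "real P * (\<Sum>\<zeta>\<in>rts. ln (nv v \<zeta> y)) = - real_of_ereal (v c)" if v: "v \<in> base_places" for v
  proof -
    note W = Wp(1)[OF v]
    have Wpos: "Wp v z > 0" if "z \<noteq> 0" for z using av_pos[OF subf_UNIV W UNIV_I that] .
    have prod: "Wp v (\<Prod>\<zeta>\<in>I. emb \<zeta> y) = (\<Prod>\<zeta>\<in>I. nv v \<zeta> y)" for I
      by (induction I rule: infinite_finite_induct) (auto simp: av_1[OF subf_UNIV W] av_mult[OF subf_UNIV W] nv_def)
    have "ln (rnorm v c) = ln ((\<Prod>\<zeta>\<in>rts. nv v \<zeta> y) ^ P)"
      using Wp(2)[OF v, of c] c av_power[OF subf_UNIV W] prod by (metis UNIV_I)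
    also have "\<dots> = real P * ln (\<Prod>\<zeta>\<in>rts. nv v \<zeta> y)"
      by (rule ln_realpow)
    also have "ln (\<Prod>\<zeta>\<in>rts. nv v \<zeta> y) = (\<Sum>\<zeta>\<in>rts. ln (nv v \<zeta> y))"
    proof (rule ln_prod[OF finite_rts])
      fix \<zeta> assume "\<zeta> \<in> rts"
      thus "nv v \<zeta> y \<noteq> 0" using Wpos[OF e0] by (fastforce simp: nv_def)
    qed
    finally show ?thesis using rnorm_ln[OF v c0] by simp
  qed
  have sub: "{v\<in>base_places. v c \<noteq> 0} \<subseteq> S"
  proof
    fix v assume v: "v \<in> {v\<in>base_places. v c \<noteq> 0}"
    show "v \<in> S"
    proof (rule ccontr)
      assume "v \<notin> S"
      hence "(\<Sum>\<zeta>\<in>rts. ln (nv v \<zeta> y)) = 0" using good[of v] v by simp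
      hence "real_of_ereal (v c) = 0" using key[of v] v by simp
      moreover obtain r where "v c = ereal r" using base_place_finite[of v c] v c0 by auto
      ultimately show False using v by (simp add: zero_ereal_def)
    qed
  qed
  have "real P * (\<Sum>v\<in>S. \<Sum>\<zeta>\<in>rts. ln (nv v \<zeta> y)) = - (\<Sum>v\<in>S. real_of_ereal (v c))"
    using key S by (simp add: sum_distrib_left sum_negf subset_iff)
  also have "\<dots> = 0" using product_formula(2)[OF c0 S sub] by simp
  finally show ?thesis using P_pos by simp
qed

end

section \<open>Twisted polynomials\<close>

lemma finite_field_power_card: "(c :: 'f::{field,finite}) ^ CARD('f) = c"
proof (cases "c = 0")
  case False
  let ?U = "UNIV - {0 :: 'f}"
  have "(\<Prod>u\<in>?U. u) = (\<Prod>u\<in>?U. c * u)"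
    by (rule prod.reindex_bij_witness[of _ "\<lambda>u. c * u" "\<lambda>u. u / c"]) (use False in auto)
  also have "\<dots> = c ^ card ?U * (\<Prod>u\<in>?U. u)" by (simp add: prod.distrib)
  finally have "c ^ card ?U = 1" by simp
  moreover have "CARD('f) = Suc (card ?U)" by (rule card.remove) auto
  ultimately have "c ^ CARD('f) = c * 1" by (metis power_Suc)
  thus ?thesis by simp
qed (simp add: zero_power)

lemma embed_poly_add: "embed_poly (a + b) = embed_poly a + embed_poly b"
  and embed_poly_power: "embed_poly (a ^ n) = embed_poly a ^ n"
  unfolding embed_poly_def to_ac_add[symmetric] to_ac_power[symmetric] by (simp_all add: Fract_power1)

lemma embed_poly_0 [simp]: "embed_poly 0 = 0"
  and embed_poly_1 [simp]: "embed_poly 1 = 1"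
  unfolding embed_poly_def Zero_fract_def[symmetric] One_fract_def[symmetric] by (rule to_ac_0, rule to_ac_1)

lemma embed_poly_eq_iff [simp]: "embed_poly a = embed_poly b \<longleftrightarrow> a = b"
  by (simp add: embed_poly_def eq_fract)

lemma embed_const_power_card: "embed_poly [:c:] ^ CARD('f) = embed_poly [:c :: 'f::{field,finite}:]"
  unfolding embed_poly_power[symmetric] poly_const_pow finite_field_power_card ..

text \<open>The argument does not pass through q being a power of the characteristic. The constants
  \<open>C\<close> are the roots of X^q - X, so the product of all \<open>z - c\<close> is
  \<open>z ^ q - z\<close>. It is invariant under shifts of \<open>z\<close> by constants, whence
  \<open>(z + c) ^ q = z ^ q + c\<close>. Thus (X + y)^q and X^q + y^q are monic of degree q and
  agree at the q points of \<open>C\<close>, so they are equal.\<close>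

lemma kbar_power_card_add: "(x + y :: 'f::{field,finite} kbar) ^ CARD('f) = x ^ CARD('f) + y ^ CARD('f)"
proof -
  define q where "q = CARD('f)"
  define C :: "'f kbar set" where "C = range (\<lambda>c. embed_poly [:c:])"
  have q1: "q > 1"
    using card_mono[of UNIV "{0, 1 :: 'f}"] by (simp add: q_def)
  have fin: "finite C" by (simp add: C_def)
  have card: "card C = q" unfolding C_def q_def by (intro card_image injI) simp
  have Cq: "c ^ q = c" if c: "c \<in> C" for c
  proof -
    obtain b where "c = embed_poly [:b:]" using c by (auto simp: C_def)
    thus ?thesis by (simp add: q_def embed_const_power_card)
  qed
  have diff: "a - b \<in> C" if ab: "a \<in> C" "b \<in> C" for a b
  proof -
    obtain a' b' where "a = embed_poly [:a':]" "b = embed_poly [:b':]" using ab by (auto simp: C_def)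
    moreover have "embed_poly [:a':] = embed_poly [:a' - b':] + embed_poly [:b':]"
      by (simp flip: embed_poly_add)
    ultimately have "a - b = embed_poly [:a' - b':]" by (simp add: algebra_simps)
    thus ?thesis by (simp add: C_def)
  qed
  have C0: "0 \<in> C" unfolding C_def by (rule image_eqI[of _ _ 0]) simp_all
  have uminus: "- b \<in> C" if "b \<in> C" for b using diff[OF C0 that] by simp
  have prod: "(\<Prod>c\<in>C. [:- c, 1:]) = Polynomial.monom 1 q - Polynomial.monom 1 1"
  proof (rule poly_eqI_degree_lead_coeff[where n = q and A = C])
    have deg: "Polynomial.degree (\<Prod>c\<in>C. [:- c, 1:]) = q" by (subst degree_prod_eq_sum_degree) (auto simp: card)
    thus "Polynomial.degree (\<Prod>c\<in>C. [:- c, 1:]) \<le> q" by simp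
    have "Polynomial.lead_coeff (\<Prod>c\<in>C. [:- c, 1:]) = 1" by (simp add: lead_coeff_prod)
    thus "Polynomial.coeff (\<Prod>c\<in>C. [:- c, 1:]) q = Polynomial.coeff (Polynomial.monom 1 q - Polynomial.monom 1 1) q"
      using deg q1 by simp
    show "poly (\<Prod>c\<in>C. [:- c, 1:]) z = poly (Polynomial.monom 1 q - Polynomial.monom 1 1) z" if z: "z \<in> C" for z
    proof -
      have "(\<Prod>c\<in>C. z - c) = 0" using fin z by (intro prod_zero) auto
      thus ?thesis using Cq[OF z] by (simp add: poly_prod poly_monom)
    qed
  qed (use card q1 in \<open>auto intro!: degree_diff_le degree_monom_le order.trans[OF degree_monom_le]\<close>)
  have ev: "(\<Prod>c\<in>C. z - c) = z ^ q - z" for z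
    using arg_cong[OF prod, of "\<lambda>p. poly p z"] by (simp add: poly_prod poly_monom)
  have shift: "(z + c) ^ q = z ^ q + c" if c: "c \<in> C" for z c
  proof -
    have "(\<Prod>b\<in>C. z + c - b) = (\<Prod>b\<in>C. z - b)"
      by (rule prod.reindex_bij_witness[of _ "\<lambda>b. b + c" "\<lambda>b. b - c"])
        (use diff uminus c in \<open>auto simp: algebra_simps dest: diff[OF _ uminus]\<close>)
    thus ?thesis unfolding ev by (simp add: algebra_simps)
  qed
  have "[:y, 1:] ^ q = Polynomial.monom 1 q + [:y ^ q:]"
  proof (rule poly_eqI_degree_lead_coeff[where n = q and A = C])
    have deg: "Polynomial.degree ([:y, 1:] ^ q) = q" by (simp add: degree_power_eq)
    thus "Polynomial.degree ([:y, 1:] ^ q) \<le> q" by simp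
    have "Polynomial.lead_coeff ([:y, 1:] ^ q) = 1" by (simp add: lead_coeff_power)
    thus "Polynomial.coeff ([:y, 1:] ^ q) q = Polynomial.coeff (Polynomial.monom 1 q + [:y ^ q:]) q"
      using deg q1 by (simp add: coeff_pCons split: nat.splits)
    show "poly ([:y, 1:] ^ q) z = poly (Polynomial.monom 1 q + [:y ^ q:]) z" if z: "z \<in> C" for z
      using shift[OF z, of y] Cq[OF z] by (simp add: poly_power poly_monom)
  qed (use card in \<open>auto intro!: degree_add_le degree_monom_le\<close>)
  from arg_cong[OF this, of "\<lambda>p. poly p x"] show ?thesis
    by (simp add: poly_power poly_monom q_def add.commute)
qed

lemma kbar_power_cards_add:
  "(x + y :: 'f::{field,finite} kbar) ^ (CARD('f) ^ i) = x ^ (CARD('f) ^ i) + y ^ (CARD('f) ^ i)"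
proof (induction i)
  case (Suc i)
  have "z ^ (CARD('f) ^ Suc i) = (z ^ (CARD('f) ^ i)) ^ CARD('f)" for z :: "'f kbar"
    by (simp add: mult.commute flip: power_mult)
  thus ?case using Suc by (simp only: kbar_power_card_add)
qed simp

lemma kbar_power_cards_sum:
  "(sum g I :: 'f::{field,finite} kbar) ^ (CARD('f) ^ i) = (\<Sum>j\<in>I. g j ^ (CARD('f) ^ i))"
  by (induction I rule: infinite_finite_induct) (auto simp: kbar_power_cards_add zero_power)

section \<open>Evaluation of twisted polynomials\<close>

lemma twisted_eval_le:
  fixes p :: "'f::{field,finite} kbar poly"
  assumes "Polynomial.degree p \<le> n"
  shows "twisted_eval p x = (\<Sum>i\<le>n. Polynomial.coeff p i * x ^ (CARD('f) ^ i))"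
  unfolding twisted_eval_def using assms by (intro sum.mono_neutral_left) (auto simp: coeff_eq_0)

lemma twisted_eval_add: "twisted_eval (p + r) x = twisted_eval p x + twisted_eval r x"
proof -
  define n where "n = max (Polynomial.degree p) (Polynomial.degree r)"
  have "Polynomial.degree (p + r) \<le> n" by (auto simp: n_def intro: degree_add_le)
  moreover have "Polynomial.degree p \<le> n" "Polynomial.degree r \<le> n" by (auto simp: n_def)
  ultimately show ?thesis by (simp add: twisted_eval_le[of _ n] sum.distrib distrib_right)
qed

lemma twisted_eval_0 [simp]: "twisted_eval 0 x = 0"
  by (simp add: twisted_eval_def)

lemma twisted_eval_1 [simp]: "twisted_eval 1 x = x"
  by (simp add: twisted_eval_def)

lemma twisted_eval_sum: "twisted_eval (sum g I) x = (\<Sum>i\<in>I. twisted_eval (g i) x)"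
  by (induction I rule: infinite_finite_induct) (auto simp: twisted_eval_add)

lemma twisted_eval_smult: "twisted_eval (Polynomial.smult c p) x = c * twisted_eval p x"
  by (subst twisted_eval_le[of _ "Polynomial.degree p"])
    (auto simp: twisted_eval_def degree_smult_le sum_distrib_left mult.assoc)

lemma twisted_eval_monom: "twisted_eval (Polynomial.monom c n) x = c * x ^ (CARD('f) ^ n)" for x :: "'f::{field,finite} kbar"
  by (subst twisted_eval_le[of _ n]) (auto simp: degree_monom_le if_distrib[of "\<lambda>c. c * _"] cong: if_cong)

lemma twisted_eval_mult:
  "twisted_eval (twisted_mult p r) x = twisted_eval p (twisted_eval r x)" for x :: "'f::{field,finite} kbar"
proof -
  let ?q = "CARD('f)"
  have "twisted_eval (twisted_mult p r) x
    = (\<Sum>i\<le>Polynomial.degree p. \<Sum>j\<le>Polynomial.degree r. Polynomial.coeff p i * Polynomial.coeff r j ^ (?q ^ i) * x ^ (?q ^ (i + j)))"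
    unfolding twisted_mult_def twisted_eval_sum twisted_eval_monom ..
  also have "\<dots> = (\<Sum>i\<le>Polynomial.degree p. Polynomial.coeff p i * (\<Sum>j\<le>Polynomial.degree r. (Polynomial.coeff r j * x ^ (?q ^ j)) ^ (?q ^ i)))"
    unfolding sum_distrib_left
    by (intro sum.cong refl) (simp add: power_mult_distrib power_add mult.commute mult.left_commute flip: power_mult)
  also have "\<dots> = twisted_eval p (twisted_eval r x)"
    unfolding twisted_eval_def[of p] twisted_eval_def[of r] kbar_power_cards_sum ..
  finally show ?thesis .
qed

section \<open>The action of polynomials on points\<close>

locale drinfeld =
  fixes d :: nat and \<Phi> :: "'f::{field,finite} poly \<Rightarrow> 'f kbar poly"
  assumes dm: "drinfeld_module d \<Phi>"
begin

definition act :: "'f poly \<Rightarrow> 'f kbar \<Rightarrow> 'f kbar" where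
  "act a x = twisted_eval (\<Phi> a) x"

lemma hom: "\<Phi> (a + b) = \<Phi> a + \<Phi> b" "\<Phi> (a * b) = twisted_mult (\<Phi> a) (\<Phi> b)" "\<Phi> 1 = 1"
proof -
  have h: "\<Phi> \<in> Ring.ring_hom ring_of_type_algebra twisted_ring" using dm by (simp add: drinfeld_module_def)
  show "\<Phi> (a + b) = \<Phi> a + \<Phi> b" using ring_hom_add[OF h, of a b]
    by (simp add: ring_of_type_algebra_def twisted_ring_def)
  show "\<Phi> (a * b) = twisted_mult (\<Phi> a) (\<Phi> b)" using ring_hom_mult[OF h, of a b]
    by (simp add: ring_of_type_algebra_def twisted_ring_def)
  show "\<Phi> 1 = 1" using ring_hom_one[OF h] by (simp add: ring_of_type_algebra_def twisted_ring_def)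
qed

lemma hom_smult: "\<Phi> (Polynomial.smult c a) = Polynomial.smult (embed_poly [:c:]) (\<Phi> a)"
  using dm by (simp add: drinfeld_module_def)

lemma act_add: "act (a + b) x = act a x + act b x"
  and act_mult: "act (a * b) x = act a (act b x)"
  and act_1 [simp]: "act 1 x = x"
  and act_smult: "act (Polynomial.smult c a) x = embed_poly [:c:] * act a x"
  by (simp_all add: act_def hom hom_smult twisted_eval_add twisted_eval_mult twisted_eval_smult)

lemma act_0 [simp]: "act 0 x = 0"
  using act_smult[of 0 0 x] by simp

lemma act_sum: "act (sum g I) x = (\<Sum>i\<in>I. act (g i) x)"
  by (induction I rule: infinite_finite_induct) (auto simp: act_add)

lemma act_expand: "act a x = (\<Sum>j\<le>Polynomial.degree a. embed_poly [:Polynomial.coeff a j:] * act (polyT ^ j) x)"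
proof -
  have "(\<Sum>j\<le>Polynomial.degree a. Polynomial.smult (Polynomial.coeff a j) (polyT ^ j)) = a"
    using poly_as_sum_of_monoms[of a] unfolding monom_altdef .
  from arg_cong[OF this, of "\<lambda>b. act b x", symmetric]
  show ?thesis unfolding act_sum act_smult .
qed

lemma degT: "Polynomial.degree (\<Phi> polyT) = d" and d_pos: "d \<ge> 1" and coeffT_0: "Polynomial.coeff (\<Phi> polyT) 0 = embed_poly polyT"
  using dm by (auto simp: drinfeld_module_def)

lemma act_T: "act polyT y = (\<Sum>i\<le>d. Polynomial.coeff (\<Phi> polyT) i * y ^ (CARD('f) ^ i))"
  unfolding act_def twisted_eval_def degT ..

lemma lead_nonzero: "Polynomial.coeff (\<Phi> polyT) d \<noteq> 0"
  using degT d_pos leading_coeff_0_iff[of "\<Phi> polyT"] by auto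

lemma act_inj:
  assumes "\<not> is_torsion \<Phi> x" "act a x = act b x" shows "a = b"
proof (rule ccontr)
  assume "a \<noteq> b"
  have "act (a - b + b) x = act (a - b) x + act b x" by (rule act_add)
  hence "act (a - b) x = 0" using assms(2) by simp
  moreover have "a - b \<noteq> 0" using \<open>a \<noteq> b\<close> by simp
  ultimately show False using assms(1) unfolding is_torsion_def act_def by blast
qed

end

section \<open>The canonical height\<close>

text \<open>The remaining errors after stage \<open>n\<close> add up to the geometric tail
  \<open>C / Q ^ n\<close> with \<open>C = h / (Q - 1)\<close>. Subtracting or adding the tail makes
  the sequence monotone. The bound \<open>C \<le> h\<close> comes from
  \<open>Q \<ge> 2\<close>.\<close>

lemma telescoping_limit:
  fixes u :: "nat \<Rightarrow> real" and Q h :: real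
  assumes Q: "Q \<ge> 2" and h: "h \<ge> 0"
    and up: "\<And>n. u (Suc n) \<le> u n + h / Q ^ Suc n" and lo: "\<And>n. u n \<le> u (Suc n) + h / Q ^ Suc n"
  shows "convergent u" "u 0 \<le> lim u + h"
proof -
  define C where "C = h / (Q - 1)"
  have C: "0 \<le> C" "C \<le> h" using Q h by (auto simp: C_def divide_le_eq mult_le_cancel_left1)
  have CQ: "C * Q = C + h" using Q by (simp add: C_def field_simps)
  have step: "C / Q ^ n = C / Q ^ Suc n + h / Q ^ Suc n" for n
  proof -
    have "C / Q ^ n = C * Q / Q ^ Suc n" using Q by simp
    thus ?thesis unfolding CQ by (simp add: add_divide_distrib)
  qed
  define w where "w n = u n - C / Q ^ n" for n
  define z where "z n = u n + C / Q ^ n" for n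
  have inc: "incseq w"
  proof (rule incseq_SucI)
    fix n show "w n \<le> w (Suc n)" using lo[of n] step[of n] by (simp add: w_def)
  qed
  have dec: "decseq z" 
  proof (rule decseq_SucI)
    fix n show "z (Suc n) \<le> z n" using up[of n] step[of n] by (simp add: z_def)
  qed
  have "w n \<le> z 0" for n
  proof -
    have "w n \<le> z n" using C Q by (simp add: w_def z_def)
    also have "z n \<le> z 0" using dec by (simp add: decseq_def)
    finally show ?thesis .
  qed
  then obtain L where L: "w \<longlonglongrightarrow> L" "\<forall>n. w n \<le> L" using incseq_convergent[OF inc] by blast
  have "(\<lambda>n. C * (1 / Q) ^ n) \<longlonglongrightarrow> C * 0"
    using Q by (intro tendsto_mult tendsto_const LIMSEQ_power_zero) auto
  hence "(\<lambda>n. C / Q ^ n) \<longlonglongrightarrow> 0" by (simp add: power_one_over)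
  from tendsto_add[OF L(1) this] have uL: "u \<longlonglongrightarrow> L" by (simp add: w_def)
  thus "convergent u" by (auto simp: convergent_def)
  have "w 0 \<le> L" using L(2) by blast
  thus "u 0 \<le> lim u + h" using limI[OF uL] C by (simp add: w_def)
qed

lemma lp_le_iff: assumes "B \<ge> 0" shows "lp s \<le> B \<longleftrightarrow> s \<le> exp B"
proof -
  have "ln (max 1 s) \<le> B \<longleftrightarrow> max 1 s \<le> exp B" 
    using ln_le_cancel_iff[of "max 1 s" "exp B"] by simp
  thus ?thesis using assms by (simp add: lp_def)
qed

lemma lp_exp: "lp s = B \<Longrightarrow> s \<le> exp B"
  using lp_le_iff[of "lp s" s] lp_nonneg[of s] by simp

lemma lp_inverse: "r > 0 \<Longrightarrow> lp (inverse r) = lp r - ln r"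
proof (cases "r \<ge> 1")
  case True
  hence "inverse r \<le> 1" by (simp add: inverse_le_1_iff)
  thus ?thesis using True by (simp add: lp_def max.absorb1 max.absorb2)
next
  case False
  assume "r > 0"
  hence "1 \<le> inverse r" using False by (simp add: one_le_inverse)
  thus ?thesis using False \<open>r > 0\<close> by (simp add: lp_def max.absorb1 max.absorb2 ln_inverse)
qed

section \<open>Local comparison of a point with its image\<close>

lemma twisted_local_upper:
  fixes q d :: nat
  assumes K: "subf K" and N: "absval K N" and a: "\<And>i. a i \<in> K" and y: "y \<in> K"
    and A: "\<And>i. i \<le> d \<Longrightarrow> lp (N (a i)) \<le> A" and q: "q \<ge> 1"
  shows "lp (N (\<Sum>i\<le>d. a i * y ^ (q ^ i))) \<le> A + real q ^ d * lp (N y)"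
proof -
  have A0: "A \<ge> 0" using A[of 0] lp_nonneg[of "N (a 0)"] by linarith
  have "N (\<Sum>i\<le>d. a i * y ^ (q ^ i)) \<le> exp (A + real q ^ d * lp (N y))"
  proof (rule av_sum_le[OF K N])
    fix i assume i: "i \<in> {..d}"
    show "a i * y ^ (q ^ i) \<in> K" using a y K by (intro subf_mult[OF K] subf_power[OF K]) auto
    have "N y ^ (q ^ i) \<le> exp (lp (N y)) ^ (q ^ i)"
      using av_nonneg[OF K N y] by (intro power_mono lp_exp[OF refl]) auto
    also have "\<dots> \<le> exp (lp (N y)) ^ (q ^ d)"
      using i q lp_nonneg by (intro power_increasing power_increasing) auto
    also have "\<dots> = exp (real q ^ d * lp (N y))" by (simp flip: exp_of_nat_mult)
    finally have "N (a i) * N y ^ (q ^ i) \<le> exp A * exp (real q ^ d * lp (N y))"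
      using A[of i] i A0 lp_le_iff[OF A0] av_nonneg[OF K N a] av_nonneg[OF K N y] by (intro mult_mono) auto
    thus "N (a i * y ^ (q ^ i)) \<le> exp (A + real q ^ d * lp (N y))"
      using a y by (simp add: av_mult[OF K N] av_power[OF K N] subf_power[OF K] exp_add)
  qed auto
  moreover have "A + real q ^ d * lp (N y) \<ge> 0" using A0 lp_nonneg by simp
  ultimately show ?thesis using lp_le_iff by blast
qed

text \<open>If \<open>y\<close> is large, the leading term strictly dominates and determines the
  value of the sum. Otherwise \<open>y\<close> is so small that the error term alone covers the left
  hand side.\<close>

lemma twisted_local_lower:
  fixes q d :: nat
  assumes K: "subf K" and N: "absval K N" and a: "\<And>i. a i \<in> K" and y: "y \<in> K"
    and A: "\<And>i. i \<le> d \<Longrightarrow> lp (N (a i)) \<le> A" and q: "q \<ge> 2" and d: "d \<ge> 1"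
    and B: "lp (N (inverse (a d))) \<le> B" and ad: "a d \<noteq> 0"
  shows "real q ^ d * lp (N y) \<le> lp (N (\<Sum>i\<le>d. a i * y ^ (q ^ i))) + 2 * (A + B)"
proof -
  have A0: "A \<ge> 0" using A[of 0] lp_nonneg[of "N (a 0)"] by linarith
  have B0: "B \<ge> 0" using B lp_nonneg[of "N (inverse (a d))"] by linarith
  define l where "l = lp (N y)"
  have l0: "l \<ge> 0" by (simp add: l_def lp_nonneg)
  \<comment> \<open>The second largest exponent is \<open>q ^ e\<close>, and
    \<open>q \<ge> 2\<close> makes \<open>q ^ e * l\<close> at most half of
    \<open>q ^ d * l\<close>. So if the two differ by at most \<open>A + B\<close>, the larger is at
    most \<open>2 * (A + B)\<close>; this is the origin of the factor 2.\<close>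
  obtain e where e: "d = Suc e" using d by (cases d) auto
  have "2 * real q ^ e \<le> real q ^ d" using q by (simp add: e)
  hence two: "2 * (real q ^ e * l) \<le> real q ^ d * l" using l0 by (metis mult.assoc mult_right_mono)
  show ?thesis
  proof (cases "real q ^ d * l - real q ^ e * l \<le> A + B")
    case True
    have "2 * b \<le> a \<Longrightarrow> a - b \<le> c \<Longrightarrow> a \<le> 2 * c" for a b c :: real by linarith
    from this[OF two True] have "real q ^ d * l \<le> 2 * (A + B)" .
    thus ?thesis using lp_nonneg[of "N (\<Sum>i\<le>d. a i * y ^ (q ^ i))"] by (simp add: l_def)
  next
    case False
    have lpos: "l > 0" 
    proof (rule ccontr)
      assume "\<not> l > 0"
      hence "l = 0" using l0 by simp
      thus False using False A0 B0 by simp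
    qed
    have Ny: "N y = exp l"
    proof -
      have "N y > 1" using lpos lp_eq_0[of "N y"] by (force simp: l_def)
      thus ?thesis by (simp add: l_def lp_def max_def)
    qed
    have Nyp: "N (y ^ (q ^ i)) = exp (real q ^ i * l)" for i
      using y by (simp add: av_power[OF K N] Ny flip: exp_of_nat_mult)
    have Kt: "a i * y ^ (q ^ i) \<in> K" for i using a y by (intro subf_mult[OF K] subf_power[OF K]) auto
    have Nt: "N (a i * y ^ (q ^ i)) = N (a i) * exp (real q ^ i * l)" for i
      using a y Nyp by (simp add: av_mult[OF K N] subf_power[OF K])
    have low: "N (\<Sum>i<d. a i * y ^ (q ^ i)) \<le> exp (A + real q ^ e * l)"
    proof (rule av_sum_le[OF K N Kt])
      fix i assume i: "i \<in> {..<d}"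
      have "real q ^ i * l \<le> real q ^ e * l" using i e q l0 by (intro mult_right_mono power_increasing) auto
      hence "N (a i) * exp (real q ^ i * l) \<le> exp A * exp (real q ^ e * l)"
        using A[of i] i lp_le_iff[OF A0] av_nonneg[OF K N a] by (intro mult_mono) auto
      thus "N (a i * y ^ (q ^ i)) \<le> exp (A + real q ^ e * l)" unfolding Nt by (simp add: exp_add)
    qed auto
    have Nd: "N (a d) > 0" using av_pos[OF K N a ad] .
    have "inverse (N (a d)) \<le> exp B" using B lp_le_iff[OF B0] a by (simp add: av_inverse[OF K N])
    from le_imp_inverse_le[OF this] have "exp (- B) \<le> N (a d)" using Nd by (simp add: exp_minus)
    hence "exp (- B) * exp (real q ^ d * l) \<le> N (a d * y ^ (q ^ d))"
      unfolding Nt by (intro mult_right_mono) auto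
    hence top: "exp (real q ^ d * l - B) \<le> N (a d * y ^ (q ^ d))" by (simp flip: exp_add)
    have "exp (A + real q ^ e * l) < exp (real q ^ d * l - B)" using False by simp
    hence lt: "N (\<Sum>i<d. a i * y ^ (q ^ i)) < N (a d * y ^ (q ^ d))" using low top by linarith
    have "N (\<Sum>i\<le>d. a i * y ^ (q ^ i)) = N (a d * y ^ (q ^ d))"
      using av_add_eq[OF K N _ _ lt] Kt subf_sum[OF K, of "{..<d}"] by (simp flip: lessThan_Suc_atMost)
    hence ge: "exp (real q ^ d * l - B) \<le> N (\<Sum>i\<le>d. a i * y ^ (q ^ i))" using top by simp
    have "real q ^ d * l - B \<le> lp (N (\<Sum>i\<le>d. a i * y ^ (q ^ i)))"
      using order.trans[OF ge lp_exp[OF refl]] by simp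
    thus ?thesis using A0 B0 by (simp add: l_def)
  qed
qed

context height_setup
begin

text \<open>The value \<open>r\<close> of a constant satisfies \<open>r ^ CARD('f) = r\<close>,
  which no \<open>r > 1\<close> does.\<close>

lemma nv_const: 
  assumes "v \<in> base_places" "\<zeta> \<in> rts" shows "nv v \<zeta> (embed_poly [:c :: 'f:]) \<le> 1"
proof (rule ccontr)
  define r where "r = nv v \<zeta> (embed_poly [:c:])"
  assume "\<not> nv v \<zeta> (embed_poly [:c:]) \<le> 1"
  hence r: "r > 1" by (simp add: r_def)
  have K: "embed_poly [:c:] \<in> Kbig" by (simp add: embed_poly_def subf_Kbig)
  have "r ^ CARD('f) = r"
    using av_power[OF subf_Kbig nv_absval[OF assms] K, of "CARD('f)"] embed_const_power_card[of c] by (simp add: r_def)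
  moreover have "CARD('f) > 1" using card_mono[of UNIV "{0, 1 :: 'f}"] by simp
  ultimately show False using power_strict_increasing[of 1 "CARD('f)" r] r by simp
qed

end

text \<open>One finite set \<open>S\<close> serves for all points considered: outside it the
  coefficients of \<open>\<Phi>\<close> are integral and the leading one is a unit, so heights
  become finite sums over \<open>S\<close>.\<close>

locale drinfeld_heights = height_setup f \<eta> e P T + drinfeld d \<Phi>
  for f :: "'f::{field,finite} poly fract poly" and \<eta> e P T d and \<Phi> :: "'f poly \<Rightarrow> 'f kbar poly" +
  fixes S :: "('f poly fract \<Rightarrow> ereal) set" and Q :: real
  assumes Q_eq: "Q = real CARD('f) ^ d" and coeffs_Kbig: "Polynomial.coeff (\<Phi> polyT) i \<in> Kbig"
    and S: "finite S" "S \<subseteq> base_places"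
    and good_coeff: "v \<in> base_places - S \<Longrightarrow> \<zeta> \<in> rts \<Longrightarrow> nv v \<zeta> (Polynomial.coeff (\<Phi> polyT) i) \<le> 1"
    and good_lead: "v \<in> base_places - S \<Longrightarrow> \<zeta> \<in> rts \<Longrightarrow> nv v \<zeta> (Polynomial.coeff (\<Phi> polyT) d) = 1"
begin

abbreviation "hh \<equiv> module_height \<Phi>"

lemma q2: "CARD('f) \<ge> 2"
  using card_mono[of UNIV "{0, 1 :: 'f}"] by simp

lemma Q2: "Q \<ge> 2"
proof -
  have "real CARD('f) ^ 1 \<le> real CARD('f) ^ d" using d_pos q2 by (intro power_increasing) auto
  hence "real CARD('f) \<le> Q" unfolding Q_eq by (simp only: power_one_right)
  thus ?thesis using q2 by linarith
qed

text \<open>The S-integers of \<open>Kbig\<close>. They are stable under the action of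
  \<open>\<Phi>\<close>, so the whole orbit of a point is covered by the same
  \<open>S\<close>.\<close>

definition good :: "'f kbar set" where
  "good = {y\<in>Kbig. \<forall>v\<in>base_places - S. \<forall>\<zeta>\<in>rts. nv v \<zeta> y \<le> 1}"

text \<open>On \<open>good\<close> this is the Weil height; elsewhere in \<open>Kbig\<close> it only
  collects the places in \<open>S\<close>, which is enough for the inequalities below.\<close>

definition H :: "'f kbar \<Rightarrow> real" where
  "H y = (\<Sum>v\<in>S. \<Sum>\<zeta>\<in>rts. lp (nv v \<zeta> y)) / real (card rts)"

lemma goodD: "y \<in> good \<Longrightarrow> y \<in> Kbig"
  by (simp add: good_def)

lemma good_add: assumes "y \<in> good" "z \<in> good" shows "y + z \<in> good"
proof -
  have "nv v \<zeta> (y + z) \<le> 1" if v: "v \<in> base_places - S" "\<zeta> \<in> rts" for v \<zeta>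
  proof -
    have N: "absval Kbig (nv v \<zeta>)" using v nv_absval by blast
    have "nv v \<zeta> y \<le> 1" "nv v \<zeta> z \<le> 1" using assms v unfolding good_def by auto
    thus ?thesis using av_add[OF subf_Kbig N goodD goodD, OF assms] by linarith
  qed
  thus ?thesis using assms subf_add[OF subf_Kbig] by (auto simp: good_def)
qed

lemma good_mult: assumes "y \<in> good" "z \<in> good" shows "y * z \<in> good"
proof -
  have "nv v \<zeta> (y * z) \<le> 1" if v: "v \<in> base_places - S" "\<zeta> \<in> rts" for v \<zeta>
  proof -
    have N: "absval Kbig (nv v \<zeta>)" using v nv_absval by blast
    have yz: "y \<in> Kbig" "z \<in> Kbig" using assms goodD by auto
    have "nv v \<zeta> y \<le> 1" "nv v \<zeta> z \<le> 1" using assms v unfolding good_def by auto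
    thus ?thesis using av_mult[OF subf_Kbig N yz] av_nonneg[OF subf_Kbig N yz(1)] av_nonneg[OF subf_Kbig N yz(2)]
      by (simp add: mult_le_one)
  qed
  thus ?thesis using assms subf_mult[OF subf_Kbig] by (auto simp: good_def)
qed

lemma good_const: "embed_poly [:c:] \<in> good"
  using nv_const by (auto simp: good_def embed_poly_def subf_Kbig)

lemma good_0: "0 \<in> good" and good_1: "1 \<in> good"
  using good_const[of 0] good_const[of 1] by (simp_all flip: one_pCons)

lemma good_sum: "(\<And>i. i \<in> I \<Longrightarrow> g i \<in> good) \<Longrightarrow> sum g I \<in> good"
  by (induction I rule: infinite_finite_induct) (auto intro: good_0 good_add)

lemma good_power: "y \<in> good \<Longrightarrow> y ^ n \<in> good"
  by (induction n) (auto intro: good_1 good_mult)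

lemma good_act_T: "y \<in> good \<Longrightarrow> act polyT y \<in> good"
proof -
  assume y: "y \<in> good"
  have "Polynomial.coeff (\<Phi> polyT) i \<in> good" for i using coeffs_Kbig good_coeff by (auto simp: good_def)
  thus ?thesis unfolding act_T by (intro good_sum good_mult good_power y)
qed

lemma good_act_T_power: "y \<in> good \<Longrightarrow> act (polyT ^ n) y \<in> good"
proof (induction n)
  case (Suc n)
  show ?case unfolding power_Suc act_mult by (intro good_act_T Suc)
qed simp

lemma good_act: "y \<in> good \<Longrightarrow> act a y \<in> good"
  by (subst act_expand) (intro good_sum good_mult good_const good_act_T_power)

lemma nvS: "v \<in> S \<Longrightarrow> \<zeta> \<in> rts \<Longrightarrow> absval Kbig (nv v \<zeta>)"
  using S(2) nv_absval by blast

section \<open>Global height inequalities\<close>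

lemma H_nonneg: "H y \<ge> 0"
  unfolding H_def by (intro divide_nonneg_nonneg sum_nonneg lp_nonneg) auto

lemma H_add: assumes "y \<in> Kbig" "z \<in> Kbig" shows "H (y + z) \<le> H y + H z"
proof -
  have "lp (nv v \<zeta> (y + z)) \<le> lp (nv v \<zeta> y) + lp (nv v \<zeta> z)" if "v \<in> S" "\<zeta> \<in> rts" for v \<zeta>
  proof -
    have "lp (nv v \<zeta> (y + z)) \<le> max (lp (nv v \<zeta> y)) (lp (nv v \<zeta> z))"
      using lp_mono[OF av_add[OF subf_Kbig nvS[OF that] assms]] by (simp add: lp_max)
    thus ?thesis using lp_nonneg[of "nv v \<zeta> y"] lp_nonneg[of "nv v \<zeta> z"] by linarith
  qed
  hence "(\<Sum>v\<in>S. \<Sum>\<zeta>\<in>rts. lp (nv v \<zeta> (y + z))) \<le> (\<Sum>v\<in>S. \<Sum>\<zeta>\<in>rts. lp (nv v \<zeta> y) + lp (nv v \<zeta> z))"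
    by (intro sum_mono) auto
  thus ?thesis unfolding H_def by (simp add: sum.distrib divide_right_mono flip: add_divide_distrib)
qed

lemma H_const_mult: assumes "y \<in> Kbig" shows "H (embed_poly [:c:] * y) \<le> H y"
proof -
  have "lp (nv v \<zeta> (embed_poly [:c:] * y)) \<le> lp (nv v \<zeta> y)" if v: "v \<in> S" "\<zeta> \<in> rts" for v \<zeta>
  proof (rule lp_mono)
    have c: "embed_poly [:c:] \<in> Kbig" by (simp add: embed_poly_def subf_Kbig)
    have "nv v \<zeta> (embed_poly [:c:] * y) = nv v \<zeta> (embed_poly [:c:]) * nv v \<zeta> y"
      using av_mult[OF subf_Kbig nvS[OF v] c assms] .
    also have "\<dots> \<le> 1 * nv v \<zeta> y"
      using v S(2) nv_const av_nonneg[OF subf_Kbig nvS[OF v] assms] by (intro mult_right_mono) auto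
    finally show "nv v \<zeta> (embed_poly [:c:] * y) \<le> nv v \<zeta> y" by simp
  qed
  thus ?thesis unfolding H_def by (intro divide_right_mono sum_mono) auto
qed

lemma H_0: "H 0 = 0"
  unfolding H_def using av_0[OF subf_Kbig nvS] by (simp add: lp_def)

lemma H_sum: "(\<And>i. i \<in> I \<Longrightarrow> g i \<in> Kbig) \<Longrightarrow> H (sum g I) \<le> (\<Sum>i\<in>I. H (g i))"
proof (induction I rule: infinite_finite_induct)
  case (insert i I)
  have "H (g i + sum g I) \<le> H (g i) + H (sum g I)"
    using insert by (intro H_add subf_sum[OF subf_Kbig]) auto
  thus ?case using insert by simp
qed (auto simp: H_0)

lemma coeff_field_sub: "coeff_field \<Phi> \<subseteq> Kbig"
  unfolding coeff_field_def using coeffs_Kbig by (intro adjoin_min subf_Kbig) auto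

lemma coeff_in_coeff_field: "Polynomial.coeff (\<Phi> polyT) i \<in> coeff_field \<Phi>"
proof (cases "i = 0 \<or> i > d")
  case True
  thus ?thesis using subf_adjoin subf_to_ac[OF subf_adjoin] subf_0[OF subf_adjoin]
    by (auto simp: coeffT_0 embed_poly_def coeff_field_def coeff_eq_0 degT)
next
  case False
  hence "Polynomial.coeff (\<Phi> polyT) i \<in> Polynomial.coeff (\<Phi> polyT) ` {1..Polynomial.degree (\<Phi> polyT)}"
    by (auto simp: degT)
  thus ?thesis using adjoin_incl unfolding coeff_field_def by blast
qed

lemma hh_eq: "hh = (\<Sum>v\<in>S. \<Sum>\<zeta>\<in>rts. loc (coeffs (\<Phi> polyT)) v \<zeta>) / real (card rts)"
  unfolding module_height_def
proof (rule height_in_eq[OF _ coeff_field_sub _ S])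
  show "subf (coeff_field \<Phi>)" by (simp add: coeff_field_def subf_adjoin)
  have ex: "\<exists>i. y = Polynomial.coeff (\<Phi> polyT) i" if "y \<in> set (coeffs (\<Phi> polyT))" for y
    using that by (auto simp: coeffs_def split: if_splits)
  show "set (coeffs (\<Phi> polyT)) \<subseteq> coeff_field \<Phi>" using ex coeff_in_coeff_field by blast
  fix v \<zeta> y assume "v \<in> base_places - S" "\<zeta> \<in> rts" "y \<in> set (coeffs (\<Phi> polyT))"
  thus "nv v \<zeta> y \<le> 1" using ex good_coeff by blast
qed

lemma lp_le_loc: "i \<le> d \<Longrightarrow> lp (nv v \<zeta> (Polynomial.coeff (\<Phi> polyT) i)) \<le> loc (coeffs (\<Phi> polyT)) v \<zeta>"
proof -
  assume "i \<le> d"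
  hence "Polynomial.coeff (\<Phi> polyT) i \<in> set (coeffs (\<Phi> polyT))"
    using coeff_in_coeffs[of "\<Phi> polyT" i] degT lead_nonzero by (metis coeff_0)
  thus ?thesis unfolding loc_def by (intro Max_ge) auto
qed

lemma H_upper: assumes "y \<in> Kbig" shows "H (act polyT y) \<le> Q * H y + hh"
proof -
  have up: "lp (nv v \<zeta> (act polyT y)) \<le> loc (coeffs (\<Phi> polyT)) v \<zeta> + Q * lp (nv v \<zeta> y)"
    if "v \<in> S" "\<zeta> \<in> rts" for v \<zeta>
    unfolding act_T Q_eq
    by (rule twisted_local_upper[OF subf_Kbig nvS[OF that] _ assms])
      (use q2 in \<open>auto intro: coeffs_Kbig lp_le_loc\<close>)
  have "(\<Sum>v\<in>S. \<Sum>\<zeta>\<in>rts. lp (nv v \<zeta> (act polyT y))) \<le> (\<Sum>v\<in>S. \<Sum>\<zeta>\<in>rts. loc (coeffs (\<Phi> polyT)) v \<zeta> + Q * lp (nv v \<zeta> y))"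
    by (intro sum_mono up)
  hence "H (act polyT y) \<le> (\<Sum>v\<in>S. \<Sum>\<zeta>\<in>rts. loc (coeffs (\<Phi> polyT)) v \<zeta> + Q * lp (nv v \<zeta> y)) / real (card rts)"
    unfolding H_def by (intro divide_right_mono) auto
  also have "\<dots> = Q * H y + hh"
    unfolding H_def hh_eq sum.distrib sum_distrib_left[symmetric] by (simp add: add_divide_distrib)
  finally show ?thesis .
qed

text \<open>The local estimate also involves the inverse of the leading coefficient. By the product
  formula its total contribution equals that of the leading coefficient, which is at most
  \<open>hh\<close>; the factor 2 of the local estimate then makes \<open>4 * hh\<close>.\<close>

lemma H_lower: assumes "y \<in> Kbig" shows "Q * H y \<le> H (act polyT y) + 4 * hh"
proof -
  let ?b = "Polynomial.coeff (\<Phi> polyT) d"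
  let ?L = "loc (coeffs (\<Phi> polyT))"
  have low: "Q * lp (nv v \<zeta> y) \<le> lp (nv v \<zeta> (act polyT y)) + 2 * (?L v \<zeta> + lp (nv v \<zeta> (inverse ?b)))"
    if "v \<in> S" "\<zeta> \<in> rts" for v \<zeta>
    unfolding act_T Q_eq
    by (rule twisted_local_lower[OF subf_Kbig nvS[OF that] _ assms _ q2 d_pos order.refl])
      (auto intro: coeffs_Kbig lp_le_loc simp: lead_nonzero)
  have "(\<Sum>v\<in>S. \<Sum>\<zeta>\<in>rts. Q * lp (nv v \<zeta> y)) \<le> (\<Sum>v\<in>S. \<Sum>\<zeta>\<in>rts. lp (nv v \<zeta> (act polyT y)) + 2 * (?L v \<zeta> + lp (nv v \<zeta> (inverse ?b))))"
    by (intro sum_mono low)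
  also have "\<dots> = (\<Sum>v\<in>S. \<Sum>\<zeta>\<in>rts. lp (nv v \<zeta> (act polyT y))) + 2 * ((\<Sum>v\<in>S. \<Sum>\<zeta>\<in>rts. ?L v \<zeta>) + (\<Sum>v\<in>S. \<Sum>\<zeta>\<in>rts. lp (nv v \<zeta> (inverse ?b))))"
    unfolding sum.distrib sum_distrib_left[symmetric] ..
  also have "(\<Sum>v\<in>S. \<Sum>\<zeta>\<in>rts. lp (nv v \<zeta> (inverse ?b))) = (\<Sum>v\<in>S. \<Sum>\<zeta>\<in>rts. lp (nv v \<zeta> ?b) - ln (nv v \<zeta> ?b))"
    using av_inverse[OF subf_Kbig nvS coeffs_Kbig] lp_inverse av_pos[OF subf_Kbig nvS coeffs_Kbig lead_nonzero]
    by (intro sum.cong) auto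
  also have "\<dots> = (\<Sum>v\<in>S. \<Sum>\<zeta>\<in>rts. lp (nv v \<zeta> ?b))"
    using product_formula_ext[OF coeffs_Kbig lead_nonzero S good_lead] unfolding sum_subtractf by simp
  finally have le: "(\<Sum>v\<in>S. \<Sum>\<zeta>\<in>rts. Q * lp (nv v \<zeta> y)) \<le> (\<Sum>v\<in>S. \<Sum>\<zeta>\<in>rts. lp (nv v \<zeta> (act polyT y)))
      + 2 * ((\<Sum>v\<in>S. \<Sum>\<zeta>\<in>rts. ?L v \<zeta>) + (\<Sum>v\<in>S. \<Sum>\<zeta>\<in>rts. lp (nv v \<zeta> ?b)))" .
  have le2: "(\<Sum>v\<in>S. \<Sum>\<zeta>\<in>rts. lp (nv v \<zeta> ?b)) \<le> (\<Sum>v\<in>S. \<Sum>\<zeta>\<in>rts. ?L v \<zeta>)" by (intro sum_mono lp_le_loc) auto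
  have arith: "a \<le> b + 2 * (c + g) \<Longrightarrow> g \<le> c \<Longrightarrow> a \<le> b + 4 * c" for a b c g :: real
    unfolding distrib_left by linarith
  from le le2 have "Q * (\<Sum>v\<in>S. \<Sum>\<zeta>\<in>rts. lp (nv v \<zeta> y)) \<le> (\<Sum>v\<in>S. \<Sum>\<zeta>\<in>rts. lp (nv v \<zeta> (act polyT y))) + 4 * (\<Sum>v\<in>S. \<Sum>\<zeta>\<in>rts. ?L v \<zeta>)"
    unfolding sum_distrib_left[symmetric] by (rule arith)
  from divide_right_mono[OF this, of "real (card rts)"] show ?thesis
    unfolding H_def hh_eq by (simp add: add_divide_distrib)
qed

lemma hh_nonneg: "hh \<ge> 0"
  using H_upper[of 0] H_nonneg[of "act polyT 0"] subf_0[OF subf_Kbig] H_0 by simp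

lemma weil_height_eq: assumes "z \<in> good" shows "weil_height [z] = H z"
proof -
  have l: "loc [z] v \<zeta> = lp (nv v \<zeta> z)" for v \<zeta> using lp_nonneg by (simp add: loc_def max_def)
  have "adjoin {z} \<subseteq> Kbig" using goodD[OF assms] by (intro adjoin_min subf_Kbig) auto
  hence "height_in (adjoin {z}) [z] = (\<Sum>v\<in>S. \<Sum>\<zeta>\<in>rts. loc [z] v \<zeta>) / real (card rts)"
    using assms adjoin_incl[of "{z}"] by (intro height_in_eq[OF subf_adjoin _ _ S]) (auto simp: good_def)
  thus ?thesis unfolding l H_def weil_height_def by simp
qed

lemma canonical_height_bounds:
  assumes y: "y \<in> good"
  shows "(\<lambda>n. H (act (polyT ^ n) y) / Q ^ n) \<longlonglongrightarrow> canonical_height \<Phi> y"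
    and "H y \<le> canonical_height \<Phi> y + 4 * hh"
proof -
  define u where "u n = H (act (polyT ^ n) y) / Q ^ n" for n
  have eq: "canonical_height \<Phi> y = lim u"
    unfolding canonical_height_def degT u_def power_mult Q_eq
    using weil_height_eq[OF good_act_T_power[OF y]] by (simp add: act_def)
  have Kb: "act (polyT ^ n) y \<in> Kbig" for n using goodD good_act_T_power[OF y] by blast
  have S: "act (polyT ^ Suc n) y = act polyT (act (polyT ^ n) y)" for n by (simp only: power_Suc act_mult)
  have Qp: "Q ^ n > 0" for n using Q2 by simp
  have qq: "Q * r / Q ^ Suc n = r / Q ^ n" for r n using Q2 by simp
  \<comment> \<open>\<open>H_upper\<close> gives \<open>hh\<close> here; it is weakened to
    \<open>4 * hh\<close> so that both directions have the same error in
    \<open>telescoping_limit\<close>.\<close>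
  have up: "u (Suc n) \<le> u n + 4 * hh / Q ^ Suc n" for n
  proof -
    have "H (act (polyT ^ Suc n) y) \<le> Q * H (act (polyT ^ n) y) + 4 * hh"
      using H_upper[OF Kb, of n] hh_nonneg unfolding S by linarith
    hence "H (act (polyT ^ Suc n) y) / Q ^ Suc n \<le> (Q * H (act (polyT ^ n) y) + 4 * hh) / Q ^ Suc n"
      using Qp[of "Suc n"] by (intro divide_right_mono) auto
    thus ?thesis unfolding u_def add_divide_distrib qq .
  qed
  have lo: "u n \<le> u (Suc n) + 4 * hh / Q ^ Suc n" for n
  proof -
    have "Q * H (act (polyT ^ n) y) \<le> H (act (polyT ^ Suc n) y) + 4 * hh"
      using H_lower[OF Kb, of n] unfolding S .
    hence "Q * H (act (polyT ^ n) y) / Q ^ Suc n \<le> (H (act (polyT ^ Suc n) y) + 4 * hh) / Q ^ Suc n"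
      using Qp[of "Suc n"] by (intro divide_right_mono) auto
    thus ?thesis unfolding u_def add_divide_distrib qq .
  qed
  have "4 * hh \<ge> 0" using hh_nonneg by simp
  note t = telescoping_limit[OF Q2 this up lo]
  show "u \<longlonglongrightarrow> canonical_height \<Phi> y" unfolding eq using t(1) convergent_LIMSEQ_iff by blast
  have "u 0 = H y" by (simp add: u_def)
  show "H y \<le> canonical_height \<Phi> y + 4 * hh" using t(2) unfolding eq \<open>u 0 = H y\<close> .
qed

lemma canonical_height_nonneg: "y \<in> good \<Longrightarrow> canonical_height \<Phi> y \<ge> 0"
  using canonical_height_bounds(1)[of y] H_nonneg Q2 by (intro LIMSEQ_le_const[of _ "canonical_height \<Phi> y"]) auto

text \<open>The power \<open>polyT ^ n\<close> commutes with \<open>a\<close>, and multiplication by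
  constants does not increase the height. Expanding \<open>a\<close> in powers of T bounds stage
  \<open>n\<close> by the sum of the stages \<open>n + j\<close>, each of which contributes
  \<open>Q ^ j\<close> times the canonical height in the limit.\<close>

lemma canonical_height_act:
  assumes y: "y \<in> good"
  shows "canonical_height \<Phi> (act a y) \<le> (\<Sum>j\<le>Polynomial.degree a. Q ^ j) * canonical_height \<Phi> y"
proof (rule LIMSEQ_le[OF canonical_height_bounds(1)[OF good_act[OF y]]])
  define u where "u n = H (act (polyT ^ n) y) / Q ^ n" for n
  have u: "u \<longlonglongrightarrow> canonical_height \<Phi> y" unfolding u_def by (rule canonical_height_bounds(1)[OF y])
  have "(\<lambda>n. \<Sum>j\<le>Polynomial.degree a. Q ^ j * u (n + j)) \<longlonglongrightarrow> (\<Sum>j\<le>Polynomial.degree a. Q ^ j * canonical_height \<Phi> y)"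
    by (intro tendsto_sum tendsto_mult tendsto_const LIMSEQ_ignore_initial_segment u)
  thus "(\<lambda>n. \<Sum>j\<le>Polynomial.degree a. Q ^ j * u (n + j)) \<longlonglongrightarrow> (\<Sum>j\<le>Polynomial.degree a. Q ^ j) * canonical_height \<Phi> y"
    by (simp add: sum_distrib_right)
  have "H (act (polyT ^ n) (act a y)) / Q ^ n \<le> (\<Sum>j\<le>Polynomial.degree a. Q ^ j * u (n + j))" for n
  proof -
    have Kb: "act (polyT ^ m) y \<in> Kbig" for m using goodD good_act_T_power[OF y] by blast
    have eq: "act (polyT ^ n) (act a y) = (\<Sum>j\<le>Polynomial.degree a. embed_poly [:Polynomial.coeff a j:] * act (polyT ^ (n + j)) y)"
    proof -
      have "act (polyT ^ n) (act a y) = act a (act (polyT ^ n) y)" by (metis act_mult mult.commute)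
      also have "\<dots> = (\<Sum>j\<le>Polynomial.degree a. embed_poly [:Polynomial.coeff a j:] * act (polyT ^ (n + j)) y)"
        unfolding act_expand[of a] by (simp only: power_add mult.commute[of "polyT ^ n"] act_mult)
      finally show ?thesis .
    qed
    have ck: "embed_poly [:c:] \<in> Kbig" for c :: 'f by (simp add: embed_poly_def subf_Kbig)
    have "H (act (polyT ^ n) (act a y)) \<le> (\<Sum>j\<le>Polynomial.degree a. H (embed_poly [:Polynomial.coeff a j:] * act (polyT ^ (n + j)) y))"
      unfolding eq by (intro H_sum subf_mult[OF subf_Kbig] ck Kb)
    also have "\<dots> \<le> (\<Sum>j\<le>Polynomial.degree a. H (act (polyT ^ (n + j)) y))"
      by (intro sum_mono H_const_mult Kb)
    finally have "H (act (polyT ^ n) (act a y)) / Q ^ n \<le> (\<Sum>j\<le>Polynomial.degree a. H (act (polyT ^ (n + j)) y)) / Q ^ n"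
      using Q2 by (intro divide_right_mono) auto
    also have "\<dots> = (\<Sum>j\<le>Polynomial.degree a. Q ^ j * u (n + j))"
      unfolding sum_divide_distrib u_def using Q2 by (intro sum.cong) (auto simp: power_add)
    finally show ?thesis .
  qed
  thus "\<exists>N. \<forall>n\<ge>N. H (act (polyT ^ n) (act a y)) / Q ^ n \<le> (\<Sum>j\<le>Polynomial.degree a. Q ^ j * u (n + j))" by blast
qed

lemma act_height_bound:
  assumes y: "y \<in> good" and n: "Polynomial.degree a \<le> n"
  shows "H (act a y) \<le> 2 * Q ^ n * canonical_height \<Phi> y + 4 * hh"
proof -
  \<comment> \<open>As \<open>Q \<ge> 2\<close>, a geometric sum is at most twice its last term;
    hence the factor 2 in the bound.\<close>
  have geom: "(\<Sum>j\<le>m. Q ^ j) \<le> 2 * Q ^ m" for m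
  proof (induction m)
    case (Suc m)
    have "2 * Q ^ m \<le> Q * Q ^ m" using Q2 by (intro mult_right_mono) auto
    thus ?case using Suc by simp
  qed simp
  have "(\<Sum>j\<le>Polynomial.degree a. Q ^ j) \<le> 2 * Q ^ n"
    using geom[of "Polynomial.degree a"] power_increasing[OF n, of Q] Q2 by linarith
  hence "(\<Sum>j\<le>Polynomial.degree a. Q ^ j) * canonical_height \<Phi> y \<le> 2 * Q ^ n * canonical_height \<Phi> y"
    using canonical_height_nonneg[OF y] by (intro mult_right_mono)
  thus ?thesis using canonical_height_act[OF y, of a] canonical_height_bounds(2)[OF good_act[OF y], of a] by linarith
qed

end

section \<open>Counting points of bounded degree and height\<close>

text \<open>The easy half of Gauss's lemma: multiplying by a linear factor with root
  \<open>z\<close> enlarges the coefficients at most by the factor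
  \<open>max 1 (N z)\<close>.\<close>

lemma coeff_le_roots:
  fixes p :: "'k::field alg_closure poly"
  assumes N: "absval UNIV N" and p: "Polynomial.lead_coeff p = 1"
  shows "N (Polynomial.coeff p j) \<le> exp (\<Sum>z\<in>#proots p. lp (N z))"
  using p
proof (induction "Polynomial.degree p" arbitrary: p j)
  case 0
  hence p1: "p = 1" using monic_degree_0 by metis
  have "N (Polynomial.coeff p j) \<le> 1"
    using av_0[OF subf_UNIV N] av_1[OF subf_UNIV N] by (cases "j = 0") (auto simp: p1)
  thus ?case by (simp add: p1)
next
  case (Suc n)
  have "Polynomial.degree p > 0" using Suc.hyps(2) by simp
  then obtain z where "poly p z = 0" using alg_closed_imp_poly_has_root by blast
  then obtain r where pr: "p = [:- z, 1:] * r" using poly_eq_0_iff_dvd by (metis dvdE)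
  have r0: "r \<noteq> 0" using pr Suc.prems by auto
  have dr: "Polynomial.degree r = n"
    using Suc.hyps(2) r0 unfolding pr by (subst (asm) degree_mult_eq) auto
  have lr: "Polynomial.lead_coeff r = 1" using Suc.prems unfolding pr lead_coeff_mult by simp
  define B where "B = (\<Sum>z\<in>#proots r. lp (N z))"
  have IH: "N (Polynomial.coeff r i) \<le> exp B" for i using Suc.hyps(1)[OF dr[symmetric] lr] by (simp add: B_def)
  have roots: "(\<Sum>z\<in>#proots p. lp (N z)) = lp (N z) + B"
    unfolding pr using r0 by (subst proots_mult) (auto simp: B_def)
  have l0: "lp (N z) \<ge> 0" by (rule lp_nonneg)
  define a where "a = (case j of 0 \<Rightarrow> 0 | Suc i \<Rightarrow> Polynomial.coeff r i)"
  have c: "Polynomial.coeff p j = a + - (z * Polynomial.coeff r j)"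
    by (simp add: pr a_def coeff_pCons split: nat.split)
  have "N a \<le> exp B" using IH av_0[OF subf_UNIV N] by (auto simp: a_def split: nat.split)
  also have "\<dots> \<le> exp (lp (N z) + B)" using l0 by simp
  finally have 1: "N a \<le> exp (lp (N z) + B)" .
  have "N (- (z * Polynomial.coeff r j)) = N z * N (Polynomial.coeff r j)"
    using av_uminus[OF subf_UNIV N] av_mult[OF subf_UNIV N] by simp
  also have "\<dots> \<le> exp (lp (N z)) * exp B"
    using IH av_nonneg[OF subf_UNIV N] by (intro mult_mono lp_exp[OF refl]) auto
  finally have 2: "N (- (z * Polynomial.coeff r j)) \<le> exp (lp (N z) + B)" by (simp add: exp_add)
  show ?case unfolding roots c using av_add[OF subf_UNIV N, of a "- (z * Polynomial.coeff r j)"] 1 2 by simp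
qed

lemma card_bounded_polys:
  "finite {p :: 'f::{field,finite} poly. Polynomial.degree p \<le> m}"
  "card {p :: 'f::{field,finite} poly. Polynomial.degree p \<le> m} = CARD('f) ^ (m + 1)"
proof -
  let ?A = "{p :: 'f poly. Polynomial.degree p \<le> m}" and ?B = "{..m} \<rightarrow>\<^sub>E (UNIV :: 'f set)"
  have bij: "bij_betw (\<lambda>p. restrict (Polynomial.coeff p) {..m}) ?A ?B"
  proof (rule bij_betw_byWitness[where f' = "\<lambda>g. \<Sum>i\<le>m. Polynomial.monom (g i) i"])
    have mon: "Polynomial.degree (\<Sum>i\<le>m. Polynomial.monom (g i) i) \<le> m" for g :: "nat \<Rightarrow> 'f"
      by (intro degree_sum_le) (auto intro: order.trans[OF degree_monom_le])
    have co: "Polynomial.coeff (\<Sum>i\<le>m. Polynomial.monom (g i) i) j = (if j \<le> m then g j else 0)" for g :: "nat \<Rightarrow> 'f" and j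
      by (simp add: coeff_sum)
    show "\<forall>p\<in>?A. (\<Sum>i\<le>m. Polynomial.monom (restrict (Polynomial.coeff p) {..m} i) i) = p"
      by (intro ballI poly_eqI, subst co) (auto simp: coeff_eq_0)
    show "\<forall>g\<in>?B. restrict (Polynomial.coeff (\<Sum>i\<le>m. Polynomial.monom (g i) i)) {..m} = g"
      by (intro ballI ext) (auto simp: co restrict_def PiE_def extensional_def)
    show "(\<lambda>p. restrict (Polynomial.coeff p) {..m}) ` ?A \<subseteq> ?B" by (auto simp: restrict_def split: if_splits)
    show "(\<lambda>g. \<Sum>i\<le>m. Polynomial.monom (g i) i) ` ?B \<subseteq> ?A" using mon by blast
  qed
  have "finite ?B" by (intro finite_PiE) auto
  thus "finite ?A" using bij_betw_finite[OF bij] by blast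
  show "card ?A = CARD('f) ^ (m + 1)"
    using bij_betw_same_card[OF bij] by (simp add: card_funcsetE)
qed

lemma card_roots_of_bounded_polys:
  fixes Y :: "'f::{field,finite} kbar set"
  assumes Y: "\<And>y. y \<in> Y \<Longrightarrow> \<exists>b. (\<forall>j. Polynomial.degree (b j) \<le> m) \<and> (\<exists>j\<le>n. b j \<noteq> 0) \<and> (\<Sum>j\<le>n. embed_poly (b j) * y ^ j) = 0"
  shows "card Y \<le> n * CARD('f) ^ ((m + 1) * (n + 1))"
proof -
  define F where "F = {..n} \<rightarrow>\<^sub>E {p :: 'f poly. Polynomial.degree p \<le> m}"
  define pl where "pl b = (\<Sum>j\<le>n. Polynomial.monom (embed_poly (b j)) j)" for b :: "nat \<Rightarrow> 'f poly"
  \<comment> \<open>The zero polynomial is given no roots, which keeps all these sets finite; the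
    polynomials belonging to points of \<open>Y\<close> are nonzero.\<close>
  define R where "R b = (if pl b = 0 then {} else {z. poly (pl b) z = 0})" for b
  have co: "Polynomial.coeff (pl b) j = (if j \<le> n then embed_poly (b j) else 0)" for b j
    by (simp add: pl_def coeff_sum)
  have fF: "finite F" unfolding F_def by (intro finite_PiE card_bounded_polys) auto
  have cF: "card F = CARD('f) ^ ((m + 1) * (n + 1))"
    unfolding F_def card_funcsetE[OF finite_atMost] card_bounded_polys(2)
    by (simp only: card_atMost Suc_eq_plus1 power_mult)
  have degpl: "Polynomial.degree (pl b) \<le> n" for b by (rule degree_le) (simp add: co)
  have R: "finite (R b) \<and> card (R b) \<le> n" for b
  proof (cases "pl b = 0")
    case False
    thus ?thesis using poly_roots_finite[OF False] card_poly_roots_bound[OF False] degpl[of b] by (simp add: R_def)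
  qed (simp add: R_def)
  have "Y \<subseteq> (\<Union>b\<in>F. R b)"
  proof
    fix y assume "y \<in> Y"
    then obtain b where b: "\<And>j. Polynomial.degree (b j) \<le> m" "\<exists>j\<le>n. b j \<noteq> 0" "(\<Sum>j\<le>n. embed_poly (b j) * y ^ j) = 0"
      using Y by blast
    define b' where "b' = restrict b {..n}"
    have "b' \<in> F" using b(1) by (auto simp: b'_def F_def)
    obtain i where i: "i \<le> n" "b i \<noteq> 0" using b(2) by blast
    have "Polynomial.coeff (pl b') i = embed_poly (b i)" using i(1) by (simp add: co b'_def)
    also have "\<dots> \<noteq> embed_poly 0" unfolding embed_poly_eq_iff using i(2) .
    finally have "pl b' \<noteq> 0" by auto
    moreover have "poly (pl b') y = (\<Sum>j\<le>n. embed_poly (b j) * y ^ j)"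
      unfolding pl_def poly_sum poly_monom by (intro sum.cong) (auto simp: b'_def)
    ultimately have "y \<in> R b'" using b(3) by (simp add: R_def)
    thus "y \<in> (\<Union>b\<in>F. R b)" using \<open>b' \<in> F\<close> by blast
  qed
  hence "card Y \<le> card (\<Union>b\<in>F. R b)" using fF R by (intro card_mono) auto
  also have "\<dots> \<le> (\<Sum>b\<in>F. card (R b))" by (rule card_UN_le[OF fF])
  also have "\<dots> \<le> (\<Sum>b\<in>F. n)" using R by (intro sum_mono) auto
  finally show ?thesis by (simp add: cF mult.commute)
qed

text \<open>The denominator \<open>\<delta>\<close> contains each \<open>l\<close> to the largest
  power whose degree is at most \<open>U\<close> at that place. Orders are integers, so rounding
  down loses nothing. The degree of \<open>\<delta>\<close> is paid for by the finite places, and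
  what the fractions add to it by the infinite place.\<close>

lemma clear_denominators:
  fixes g :: "nat \<Rightarrow> 'f::field poly fract" and U :: "('f poly fract \<Rightarrow> ereal) \<Rightarrow> real"
  assumes S: "finite S" "S \<subseteq> base_places" "infinite_place \<in> S"
    and U: "\<And>v j. v \<in> base_places \<Longrightarrow> rnorm v (g j) \<le> exp (U v)"
    and U0: "\<And>v. v \<in> base_places \<Longrightarrow> U v \<ge> 0" "\<And>v. v \<in> base_places - S \<Longrightarrow> U v = 0"
  shows "\<exists>\<delta> b. \<delta> \<noteq> 0 \<and> (\<forall>j. Fract (b j) 1 = Fract \<delta> 1 * g j \<and> real (Polynomial.degree (b j)) \<le> (\<Sum>v\<in>S. U v))"
proof -
  define L where "L = {l\<in>monic_irr. finite_place l \<in> S}"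
  have Lirr: "Factorial_Ring.irreducible l" "Polynomial.degree l > 0" if "l \<in> monic_irr" for l :: "'f poly"
    using that irreducible_poly_degree_pos by (auto simp: monic_irr_def)
  have inj: "inj_on finite_place L" using inj_on_finite_place by (rule inj_on_subset) (auto simp: L_def)
  have fL: "finite L" using finite_imageD[OF finite_subset[OF _ S(1)] inj] by (auto simp: L_def)
  have S_eq: "S = insert infinite_place (finite_place ` L)"
    using S(2,3) unfolding base_places_alt L_def by auto
  have bp: "finite_place l \<in> base_places" if "l \<in> monic_irr" for l :: "'f poly" using that unfolding base_places_alt by blast
  have ip: "infinite_place \<in> (base_places :: ('f poly fract \<Rightarrow> ereal) set)" unfolding base_places_alt by blast
  have "infinite_place \<notin> finite_place ` L" using infinite_place_notin by (auto simp: L_def)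
  hence sumU: "(\<Sum>v\<in>S. U v) = U infinite_place + (\<Sum>l\<in>L. U (finite_place l))"
    unfolding S_eq using fL inj by (simp add: sum.reindex)
  define r where "r l = nat \<lfloor>U (finite_place l) / real (Polynomial.degree l)\<rfloor>" for l
  define \<delta> where "\<delta> = (\<Prod>l\<in>L. l ^ r l)"
  have L0: "l \<noteq> 0" if "l \<in> L" for l using Lirr(2)[of l] that by (auto simp: L_def)
  have \<delta>0: "\<delta> \<noteq> 0" using fL L0 by (simp add: \<delta>_def)
  have "Polynomial.degree \<delta> = (\<Sum>l\<in>L. r l * Polynomial.degree l)"
    unfolding \<delta>_def using L0 by (subst degree_prod_eq_sum_degree) (auto simp: degree_power_eq mult.commute)
  also have "real \<dots> \<le> (\<Sum>l\<in>L. U (finite_place l))"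
    unfolding of_nat_sum
  proof (rule sum_mono)
    fix l assume l: "l \<in> L"
    hence d: "real (Polynomial.degree l) > 0" using Lirr(2)[of l] by (simp add: L_def)
    have "U (finite_place l) / real (Polynomial.degree l) \<ge> 0" using l U0(1) bp d by (simp add: L_def)
    hence "real (r l) \<le> U (finite_place l) / real (Polynomial.degree l)" by (simp add: r_def)
    thus "real (r l * Polynomial.degree l) \<le> U (finite_place l)" using d by (simp add: pos_le_divide_eq)
  qed
  finally have deg\<delta>: "real (Polynomial.degree \<delta>) \<le> (\<Sum>l\<in>L. U (finite_place l))" .
  have "\<exists>b. Fract b 1 = Fract \<delta> 1 * g j \<and> real (Polynomial.degree b) \<le> (\<Sum>v\<in>S. U v)" for j
  proof (cases "g j = 0")
    case True
    have "0 \<le> (\<Sum>v\<in>S. U v)" using U0(1) S(2) by (intro sum_nonneg) auto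
    thus ?thesis using True by (intro exI[of _ 0]) (simp flip: Zero_fract_def)
  next
    case False
    obtain a c where ac: "a \<noteq> 0" "c \<noteq> 0" "g j = Fract a c" using False by (rule Fract_nonzero_cases)
    have prod: "Fract \<delta> 1 * g j = Fract (\<delta> * a) c" by (simp add: ac(3))
    have "0 \<le> finite_place l (Fract \<delta> 1 * g j)" if l: "l \<in> monic_irr" for l
    proof -
      note irr = Lirr(1)[OF l] and dl = Lirr(2)[OF l]
      have "exp (- (real (Polynomial.degree l) * (real (exponent_at l a) - real (exponent_at l c)))) \<le> exp (U (finite_place l))"
        using U[OF bp[OF l], of j] unfolding ac(3) rnorm_ereal[where w = "finite_place l", OF finite_place_Fract[OF irr ac(1,2)]] .
      hence u: "real (Polynomial.degree l) * (real (exponent_at l c) - real (exponent_at l a)) \<le> U (finite_place l)"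
        by (simp add: algebra_simps)
      have "real (exponent_at l c) \<le> real (exponent_at l \<delta>) + real (exponent_at l a)"
      proof (cases "l \<in> L")
        case True
        have "l ^ r l dvd \<delta>" unfolding \<delta>_def using fL True by (rule dvd_prodI)
        hence "r l \<le> exponent_at l \<delta>" using exponent_ge_iff[OF irr \<delta>0] by blast
        moreover have "real (exponent_at l c) - real (exponent_at l a) \<le> U (finite_place l) / real (Polynomial.degree l)"
          using u dl by (simp add: pos_le_divide_eq mult.commute)
        hence "int (exponent_at l c) - int (exponent_at l a) \<le> \<lfloor>U (finite_place l) / real (Polynomial.degree l)\<rfloor>"
          by (simp add: le_floor_iff)
        moreover have "\<lfloor>U (finite_place l) / real (Polynomial.degree l)\<rfloor> \<le> int (r l)"
          unfolding r_def by linarith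
        ultimately show ?thesis by linarith
      next
        case False
        hence "finite_place l \<in> base_places - S" using l bp by (simp add: L_def)
        hence "real (Polynomial.degree l) * (real (exponent_at l c) - real (exponent_at l a)) \<le> 0" using u U0(2) by simp
        hence "real (exponent_at l c) \<le> real (exponent_at l a)" using dl by (simp add: mult_le_0_iff)
        thus ?thesis by linarith
      qed
      hence "0 \<le> real (Polynomial.degree l) * (real (exponent_at l (\<delta> * a)) - real (exponent_at l c))"
        unfolding exponent_mult[OF irr \<delta>0 ac(1)] by (intro mult_nonneg_nonneg) auto
      thus ?thesis unfolding prod using finite_place_Fract[OF irr _ ac(2), of "\<delta> * a"] \<delta>0 ac(1) by simp
    qed
    then obtain b where b: "Fract \<delta> 1 * g j = Fract b 1" using integral_imp_poly by blast
    have b0: "b \<noteq> 0"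
    proof
      assume "b = 0"
      hence "Fract (\<delta> * a) c = 0" using b prod by (simp flip: Zero_fract_def)
      thus False using \<delta>0 ac(1,2) by (simp add: Zero_fract_def eq_fract)
    qed
    have "b * c = \<delta> * a" using b ac(2) unfolding prod by (simp add: eq_fract)
    hence "Polynomial.degree b + Polynomial.degree c = Polynomial.degree \<delta> + Polynomial.degree a"
      using degree_mult_eq[OF b0 ac(2)] degree_mult_eq[OF \<delta>0 ac(1)] by simp
    moreover have "real (Polynomial.degree a) - real (Polynomial.degree c) \<le> U infinite_place"
      using U[OF ip, of j] unfolding ac(3) rnorm_ereal[where w = infinite_place, OF infinite_place_Fract[OF ac(1,2)]] by simp
    ultimately have "real (Polynomial.degree b) \<le> (\<Sum>v\<in>S. U v)" using deg\<delta> unfolding sumU by linarith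
    thus ?thesis using b by metis
  qed
  then obtain b where "\<And>j. Fract (b j) 1 = Fract \<delta> 1 * g j \<and> real (Polynomial.degree (b j)) \<le> (\<Sum>v\<in>S. U v)" by metis
  thus ?thesis using \<delta>0 by blast
qed

section \<open>Minimal polynomials and the Northcott bound\<close>

context height_setup
begin

text \<open>By \<open>conjugates_power\<close> the roots of \<open>g\<close>, repeated
  \<open>t\<close> times, are the conjugates of \<open>y\<close>, repeated \<open>P\<close> times.
  Comparing degrees, the sum of \<open>lp\<close> over the roots of \<open>g\<close> is the degree
  of \<open>g\<close> times the average over the embeddings, and \<open>coeff_le_roots\<close>
  applies.\<close>

lemma minimal_poly_coeff_bound:
  assumes y: "y \<in> Kbig" and g: "minimal_poly g y" and v: "v \<in> base_places"
  shows "rnorm v (Polynomial.coeff g j) \<le> exp (real (Polynomial.degree g) * (\<Sum>\<zeta>\<in>rts. lp (nv v \<zeta> y)) / real (card rts))"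
proof -
  obtain t where t: "acp g ^ t = (\<Prod>\<zeta>\<in>rts. [:- emb \<zeta> y, 1:] ^ P)" "t * Polynomial.degree g = P * card rts"
    using conjugates_power[OF y g] by blast
  \<comment> \<open>The logarithmic Mahler measure at \<open>v\<close>. It is additive on products,
    so it can be computed from the factorisation in \<open>t\<close> and divided by
    \<open>t\<close>.\<close>
  define ml where "ml p = (\<Sum>z\<in>#proots p. lp (Wp v z))" for p
  have ml_mult: "ml (p * r) = ml p + ml r" if "p \<noteq> 0" "r \<noteq> 0" for p r
    using that by (simp add: ml_def proots_mult)
  have ml_1: "ml 1 = 0" by (simp add: ml_def)
  have ml_pow: "ml (p ^ n) = real n * ml p" if p: "p \<noteq> 0" for p n
  proof (induction n)
    case (Suc n)
    have "ml (p ^ Suc n) = ml p + ml (p ^ n)" using ml_mult[OF p, of "p ^ n"] p by simp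
    thus ?case unfolding Suc.IH by (simp add: distrib_right)
  qed (simp add: ml_1)
  have ml_prod: "ml (\<Prod>i\<in>I. p i) = (\<Sum>i\<in>I. ml (p i))" if "\<And>i. p i \<noteq> 0" for p :: "'f kbar \<Rightarrow> 'f kbar poly" and I
    by (induction I rule: infinite_finite_induct) (use that in \<open>simp_all add: ml_1 ml_mult\<close>)
  have g0: "acp g \<noteq> 0" using minimal_poly_nonzero[OF g] by simp
  have "real t * ml (acp g) = ml (\<Prod>\<zeta>\<in>rts. [:- emb \<zeta> y, 1:] ^ P)" using ml_pow[OF g0] t(1) by metis
  also have "\<dots> = (\<Sum>\<zeta>\<in>rts. ml ([:- emb \<zeta> y, 1:] ^ P))" by (rule ml_prod) simp
  also have "\<dots> = (\<Sum>\<zeta>\<in>rts. real P * lp (nv v \<zeta> y))"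
    by (intro sum.cong refl) (simp add: ml_pow, simp add: ml_def nv_def)
  also have "\<dots> = real P * (\<Sum>\<zeta>\<in>rts. lp (nv v \<zeta> y))" by (simp add: sum_distrib_left)
  finally have tm: "real t * ml (acp g) = real P * (\<Sum>\<zeta>\<in>rts. lp (nv v \<zeta> y))" .
  have t0: "real t > 0" using t(2) P_pos card_rts_pos by (intro of_nat_0_less_iff[THEN iffD2] Nat.gr0I) auto
  have td: "real t * real (Polynomial.degree g) = real P * real (card rts)" using t(2) by (metis of_nat_mult)
  have rP: "real P > 0" "real (card rts) > 0" using P_pos card_rts_pos by auto
  have "real t * (ml (acp g) * real (card rts)) = real t * (real (Polynomial.degree g) * (\<Sum>\<zeta>\<in>rts. lp (nv v \<zeta> y)))"
  proof -
    have "real t * (ml (acp g) * real (card rts)) = (real t * ml (acp g)) * real (card rts)" by simp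
    also have "\<dots> = (real P * real (card rts)) * (\<Sum>\<zeta>\<in>rts. lp (nv v \<zeta> y))" unfolding tm by simp
    finally show ?thesis unfolding td[symmetric] by simp
  qed
  hence "ml (acp g) = real (Polynomial.degree g) * (\<Sum>\<zeta>\<in>rts. lp (nv v \<zeta> y)) / real (card rts)"
    using t0 rP by (simp add: eq_divide_eq)
  moreover have "rnorm v (Polynomial.coeff g j) \<le> exp (ml (acp g))"
    using coeff_le_roots[OF Wp(1)[OF v], of "acp g" j] g by (simp add: ml_def Wp(2)[OF v] minimal_poly_def)
  ultimately show ?thesis by simp
qed

theorem northcott:
  assumes S: "finite S" "S \<subseteq> base_places" "infinite_place \<in> S"
    and Y: "\<And>y. y \<in> Y \<Longrightarrow> y \<in> Kbig"
    and deg: "\<And>y. y \<in> Y \<Longrightarrow> \<exists>g. minimal_poly g y \<and> Polynomial.degree g \<le> n"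
    and good: "\<And>y v \<zeta>. y \<in> Y \<Longrightarrow> v \<in> base_places - S \<Longrightarrow> \<zeta> \<in> rts \<Longrightarrow> nv v \<zeta> y \<le> 1"
    and height: "\<And>y. y \<in> Y \<Longrightarrow> real n * ((\<Sum>v\<in>S. \<Sum>\<zeta>\<in>rts. lp (nv v \<zeta> y)) / real (card rts)) < real m + 1"
  shows "card Y \<le> n * CARD('f) ^ ((m + 1) * (n + 1))"
proof (rule card_roots_of_bounded_polys)
  fix y assume y: "y \<in> Y"
  obtain g where g: "minimal_poly g y" "Polynomial.degree g \<le> n" using deg[OF y] by blast
  define U where "U v = real (Polynomial.degree g) * (\<Sum>\<zeta>\<in>rts. lp (nv v \<zeta> y)) / real (card rts)" for v
  have "\<exists>\<delta> b. \<delta> \<noteq> 0 \<and> (\<forall>j. Fract (b j) 1 = Fract \<delta> 1 * Polynomial.coeff g j \<and> real (Polynomial.degree (b j)) \<le> (\<Sum>v\<in>S. U v))"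
  proof (rule clear_denominators[OF S])
    show "rnorm v (Polynomial.coeff g j) \<le> exp (U v)" if "v \<in> base_places" for v j
      unfolding U_def using minimal_poly_coeff_bound[OF Y[OF y] g(1) that] .
    show "U v \<ge> 0" for v
      unfolding U_def by (intro divide_nonneg_nonneg mult_nonneg_nonneg sum_nonneg lp_nonneg) auto
    show "U v = 0" if "v \<in> base_places - S" for v
      unfolding U_def using good[OF y that] lp_eq_0 by simp
  qed
  then obtain \<delta> b where \<delta>: "\<delta> \<noteq> 0" and b: "\<And>j. Fract (b j) 1 = Fract \<delta> 1 * Polynomial.coeff g j"
    "\<And>j. real (Polynomial.degree (b j)) \<le> (\<Sum>v\<in>S. U v)" by blast
  have "(\<Sum>v\<in>S. U v) = real (Polynomial.degree g) * ((\<Sum>v\<in>S. \<Sum>\<zeta>\<in>rts. lp (nv v \<zeta> y)) / real (card rts))"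
    unfolding U_def by (simp add: sum_distrib_left sum_divide_distrib)
  also have "\<dots> \<le> real n * ((\<Sum>v\<in>S. \<Sum>\<zeta>\<in>rts. lp (nv v \<zeta> y)) / real (card rts))"
    using g(2) by (intro mult_right_mono divide_nonneg_nonneg sum_nonneg lp_nonneg) auto
  finally have Un: "(\<Sum>v\<in>S. U v) < real m + 1" using height[OF y] by linarith
  \<comment> \<open>Degrees are integers, so a strict bound by \<open>m + 1\<close>
    suffices.\<close>
  have "Polynomial.degree (b j) \<le> m" for j using b(2)[of j] Un by linarith
  moreover have "b (Polynomial.degree g) \<noteq> 0"
  proof
    assume "b (Polynomial.degree g) = 0"
    moreover have "Polynomial.coeff g (Polynomial.degree g) = 1" using g(1) by (simp add: minimal_poly_def)
    ultimately have "Fract 0 1 = Fract \<delta> 1" using b(1)[of "Polynomial.degree g"] by simp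
    thus False using \<delta> by (simp add: eq_fract)
  qed
  moreover have "(\<Sum>j\<le>n. embed_poly (b j) * y ^ j) = 0"
  proof -
    have "(\<Sum>j\<le>n. embed_poly (b j) * y ^ j) = to_ac (Fract \<delta> 1) * (\<Sum>j\<le>n. to_ac (Polynomial.coeff g j) * y ^ j)"
      unfolding sum_distrib_left embed_poly_def b(1) by (simp add: mult.assoc)
    also have "(\<Sum>j\<le>n. to_ac (Polynomial.coeff g j) * y ^ j) = poly (acp g) y"
      unfolding poly_altdef using g(2) by (intro sum.mono_neutral_cong_right) (auto simp: coeff_eq_0)
    finally show ?thesis using g(1) by (simp add: minimal_poly_def)
  qed
  ultimately show "\<exists>b. (\<forall>j. Polynomial.degree (b j) \<le> m) \<and> (\<exists>j\<le>n. b j \<noteq> 0) \<and> (\<Sum>j\<le>n. embed_poly (b j) * y ^ j) = 0"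
    using g(2) by blast
qed

end

text \<open>Assumption \<open>L\<close> expresses that \<open>y\<close> lies in the ring generated
  by the products of elements of \<open>K1\<close> and \<open>K2\<close>, without constructing the
  compositum. This ring is spanned by the \<open>c * D\<close> products of basis elements, so the
  powers of \<open>y\<close> up to \<open>c * D\<close> are dependent.\<close>

lemma degree_compositum:
  fixes y :: "'f::field kbar"
  assumes K: "subf K1" "subf K2" and fin: "AR.finite_dimension base_field K1" "AR.finite_dimension base_field K2"
    and L: "\<And>L. (\<And>a b. a \<in> K1 \<Longrightarrow> b \<in> K2 \<Longrightarrow> a * b \<in> L) \<Longrightarrow> (\<And>a b. a \<in> L \<Longrightarrow> b \<in> L \<Longrightarrow> a + b \<in> L \<and> a * b \<in> L) \<Longrightarrow> y \<in> L"
    and g: "minimal_poly g y"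
  shows "Polynomial.degree g \<le> ext_degree K1 * ext_degree K2"
proof -
  define c D where "c = ext_degree K1" and "D = ext_degree K2"
  obtain us where us: "length us = c" "set us \<subseteq> K1" "\<And>z. z \<in> K1 \<Longrightarrow> \<exists>x. z = (\<Sum>l<c. to_ac (x l) * us ! l)"
    using ext_degree_basis[OF fin(1)] unfolding c_def by blast
  obtain ws where ws: "length ws = D" "set ws \<subseteq> K2" "\<And>z. z \<in> K2 \<Longrightarrow> \<exists>x. z = (\<Sum>l<D. to_ac (x l) * ws ! l)"
    using ext_degree_basis[OF fin(2)] unfolding D_def by blast
  have usK: "us ! i \<in> K1" if "i < c" for i using us(1,2) that by auto
  define L where "L = {z. \<exists>b. (\<forall>i<c. b i \<in> K2) \<and> z = (\<Sum>i<c. us ! i * b i)}"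
  have Ladd: "a + b \<in> L" if "a \<in> L" "b \<in> L" for a b
  proof -
    obtain r s where "\<forall>i<c. r i \<in> K2" "a = (\<Sum>i<c. us ! i * r i)" "\<forall>i<c. s i \<in> K2" "b = (\<Sum>i<c. us ! i * s i)"
      using \<open>a \<in> L\<close> \<open>b \<in> L\<close> unfolding L_def by blast
    thus ?thesis unfolding L_def
      by (intro CollectI exI[of _ "\<lambda>i. r i + s i"]) (auto simp: sum.distrib algebra_simps subf_add[OF K(2)])
  qed
  have L0: "0 \<in> L" unfolding L_def using K(2) by (intro CollectI exI[of _ "\<lambda>_. 0"]) auto
  have Lsum: "sum h I \<in> L" if "\<And>i. i \<in> I \<Longrightarrow> h i \<in> L" for h :: "nat \<Rightarrow> 'f kbar" and I
    using that by (induction I rule: infinite_finite_induct) (auto intro: L0 Ladd)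
  have Lprod: "a * b \<in> L" if a: "a \<in> K1" and b: "b \<in> K2" for a b
  proof -
    obtain s where "a = (\<Sum>l<c. to_ac (s l) * us ! l)" using us(3)[OF a] by blast
    hence "a * b = (\<Sum>l<c. us ! l * (to_ac (s l) * b))" by (simp add: sum_distrib_left sum_distrib_right mult_ac)
    thus ?thesis unfolding L_def using b K(2) by (intro CollectI exI[of _ "\<lambda>l. to_ac (s l) * b"]) (auto intro: subf_mult)
  qed
  have Lmult: "a * b \<in> L" if ab: "a \<in> L" "b \<in> L" for a b
  proof -
    obtain r s where rs: "\<And>i. i < c \<Longrightarrow> r i \<in> K2" "a = (\<Sum>i<c. us ! i * r i)" "\<And>i. i < c \<Longrightarrow> s i \<in> K2" "b = (\<Sum>i<c. us ! i * s i)"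
      using ab unfolding L_def by blast
    have "a * b = (\<Sum>i<c. \<Sum>j<c. (us ! i * us ! j) * (r i * s j))"
      unfolding rs(2,4) sum_product by (intro sum.cong) (auto simp: mult_ac)
    also have "\<dots> \<in> L"
      using rs(1,3) usK by (intro Lsum Lprod subf_mult[OF K(1)] subf_mult[OF K(2)]) auto
    finally show ?thesis .
  qed
  have yL: "y \<in> L" using L[of L] Ladd Lmult Lprod by blast
  have pow: "y ^ n \<in> L" for n
  proof (induction n)
    case 0 show ?case using Lprod[of 1 1] K by simp
  qed (use yL Lmult in simp)
  have span: "\<exists>x. z = (\<Sum>p\<in>{..<c} \<times> {..<D}. to_ac (x p) * (us ! fst p * ws ! snd p))" if z: "z \<in> L" for z
  proof -
    obtain b where b: "\<forall>i<c. b i \<in> K2" "z = (\<Sum>i<c. us ! i * b i)" using z unfolding L_def by blast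
    have "\<forall>i<c. \<exists>x. b i = (\<Sum>l<D. to_ac (x l) * ws ! l)" using b(1) ws(3) by blast
    then obtain x where x: "\<And>i. i < c \<Longrightarrow> b i = (\<Sum>l<D. to_ac (x i l) * ws ! l)" by metis
    have "z = (\<Sum>i<c. \<Sum>l<D. to_ac (x i l) * (us ! i * ws ! l))"
      unfolding b(2) by (intro sum.cong refl) (simp add: x sum_distrib_left mult_ac)
    also have "\<dots> = (\<Sum>p\<in>{..<c} \<times> {..<D}. to_ac (x (fst p) (snd p)) * (us ! fst p * ws ! snd p))"
      by (simp add: sum.cartesian_product case_prod_unfold)
    finally show ?thesis by (rule exI[of _ "\<lambda>p. x (fst p) (snd p)"])
  qed
  have "\<forall>n. \<exists>x. y ^ n = (\<Sum>p\<in>{..<c} \<times> {..<D}. to_ac (x p) * (us ! fst p * ws ! snd p))"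
    using span[OF pow] by (rule allI)
  from choice[OF this] obtain x where x: "\<And>n. y ^ n = (\<Sum>p\<in>{..<c} \<times> {..<D}. to_ac (x n p) * (us ! fst p * ws ! snd p))"
    by (elim exE) (rule that, erule spec)
  have "\<exists>t. (\<exists>i\<in>{..c * D}. t i \<noteq> 0) \<and> (\<forall>p\<in>{..<c} \<times> {..<D}. (\<Sum>i\<in>{..c * D}. t i * x i p) = 0)"
    by (rule lin_dep) auto
  then obtain t where t: "\<exists>i\<le>c * D. t i \<noteq> 0" "\<And>p. p \<in> {..<c} \<times> {..<D} \<Longrightarrow> (\<Sum>i\<le>c * D. t i * x i p) = 0" by blast
  define h where "h = (\<Sum>i\<le>c * D. Polynomial.monom (t i) i)"
  have co: "Polynomial.coeff h j = (if j \<le> c * D then t j else 0)" for j by (simp add: h_def coeff_sum)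
  have "poly (acp h) y = (\<Sum>i\<le>c * D. to_ac (t i) * y ^ i)"
    unfolding h_def acp_sum acp_monom poly_sum poly_monom ..
  also have "\<dots> = (\<Sum>i\<le>c * D. \<Sum>p\<in>{..<c} \<times> {..<D}. to_ac (t i * x i p) * (us ! fst p * ws ! snd p))"
    unfolding x sum_distrib_left by (simp add: mult.assoc)
  also have "\<dots> = (\<Sum>p\<in>{..<c} \<times> {..<D}. \<Sum>i\<le>c * D. to_ac (t i * x i p) * (us ! fst p * ws ! snd p))" by (rule sum.swap)
  also have "\<dots> = (\<Sum>p\<in>{..<c} \<times> {..<D}. to_ac (\<Sum>i\<le>c * D. t i * x i p) * (us ! fst p * ws ! snd p))"
    unfolding to_ac_sum sum_distrib_right ..
  also have "\<dots> = 0" by (rule sum.neutral) (simp add: t(2))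
  finally have "poly (acp h) y = 0" .
  moreover have "h \<noteq> 0" using t(1) co by (metis coeff_0)
  ultimately have "Polynomial.degree g \<le> Polynomial.degree h" by (rule minimal_poly_degree_le[OF g])
  also have "\<dots> \<le> c * D" by (rule degree_le) (simp add: co)
  finally show ?thesis by (simp add: c_def D_def)
qed


section \<open>The lower bound for the canonical height\<close>

context drinfeld_heights
begin

text \<open>The image of \<open>x\<close> is a polynomial expression in \<open>x\<close>, constants
  and the coefficients of \<open>\<Phi> polyT\<close>, so it lies in every set \<open>L\<close> as
  in \<open>degree_compositum\<close>.\<close>

lemma act_minimal_degree:
  assumes x: "x \<in> good" and g: "minimal_poly g (act a x)"
  shows "Polynomial.degree g \<le> coeff_degree \<Phi> * ext_degree (adjoin {x})"
  unfolding coeff_degree_def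
proof (rule degree_compositum[OF _ subf_adjoin _ _ _ g])
  show cf: "subf (coeff_field \<Phi>)" by (simp add: coeff_field_def subf_adjoin)
  show "AR.finite_dimension base_field (coeff_field \<Phi>)" by (rule Kbig_dimension(1)[OF cf coeff_field_sub])
  show "AR.finite_dimension base_field (adjoin {x})"
    using goodD[OF x] by (intro Kbig_dimension(1) subf_adjoin adjoin_min subf_Kbig) auto
  fix L assume prod: "\<And>a b. a \<in> coeff_field \<Phi> \<Longrightarrow> b \<in> adjoin {x} \<Longrightarrow> a * b \<in> L"
    and L: "\<And>a b. a \<in> L \<Longrightarrow> b \<in> L \<Longrightarrow> a + b \<in> L \<and> a * b \<in> L"
  have L1: "b \<in> L" if "b \<in> coeff_field \<Phi>" for b using prod[OF that subf_1[OF subf_adjoin]] by simp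
  have xL: "x \<in> L" using prod[OF subf_1[OF cf], of x] adjoin_incl[of "{x}"] by simp
  have L0: "0 \<in> L" and L1': "1 \<in> L" using L1 subf_0[OF cf] subf_1[OF cf] by auto
  have Lsum: "sum h I \<in> L" if "\<And>i. i \<in> I \<Longrightarrow> h i \<in> L" for h :: "nat \<Rightarrow> 'f kbar" and I
    using that by (induction I rule: infinite_finite_induct) (auto simp: L0 L)
  have Lpow: "z ^ n \<in> L" if "z \<in> L" for z n by (induction n) (auto simp: L1' L that)
  have LT: "act polyT z \<in> L" if "z \<in> L" for z
    unfolding act_T using L1[OF coeff_in_coeff_field] Lpow[OF that] L by (intro Lsum) blast
  have LTn: "act (polyT ^ n) x \<in> L" for n
  proof (induction n)
    case (Suc n)
    show ?case unfolding power_Suc act_mult by (rule LT[OF Suc])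
  qed (use xL in simp)
  have "embed_poly [:c:] \<in> L" for c using L1 subf_to_ac[OF cf] by (simp add: embed_poly_def)
  thus "act a x \<in> L" unfolding act_expand[of a x] using LTn L by (intro Lsum) blast
qed

lemma height_lower_bound:
  assumes x: "x \<in> good" and nontorsion: "\<not> is_torsion \<Phi> x" and inf: "infinite_place \<in> S"
  defines "G \<equiv> coeff_degree \<Phi> * ext_degree (adjoin {x})"
  shows "canonical_height \<Phi> x \<ge> real CARD('f) powr (- (5 * real d * (2 * (real d + 1) * hh + 1) * (real G)\<^sup>2))"
proof (rule ccontr)
  define qr where "qr = real CARD('f)"
  define g2 where "g2 = (real G)\<^sup>2"
  define hx where "hx = canonical_height \<Phi> x"
  assume "\<not> canonical_height \<Phi> x \<ge> real CARD('f) powr (- (5 * real d * (2 * (real d + 1) * hh + 1) * (real G)\<^sup>2))"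
  hence neg: "hx < qr powr (- (5 * real d * (2 * (real d + 1) * hh + 1) * g2))" by (simp add: qr_def g2_def hx_def)
  have q: "qr \<ge> 2" using q2 unfolding qr_def by linarith
  have d1: "real d \<ge> 1" using d_pos by simp
  obtain g where g: "minimal_poly g x" using minimal_poly_exists by blast
  have "Polynomial.degree g \<le> G" using act_minimal_degree[OF x, of g 1] g by (simp add: G_def)
  hence G1: "G \<ge> 1" using minimal_poly_degree_pos[OF g] by linarith
  have g2: "real G \<ge> 1" "real G \<le> g2" "g2 \<ge> 1" using G1 mult_mono[of 1 "real G" 1 "real G"] by (auto simp: g2_def power2_eq_square)
  have h0: "hh \<ge> 0" by (rule hh_nonneg)
  \<comment> \<open>The choice is dictated by the end of the proof: the exponent in the counting
    bound is at most \<open>2 * g2 * B + 2 * g2 = g2 * (8 * hh + 4)\<close>, and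
    \<open>N + 1\<close> has to exceed it.\<close>
  define N where "N = nat \<lfloor>g2 * (8 * hh + 4)\<rfloor>"
  have N0: "g2 * (8 * hh + 4) \<ge> 0" using g2 h0 by simp
  have N: "real N \<le> g2 * (8 * hh + 4)" "g2 * (8 * hh + 4) < real N + 1"
    using N0 unfolding N_def by linarith+
  have small: "2 * Q ^ N * hx \<le> 1"
  proof -
    have "Q ^ N = qr powr (real d * real N)"
      using q by (simp add: Q_eq qr_def powr_realpow flip: power_mult of_nat_mult)
    also have "\<dots> \<le> qr powr (real d * (g2 * (8 * hh + 4)))"
      using q N(1) by (intro powr_mono mult_left_mono) auto
    finally have QN: "Q ^ N \<le> qr powr (real d * (g2 * (8 * hh + 4)))" .
    \<comment> \<open>As \<open>d \<ge> 1\<close>, \<open>2 * (d + 1)\<close> is at least 4. From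
      here on the exponent is used in the form \<open>5 * d * (4 * hh + 1) * g2\<close>, which
      exceeds the exponent available for \<open>Q ^ N\<close> by at least 1; this last unit pays for
      the factor 2.\<close>
    have "4 * hh \<le> 2 * (real d + 1) * hh" using d1 h0 by (intro mult_right_mono) auto
    hence "(4 * hh + 1) * (5 * real d * g2) \<le> (2 * (real d + 1) * hh + 1) * (5 * real d * g2)"
      using d1 g2 by (intro mult_right_mono) auto
    hence "- (5 * real d * (2 * (real d + 1) * hh + 1) * g2) \<le> - ((4 * hh + 1) * (5 * real d * g2))"
      by (simp add: mult_ac)
    hence "qr powr (- (5 * real d * (2 * (real d + 1) * hh + 1) * g2)) \<le> qr powr (- ((4 * hh + 1) * (5 * real d * g2)))"
      using q by (intro powr_mono) auto
    hence hx: "hx \<le> qr powr (- ((4 * hh + 1) * (5 * real d * g2)))" using neg by linarith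
    have hx0: "hx \<ge> 0" unfolding hx_def by (rule canonical_height_nonneg[OF x])
    have "Q ^ N * hx \<le> qr powr (real d * (g2 * (8 * hh + 4))) * qr powr (- ((4 * hh + 1) * (5 * real d * g2)))"
      using QN hx hx0 by (intro mult_mono) auto
    also have "\<dots> = qr powr (real d * (g2 * (8 * hh + 4)) + - ((4 * hh + 1) * (5 * real d * g2)))"
      by (rule powr_add[symmetric])
    also have "real d * (g2 * (8 * hh + 4)) + - ((4 * hh + 1) * (5 * real d * g2)) = - (real d * g2 * (12 * hh + 1))"
      by (simp add: algebra_simps)
    also have "qr powr (- (real d * g2 * (12 * hh + 1))) \<le> qr powr (- 1)"
    proof (intro powr_mono)
      have "1 * 1 * 1 \<le> real d * g2 * (12 * hh + 1)" using d1 g2 h0 by (intro mult_mono) auto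
      thus "- (real d * g2 * (12 * hh + 1)) \<le> - 1" by simp
    qed (use q in auto)
    also have "qr powr (- 1) \<le> 1 / 2" using q by (simp add: powr_minus divide_simps)
    finally show ?thesis by simp
  qed
  define B where "B = 4 * hh + 1"
  define m where "m = nat \<lfloor>real G * B\<rfloor>"
  have GB: "real G * B \<ge> 0" using h0 by (simp add: B_def)
  have m: "real m \<le> real G * B" "real G * B < real m + 1" using GB unfolding m_def by linarith+
  define Y where "Y = (\<lambda>a. act a x) ` {a. Polynomial.degree a \<le> N}"
  have "card Y = card {a :: 'f poly. Polynomial.degree a \<le> N}"
    unfolding Y_def using act_inj[OF nontorsion] by (intro card_image inj_onI)
  hence cY: "card Y = CARD('f) ^ (N + 1)" by (simp add: card_bounded_polys(2))
  have "card Y \<le> G * CARD('f) ^ ((m + 1) * (G + 1))"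
  proof (rule northcott[OF S inf])
    fix y assume "y \<in> Y"
    then obtain a where a: "Polynomial.degree a \<le> N" "y = act a x" by (auto simp: Y_def)
    have y: "y \<in> good" unfolding a(2) by (rule good_act[OF x])
    show "y \<in> Kbig" by (rule goodD[OF y])
    show "nv v \<zeta> y \<le> 1" if "v \<in> base_places - S" "\<zeta> \<in> rts" for v \<zeta> using y that by (simp add: good_def)
    show "\<exists>g. minimal_poly g y \<and> Polynomial.degree g \<le> G"
      using minimal_poly_exists act_minimal_degree[OF x] unfolding a(2) G_def by blast
    have "H y \<le> B" using act_height_bound[OF x a(1)] small unfolding a(2) B_def hx_def by linarith
    hence "real G * H y \<le> real G * B" by (intro mult_left_mono) auto
    thus "real G * ((\<Sum>v\<in>S. \<Sum>\<zeta>\<in>rts. lp (nv v \<zeta> y)) / real (card rts)) < real m + 1"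
      using m(2) unfolding H_def by linarith
  qed
  also have "\<dots> \<le> CARD('f) ^ (G - 1) * CARD('f) ^ ((m + 1) * (G + 1))"
  proof (intro mult_right_mono)
    \<comment> \<open>The factor \<open>G\<close> of the counting bound is absorbed in a power of q,
      so that only exponents remain to be compared.\<close>
    have "G \<le> 2 ^ (G - 1)" using less_exp[of "G - 1"] G1 by linarith
    also have "\<dots> \<le> CARD('f) ^ (G - 1)" using q2 by (intro power_mono) auto
    finally show "G \<le> CARD('f) ^ (G - 1)" .
  qed simp
  finally have "CARD('f) ^ (N + 1) \<le> CARD('f) ^ (G - 1 + (m + 1) * (G + 1))" unfolding cY power_add .
  hence "N + 1 \<le> G - 1 + (m + 1) * (G + 1)" using q2 by (subst (asm) power_increasing_iff) auto
  hence "N + 2 \<le> G + (m + 1) * (G + 1)" using G1 by linarith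
  hence "real N + 2 \<le> real G + (real m + 1) * (real G + 1)"
    by (metis (no_types) of_nat_1 of_nat_add of_nat_le_iff of_nat_mult of_nat_numeral)
  also have "\<dots> \<le> real G + (real G * B + 1) * (real G + 1)" using m(1) by (intro add_left_mono mult_right_mono) auto
  also have "\<dots> = g2 * B + real G * B + 2 * real G + 1" by (simp add: g2_def power2_eq_square algebra_simps)
  also have "\<dots> \<le> g2 * B + g2 * B + 2 * g2 + 1" using g2(2) h0 by (intro add_mono mult_right_mono) (auto simp: B_def)
  also have "\<dots> = g2 * (8 * hh + 4) + 1" by (simp add: B_def algebra_simps)
  finally show False using N(2) by linarith
qed

end

theorem theorem7:
  fixes \<Phi> :: "'f::{field,finite} poly \<Rightarrow> 'f kbar poly"
    and d D :: nat and c\<^sub>2 :: real and x :: "'f kbar"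
  defines "c\<^sub>2 \<equiv> real CARD('f) powr
      (5 * real d * (2 * (real d + 1) * module_height \<Phi> + 1) * (real (coeff_degree \<Phi>))\<^sup>2)"
    and "D \<equiv> ext_degree (adjoin {x})"
  assumes "drinfeld_module d \<Phi>"
    and "\<not> is_torsion \<Phi> x"
  shows "canonical_height \<Phi> x \<ge> c\<^sub>2 powr (- ((real D)\<^sup>2))"
proof -
  interpret pc: prime_char "TYPE('f poly fract)"
    by (intro prime_char.intro) (simp add: finite_field_prime_CHAR)
  interpret dr: drinfeld d \<Phi> by (rule drinfeld.intro[OF assms(3)])
  define a where "a = Polynomial.coeff (\<Phi> polyT)"
  obtain \<eta> e where \<eta>: "separable \<eta>" and se: "\<forall>y\<in>insert x (a ` {..d}). y ^ (CHAR('f poly fract) ^ e) \<in> simple_ext \<eta>"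
    using pc.separable_generator[OF infinite_fract, of "insert x (a ` {..d})"] by auto
  obtain f where f: "minimal_poly f \<eta>" "pderiv f \<noteq> 0" using \<eta> by (auto simp: separable_def)
  define P where "P = CHAR('f poly fract) ^ e"
  have basis: "\<exists>s. c = (\<Sum>j<P. s j ^ P * Fract polyT 1 ^ j)" for c :: "'f poly fract"
    by (rule fract_frobenius_basis[OF _ finite_field_prime_CHAR]) (simp add: P_def)
  interpret hs: height_setup f \<eta> e P "Fract polyT 1"
    by (intro height_setup.intro cofinal_ext.intro pc.prime_char_axioms cofinal_ext_axioms.intro f P_def basis)
  have se': "\<forall>y\<in>insert x (a ` {..d}). y ^ P \<in> simple_ext \<eta>" using se unfolding P_def .
  have xK: "x \<in> hs.Kbig" using se' by (simp add: hs.Kbig_def)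
  have aK: "a i \<in> hs.Kbig" for i
  proof (cases "i \<le> d")
    case True thus ?thesis using se' by (simp add: hs.Kbig_def)
  next
    case False
    hence "a i = 0" by (simp add: a_def coeff_eq_0 dr.degT)
    thus ?thesis using subf_0[OF hs.subf_Kbig] by simp
  qed
  define bad where "bad y S \<longleftrightarrow> finite S \<and> S \<subseteq> base_places \<and> (\<forall>v\<in>base_places - S. \<forall>\<zeta>\<in>hs.rts. hs.nv v \<zeta> y \<le> 1)" for y S
  \<comment> \<open>The inverse of the leading coefficient is included: outside \<open>S\<close>
    both it and the leading coefficient have value at most 1, which makes the value exactly 1, as
    \<open>drinfeld_heights\<close> demands.\<close>
  define F where "F = insert (inverse (a d)) (insert x (a ` {..d}))"
  have "\<exists>S. bad y S" if "y \<in> hs.Kbig" for y unfolding bad_def using hs.finite_bad_places[OF that] .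
  then obtain Sf where Sf: "\<And>y. y \<in> hs.Kbig \<Longrightarrow> bad y (Sf y)" by metis
  \<comment> \<open>The infinite place is added for \<open>northcott\<close>, where it bounds the
    degrees of the cleared coefficients.\<close>
  define S where "S = insert infinite_place (\<Union>y\<in>F. Sf y)"
  have FK: "F \<subseteq> hs.Kbig" using xK aK subf_inverse[OF hs.subf_Kbig aK] by (auto simp: F_def)
  have fS: "finite S" unfolding S_def using Sf FK by (auto simp: F_def bad_def)
  have Sb: "S \<subseteq> base_places" unfolding S_def using Sf FK by (auto simp: bad_def base_places_def)
  have good: "hs.nv v \<zeta> y \<le> 1" if "v \<in> base_places - S" "\<zeta> \<in> hs.rts" "y \<in> F" for v \<zeta> y
  proof -
    have "bad y (Sf y)" using Sf FK that(3) by blast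
    moreover have "v \<in> base_places - Sf y" using that by (auto simp: S_def)
    ultimately show ?thesis using that(2) unfolding bad_def by blast
  qed
  have ad: "a d \<noteq> 0" using dr.lead_nonzero by (simp add: a_def)
  interpret dh: drinfeld_heights f \<eta> e P "Fract polyT 1" d \<Phi> S "real CARD('f) ^ d"
  proof (intro drinfeld_heights.intro hs.height_setup_axioms dr.drinfeld_axioms drinfeld_heights_axioms.intro)
    show "Polynomial.coeff (\<Phi> polyT) i \<in> hs.Kbig" for i using aK by (simp add: a_def)
    fix v \<zeta> assume v: "v \<in> base_places - S" and \<zeta>: "\<zeta> \<in> hs.rts"
    have N: "absval hs.Kbig (hs.nv v \<zeta>)" using v \<zeta> hs.nv_absval by blast
    show "hs.nv v \<zeta> (Polynomial.coeff (\<Phi> polyT) i) \<le> 1" for i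
    proof (cases "i \<le> d")
      case True thus ?thesis using good[OF v \<zeta>, of "a i"] by (simp add: F_def a_def)
    next
      case False thus ?thesis using av_0[OF hs.subf_Kbig N] by (simp add: coeff_eq_0 dr.degT)
    qed
    have "hs.nv v \<zeta> (a d) \<le> 1" "inverse (hs.nv v \<zeta> (a d)) \<le> 1"
      using good[OF v \<zeta>, of "a d"] good[OF v \<zeta>, of "inverse (a d)"] av_inverse[OF hs.subf_Kbig N aK] by (simp_all add: F_def)
    moreover have "hs.nv v \<zeta> (a d) > 0" by (rule av_pos[OF hs.subf_Kbig N aK ad])
    ultimately have "hs.nv v \<zeta> (a d) = 1" by (simp add: inverse_le_1_iff)
    thus "hs.nv v \<zeta> (Polynomial.coeff (\<Phi> polyT) d) = 1" by (simp add: a_def)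
  qed (use fS Sb in auto)
  have xg: "x \<in> dh.good" using xK good[of _ _ x] by (auto simp: dh.good_def F_def)
  define X0 where "X0 = 5 * real d * (2 * (real d + 1) * module_height \<Phi> + 1)"
  have "c\<^sub>2 powr (- ((real D)\<^sup>2)) = real CARD('f) powr (X0 * (real (coeff_degree \<Phi>))\<^sup>2 * - ((real D)\<^sup>2))"
    unfolding c\<^sub>2_def X0_def by (rule powr_powr)
  also have "X0 * (real (coeff_degree \<Phi>))\<^sup>2 * - ((real D)\<^sup>2) = - (X0 * (real (coeff_degree \<Phi> * D))\<^sup>2)"
    by (simp add: power_mult_distrib)
  also have "real CARD('f) powr \<dots> \<le> canonical_height \<Phi> x"
    using dh.height_lower_bound[OF xg assms(4)] unfolding X0_def D_def by (simp add: S_def)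
  finally show ?thesis .
qed

end
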